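(* The following hold. (1) The group $\mathrm{Alt}(5)$ admits SGGIs, and they all have rank $3$. (2) The groups $\mathrm{Alt}(3)$, $\mathrm{Alt}(4)$, $\mathrm{Alt}(6)$, $\mathrm{Alt}(7)$ and $\mathrm{Alt}(8)$ do not admit SGGIs. (3) For every $n\ge 9$, the maximum rank of an SGGI for $\mathrm{Alt}(n)$ is at most $\lfloor 3(n-1)/5\rfloor$. Moreover, this bound is attained when $n\equiv 0,1,4\pmod 5$.
   Context: $\mathrm{Alt}(n)$ is the alternating group of degree $n$. A string group generated by involutions (SGGI) is a pair $\Gamma=(G,S)$, where $G$ is a group and $S=\{\rho_0,\ldots,\rho_{r-1}\}$ is an ordered set of involutions generating $G$ such that $(\rho_i\rho_j)^2=1$ for all $i,j\in\{0,\ldots,r-1\}$ with $|i-j|\ne 1$. The set $S$ is an independent generating set for $G$ if $G=\langle S\rangle$ and $s\notin\langle S\setminus\{s\}\rangle$ for every $s\in S$. The rank of an SGGI $(G,S)$ is defined when $S$ is independent, and it is then $|S|$; an SGGI for $G$ of rank $r$ is an SGGI $(G,S)$ with $S$ an independent generating set of cardinality $r$. *)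

theory Defs
  imports "HOL-Algebra.Sym_Groups"
begin

definition involution :: "('a, 'b) monoid_scheme \<Rightarrow> 'a \<Rightarrow> bool"
  where "involution G x \<longleftrightarrow> x \<in> carrier G \<and> x \<noteq> \<one>\<^bsub>G\<^esub> \<and> x [^]\<^bsub>G\<^esub> (2::nat) = \<one>\<^bsub>G\<^esub>"

text \<open>An ordered set of generators is a list without repetitions; the generator
  \<open>\<rho>\<^sub>i\<close> is \<open>S ! i\<close>. The case \<open>i = j\<close> of the last condition is harmless, since
  \<open>\<rho>\<^sub>i\<close> is an involution.\<close>

definition sggi :: "('a, 'b) monoid_scheme \<Rightarrow> 'a list \<Rightarrow> bool"
  where "sggi G S \<longleftrightarrow>
    group G \<and> distinct S \<and> (\<forall>x\<in>set S. involution G x) \<and> generate G (set S) = carrier G \<and>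
    (\<forall>i<length S. \<forall>j<length S. \<bar>int i - int j\<bar> \<noteq> 1 \<longrightarrow>
       (S ! i \<otimes>\<^bsub>G\<^esub> S ! j) [^]\<^bsub>G\<^esub> (2::nat) = \<one>\<^bsub>G\<^esub>)"

definition independent_generating_set :: "('a, 'b) monoid_scheme \<Rightarrow> 'a set \<Rightarrow> bool"
  where "independent_generating_set G A \<longleftrightarrow>
    A \<subseteq> carrier G \<and> generate G A = carrier G \<and> (\<forall>s\<in>A. s \<notin> generate G (A - {s}))"

text \<open>The rank is only defined for independent generating sets, so having rank \<open>r\<close>
  includes independence.\<close>

definition sggi_of_rank :: "('a, 'b) monoid_scheme \<Rightarrow> 'a list \<Rightarrow> nat \<Rightarrow> bool"
  where "sggi_of_rank G S r \<longleftrightarrow>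
    sggi G S \<and> independent_generating_set G (set S) \<and> card (set S) = r"

definition sggi_ranks :: "('a, 'b) monoid_scheme \<Rightarrow> nat set"
  where "sggi_ranks G = {r. \<exists>S. sggi_of_rank G S r}"

definition max_sggi_rank :: "('a, 'b) monoid_scheme \<Rightarrow> nat"
  where "max_sggi_rank G = Max (sggi_ranks G)"

text \<open>For a finite group, \<open>Max\<close> is therefore the true maximum as soon as the set of
  ranks is nonempty.\<close>

lemma finite_sggi_ranks:
  assumes "finite (carrier G)"
  shows "finite (sggi_ranks G)"
proof (rule finite_subset)
  show "sggi_ranks G \<subseteq> {..card (carrier G)}"
    using assms by (auto simp: sggi_ranks_def sggi_of_rank_def independent_generating_set_def
        intro: card_mono)
qed simp

lemma finite_carrier_alt_group: "finite (carrier (alt_group n))"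
  by (rule finite_subset[OF _ finite_permutations[of "{1..n}"]]) (auto simp: alt_group_carrier)

end

theory Submission
  imports Defs
begin

text \<open>A string \<open>\<rho>\<^sub>0, \<dots>, \<rho>\<^sub>r\<^sub>-\<^sub>1\<close> generating \<open>Alt(n)\<close> is studied through its action on points. From a base
  point \<open>x\<close> the orbits \<open>A k\<close> under the labels below \<open>k\<close> grow by layers \<open>N k\<close>, and primitivity
  provides a base point for which no layer is empty before all points are reached. If all
  layers beyond the last label that moves \<open>x\<close> have at least two points, then \<open>2r \<le> n + 1\<close>.
  Otherwise one cuts at the last one-point layer. On both sides a run of larger layers
  starting behind a one-point layer is long enough to pay for the one-point layers, because a
  label of small index that acts far away drags all intermediate labels with it, and because
  evenness forbids a label to consist of a single transposition. This gives \<open>5r + 3 \<le> 3n\<close>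
  without using independence, provided that \<open>r \<ge> 6\<close>. For nine points and five labels independence is needed: the
  last generator is then a word in the others.

  On seven and eight points a counting argument over the field with two elements produces a
  two-colouring preserved by all generators, and on six points one finds blocks or the design
  of \<open>PSL(2,5)\<close>.

  Conversely, labelling the edges of a path with \<open>n\<close> vertices by blocks of five edges carrying
  three labels gives an independent string, since the removal of a label disconnects the path.
  It generates \<open>Alt(n)\<close>, because a three-cycle on consecutive points spreads along the path.\<close>

section \<open>Chains of orbits and their layers\<close>

text \<open>The upper bound is an exchange: every label costs five units, every point pays three,
  and a label that is odd so far, in that it has moved a number of points not divisible by four,
  carries a debt of two. A one-point layer directly behind another brings one point and one label
  and balances exactly by making that label odd. Since every label is even on the set of all points,
  a label odd on one side of the cut is odd on the other side too, where the surplus of the run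
  repays the debt. The starting value, two points for one odd label, is the source of the 3 in
  \<open>5 * r + 3 \<le> 3 * n\<close>. The alternative \<open>2 * r \<le> n + 1\<close> implies
  \<open>5 * r \<le> 3 * (n - 1)\<close> only if \<open>3 * (2 * r - 2) \<ge> 5 * r\<close>, that
  is, for \<open>r \<ge> 6\<close>; smaller ranks satisfy the bound trivially except for rank five
  on nine points. The main obstacle is a base point moved by the last label, for which layers are of
  no help: there the last labels are used as automorphisms of the orbits of the first ones, and
  linear bounds compete with powers of two.\<close>

locale invol_string =
  fixes \<rho> :: "nat \<Rightarrow> 'a \<Rightarrow> 'a"
  assumes invol [simp]: "\<rho> i (\<rho> i y) = y"
    and comm: "Suc i < j \<Longrightarrow> \<rho> i (\<rho> j y) = \<rho> j (\<rho> i y)"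
begin

text \<open>Closure under the labels alone gives the orbit of the generated group, as every label is
  its own inverse.\<close>

inductive_set orb :: "nat set \<Rightarrow> 'a \<Rightarrow> 'a set" for I x where
  orb_base [simp, intro!]: "x \<in> orb I x"
| orb_step: "y \<in> orb I x \<Longrightarrow> i \<in> I \<Longrightarrow> \<rho> i y \<in> orb I x"

lemma rho_inj: "\<rho> i y = \<rho> i z \<longleftrightarrow> y = z"
  by (metis invol)

lemma rho_flip: "\<rho> i y = z \<longleftrightarrow> y = \<rho> i z"
  by (metis invol)

lemma orb_subset: "x \<in> S \<Longrightarrow> (\<And>y i. y \<in> S \<Longrightarrow> i \<in> I \<Longrightarrow> \<rho> i y \<in> S) \<Longrightarrow> orb I x \<subseteq> S"
proof
  fix y assume S: "x \<in> S" "\<And>y i. y \<in> S \<Longrightarrow> i \<in> I \<Longrightarrow> \<rho> i y \<in> S" and "y \<in> orb I x"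
  from this(3) show "y \<in> S" by induction (use S in auto)
qed

lemma orb_step_iff: "i \<in> I \<Longrightarrow> \<rho> i y \<in> orb I x \<longleftrightarrow> y \<in> orb I x"
  by (metis invol orb_step)

lemma orb_mono: "I \<subseteq> J \<Longrightarrow> orb I x \<subseteq> orb J x"
  by (rule orb_subset) (auto intro: orb_step)

lemma orb_sub_orb: "y \<in> orb I x \<Longrightarrow> orb I y \<subseteq> orb I x"
  by (rule orb_subset) (auto intro: orb_step)

lemma orb_sym: "y \<in> orb I x \<Longrightarrow> x \<in> orb I y"
proof (induction rule: orb.induct)
  case (orb_step y i)
  have "y \<in> orb I (\<rho> i y)" by (metis invol orb.orb_base orb.orb_step orb_step.hyps(2))
  then show ?case using orb_sub_orb orb_step.IH by blast
qed simp

lemma orb_eq: "y \<in> orb I x \<Longrightarrow> orb I y = orb I x"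
  by (simp add: orb_sub_orb orb_sym subset_antisym)

text \<open>A map commuting with the labels is determined on an orbit by one value. All
  semiregularity arguments below go back to this.\<close>

lemma orb_fixed:
  assumes "\<And>i y. i \<in> I \<Longrightarrow> g (\<rho> i y) = \<rho> i (g y)" "g x = x" "y \<in> orb I x"
  shows "g y = y"
  using assms(3) by induction (use assms in auto)

lemma orb_commute_mem:
  assumes "\<And>i y. i \<in> I \<Longrightarrow> g (\<rho> i y) = \<rho> i (g y)" "y \<in> orb I x"
  shows "g y \<in> orb I (g x)"
  using assms(2) by induction (use assms in \<open>auto intro: orb_step\<close>)

lemma orb_commute:
  assumes "\<And>i y. i \<in> I \<Longrightarrow> g (\<rho> i y) = \<rho> i (g y)"
  shows "g ` orb I x = orb I (g x)"
proof
  show "g ` orb I x \<subseteq> orb I (g x)" using orb_commute_mem[OF assms] by blast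
  show "orb I (g x) \<subseteq> g ` orb I x"
    by (rule orb_subset) (auto intro!: imageI orb_step simp: assms[symmetric])
qed

lemma comm': "Suc j < i \<Longrightarrow> \<rho> i (\<rho> j y) = \<rho> j (\<rho> i y)"
  using comm by simp

lemma fixed_transfer: "Suc i < j \<or> Suc j < i \<Longrightarrow> \<rho> i (\<rho> j y) = \<rho> j y \<longleftrightarrow> \<rho> i y = y"
  by (metis comm invol)

end

text \<open>The threshold \<open>c\<close> stays a parameter because layers behave well only from
  there on: a chain read backwards from a one-point layer has \<open>c = 1\<close>, while for a
  general base point \<open>c\<close> is one above the last label that moves it.\<close>

locale pure_chain = invol_string \<rho> for \<rho> :: "nat \<Rightarrow> 'a \<Rightarrow> 'a" +
  fixes x :: 'a and c :: nat
  assumes base_fixed: "c \<le> i \<Longrightarrow> \<rho> i x = x"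
    and finite_orbit: "finite (orb UNIV x)"
begin

definition A where "A k = orb {..<k} x"
definition N where "N k = A (Suc k) - A k"

lemma A_0: "A 0 = {x}"
  unfolding A_def using orb_subset[of x "{x}" "{..<0}"] by auto

lemma A_mono: "k \<le> l \<Longrightarrow> A k \<subseteq> A l"
  unfolding A_def by (rule orb_mono) auto

lemma x_A [simp]: "x \<in> A k" by (simp add: A_def)

lemma finite_A [simp]: "finite (A k)"
  unfolding A_def by (rule finite_subset[OF orb_mono finite_orbit]) auto

lemma finite_N [simp]: "finite (N k)" by (simp add: N_def)

lemma A_closed: "i < k \<Longrightarrow> \<rho> i y \<in> A k \<longleftrightarrow> y \<in> A k"
  unfolding A_def by (rule orb_step_iff) simp

lemma N_closed: "i < k \<Longrightarrow> \<rho> i y \<in> N k \<longleftrightarrow> y \<in> N k"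
  unfolding N_def using A_closed[of i k y] A_closed[of i "Suc k" y] by simp

lemma A_Suc: "A (Suc k) = A k \<union> N k" and A_N_disj: "A k \<inter> N k = {}"
  unfolding N_def using A_mono[of k "Suc k"] by auto

lemma card_A_Suc: "card (A (Suc k)) = card (A k) + card (N k)"
  unfolding A_Suc by (rule card_Un_disjoint) (auto simp: A_N_disj)

text \<open>Label \<open>i\<close> commutes with all labels below \<open>k\<close>, so fixing the
  base point is enough. The gap between \<open>k\<close> and \<open>i\<close> is the reason why only
  consecutive layers are joined.\<close>

lemma A_fixed:
  assumes "c \<le> Suc k" "Suc k \<le> i" "y \<in> A k" shows "\<rho> i y = y"
  using assms(3) unfolding A_def
proof (rule orb_fixed[rotated 2])
  show "\<rho> i x = x" using base_fixed assms by simp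
  show "\<And>j y. j \<in> {..<k} \<Longrightarrow> \<rho> i (\<rho> j y) = \<rho> j (\<rho> i y)" using assms comm' by auto
qed

text \<open>The points through which the layer is attached to \<open>A j\<close>; only label
  \<open>j\<close> can lead out of the layer downwards.\<close>

definition entry where "entry j = {y \<in> N j. \<rho> j y \<notin> N j}"
text \<open>The growth argument produces points of this kind only, so inactive points can be counted
  on top of it.\<close>

definition active where "active j = {y \<in> N j. \<exists>i<j. \<rho> i y \<noteq> y}"

lemma finite_entry [simp]: "finite (entry j)" by (simp add: entry_def)
lemma finite_active [simp]: "finite (active j)" by (simp add: active_def)
lemma entry_N: "entry j \<subseteq> N j" and active_N: "active j \<subseteq> N j"
  by (auto simp: entry_def active_def)

lemma entry_iff:
  assumes "y \<in> N j" shows "y \<in> entry j \<longleftrightarrow> \<rho> j y \<in> A j"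
proof -
  have "\<rho> j y \<in> A (Suc j)" using assms A_closed[of j "Suc j" y] by (auto simp: N_def)
  then show ?thesis using assms by (auto simp: entry_def N_def)
qed

text \<open>Label \<open>j\<close> fixes \<open>A l\<close> pointwise, so the layer is attached to
  the one directly before it.\<close>

lemma entry_prev:
  assumes "c \<le> j" "j = Suc l" "y \<in> entry j" shows "\<rho> j y \<in> N l"
proof -
  have "\<rho> j y \<in> A j" using assms entry_iff by (auto simp: entry_def)
  moreover have "\<rho> j y \<notin> A l"
  proof
    assume "\<rho> j y \<in> A l"
    then have "\<rho> j (\<rho> j y) = \<rho> j y" using A_fixed[of l j "\<rho> j y"] assms(1,2) by auto
    then have "\<rho> j y = y" by (metis invol)
    then show False using assms \<open>\<rho> j y \<in> A j\<close> by (auto simp: entry_def N_def)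
  qed
  ultimately show ?thesis using assms by (simp add: N_def)
qed

lemma entry_closed:
  assumes "Suc i < j" "y \<in> entry j" shows "\<rho> i y \<in> entry j"
proof -
  have "\<rho> i (\<rho> j y) \<notin> N j" using assms N_closed[of i j "\<rho> j y"] by (simp add: entry_def)
  then have "\<rho> j (\<rho> i y) \<notin> N j" using comm[OF assms(1), of y] by simp
  moreover have "\<rho> i y \<in> N j" using assms N_closed[of i j y] by (simp add: entry_def)
  ultimately show ?thesis by (simp add: entry_def)
qed

text \<open>Paths inside the layer that use labels from \<open>e\<close> upwards. Lowering
  \<open>e\<close> one at a time shows at which label new points appear.\<close>

inductive_set reach for j E e where
  reach_base: "y \<in> E \<Longrightarrow> y \<in> reach j E e"
| reach_step: "y \<in> reach j E e \<Longrightarrow> e \<le> i \<Longrightarrow> i \<le> j \<Longrightarrow> \<rho> i y \<in> N j \<Longrightarrow> \<rho> i y \<in> reach j E e"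

lemma reach_N:
  assumes E: "E \<subseteq> N j" shows "reach j E e \<subseteq> N j"
proof
  fix y assume "y \<in> reach j E e" then show "y \<in> N j" by induction (use E in auto)
qed

lemma reach_antimono: "e \<le> e' \<Longrightarrow> reach j E e' \<subseteq> reach j E e"
proof
  fix y assume "e \<le> e'" "y \<in> reach j E e'"
  from this(2) show "y \<in> reach j E e"
    by induction (use \<open>e \<le> e'\<close> in \<open>auto intro: reach_base reach_step\<close>)
qed

text \<open>\<open>A j\<close> together with the reached points is closed under the labels up to
  \<open>j\<close>, because a step from \<open>A j\<close> into the layer ends in
  \<open>entry j\<close>.\<close>

lemma reach_0:
  assumes E: "entry j \<subseteq> E" "E \<subseteq> N j" shows "reach j E 0 = N j"
proof
  show "N j \<subseteq> reach j E 0"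
  proof -
    have "A (Suc j) \<subseteq> A j \<union> reach j E 0"
      unfolding A_def[of "Suc j"]
    proof (rule orb_subset)
      show "x \<in> A j \<union> reach j E 0" by simp
      fix y i assume y: "y \<in> A j \<union> reach j E 0" and i: "i \<in> {..<Suc j}"
      have yS: "y \<in> A (Suc j)" using y reach_N[OF E(2), of 0] A_Suc[of j] by auto
      have iS: "\<rho> i y \<in> A (Suc j)" using yS A_closed[of i "Suc j"] i by auto
      show "\<rho> i y \<in> A j \<union> reach j E 0"
      proof (cases "\<rho> i y \<in> A j")
        case False
        then have iN: "\<rho> i y \<in> N j" using iS by (simp add: N_def)
        show ?thesis
        proof (cases "y \<in> A j")
          case True
          then have "i = j" using A_closed[of i j y] i False by force
          then have "\<rho> i y \<in> E" using iN True E(1) by (auto simp: entry_iff)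
          then show ?thesis by (simp add: reach_base)
        next
          case False
          then show ?thesis using y iN i by (auto intro: reach_step)
        qed
      qed simp
    qed
    then show ?thesis by (auto simp: N_def)
  qed
qed (rule reach_N[OF E(2)])

lemma reach_fixed:
  assumes "\<And>y. y \<in> E \<Longrightarrow> \<rho> i y = y" "Suc i < e" "y \<in> reach j E e"
  shows "\<rho> i y = y"
  using assms(3)
proof induction
  case (reach_step y l)
  then have "Suc i < l" using assms(2) by simp
  then have "\<rho> i (\<rho> l y) = \<rho> l (\<rho> i y)" by (rule comm)
  then show ?case using reach_step by simp
qed (use assms in auto)

text \<open>All labels below \<open>m\<close> fix what has been reached, so nothing else can be.\<close>

lemma reach_stuck:
  assumes E: "entry j \<subseteq> E" "E \<subseteq> N j" and fix_entry: "\<And>i y. i < dl \<Longrightarrow> y \<in> E \<Longrightarrow> \<rho> i y = y"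
    and m: "m \<le> dl" "reach j E m = reach j E (Suc m)"
  shows "reach j E m = N j" "\<And>i y. i < m \<Longrightarrow> y \<in> N j \<Longrightarrow> \<rho> i y = y"
proof -
  have fx: "\<rho> i y = y" if "i < m" "y \<in> reach j E m" for i y
    using reach_fixed[of E i "Suc m" y j] fix_entry m that by auto
  have "reach j E 0 \<subseteq> reach j E m"
  proof
    fix y assume "y \<in> reach j E 0" then show "y \<in> reach j E m"
    proof induction
      case (reach_step y i)
      then show ?case using fx[of i y] by (cases "i < m") (auto intro: reach.reach_step)
    qed (rule reach_base)
  qed
  then show *: "reach j E m = N j" using reach_0[OF E] reach_N[OF E(2)] by blast
  show "\<And>i y. i < m \<Longrightarrow> y \<in> N j \<Longrightarrow> \<rho> i y = y" using fx * by simp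
qed

lemma reach_new_point:
  assumes E: "E \<subseteq> N j" and ne: "reach j E m \<noteq> reach j E (Suc m)" "m < j"
  obtains y where "y \<in> reach j E m" "y \<notin> reach j E (Suc m)" "\<rho> m y \<noteq> y" "\<rho> m y \<in> reach j E (Suc m)"
proof -
  have "\<exists>y. y \<in> reach j E (Suc m) \<and> \<rho> m y \<notin> reach j E (Suc m)"
  proof (rule ccontr)
    assume no: "\<not> ?thesis"
    have "reach j E m \<subseteq> reach j E (Suc m)"
    proof
      fix y assume "y \<in> reach j E m" then show "y \<in> reach j E (Suc m)"
      proof induction
        case (reach_step y i)
        then show ?case using no by (cases "i = m") (auto intro: reach.reach_step)
      qed (rule reach_base)
    qed
    then show False using ne reach_antimono[of m "Suc m" j E] by auto
  qed
  then obtain y where y: "y \<in> reach j E (Suc m)" "\<rho> m y \<notin> reach j E (Suc m)" by blast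
  moreover have "\<rho> m y \<in> reach j E m"
    using y reach_antimono[of m "Suc m" j E] reach_N[OF E, of "Suc m"] N_closed[of m j y] ne(2)
    by (intro reach_step) auto
  moreover have "\<rho> m (\<rho> m y) \<noteq> \<rho> m y" using y by auto
  ultimately show ?thesis using that[of "\<rho> m y"] by simp
qed

text \<open>By \<open>reach_stuck\<close>, every label between \<open>e\<close> and \<open>dl\<close> contributes a new point.\<close>

lemma layer_growth_aux:
  assumes E: "entry j \<subseteq> E" "E \<subseteq> N j" and X: "active j - E \<subseteq> X" "X \<subseteq> N j - E" and fix_entry: "\<And>i y. i < dl \<Longrightarrow> y \<in> E \<Longrightarrow> \<rho> i y = y"
    and e: "e < dl" "dl < j" and z: "z \<in> N j" "\<rho> e z \<noteq> z"
  shows "dl - e + 1 \<le> card X"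
    and "(\<And>i y. i \<le> dl \<Longrightarrow> y \<in> E \<Longrightarrow> \<rho> i y \<in> E) \<Longrightarrow> X = N j - E \<Longrightarrow> dl - e + 2 \<le> card X"
proof -
  define R where "R m = reach j E m \<inter> X" for m
  have finX: "finite X" using X(2) by (meson finite_Diff finite_N finite_subset)
  then have finR: "finite (R m)" for m by (simp add: R_def)
  have strict: "reach j E m \<noteq> reach j E (Suc m)" if "e < m" "m \<le> dl" for m
    using reach_stuck(2)[OF E, of dl m e z] fix_entry that z by blast
  have step: "\<exists>y. y \<in> R m \<and> y \<notin> reach j E (Suc m)" if m: "e < m" "m \<le> dl" for m
  proof -
    have "m < j" using m e by simp
    from reach_new_point[OF E(2) strict[OF m] this] obtain y
      where y: "y \<in> reach j E m" "y \<notin> reach j E (Suc m)" "\<rho> m y \<noteq> y" by metis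
    then have "y \<in> active j" using reach_N[OF E(2), of m] \<open>m < j\<close> by (auto simp: active_def)
    moreover have "y \<notin> E" using y reach_base by blast
    ultimately show ?thesis using y X by (auto simp: R_def)
  qed
  have grow: "card (R (Suc dl)) + (Suc dl - m) \<le> card (R m)" if "e < m" "m \<le> Suc dl" for m
    using that
  proof (induction "Suc dl - m" arbitrary: m)
    case (Suc k)
    then have m: "m \<le> dl" by simp
    have IH: "card (R (Suc dl)) + (Suc dl - Suc m) \<le> card (R (Suc m))"
      using Suc.hyps(1)[of "Suc m"] Suc.hyps(2) Suc.prems m by simp
    obtain y where "y \<in> R m" "y \<notin> reach j E (Suc m)" using step m Suc.prems by blast
    then have "R (Suc m) \<subset> R m" using reach_antimono[of m "Suc m" j E] by (auto simp: R_def)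
    then have "card (R (Suc m)) < card (R m)" using finR psubset_card_mono by blast
    then show ?case using IH m by linarith
  qed simp
  \<comment> \<open>Labels \<open>e\<close> and \<open>Suc e\<close> are treated together. If
    \<open>e\<close> brings nothing new, the layer is exhausted at \<open>Suc e\<close>, and both
    \<open>z\<close> and \<open>\<rho> e z\<close> are missing at \<open>Suc (Suc e)\<close>, where
    label \<open>e\<close> fixes everything reached.\<close>
  have last: "card (R (Suc (Suc e))) + 2 \<le> card (R e)"
  proof (cases "reach j E e = reach j E (Suc e)")
    case True
    have N: "reach j E (Suc e) = N j" using reach_stuck(1)[OF E, of dl e] fix_entry True e by auto
    have zm: "z \<notin> reach j E (Suc (Suc e))" "\<rho> e z \<notin> reach j E (Suc (Suc e))"
      using reach_fixed[of E e "Suc (Suc e)" _ j] fix_entry e z by (auto, metis invol lessI)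
    have "\<rho> e z \<in> N j" using N_closed[of e j z] e z by simp
    then have "z \<in> active j" "\<rho> e z \<in> active j" using z e by (auto simp: active_def intro!: exI[of _ e])
    moreover have "z \<notin> E" "\<rho> e z \<notin> E" using zm reach_base by blast+
    ultimately have "{z, \<rho> e z} \<subseteq> R e - R (Suc (Suc e))"
      using True N z \<open>\<rho> e z \<in> N j\<close> zm X by (auto simp: R_def)
    moreover have "R (Suc (Suc e)) \<subseteq> R e" using reach_antimono[of e "Suc (Suc e)" j E] by (auto simp: R_def)
    ultimately have "card {z, \<rho> e z} \<le> card (R e) - card (R (Suc (Suc e)))"
      by (metis card_Diff_subset card_mono finR finite_Diff)
    moreover have "card {z, \<rho> e z} = 2" using z by (simp add: card_insert_if)
    ultimately show ?thesis by linarith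
  next
    case False
    have "e < j" using e by simp
    from reach_new_point[OF E(2) False this] obtain y
      where y: "y \<in> reach j E e" "y \<notin> reach j E (Suc e)" "\<rho> e y \<noteq> y" by metis
    then have "y \<in> active j" using reach_N[OF E(2), of e] \<open>e < j\<close> by (auto simp: active_def)
    moreover have "y \<notin> E" using y reach_base by blast
    ultimately have "R (Suc e) \<subset> R e" using y X reach_antimono[of e "Suc e" j E] by (auto simp: R_def)
    then have 1: "card (R (Suc e)) < card (R e)" using finR psubset_card_mono by blast
    obtain y' where "y' \<in> R (Suc e)" "y' \<notin> reach j E (Suc (Suc e))" using step[of "Suc e"] e by auto
    then have "R (Suc (Suc e)) \<subset> R (Suc e)" using reach_antimono[of "Suc e" "Suc (Suc e)" j E]
      by (auto simp: R_def)
    then have "card (R (Suc (Suc e))) < card (R (Suc e))" using finR psubset_card_mono by blast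
    then show ?thesis using 1 by linarith
  qed
  have g: "card (R (Suc dl)) + (dl - e) + 1 \<le> card (R e)"
    using grow[of "Suc (Suc e)"] last e by simp
  have Re: "card (R e) \<le> card X" using finX by (rule card_mono) (auto simp: R_def)
  show "dl - e + 1 \<le> card X" using g Re by linarith
  assume cl: "\<And>i y. i \<le> dl \<Longrightarrow> y \<in> E \<Longrightarrow> \<rho> i y \<in> E" and XN: "X = N j - E"
  \<comment> \<open>Otherwise no label leads from \<open>E\<close> to the rest of the layer, so
    \<open>E\<close> is the whole layer, although label \<open>e\<close> fixes \<open>E\<close> and
    moves \<open>z\<close>.\<close>
  have "reach j E (Suc dl) \<noteq> E"
  proof
    assume eq: "reach j E (Suc dl) = E"
    have "reach j E 0 \<subseteq> E"
    proof
      fix y assume "y \<in> reach j E 0" then show "y \<in> E"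
      proof induction
        case (reach_step y i)
        show ?case
        proof (cases "i \<le> dl")
          case True then show ?thesis using reach_step cl by blast
        next
          case False
          then have "\<rho> i y \<in> reach j E (Suc dl)" using reach_step eq by (intro reach.reach_step) auto
          then show ?thesis using eq by simp
        qed
      qed
    qed
    then show False using reach_0[OF E] z fix_entry e by blast
  qed
  moreover have "E \<subseteq> reach j E (Suc dl)" by (auto intro: reach_base)
  ultimately obtain y i where y: "y \<in> E" and i: "Suc dl \<le> i" "i \<le> j" "\<rho> i y \<in> N j" "\<rho> i y \<notin> E"
  proof -
    assume a: "reach j E (Suc dl) \<noteq> E" "E \<subseteq> reach j E (Suc dl)"
    have "\<exists>y i. y \<in> E \<and> Suc dl \<le> i \<and> i \<le> j \<and> \<rho> i y \<in> N j \<and> \<rho> i y \<notin> E"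
    proof (rule ccontr)
      assume no: "\<not> ?thesis"
      have "reach j E (Suc dl) \<subseteq> E"
      proof
        fix y assume "y \<in> reach j E (Suc dl)" then show "y \<in> E"
          by induction (use no in auto)
      qed
      then show False using a by blast
    qed
    then show thesis using that by blast
  qed
  have "\<rho> i y \<in> R (Suc dl)"
    using y i XN by (auto simp: R_def intro: reach_base reach_step)
  then have "1 \<le> card (R (Suc dl))" using finR by (metis One_nat_def Suc_leI card_gt_0_iff empty_iff)
  then show "dl - e + 2 \<le> card X" using g Re by linarith
qed

lemma layer_growth:
  assumes "entry j \<subseteq> E" "E \<subseteq> N j" and "\<And>i y. i < dl \<Longrightarrow> y \<in> E \<Longrightarrow> \<rho> i y = y"
    and "e < dl" "dl < j" and "z \<in> N j" "\<rho> e z \<noteq> z"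
  shows "dl - e + 1 \<le> card (active j - E)"
    and "(\<And>i y. i \<le> dl \<Longrightarrow> y \<in> E \<Longrightarrow> \<rho> i y \<in> E) \<Longrightarrow> dl - e + 2 \<le> card (N j - E)"
proof -
  show "dl - e + 1 \<le> card (active j - E)"
    by (rule layer_growth_aux(1)[OF assms(1,2) _ _ assms(3-7)]) (use active_N in auto)
  assume cl: "\<And>i y. i \<le> dl \<Longrightarrow> y \<in> E \<Longrightarrow> \<rho> i y \<in> E"
  show "dl - e + 2 \<le> card (N j - E)"
    by (rule layer_growth_aux(2)[OF assms(1,2) _ _ assms(3-7) cl refl]) (use active_N in auto)
qed

end

section \<open>Parity of moved points and reversal of strings\<close>

lemma even_gap: "even (m::nat) \<Longrightarrow> even n \<Longrightarrow> m < n \<Longrightarrow> m + 2 \<le> n"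
  by presburger

lemma even_card_fpf_involution:
  assumes "finite X" "\<And>y. y \<in> X \<Longrightarrow> g y \<in> X \<and> g (g y) = y \<and> g y \<noteq> y"
  shows "even (card X)"
  using assms
proof (induction "card X" arbitrary: X rule: less_induct)
  case less
  show ?case
  proof (cases "X = {}")
    case False
    then obtain y where y: "y \<in> X" by blast
    let ?Y = "X - {y, g y}"
    have sub: "{y, g y} \<subseteq> X" using y less.prems by auto
    have two: "card {y, g y} = 2" using y less.prems by (simp add: card_insert_if) (metis y)
    have c: "card X = card ?Y + 2"
      using card_Diff_subset[of "{y, g y}" X] sub two card_mono[OF less.prems(1) sub] by simp
    have "even (card ?Y)"
    proof (rule less.hyps)
      show "card ?Y < card X" "finite ?Y" using c less.prems by auto
      fix z assume "z \<in> ?Y"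
      then show "g z \<in> ?Y \<and> g (g z) = z \<and> g z \<noteq> z" using less.prems(2)[of z] less.prems(2)[of y] y by auto
    qed
    then show ?thesis using c by simp
  qed simp
qed

context invol_string
begin

text \<open>Taken over all points, this number is divisible by four exactly if the involution is
  even. It is additive, so parity can be split between the two sides of a cut.\<close>

definition mv where "mv i X = card {y \<in> X. \<rho> i y \<noteq> y}"

lemma mv_Un: "finite X \<Longrightarrow> finite Y \<Longrightarrow> X \<inter> Y = {} \<Longrightarrow> mv i (X \<union> Y) = mv i X + mv i Y"
proof -
  assume a: "finite X" "finite Y" "X \<inter> Y = {}"
  have "{y \<in> X \<union> Y. \<rho> i y \<noteq> y} = {y \<in> X. \<rho> i y \<noteq> y} \<union> {y \<in> Y. \<rho> i y \<noteq> y}" by auto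
  then show ?thesis unfolding mv_def using a by (simp only:) (rule card_Un_disjoint, auto)
qed

lemma mv_eq_0: "(\<And>y. y \<in> X \<Longrightarrow> \<rho> i y = y) \<Longrightarrow> mv i X = 0"
  unfolding mv_def by (subst card_eq_0_iff) auto

text \<open>The labels from \<open>m\<close> on become trivial, so an initial segment read backwards
  is again a string and can carry a chain from its far end.\<close>

definition reverse where "reverse m i = (if i < m then \<rho> (m - 1 - i) else id)"

lemma rev_string: "invol_string (reverse m)"
proof
  fix i y show "reverse m i (reverse m i y) = y" by (simp add: reverse_def)
next
  fix i j :: nat and y assume "Suc i < j"
  then show "reverse m i (reverse m j y) = reverse m j (reverse m i y)" by (auto simp: reverse_def intro!: comm')
qed

lemma orb_rev: "invol_string.orb (reverse m) UNIV y = orb {..<m} y"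
proof -
  interpret R: invol_string "reverse m" by (rule rev_string)
  show ?thesis
  proof
    show "R.orb UNIV y \<subseteq> orb {..<m} y"
      by (rule R.orb_subset) (auto simp: reverse_def intro!: orb_step)
    show "orb {..<m} y \<subseteq> R.orb UNIV y"
    proof (rule orb_subset)
      fix z i assume z: "z \<in> R.orb UNIV y" and i: "i \<in> {..<m}"
      have "reverse m (m - 1 - i) z \<in> R.orb UNIV y" using z by (intro R.orb_step) auto
      moreover have "m - 1 - (m - 1 - i) = i" "m - 1 - i < m" using i by auto
      ultimately show "\<rho> i z \<in> R.orb UNIV y" by (simp add: reverse_def)
    qed simp
  qed
qed

text \<open>The labels below \<open>t\<close> fix \<open>y\<close>, so in reversed order only the
  label that now comes first can move the base point.\<close>

lemma rev_chain:
  assumes "\<And>i. i < t \<Longrightarrow> \<rho> i y = y" "finite (orb {..<Suc t} y)"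
  shows "pure_chain (reverse (Suc t)) y 1"
proof -
  interpret R: invol_string "reverse (Suc t)" by (rule rev_string)
  show ?thesis
    by unfold_locales (use assms in \<open>auto simp: reverse_def orb_rev\<close>)
qed

end

section \<open>Lower bounds for an orbit on which a given label acts\<close>

context pure_chain
begin

lemma orb_UNIV_A: "y \<in> orb UNIV x \<Longrightarrow> \<exists>k. y \<in> A k"
proof (induction rule: orb.induct)
  case (orb_step y i)
  then obtain k where "y \<in> A k" by blast
  then have "y \<in> A (max k (Suc i))" using A_mono[of k "max k (Suc i)"] by auto
  then have "\<rho> i y \<in> A (max k (Suc i))" using A_closed[of i "max k (Suc i)" y] by auto
  then show ?case by blast
qed (rule exI[of _ 0], simp add: A_0)

lemma orb_UNIV_eq_A: "(\<And>i y. y \<in> A k \<Longrightarrow> \<rho> i y \<in> A k) \<Longrightarrow> orb UNIV x = A k"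
  using orb_subset[of x "A k" UNIV] orb_mono[of "{..<k}" UNIV x] by (auto simp: A_def)

lemma A_sub_orb: "A k \<subseteq> orb UNIV x"
  unfolding A_def by (rule orb_mono) auto

text \<open>If \<open>N j\<close> is empty then \<open>A j\<close> is the whole orbit and labels
  above \<open>j\<close> fix it. So there is a point in every layer below \<open>e\<close>; if
  \<open>N e\<close> itself is empty, both ends of an \<open>e\<close>-edge lie in the layer before
  it.\<close>

lemma acting_layers:
  assumes c: "c \<le> 1" and z: "z \<in> orb UNIV x" "\<rho> e z \<noteq> z"
  shows "j < e \<Longrightarrow> N j \<noteq> {}" "j \<le> e \<Longrightarrow> Suc j \<le> card (A j)" "e + 2 \<le> card (orb UNIV x)"
proof -
  have ne: "N j \<noteq> {}" if "j < e" for j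
  proof
    assume "N j = {}"
    then have eq: "A (Suc j) = A j" using A_Suc by auto
    have "\<rho> i y \<in> A j" if "y \<in> A j" for i y
    proof (cases "i \<le> j")
      case True then show ?thesis using that A_closed[of i "Suc j" y] eq by simp
    next
      case False then show ?thesis using that A_fixed[of j i y] c by simp
    qed
    then have "orb UNIV x = A j" by (rule orb_UNIV_eq_A)
    then show False using z A_fixed[of j e z] \<open>j < e\<close> c by simp
  qed
  then show "j < e \<Longrightarrow> N j \<noteq> {}" .
  have sz: "Suc j \<le> card (A j)" if "j \<le> e" for j using that
  proof (induction j)
    case (Suc j)
    have "0 < card (N j)" using ne[of j] Suc by (simp add: card_gt_0_iff)
    then show ?case using Suc card_A_Suc[of j] by simp
  qed (simp add: A_0)
  then show "j \<le> e \<Longrightarrow> Suc j \<le> card (A j)" .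
  show "e + 2 \<le> card (orb UNIV x)"
  proof (cases "N e = {}")
    case False
    then have "0 < card (N e)" by (simp add: card_gt_0_iff)
    then have "e + 2 \<le> card (A (Suc e))" using sz[of e] card_A_Suc[of e] by simp
    also have "\<dots> \<le> card (orb UNIV x)" using finite_orbit A_sub_orb by (rule card_mono)
    finally show ?thesis .
  next
    case True
    then have eq: "A (Suc e) = A e" using A_Suc by auto
    have "\<rho> i y \<in> A e" if "y \<in> A e" for i y
    proof (cases "i \<le> e")
      case True then show ?thesis using that A_closed[of i "Suc e" y] eq by simp
    next
      case False then show ?thesis using that A_fixed[of e i y] c by simp
    qed
    then have O: "orb UNIV x = A e" by (rule orb_UNIV_eq_A)
    have e0: "e \<noteq> 0"
    proof
      assume "e = 0"
      then have "z = x" "\<rho> e z \<in> A e" using z O A_0 orb_step[OF z(1), of e] by auto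
      then show False using z \<open>e = 0\<close> A_0 by simp
    qed
    then obtain l where l: "e = Suc l" by (cases e) auto
    have "\<rho> e z \<in> A e" "z \<in> A e" using O z orb_step[OF z(1), of e] by auto
    moreover have "z \<notin> A l" "\<rho> e z \<notin> A l" using A_fixed[of l e] c l z by (auto, metis invol le_refl)
    ultimately have "{z, \<rho> e z} \<subseteq> N l" using l by (auto simp: N_def)
    then have "card {z, \<rho> e z} \<le> card (N l)" by (rule card_mono[OF finite_N])
    moreover have "card {z, \<rho> e z} = 2" using z by (simp add: card_insert_if)
    ultimately show ?thesis using sz[of l] l card_A_Suc[of l] O by simp
  qed
qed

text \<open>\<open>g\<close> has no fixed point on the orbit, as a fixed point would spread to
  \<open>x\<close>. Before the index \<open>i0\<close> at which the chain first contains
  \<open>g x\<close>, there are two disjoint copies of the chain; from \<open>i0\<close> on all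
  sizes are even, so a nonempty layer has at least two points.\<close>

lemma commuting_double:
  assumes c: "c \<le> 1" and z: "z \<in> orb UNIV x" "\<rho> e z \<noteq> z"
    and g: "\<And>i y. g (\<rho> i y) = \<rho> i (g y)" "\<And>y. g (g y) = y" "g x \<in> orb UNIV x" "g x \<noteq> x"
  shows "2 * (e + 1) \<le> card (orb UNIV x)"
proof -
  have fpf: "g y \<noteq> y" if "y \<in> orb UNIV x" for y
    using orb_fixed[of UNIV g y x] g orb_sym[OF that] by auto
  define i0 where "i0 = (LEAST i. g x \<in> A i)"
  have i0: "g x \<in> A i0" unfolding i0_def using orb_UNIV_A[OF g(3)] by (auto intro: LeastI_ex)
  have "i0 \<noteq> 0" using i0 A_0 g by (metis singletonD)
  then obtain l where l: "i0 = Suc l" by (cases i0) auto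
  have nl: "g x \<notin> A l" using not_less_Least[of l "\<lambda>i. g x \<in> A i"] l unfolding i0_def by auto
  have im: "g ` A k = orb {..<k} (g x)" for k unfolding A_def by (rule orb_commute) (simp add: g)
  have disj: "A l \<inter> g ` A l = {}"
  proof (rule ccontr)
    assume "A l \<inter> g ` A l \<noteq> {}"
    then obtain w where "w \<in> orb {..<l} x" "w \<in> orb {..<l} (g x)" using im A_def by auto
    then have "g x \<in> orb {..<l} x" using orb_sym orb_eq by blast
    then show False using nl by (simp add: A_def)
  qed
  have inv: "g ` A k = A k" if "i0 \<le> k" for k
  proof -
    have "g x \<in> orb {..<k} x" using i0 A_mono[OF that] by (auto simp: A_def)
    then show ?thesis using im orb_eq by (simp add: A_def)
  qed
  have fin: "finite (orb UNIV x)" by (rule finite_orbit)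
  have card_gl: "card (g ` A l) = card (A l)" by (rule card_image) (metis g(2) inj_onI)
  have union: "card (A l \<union> g ` A l) = 2 * card (A l)"
    using card_Un_disjoint[OF _ _ disj] card_gl by simp
  have ev: "even (card (A k))" if "i0 \<le> k" for k
    by (rule even_card_fpf_involution[of _ g]) (use inv[OF that] fpf A_sub_orb g in auto)
  have "A l \<subseteq> A i0" using A_mono l by simp
  moreover from this have "g ` A l \<subseteq> A i0" using inv[of i0] image_mono[of "A l" "A i0" g] by simp
  ultimately have sub: "A l \<union> g ` A l \<subseteq> A i0" by simp
  show ?thesis
  proof (cases "e \<le> l")
    case True
    have "Suc e \<le> card (A l)" using acting_layers(2)[OF c z, of e] card_mono[OF finite_A A_mono[OF True]] by simp
    moreover have "A l \<union> g ` A l \<subseteq> orb UNIV x" using sub A_sub_orb[of i0] by (rule subset_trans)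
    then have "card (A l \<union> g ` A l) \<le> card (orb UNIV x)" by (rule card_mono[OF fin])
    ultimately show ?thesis using union by simp
  next
    case False
    then have le: "i0 \<le> e" using l by simp
    \<comment> \<open>Equality would make all labels from \<open>i0\<close> on trivial on the orbit,
      and \<open>e\<close> is one of them.\<close>
    have "A l \<union> g ` A l \<noteq> A i0"
    proof
      assume eq: "A l \<union> g ` A l = A i0"
      have fx: "\<rho> i y = y" if y: "y \<in> A i0" and i: "i0 \<le> i" for i y
      proof -
        have fl: "\<rho> i v = v" if "v \<in> A l" for v using A_fixed[of l i v] c l i that by simp
        have "y \<in> A l \<or> (\<exists>v\<in>A l. y = g v)" using y eq by blast
        then show ?thesis using fl g(1) by metis
      qed
      have "\<rho> i y \<in> A i0" if "y \<in> A i0" for i y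
        using that fx[of y i] A_closed[of i i0 y] by (cases "i < i0") auto
      then have "orb UNIV x = A i0" by (rule orb_UNIV_eq_A)
      then show False using z fx le by blast
    qed
    then have "card (A l \<union> g ` A l) < card (A i0)" using sub by (metis finite_A psubsetI psubset_card_mono)
    moreover have "Suc l \<le> card (A l)" using acting_layers(2)[OF c z, of l] le l by simp
    ultimately have "2 * i0 < card (A i0)" using union l by simp
    then have base: "2 * i0 + 2 \<le> card (A i0)" using even_gap[of "2 * i0"] ev[OF order_refl] by simp
    have "2 * k + 2 \<le> card (A k)" if "i0 \<le> k" "k \<le> e" for k
      using that
    proof (induction k rule: dec_induct)
      case base show ?case by (rule \<open>2 * i0 + 2 \<le> card (A i0)\<close>)
    next
      case (step k)
      have "0 < card (N k)" using acting_layers(1)[OF c z, of k] step by (simp add: card_gt_0_iff)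
      then have "card (A k) < card (A (Suc k))" using card_A_Suc by simp
      moreover have "even (card (A k))" "even (card (A (Suc k)))" using ev step by simp_all
      ultimately have "card (A k) + 2 \<le> card (A (Suc k))" using even_gap by blast
      then show ?case using step by simp
    qed
    from this[OF le order_refl] have "2 * e + 2 \<le> card (A e)" .
    also have "\<dots> \<le> card (orb UNIV x)" using fin A_sub_orb by (rule card_mono)
    finally show ?thesis by simp
  qed
qed

lemma entry_nonempty:
  assumes "N j \<noteq> {}" shows "entry j \<noteq> {}"
proof
  assume e: "entry j = {}"
  have "y \<in> reach j {} 0 \<Longrightarrow> False" for y by (induction rule: reach.induct) auto
  then show False using reach_0[of j "{}"] e assms by auto
qed

text \<open>Only label \<open>j\<close> can lead to a point that is neither active nor an entry, and
  its partner under \<open>j\<close> is no entry either, since entries leave the layer under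
  \<open>j\<close>. With some entry this makes three points.\<close>

lemma inactive_big:
  assumes y: "y \<in> N j" "y \<notin> entry j" "y \<notin> active j"
  shows "3 \<le> card (N j)" "card (active j - entry j) + card (entry j) + 1 \<le> card (N j)"
proof -
  have sub: "insert y ((active j - entry j) \<union> entry j) \<subseteq> N j" using active_N entry_N y by auto
  have "card (insert y ((active j - entry j) \<union> entry j)) = Suc (card ((active j - entry j) \<union> entry j))"
    using y by (subst card_insert_disjoint) auto
  also have "card ((active j - entry j) \<union> entry j) = card (active j - entry j) + card (entry j)"
    by (rule card_Un_disjoint) auto
  finally show 2: "card (active j - entry j) + card (entry j) + 1 \<le> card (N j)"
    using card_mono[OF finite_N sub] by simp
  obtain w where w: "w \<in> entry j" using entry_nonempty y by blast
  have "\<exists>v\<in>N j. v \<noteq> y \<and> v \<notin> entry j"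
  proof (rule ccontr)
    assume no: "\<not> ?thesis"
    have "v \<in> reach j (entry j) 0 \<Longrightarrow> v \<in> entry j" for v
    proof (induction rule: reach.induct)
      case (reach_step u i)
      show ?case
      proof (rule ccontr)
        assume "\<rho> i u \<notin> entry j"
        then have "\<rho> i u = y" using no reach_step by blast
        then have u: "u = \<rho> i y" by (metis invol)
        show False
        proof (cases "i < j")
          case True
          then have "u = y" using u y by (auto simp: active_def)
          then show False using reach_step y by simp
        next
          case False
          then have "\<rho> j u \<in> N j" using reach_step by (metis le_neq_implies_less)
          then show False using reach_step by (simp add: entry_def)
        qed
      qed
    qed
    then show False using reach_0[of j "entry j"] entry_N[of j] y by blast
  qed
  then obtain v where v: "v \<in> N j" "v \<noteq> y" "v \<notin> entry j" by blast
  have "{w, y, v} \<subseteq> N j" using w v y entry_N by auto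
  then have "card {w, y, v} \<le> card (N j)" by (rule card_mono[OF finite_N])
  moreover have "card {w, y, v} = 3" using w v y by (auto simp: card_insert_if)
  ultimately show "3 \<le> card (N j)" by simp
qed

end

section \<open>Runs of layers behind a one-point layer\<close>

text \<open>The run hangs on the single edge with label \<open>Suc t\<close> between
  \<open>q\<close> and \<open>p\<close>. This bottleneck forces labels to act in decreasing order
  along the run.\<close>

locale fat_run = pure_chain +
  fixes t :: nat and q :: 'a
  assumes ct: "c \<le> Suc t" and single: "N t = {q}" and fat_first: "2 \<le> card (N (Suc t))"
begin

definition p where "p = \<rho> (Suc t) q"

definition acts where "acts e g \<longleftrightarrow> (\<exists>j\<in>{Suc t..g}. \<exists>z\<in>N j. \<rho> e z \<noteq> z)"

lemma q_fixed: "i < t \<Longrightarrow> \<rho> i q = q"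
  using N_closed[of i t q] single by simp

lemma entry_first: "entry (Suc t) = {p}"
proof -
  have "entry (Suc t) \<subseteq> {p}"
    using entry_prev[of "Suc t" t] ct single rho_flip by (auto simp: p_def)
  moreover have "entry (Suc t) \<noteq> {}" using entry_nonempty[of "Suc t"] fat_first by fastforce
  ultimately show ?thesis by blast
qed

lemma p_N: "p \<in> N (Suc t)" using entry_first entry_N by blast

lemma p_fixed: "i < t \<Longrightarrow> \<rho> i p = p"
  unfolding p_def using q_fixed[of i] comm[of i "Suc t" q] by simp

text \<open>The labels below \<open>t\<close> fix \<open>q\<close> and hence \<open>p\<close>, and
  label \<open>Suc t\<close> leads back to \<open>q\<close>. If label \<open>t\<close> fixed
  \<open>p\<close> as well, \<open>p\<close> would be alone in its layer.\<close>

lemma t_moves: "\<rho> t p \<noteq> p"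
proof
  assume fx: "\<rho> t p = p"
  have "y \<in> reach (Suc t) {p} 0 \<Longrightarrow> y = p" for y
  proof (induction rule: reach.induct)
    case (reach_step y i)
    then have y: "y = p" by simp
    consider "i < t" | "i = t" | "i = Suc t" using reach_step by linarith
    then show ?case
    proof cases
      case 3
      then have "\<rho> i y = q" using y by (simp add: p_def)
      moreover have "q \<notin> N (Suc t)" using single A_N_disj[of "Suc t"] A_Suc[of t] by auto
      ultimately show ?thesis using reach_step by simp
    qed (use y p_fixed fx in auto)
  qed simp
  moreover have "reach (Suc t) {p} 0 = N (Suc t)" by (rule reach_0) (use entry_first p_N in simp_all)
  ultimately have "N (Suc t) \<subseteq> {p}" by blast
  then have "card (N (Suc t)) \<le> card {p}" by (rule card_mono[rotated]) simp
  then show False using fat_first by simp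
qed

lemma acts_t: "Suc t \<le> g \<Longrightarrow> acts t g"
  unfolding acts_def using p_N t_moves by force

lemma acts_Suc: "acts e (Suc g) \<Longrightarrow> \<not> acts e g \<Longrightarrow> \<exists>z\<in>N (Suc g). \<rho> e z \<noteq> z"
  unfolding acts_def by (metis atLeastAtMost_iff le_Suc_eq)

lemma least_acting:
  assumes "Suc t \<le> g"
  obtains dl where "dl \<le> t" "acts dl g" "\<And>i. i < dl \<Longrightarrow> \<not> acts i g"
proof
  show "(LEAST i. acts i g) \<le> t" using acts_t[OF assms] by (rule Least_le)
  show "acts (LEAST i. acts i g) g" using acts_t[OF assms] by (rule LeastI)
  show "\<And>i. i < (LEAST i. acts i g) \<Longrightarrow> \<not> acts i g" by (rule not_less_Least)
qed

lemma entry_fixed: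
  assumes "Suc t \<le> g" "i \<le> t" "\<not> acts i g" "y \<in> entry (Suc g)"
  shows "\<rho> i y = y"
proof -
  have "\<rho> (Suc g) y \<in> N g" using entry_prev[of "Suc g" g y] assms ct by simp
  then have "\<rho> i (\<rho> (Suc g) y) = \<rho> (Suc g) y" using assms by (auto simp: acts_def)
  then show ?thesis using fixed_transfer[of i "Suc g"] assms by simp
qed

text \<open>Two points per layer are given. A label \<open>e\<close> acting in the run costs
  \<open>t - e\<close> more: in the layer where it first acts, all labels between \<open>e\<close>
  and the least label \<open>dl\<close> acting before must show up as well. The function
  \<open>h\<close> records points known to exist besides entries and active points.\<close>

lemma fat_run_sum_slack:
  assumes "Suc t \<le> g"
    and "\<And>j. j \<in> {Suc t..g} \<Longrightarrow> 2 + h j \<le> card (N j)"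
    and "\<And>j. j \<in> {Suc t..g} \<Longrightarrow> card (active j - entry j) + card (entry j) + h j \<le> card (N j)"
    and "e \<le> t" "acts e g"
  shows "2 * (g - t) + (Suc t - e) + (\<Sum>j=Suc t..g. h j) \<le> Suc (\<Sum>j=Suc t..g. card (N j))"
  using assms
proof (induction g arbitrary: e rule: dec_induct)
  case base
  from base(4) obtain z where z: "z \<in> N (Suc t)" "\<rho> e z \<noteq> z" by (auto simp: acts_def)
  show ?case
  proof (cases "e = t")
    case True then show ?thesis using base(1)[of "Suc t"] by simp
  next
    case False
    then have "t - e + 1 \<le> card (active (Suc t) - entry (Suc t))"
      using z base(3) p_fixed by (intro layer_growth(1)[of _ _ _ _ z]) (auto simp: entry_first p_N)
    then show ?thesis using base(2)[of "Suc t"] base(3) by (simp add: entry_first)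
  qed
next
  case (step g)
  have IH: "2 * (g - t) + (Suc t - e') + (\<Sum>j=Suc t..g. h j) \<le> Suc (\<Sum>j=Suc t..g. card (N j))"
    if "e' \<le> t" "acts e' g" for e' using step.IH[of e'] step.prems that by auto
  have S: "(\<Sum>j=Suc t..Suc g. f j) = (\<Sum>j=Suc t..g. f j) + f (Suc g)" for f :: "nat \<Rightarrow> nat"
    using step.hyps by simp
  obtain dl where dl: "dl \<le> t" "acts dl g" "\<And>i. i < dl \<Longrightarrow> \<not> acts i g"
    using least_acting step.hyps by blast
  have two: "2 + h (Suc g) \<le> card (N (Suc g))" using step.prems(1)[of "Suc g"] step.hyps by simp
  show ?case
  proof (cases "dl \<le> e")
    case True
    then show ?thesis using IH[OF dl(1,2)] two step.hyps unfolding S by simp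
  next
    case False
    then have "\<not> acts e g" using dl by simp
    then obtain z where z: "z \<in> N (Suc g)" "\<rho> e z \<noteq> z" using acts_Suc step.prems by blast
    have "dl - e + 1 \<le> card (active (Suc g) - entry (Suc g))"
      using False z dl step.hyps entry_fixed[of g]
      by (intro layer_growth(1)[of _ _ _ _ z]) (auto simp: entry_N)
    moreover have "0 < card (entry (Suc g))" using entry_nonempty z by (auto simp: card_gt_0_iff)
    moreover have "card (active (Suc g) - entry (Suc g)) + card (entry (Suc g)) + h (Suc g) \<le> card (N (Suc g))"
      using step.prems(2)[of "Suc g"] step.hyps by simp
    ultimately show ?thesis using IH[OF dl(1,2)] False dl(1) step.hyps unfolding S by simp
  qed
qed

lemma active_entry_card: "card (active j - entry j) + card (entry j) \<le> card (N j)"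
proof -
  have "card (active j - entry j) + card (entry j) = card ((active j - entry j) \<union> entry j)"
    by (subst card_Un_disjoint) auto
  also have "\<dots> \<le> card (N j)" using active_N entry_N by (intro card_mono) auto
  finally show ?thesis .
qed

lemma fat_run_sum:
  assumes "Suc t \<le> g" "\<And>j. j \<in> {Suc t..g} \<Longrightarrow> 2 \<le> card (N j)" "e \<le> t" "acts e g"
  shows "2 * (g - t) + (Suc t - e) \<le> Suc (\<Sum>j=Suc t..g. card (N j))"
  using fat_run_sum_slack[of g "\<lambda>_. 0" e] assms active_entry_card by simp

text \<open>Going back from \<open>y\<close> through entries, the point stays fixed by all labels
  below its layer. The walk cannot end in \<open>p\<close>, which label \<open>t\<close> moves, so
  it stops at a point that is no entry.\<close>

lemma inactive_trace:
  assumes "Suc t \<le> g" "\<And>j. j \<in> {Suc t..g} \<Longrightarrow> 2 \<le> card (N j)"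
    and "y \<in> N g" "\<And>i. i < g \<Longrightarrow> \<rho> i y = y"
  shows "\<exists>j\<in>{Suc t..g}. \<exists>y\<in>N j. y \<notin> entry j \<and> y \<notin> active j"
  using assms
proof (induction g arbitrary: y rule: dec_induct)
  case base
  have "y \<noteq> p" using t_moves base(3)[of t] by auto
  then have "y \<notin> entry (Suc t)" by (simp add: entry_first)
  moreover have "y \<notin> active (Suc t)" using base(3) by (auto simp: active_def)
  ultimately show ?case using base by auto
next
  case (step g)
  have na: "y \<notin> active (Suc g)" using step.prems(3) by (auto simp: active_def)
  show ?case
  proof (cases "y \<in> entry (Suc g)")
    case False then show ?thesis using na step by auto
  next
    case True
    have "\<rho> (Suc g) y \<in> N g" using entry_prev[of "Suc g" g y] True ct step.hyps by simp
    moreover have "\<rho> i (\<rho> (Suc g) y) = \<rho> (Suc g) y" if "i < g" for i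
      using step.prems(3)[of i] fixed_transfer[of i "Suc g"] that by simp
    ultimately have "\<exists>j\<in>{Suc t..g}. \<exists>y\<in>N j. y \<notin> entry j \<and> y \<notin> active j"
      using step.IH[of "\<rho> (Suc g) y"] step.prems(1) by auto
    then show ?thesis using step.hyps by auto
  qed
qed

text \<open>A single inactive point anywhere in the run is not counted by \<open>fat_run_sum\<close>
  and improves its bound by one.\<close>

lemma fat_run_sum_inactive:
  assumes "Suc t \<le> g" "\<And>j. j \<in> {Suc t..g} \<Longrightarrow> 2 \<le> card (N j)" "e \<le> t" "acts e g"
    and "y \<in> N g" "\<And>i. i < g \<Longrightarrow> \<rho> i y = y"
  shows "2 * (g - t) + (Suc t - e) \<le> (\<Sum>j=Suc t..g. card (N j))"
proof -
  obtain j w where j: "j \<in> {Suc t..g}" "w \<in> N j" "w \<notin> entry j" "w \<notin> active j"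
    using inactive_trace[of g y] assms by blast
  define h where "h = (\<lambda>i. if i = j then 1 else 0 :: nat)"
  have "(\<Sum>i=Suc t..g. h i) = 1" unfolding h_def using j(1) by (subst sum.delta) auto
  moreover have "2 + h i \<le> card (N i)" if "i \<in> {Suc t..g}" for i
    using that assms(2)[of i] inactive_big(1)[OF j(2-4)] by (simp add: h_def)
  moreover have "card (active i - entry i) + card (entry i) + h i \<le> card (N i)" for i
    using active_entry_card[of i] inactive_big(2)[OF j(2-4)] by (simp add: h_def)
  ultimately show ?thesis using fat_run_sum_slack[of g h e] assms(1,3,4) by simp
qed

text \<open>Label \<open>t + 2\<close> is an automorphism of the layer for the labels up to
  \<open>t\<close>. Let \<open>O'\<close> be the orbit of \<open>p\<close> under these, read
  backwards from \<open>p\<close>. If \<open>p\<close> is fixed by the automorphism, its four moved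
  points lie outside \<open>O'\<close>; if \<open>p\<close> leaves \<open>O'\<close>, there is a
  second copy of \<open>O'\<close>; if \<open>p\<close> moves inside \<open>O'\<close>, then
  \<open>O'\<close> is doubled. Only the last bound can fall short, by one point and in one case,
  which the conclusion keeps.\<close>

lemma single_layer_symmetry_least:
  assumes pres: "\<And>y. y \<in> N (Suc t) \<Longrightarrow> \<rho> (t + 2) y \<in> N (Suc t)"
    and four: "4 \<le> mv (t + 2) (N (Suc t))"
    and e: "e \<le> t" "z \<in> N (Suc t)" "\<rho> e z \<noteq> z"
    and least: "\<And>i y. i < e \<Longrightarrow> y \<in> N (Suc t) \<Longrightarrow> \<rho> i y = y"
  shows "(Suc t - e) + 3 \<le> card (N (Suc t)) \<or>
    (Suc t - e = 2 \<and> card (N (Suc t)) = 4 \<and> mv t (N (Suc t)) = 4)"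
proof -
  let ?N = "N (Suc t)" and ?\<tau> = "\<rho> (t + 2)"
  define O' where "O' = orb {..<Suc t} p"
  have ON: "O' \<subseteq> ?N" unfolding O'_def
    by (rule orb_subset) (use p_N N_closed in auto)
  have finO: "finite O'" using ON finite_N finite_subset by blast
  have O_closed: "i \<le> t \<Longrightarrow> y \<in> O' \<Longrightarrow> \<rho> i y \<in> O'" for i y by (simp add: O'_def orb_step_iff)
  have pO: "p \<in> O'" by (simp add: O'_def)
  have four': "4 \<le> card ?N" using four card_mono[of ?N "{y \<in> ?N. ?\<tau> y \<noteq> y}"] by (simp add: mv_def)
  interpret R: pure_chain "reverse (Suc t)" p 1
    using p_fixed finO unfolding O'_def by (intro rev_chain) auto
  have RO: "R.orb UNIV p = O'" by (simp add: orb_rev O'_def)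
  have revd: "reverse (Suc t) (t - i) = \<rho> i" if "i \<le> t" for i using that by (simp add: reverse_def less_Suc_eq_le)
  have sizeO: "Suc t - i + 1 \<le> card O'" if "i \<le> t" "y \<in> O'" "\<rho> i y \<noteq> y" for i y
    using R.acting_layers(3)[of y "t - i"] that by (simp add: RO revd)
  have t2: "\<rho> (t + 2) (\<rho> i y) = \<rho> i (\<rho> (t + 2) y)" if "i \<le> t" for i y using that by (simp add: comm')
  show ?thesis
  proof (cases "\<exists>y\<in>O'. \<rho> e y \<noteq> y")
    case False
    define dl where "dl = (LEAST i. \<exists>y\<in>O'. \<rho> i y \<noteq> y)"
    have ex: "\<exists>y\<in>O'. \<rho> t y \<noteq> y" using t_moves pO by blast
    have dl_t: "dl \<le> t" unfolding dl_def using ex by (rule Least_le)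
    have "\<exists>y\<in>O'. \<rho> dl y \<noteq> y" unfolding dl_def using ex by (rule LeastI)
    then obtain y where y: "y \<in> O'" "\<rho> dl y \<noteq> y" by blast
    have fx: "\<rho> i w = w" if "i < dl" "w \<in> O'" for i w
      using not_less_Least[of i "\<lambda>i. \<exists>y\<in>O'. \<rho> i y \<noteq> y"] that by (auto simp: dl_def)
    have "e \<noteq> dl" using False y by auto
    moreover have "\<not> dl < e" using y least ON by blast
    ultimately have "e < dl" by simp
    \<comment> \<open>Growth starts from all of \<open>O'\<close> instead of the entry. As
      \<open>O'\<close> is closed under the labels up to \<open>dl\<close>, the stronger form of
      \<open>layer_growth\<close> is available.\<close>
    have "dl - e + 2 \<le> card (?N - O')"
      using \<open>e < dl\<close> dl_t fx O_closed e pO ON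
      by (intro layer_growth(2)[of _ _ _ _ z]) (auto simp: entry_first)
    moreover have "card ?N = card O' + card (?N - O')"
      using ON finO by (metis card_Diff_subset card_mono finite_N le_add_diff_inverse)
    ultimately have "(Suc t - e) + 3 \<le> card ?N" using sizeO[OF dl_t y] \<open>e < dl\<close> dl_t by linarith
    then show ?thesis ..
  next
    case True
    then obtain y where y: "y \<in> O'" "\<rho> e y \<noteq> y" by blast
    have sz: "Suc t - e + 1 \<le> card O'" using sizeO[OF e(1) y] .
    consider "?\<tau> p = p" | "?\<tau> p \<notin> O'" | "?\<tau> p \<in> O'" "?\<tau> p \<noteq> p" by blast
    then show ?thesis
    proof cases
      case 1
      have "?\<tau> w = w" if "w \<in> O'" for w
        by (rule orb_fixed[where I = "{..<Suc t}" and x = p]) (use t2 1 that in \<open>auto simp: O'_def\<close>)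
      then have "{w \<in> ?N. ?\<tau> w \<noteq> w} \<subseteq> ?N - O'" by blast
      then have "mv (t + 2) ?N \<le> card (?N - O')" unfolding mv_def by (rule card_mono[rotated]) simp
      moreover have "card ?N = card O' + card (?N - O')"
        using ON finO by (metis card_Diff_subset card_mono finite_N le_add_diff_inverse)
      ultimately show ?thesis using four sz by simp
    next
      case 2
      have im: "?\<tau> ` O' = orb {..<Suc t} (?\<tau> p)" unfolding O'_def by (rule orb_commute) (use t2 in auto)
      have disj: "O' \<inter> ?\<tau> ` O' = {}"
      proof (rule ccontr)
        assume "O' \<inter> ?\<tau> ` O' \<noteq> {}"
        then obtain w where "w \<in> orb {..<Suc t} p" "w \<in> orb {..<Suc t} (?\<tau> p)" using im O'_def by auto
        then have "?\<tau> p \<in> orb {..<Suc t} p" using orb_sym orb_eq by blast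
        then show False using 2 by (simp add: O'_def)
      qed
      have "card (?\<tau> ` O') = card O'" by (rule card_image) (simp add: inj_on_def rho_inj)
      then have "card (O' \<union> ?\<tau> ` O') = 2 * card O'" using card_Un_disjoint[OF _ _ disj] finO by simp
      moreover have "O' \<union> ?\<tau> ` O' \<subseteq> ?N" using ON pres by auto
      ultimately have "2 * card O' \<le> card ?N" using card_mono[OF finite_N] by metis
      then show ?thesis using sz e(1) by linarith
    next
      case 3
      have "2 * (t - e + 1) \<le> card O'"
        using R.commuting_double[of y "t - e" ?\<tau>] y 3 e(1) t2 unfolding RO
        by (simp add: revd) (simp add: reverse_def)
      moreover have "card O' \<le> card ?N" using ON by (rule card_mono[OF finite_N])
      ultimately have N2: "2 * (Suc t - e) \<le> card ?N" using e(1) by simp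
      \<comment> \<open>In the exceptional case \<open>O'\<close> is the whole layer and consists of
        two \<open>t\<close>-edges exchanged by label \<open>t + 2\<close>, so label
        \<open>t\<close> moves all four points.\<close>
      have exc: "mv t ?N = 4" if eq: "Suc t - e = 2" "card ?N = 4"
      proof -
        have "4 \<le> card O'" using \<open>2 * (t - e + 1) \<le> card O'\<close> eq e(1) by simp
        then have O4: "O' = ?N" using ON card_seteq[OF finite_N ON] eq by simp
        have e': "e = t - 1" "0 < t" using eq e(1) by auto
        let ?a = "\<rho> t p"
        have "?\<tau> p \<noteq> ?a"
        proof
          assume a: "?\<tau> p = ?a"
          have "O' \<subseteq> {p, ?a}" unfolding O'_def
          proof (rule orb_subset)
            fix w i assume w: "w \<in> {p, ?a}" and i: "i \<in> {..<Suc t}"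
            show "\<rho> i w \<in> {p, ?a}"
            proof (cases "i = t")
              case True then show ?thesis using w by auto
            next
              case False
              then have "\<rho> i p = p" using i p_fixed by simp
              moreover have "\<rho> i ?a = ?a" using t2[of i p] a \<open>\<rho> i p = p\<close> i by simp
              ultimately show ?thesis using w by auto
            qed
          qed simp
          then have "card O' \<le> card {p, ?a}" by (rule card_mono[rotated]) simp
          also have "\<dots> \<le> 2" by (simp add: card_insert_if)
          finally show False using \<open>4 \<le> card O'\<close> by simp
        qed
        moreover have ta: "?\<tau> ?a = \<rho> t (?\<tau> p)" using t2 by simp
        have "?\<tau> ?a \<noteq> ?a" using ta 3 rho_inj by metis
        moreover have "?\<tau> ?a \<noteq> p" using \<open>?\<tau> p \<noteq> ?a\<close> rho_flip by metis
        moreover have "?\<tau> ?a \<noteq> ?\<tau> p" using t_moves rho_inj by metis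
        ultimately have "card {p, ?a, ?\<tau> p, ?\<tau> ?a} = 4"
          using 3 t_moves by (simp add: card_insert_if eq_commute)
        moreover have sub: "{p, ?a, ?\<tau> p, ?\<tau> ?a} \<subseteq> {w \<in> ?N. \<rho> t w \<noteq> w}"
        proof -
          have aN: "?a \<in> ?N" using N_closed[of t "Suc t" p] p_N by simp
          have "\<rho> t p \<noteq> p" "\<rho> t ?a \<noteq> ?a" using t_moves by (auto simp: eq_commute)
          moreover have "\<rho> t (?\<tau> p) \<noteq> ?\<tau> p" using ta \<open>?\<tau> ?a \<noteq> ?\<tau> p\<close> by simp
          moreover have "\<rho> t (?\<tau> ?a) \<noteq> ?\<tau> ?a" using ta \<open>?\<tau> ?a \<noteq> ?\<tau> p\<close> by simp
          ultimately show ?thesis using p_N aN pres[OF p_N] pres[OF aN] by simp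
        qed
        ultimately have "4 \<le> mv t ?N" unfolding mv_def using card_mono[OF _ sub] by simp
        moreover have "mv t ?N \<le> card ?N" unfolding mv_def by (rule card_mono) auto
        ultimately show ?thesis using eq by simp
      qed
      show ?thesis
      proof (cases "Suc t - e = 2 \<and> card ?N = 4")
        case True then show ?thesis using exc by blast
      next
        case False
        have "Suc t - e + 3 \<le> card ?N"
        proof (cases "Suc t - e \<le> 2")
          case True
          then show ?thesis using False N2 four' e(1) by linarith
        next
          case False then show ?thesis using N2 by linarith
        qed
        then show ?thesis ..
      qed
    qed
  qed
qed

lemma single_layer_symmetry:
  assumes pres: "\<And>y. y \<in> N (Suc t) \<Longrightarrow> \<rho> (t + 2) y \<in> N (Suc t)"
    and four: "4 \<le> mv (t + 2) (N (Suc t))"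
    and e: "e \<le> t" "z \<in> N (Suc t)" "\<rho> e z \<noteq> z"
  shows "(Suc t - e) + 3 \<le> card (N (Suc t)) \<or>
    (Suc t - e = 2 \<and> card (N (Suc t)) = 4 \<and> mv t (N (Suc t)) = 4)"
proof -
  define e0 where "e0 = (LEAST i. \<exists>y\<in>N (Suc t). \<rho> i y \<noteq> y)"
  have ex: "\<exists>y\<in>N (Suc t). \<rho> e y \<noteq> y" using e by blast
  have le: "e0 \<le> e" unfolding e0_def using ex by (rule Least_le)
  have "\<exists>y\<in>N (Suc t). \<rho> e0 y \<noteq> y" unfolding e0_def using ex by (rule LeastI)
  then obtain y where y: "y \<in> N (Suc t)" "\<rho> e0 y \<noteq> y" by blast
  have "\<rho> i w = w" if "i < e0" "w \<in> N (Suc t)" for i w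
    using not_less_Least[of i "\<lambda>i. \<exists>y\<in>N (Suc t). \<rho> i y \<noteq> y"] that by (auto simp: e0_def)
  then have "(Suc t - e0) + 3 \<le> card (N (Suc t)) \<or>
    (Suc t - e0 = 2 \<and> card (N (Suc t)) = 4 \<and> mv t (N (Suc t)) = 4)"
    using single_layer_symmetry_least[OF pres four _ y] le e(1) by (meson le_trans)
  then show ?thesis using le e(1) by (cases "e = e0") auto
qed

end

context pure_chain
begin

lemma card_A_sum: "m \<le> g \<Longrightarrow> card (A (Suc g)) = card (A m) + (\<Sum>j=m..g. card (N j))"
  by (induction g rule: dec_induct) (simp_all add: card_A_Suc)

lemma A_diff: "m \<le> g \<Longrightarrow> A (Suc g) - A m = (\<Union>j\<in>{m..g}. N j)"
proof (induction g rule: dec_induct)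
  case base show ?case by (simp add: N_def)
next
  case (step g)
  have "A m \<inter> N (Suc g) = {}" using A_mono[of m "Suc g"] A_N_disj[of "Suc g"] step.hyps by auto
  then have "A (Suc (Suc g)) - A m = (A (Suc g) - A m) \<union> N (Suc g)"
    unfolding A_Suc[of "Suc g"] by blast
  moreover have "{m..Suc g} = insert (Suc g) {m..g}" using step.hyps by auto
  ultimately show ?case using step.IH by (simp add: Un_commute)
qed

lemma mv_A_split:
  assumes "m \<le> g" shows "mv i (A g) = mv i (A m) + mv i (A g - A m)"
proof -
  have "A g = A m \<union> (A g - A m)" using A_mono[OF assms] by blast
  moreover have "mv i (A m \<union> (A g - A m)) = mv i (A m) + mv i (A g - A m)" by (rule mv_Un) auto
  ultimately show ?thesis by simp
qed

text \<open>A label that opens no layer fixes \<open>A g\<close> pointwise, so it permutes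
  \<open>N g\<close> and moves nothing else.\<close>

lemma empty_layer_symmetry:
  assumes "c \<le> Suc g" "N (Suc g) = {}"
  shows "y \<in> N g \<Longrightarrow> \<rho> (Suc g) y \<in> N g" "mv (Suc g) (A (Suc g)) = mv (Suc g) (N g)"
proof -
  have eq: "A (Suc (Suc g)) = A (Suc g)" using assms A_Suc by auto
  have fx: "\<rho> (Suc g) y = y" if "y \<in> A g" for y using A_fixed[of g "Suc g" y] assms that by simp
  show "\<rho> (Suc g) y \<in> N g" if y: "y \<in> N g"
  proof -
    have "\<rho> (Suc g) y \<in> A (Suc g)" using y A_closed[of "Suc g" "Suc (Suc g)" y] by (simp add: eq N_def)
    moreover have "\<rho> (Suc g) y \<notin> A g"
    proof
      assume "\<rho> (Suc g) y \<in> A g"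
      then have "y \<in> A g" using fx by (metis invol)
      then show False using y by (simp add: N_def)
    qed
    ultimately show ?thesis by (simp add: N_def)
  qed
  have "mv (Suc g) (A (Suc g)) = mv (Suc g) (A g) + mv (Suc g) (N g)"
    unfolding A_Suc by (rule mv_Un) (auto simp: A_N_disj)
  then show "mv (Suc g) (A (Suc g)) = mv (Suc g) (N g)" using mv_eq_0[of "A g"] fx by simp
qed

end

context fat_run
begin

text \<open>Label \<open>Suc g\<close> brings no layer, so two points more than in
  \<open>fat_run_sum\<close> are needed to pay for it. If a label as small as \<open>e\<close> acts
  before the last layer, the four moved points of \<open>Suc g\<close> suffice. Otherwise the growth
  in the last layer does, with an inactive point of the run making up for an entry set of size
  one.\<close>

lemma symmetric_end:
  assumes g: "Suc t \<le> g" and fat: "\<And>j. j \<in> {Suc t..g} \<Longrightarrow> 2 \<le> card (N j)"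
    and empty: "N (Suc g) = {}" and four: "4 \<le> mv (Suc g) (A (Suc g))"
    and e: "e \<le> t" "acts e g"
  shows "2 * (g - t) + (Suc t - e) + 1 \<le> (\<Sum>j=Suc t..g. card (N j)) \<or>
    (g = Suc t \<and> Suc t - e = 2 \<and> (\<Sum>j=Suc t..g. card (N j)) = 4 \<and> mv t (N (Suc t)) = 4)"
proof -
  have cg: "c \<le> Suc g" using ct g by simp
  note sym = empty_layer_symmetry[OF cg empty]
  have four': "4 \<le> card (N g)"
    using four card_mono[of "N g" "{y \<in> N g. \<rho> (Suc g) y \<noteq> y}"] unfolding sym(2)
    unfolding mv_def by simp
  show ?thesis
  proof (cases "g = Suc t")
    case True
    then obtain z where "z \<in> N (Suc t)" "\<rho> e z \<noteq> z" using e by (auto simp: acts_def)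
    then have "(Suc t - e) + 3 \<le> card (N (Suc t)) \<or>
        (Suc t - e = 2 \<and> card (N (Suc t)) = 4 \<and> mv t (N (Suc t)) = 4)"
      using single_layer_symmetry[of e z] sym four e(1) True by simp
    moreover have "g - t = 1" using True by simp
    ultimately show ?thesis using True by auto
  next
    case False
    then obtain h where h: "g = Suc h" "Suc t \<le> h" using g by (cases g) auto
    have S: "(\<Sum>j=Suc t..g. card (N j)) = (\<Sum>j=Suc t..h. card (N j)) + card (N g)"
      using h by simp
    have fat': "\<And>j. j \<in> {Suc t..h} \<Longrightarrow> 2 \<le> card (N j)" using fat h by auto
    obtain dl where dl: "dl \<le> t" "acts dl h" "\<And>i. i < dl \<Longrightarrow> \<not> acts i h"
      using least_acting h by blast
    note run = fat_run_sum[OF h(2) fat' dl(1,2)]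
    show ?thesis
    proof (cases "dl \<le> e")
      case True
      then show ?thesis using run four' S h e(1) by linarith
    next
      case False
      then have ed: "e < dl" by simp
      then have "\<not> acts e h" using dl by simp
      then obtain z where z: "z \<in> N (Suc h)" "\<rho> e z \<noteq> z" using acts_Suc e h by blast
      have "dl - e + 2 \<le> card (N (Suc h) - entry (Suc h))"
        using ed dl(1,3) z h entry_fixed[of h] entry_closed[of _ "Suc h"] entry_N
        by (intro layer_growth(2)[of _ _ _ _ z]) auto
      moreover have "card (N (Suc h)) = card (entry (Suc h)) + card (N (Suc h) - entry (Suc h))"
        using entry_N by (metis card_Diff_subset card_mono finite_N finite_entry le_add_diff_inverse)
      moreover have pos: "0 < card (entry (Suc h))" using entry_nonempty z by (auto simp: card_gt_0_iff)
      ultimately have big: "card (entry (Suc h)) + (dl - e) + 2 \<le> card (N g)" using h by simp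
      show ?thesis
      proof (cases "card (entry (Suc h)) = 1")
        case False
        then show ?thesis using big run S h ed dl(1) pos by linarith
      next
        case True
        then obtain y where y: "entry (Suc h) = {y}" by (auto simp: card_1_singleton_iff)
        have "\<rho> (Suc h) y \<in> N h" using entry_prev[of "Suc h" h y] y ct h by simp
        moreover have "\<rho> i (\<rho> (Suc h) y) = \<rho> (Suc h) y" if "i < h" for i
        proof -
          have "\<rho> i y = y" using entry_closed[of i "Suc h" y] y that by simp
          then show ?thesis using fixed_transfer[of i "Suc h"] that by simp
        qed
        ultimately have "2 * (h - t) + (Suc t - dl) \<le> (\<Sum>j=Suc t..h. card (N j))"
          using fat_run_sum_inactive[OF h(2) fat' dl(1,2)] by blast
        then show ?thesis using big S h ed dl(1) True by linarith
      qed
    qed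
  qed
qed

text \<open>The labels whose parity on the run has to be compensated elsewhere; each is worth two
  units in the exchange of labels for points.\<close>

definition odd_on_run where "odd_on_run g = {i. i \<le> t \<and> mv i (A (Suc g) - A (Suc t)) mod 4 \<noteq> 0}"

lemma finite_odd_on_run [simp]: "finite (odd_on_run g)"
  by (rule finite_subset[of _ "{..t}"]) (auto simp: odd_on_run_def)

lemma odd_on_run_acts:
  assumes "Suc t \<le> g" "i \<in> odd_on_run g" shows "acts i g"
proof -
  have "mv i (A (Suc g) - A (Suc t)) \<noteq> 0" using assms(2) by (auto simp: odd_on_run_def)
  then obtain z where "z \<in> A (Suc g) - A (Suc t)" "\<rho> i z \<noteq> z"
    by (metis mv_eq_0)
  then show ?thesis unfolding A_diff[OF assms(1)] acts_def by blast
qed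

lemma odd_on_run_bound:
  assumes g: "Suc t \<le> g"
  obtains e where "e \<le> t" "acts e g" "card (odd_on_run g) \<le> Suc t - e" "\<And>i. i \<in> odd_on_run g \<Longrightarrow> e \<le> i \<and> i \<le> t"
proof
  \<comment> \<open>Label \<open>t\<close> always acts on the run and keeps the minimum defined if
    no label is odd.\<close>
  let ?V = "insert t (odd_on_run g)"
  have m: "Min ?V \<in> ?V" by (rule Min_in) auto
  have V: "i \<in> ?V \<Longrightarrow> Min ?V \<le> i \<and> i \<le> t" for i by (auto simp: odd_on_run_def)
  then show "Min ?V \<le> t" by simp
  show "acts (Min ?V) g" using m odd_on_run_acts[OF g] acts_t[OF g] by (cases "Min ?V = t") simp_all
  show "\<And>i. i \<in> odd_on_run g \<Longrightarrow> Min ?V \<le> i \<and> i \<le> t" using V by blast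
  have "odd_on_run g \<subseteq> {Min ?V..t}" using V by auto
  then have "card (odd_on_run g) \<le> card {Min ?V..t}" by (rule card_mono[rotated]) simp
  then show "card (odd_on_run g) \<le> Suc t - Min ?V" by simp
qed

text \<open>The one-point layer is attached to a point fixed by all lower labels, so the run
  contains an inactive point. With \<open>a = g - t\<close> and \<open>b = Suc t - e\<close> there
  are at least \<open>2 * a + b + 1\<close> points, and three times this exceeds
  \<open>5 * (a + 1) + 2 * b\<close> by \<open>a + b - 2\<close>.\<close>

lemma run_sum_then_thin:
  assumes g: "Suc t \<le> g" "\<And>j. j \<in> {Suc t..g} \<Longrightarrow> 2 \<le> card (N j)" and thin: "card (N (Suc g)) = 1"
  shows "5 * (Suc g - t) + 2 * card (odd_on_run g) \<le> 3 * (\<Sum>j=Suc t..Suc g. card (N j))"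
proof -
  obtain e where e: "e \<le> t" "acts e g" "card (odd_on_run g) \<le> Suc t - e" using odd_on_run_bound[OF g(1)] by metis
  obtain y where y: "N (Suc g) = {y}" using thin by (auto simp: card_1_singleton_iff)
  then have "entry (Suc g) = {y}" using entry_nonempty[of "Suc g"] entry_N[of "Suc g"] by auto
  then have "\<rho> (Suc g) y \<in> N g" using entry_prev[of "Suc g" g y] ct g by simp
  moreover have "\<rho> i (\<rho> (Suc g) y) = \<rho> (Suc g) y" if "i < g" for i
  proof -
    have "\<rho> i y = y" using N_closed[of i "Suc g" y] y that by simp
    then show ?thesis using fixed_transfer[of i "Suc g"] that by simp
  qed
  ultimately have "2 * (g - t) + (Suc t - e) \<le> (\<Sum>j=Suc t..g. card (N j))"
    using fat_run_sum_inactive[OF g e(1,2)] by blast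
  moreover have "(\<Sum>j=Suc t..Suc g. card (N j)) = (\<Sum>j=Suc t..g. card (N j)) + 1" using g thin by simp
  ultimately show ?thesis using e(1,3) g(1) by linarith
qed

text \<open>The bound of \<open>fat_run_sum\<close> suffices unless the run is one layer and no
  label below \<open>t\<close> is odd on it. In that case two points would make label
  \<open>Suc t\<close> a single transposition of \<open>p\<close> and \<open>q\<close>, which
  evenness excludes.\<close>

lemma run_sum_end:
  assumes g: "Suc t \<le> g" "\<And>j. j \<in> {Suc t..g} \<Longrightarrow> 2 \<le> card (N j)"
    and even_g: "mv g (A (Suc g)) mod 4 = 0"
  shows "5 * (g - t) + 2 * card (odd_on_run g) \<le> 3 * (\<Sum>j=Suc t..g. card (N j))"
proof -
  obtain e where e: "e \<le> t" "acts e g" "card (odd_on_run g) \<le> Suc t - e" using odd_on_run_bound[OF g(1)] by metis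
  note run = fat_run_sum[OF g e(1,2)]
  show ?thesis
  proof (cases "g = Suc t \<and> e = t")
    case False
    then have "3 \<le> (g - t) + (Suc t - e)" using e g by linarith
    then show ?thesis using run e(3) by linarith
  next
    case True
    have "card (N (Suc t)) \<noteq> 2"
    proof
      assume two: "card (N (Suc t)) = 2"
      have bN: "\<rho> t p \<in> N (Suc t)" using N_closed[of t "Suc t" p] p_N by simp
      have Neq: "N (Suc t) = {p, \<rho> t p}"
        by (rule sym, rule card_seteq) (use two p_N bN t_moves in \<open>auto simp: card_insert_if\<close>)
      have pq: "\<rho> (Suc t) p = q" by (simp add: p_def)
      have pneq: "p \<noteq> q" using p_N single A_N_disj[of "Suc t"] A_Suc[of t] by auto
      have "\<rho> t p \<notin> entry (Suc t)" using entry_first t_moves by simp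
      then have "\<rho> (Suc t) (\<rho> t p) \<in> {p, \<rho> t p}" using bN Neq by (auto simp: entry_def)
      moreover have "\<rho> (Suc t) (\<rho> t p) \<noteq> p"
      proof
        assume "\<rho> (Suc t) (\<rho> t p) = p"
        then have "\<rho> t p = q" using pq by (metis invol)
        then show False using bN single A_N_disj[of "Suc t"] A_Suc[of t] by auto
      qed
      ultimately have bfix: "\<rho> (Suc t) (\<rho> t p) = \<rho> t p" by blast
      have "{y \<in> A (Suc (Suc t)). \<rho> (Suc t) y \<noteq> y} = {q, p}"
        unfolding A_Suc[of "Suc t"] A_Suc[of t] Neq single
        using A_fixed[of t "Suc t"] ct bfix pq pneq rho_flip[of "Suc t" p q] by auto
      then have "mv g (A (Suc g)) = card {q, p}" using True by (simp add: mv_def)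
      then show False using even_g pneq by (simp add: card_insert_if)
    qed
    then have "3 \<le> (\<Sum>j=Suc t..g. card (N j))" using True g(2)[of "Suc t"] by simp
    then show ?thesis using True e(3) by simp
  qed
qed

text \<open>In the exceptional case four points pay exactly for two labels and one odd label. A
  second odd label does not occur, since label \<open>t\<close> moves four points.\<close>

lemma run_sum_symmetric_end:
  assumes g: "Suc t \<le> g" "\<And>j. j \<in> {Suc t..g} \<Longrightarrow> 2 \<le> card (N j)"
    and empty: "N (Suc g) = {}" and four: "4 \<le> mv (Suc g) (A (Suc g))"
  shows "5 * (Suc g - t) + 2 * card (odd_on_run g) \<le> 3 * (\<Sum>j=Suc t..g. card (N j))"
proof -
  obtain e where e: "e \<le> t" "acts e g" "card (odd_on_run g) \<le> Suc t - e" "\<And>i. i \<in> odd_on_run g \<Longrightarrow> e \<le> i \<and> i \<le> t"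
    using odd_on_run_bound[OF g(1)] by metis
  from symmetric_end[OF g empty four e(1,2)] show ?thesis
  proof
    assume "2 * (g - t) + (Suc t - e) + 1 \<le> (\<Sum>j=Suc t..g. card (N j))"
    then show ?thesis using e(1,3) g(1) by linarith
  next
    assume x: "g = Suc t \<and> Suc t - e = 2 \<and> (\<Sum>j=Suc t..g. card (N j)) = 4 \<and> mv t (N (Suc t)) = 4"
    then have "t \<notin> odd_on_run g" by (simp add: odd_on_run_def N_def)
    have "odd_on_run g \<subseteq> {e}"
    proof
      fix i assume i: "i \<in> odd_on_run g"
      then have "i \<noteq> t" using \<open>t \<notin> odd_on_run g\<close> by blast
      moreover have "Suc t - e = 2" using x by blast
      ultimately have "i = e" using e(4)[OF i] by linarith
      then show "i \<in> {e}" by simp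
    qed
    then have "card (odd_on_run g) \<le> card {e}" by (rule card_mono[rotated]) simp
    then have "card (odd_on_run g) \<le> 1" by simp
    moreover have "Suc g - t = 2" "(\<Sum>j=Suc t..g. card (N j)) = 4" using x by (simp, blast)
    ultimately show ?thesis by linarith
  qed
qed

end

section \<open>Counting on both sides of a one-point layer\<close>

lemma four_le: "(m::nat) mod 4 = 0 \<Longrightarrow> m \<noteq> 0 \<Longrightarrow> 4 \<le> m"
  by presburger

context fat_run
begin

lemma odd_outside_run:
  assumes "Suc t \<le> g" "i \<le> t" "mv i (A (Suc t)) mod 4 \<noteq> 0" "i \<notin> odd_on_run g"
  shows "mv i (A (Suc g)) mod 4 \<noteq> 0"
proof -
  have "mv i (A (Suc g) - A (Suc t)) mod 4 = 0" using assms by (simp add: odd_on_run_def)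
  moreover have "mv i (A (Suc g)) = mv i (A (Suc t)) + mv i (A (Suc g) - A (Suc t))"
    using assms(1) by (intro mv_A_split) simp
  ultimately show ?thesis using assms(3) by presburger
qed

end

context pure_chain
begin

lemma fat_runI: "c \<le> Suc t \<Longrightarrow> N t = {q} \<Longrightarrow> 2 \<le> card (N (Suc t)) \<Longrightarrow> fat_run \<rho> x c t q"
  by unfold_locales auto

lemma first_layer:
  assumes "N 0 \<noteq> {}" shows "A (Suc 0) = {x, \<rho> 0 x}" "\<rho> 0 x \<noteq> x" "card (N 0) = 1"
proof -
  have sub: "A (Suc 0) \<subseteq> {x, \<rho> 0 x}" unfolding A_def by (rule orb_subset) auto
  have "\<rho> 0 x \<in> A (Suc 0)" using A_closed[of 0 "Suc 0" x] by simp
  then show eq: "A (Suc 0) = {x, \<rho> 0 x}" using sub by auto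
  then have N0: "N 0 = {x, \<rho> 0 x} - {x}" by (simp add: N_def A_0)
  then show "\<rho> 0 x \<noteq> x" using assms by auto
  then show "card (N 0) = 1" using N0 by (auto simp: card_1_singleton_iff)
qed

lemma last_thin:
  assumes "card (N 0) = 1" "0 < m"
  obtains t where "t < m" "card (N t) = 1" "\<And>j. t < j \<Longrightarrow> j < m \<Longrightarrow> card (N j) \<noteq> 1"
proof
  let ?T = "{t. t < m \<and> card (N t) = 1}"
  have "Max ?T \<in> ?T" using assms by (intro Max_in) auto
  then show "Max ?T < m" "card (N (Max ?T)) = 1" by auto
  fix j assume "Max ?T < j" "j < m"
  show "card (N j) \<noteq> 1"
  proof
    assume "card (N j) = 1"
    then have "j \<le> Max ?T" using \<open>j < m\<close> by (intro Max_ge) auto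
    then show False using \<open>Max ?T < j\<close> by simp
  qed
qed

lemma mv_thin_layer:
  assumes "N j = {y}" "i < j" shows "mv i (A (Suc j)) = mv i (A j)"
proof -
  have "\<rho> i y = y" using N_closed[of i j y] assms by simp
  then have "mv i (N j) = 0" using assms mv_eq_0[of "N j" i] by simp
  moreover have "mv i (A (Suc j)) = mv i (A j) + mv i (N j)"
    unfolding A_Suc by (rule mv_Un) (auto simp: A_N_disj)
  ultimately show ?thesis by simp
qed

text \<open>Induction along the one-point layers, with the odd labels \<open>U\<close> as debt. A
  one-point layer directly behind another has a label that moves only the last two points and so
  becomes odd; a run in between pays for its own labels and for those that it removes from
  \<open>U\<close>. At the start, two points and one odd label give equality.\<close>

lemma down_thin:
  assumes c: "c \<le> 1" and ne: "N 0 \<noteq> {}" "\<And>i. i < k \<Longrightarrow> N i \<noteq> {}"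
    and j: "j \<le> k" "card (N j) = 1"
  shows "\<exists>U. U \<subseteq> {..j} \<and> (\<forall>i\<in>U. mv i (A (Suc j)) mod 4 \<noteq> 0) \<and>
    5 * Suc j + 3 \<le> 3 * card (A (Suc j)) + 2 * card U"
  using j
proof (induction j rule: less_induct)
  case (less j)
  show ?case
  proof (cases "j = 0")
    case True
    have "{y \<in> {x, \<rho> 0 x}. \<rho> 0 y \<noteq> y} = {x, \<rho> 0 x}" using first_layer(2)[OF ne(1)] by auto
    then have "mv 0 (A (Suc 0)) = 2" unfolding first_layer(1)[OF ne(1)] mv_def
      using first_layer(2)[OF ne(1)] by (simp add: card_insert_if)
    moreover have "card (A (Suc 0)) = 2" unfolding first_layer(1)[OF ne(1)]
      using first_layer(2)[OF ne(1)] by (simp add: card_insert_if)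
    ultimately show ?thesis using True by (intro exI[of _ "{0}"]) simp
  next
    case False
    obtain t where t: "t < j" "card (N t) = 1" "\<And>l. t < l \<Longrightarrow> l < j \<Longrightarrow> card (N l) \<noteq> 1"
      using last_thin[OF first_layer(3)[OF ne(1)], of j] False by auto
    obtain U where U: "U \<subseteq> {..t}" "\<And>i. i \<in> U \<Longrightarrow> mv i (A (Suc t)) mod 4 \<noteq> 0"
      "5 * Suc t + 3 \<le> 3 * card (A (Suc t)) + 2 * card U"
      using less.IH[of t] t less.prems by auto
    have finU: "finite U" using U(1) finite_subset by blast
    obtain y where y: "N j = {y}" using less.prems by (auto simp: card_1_singleton_iff)
    obtain q where q: "N t = {q}" using t by (auto simp: card_1_singleton_iff)
    show ?thesis
    proof (cases "Suc t = j")
      case True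
      have old: "mv i (A (Suc j)) mod 4 \<noteq> 0" if "i \<in> U" for i
      proof -
        have "i < j" using U(1) that t(1) by auto
        then have "mv i (A (Suc j)) = mv i (A (Suc t))" using mv_thin_layer[OF y] True by simp
        then show ?thesis using U(2)[OF that] by simp
      qed
      have "entry j = {y}" using entry_nonempty[of j] entry_N[of j] y by auto
      then have "\<rho> j y \<in> N t" by (intro entry_prev) (use c True in simp_all)
      then have jy: "\<rho> j y = q" using q by simp
      then have jq: "\<rho> j q = y" by (metis invol)
      have yq: "y \<noteq> q" using y q A_N_disj[of j] A_Suc[of t] True by auto
      have fx: "\<rho> j z = z" if "z \<in> A t" for z using A_fixed[of t j z] c that True by simp
      have Aj: "A (Suc j) = insert y (insert q (A t))" using A_Suc[of j] A_Suc[of t] y q True by auto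
      have "{z \<in> A (Suc j). \<rho> j z \<noteq> z} = {y, q}" unfolding Aj using fx jy jq yq by auto
      then have "mv j (A (Suc j)) = 2" unfolding mv_def using yq by simp
      moreover have "card (A (Suc j)) = card (A (Suc t)) + 1" using card_A_Suc[of j] True less.prems by simp
      moreover have "j \<notin> U" using U(1) t by auto
      ultimately show ?thesis using U old finU True
        by (intro exI[of _ "insert j U"]) (auto simp: card_insert_if)
    next
      case False
      then obtain g where g: "j = Suc g" "Suc t \<le> g" using t by (cases j) auto
      have fat: "2 \<le> card (N l)" if "l \<in> {Suc t..g}" for l
      proof -
        have "card (N l) \<noteq> 1" using t(3)[of l] that g by auto
        moreover have "card (N l) \<noteq> 0" using ne(2)[of l] that g less.prems by simp
        ultimately show ?thesis by linarith
      qed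
      interpret F: fat_run \<rho> x c t q by (rule fat_runI) (use c q fat[of "Suc t"] g in auto)
      have sum: "5 * (j - t) + 2 * card (F.odd_on_run g) \<le> 3 * (\<Sum>l=Suc t..j. card (N l))"
        using F.run_sum_then_thin[OF g(2) fat] less.prems g by simp
      have old: "mv i (A (Suc j)) mod 4 \<noteq> 0" if "i \<in> U - F.odd_on_run g" for i
      proof -
        have i: "i \<le> t" "i < j" using U(1) that t(1) by auto
        then show ?thesis using F.odd_outside_run[OF g(2) i(1)] U(2)[of i] that mv_thin_layer[OF y i(2)] g by simp
      qed
      have "card U \<le> card (U - F.odd_on_run g) + card (F.odd_on_run g)"
        using diff_card_le_card_Diff[of "F.odd_on_run g" U] by simp
      moreover have "card (A (Suc j)) = card (A (Suc t)) + (\<Sum>l=Suc t..j. card (N l))"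
        using t(1) by (intro card_A_sum) simp
      ultimately show ?thesis using U(1,3) old sum t(1)
        by (intro exI[of _ "U - F.odd_on_run g"]) auto
    qed
  qed
qed

text \<open>Behind the last one-point layer the chain may end in a run. Evenness of label
  \<open>k\<close> is what \<open>run_sum_end\<close> requires, and if \<open>k\<close> opens no
  layer, its moved points supply the symmetry for \<open>run_sum_symmetric_end\<close>.\<close>

lemma down_sum:
  assumes c: "c \<le> 1" and ne: "N 0 \<noteq> {}" "\<And>i. i < k \<Longrightarrow> N i \<noteq> {}"
    and ev: "mv k (A (Suc k)) mod 4 = 0" "mv k (A (Suc k)) \<noteq> 0"
  shows "\<exists>U. U \<subseteq> {..k} \<and> (\<forall>i\<in>U. mv i (A (Suc k)) mod 4 \<noteq> 0) \<and>
    5 * Suc k + 3 \<le> 3 * card (A (Suc k)) + 2 * card U"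
proof (cases "card (N k) = 1")
  case True
  then show ?thesis using down_thin[OF c ne order_refl] by blast
next
  case False
  then have "k \<noteq> 0" using first_layer(3)[OF ne(1)] by metis
  then obtain t where t: "t < k" "card (N t) = 1" "\<And>l. t < l \<Longrightarrow> l < k \<Longrightarrow> card (N l) \<noteq> 1"
    using last_thin[OF first_layer(3)[OF ne(1)], of k] by auto
  obtain U where U: "U \<subseteq> {..t}" "\<And>i. i \<in> U \<Longrightarrow> mv i (A (Suc t)) mod 4 \<noteq> 0"
    "5 * Suc t + 3 \<le> 3 * card (A (Suc t)) + 2 * card U"
    using down_thin[OF c ne _ t(2)] t(1) by (meson less_imp_le)
  obtain q where q: "N t = {q}" using t by (auto simp: card_1_singleton_iff)
  have fat0: "2 \<le> card (N l)" if "t < l" "l < k" for l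
  proof -
    have "card (N l) \<noteq> 1" using t(3)[of l] that by auto
    moreover have "card (N l) \<noteq> 0" using ne(2)[of l] that by simp
    ultimately show ?thesis by linarith
  qed
  have four: "4 \<le> mv k (A (Suc k))" using ev by (rule four_le)
  have finish: ?thesis if g: "Suc t \<le> g" "A (Suc g) = A (Suc k)" and F: "fat_run \<rho> x c t q"
    and sum: "5 * (k - t) + 2 * card (fat_run.odd_on_run \<rho> x t g) \<le> 3 * (\<Sum>l=Suc t..g. card (N l))" for g
  proof -
    interpret F: fat_run \<rho> x c t q by (rule F)
    have old: "mv i (A (Suc k)) mod 4 \<noteq> 0" if "i \<in> U - F.odd_on_run g" for i
      using F.odd_outside_run[OF g(1), of i] U(1) U(2)[of i] that g(2) by auto
    have "card U \<le> card (U - F.odd_on_run g) + card (F.odd_on_run g)"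
      using diff_card_le_card_Diff[of "F.odd_on_run g" U] by simp
    moreover have "card (A (Suc k)) = card (A (Suc t)) + (\<Sum>l=Suc t..g. card (N l))"
      using g card_A_sum[OF g(1)] by simp
    ultimately show ?thesis using U(1,3) old sum t(1)
      by (intro exI[of _ "U - F.odd_on_run g"]) auto
  qed
  show ?thesis
  proof (cases "N k = {}")
    case False
    then have "2 \<le> card (N k)" using \<open>card (N k) \<noteq> 1\<close> by (metis One_nat_def Suc_1 Suc_leI card_eq_0_iff finite_N less_one linorder_neqE_nat)
    then have fat: "2 \<le> card (N l)" if "l \<in> {Suc t..k}" for l
      using that fat0[of l] by (cases "l = k") auto
    interpret F: fat_run \<rho> x c t q by (rule fat_runI) (use c q fat[of "Suc t"] t in auto)
    show ?thesis using finish[of k] F.run_sum_end[of k] fat t(1) ev F.fat_run_axioms by auto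
  next
    case True
    obtain g where g: "k = Suc g" using t(1) by (cases k) auto
    have Ak: "A (Suc k) = A k" using True A_Suc by auto
    have "mv k (A (Suc k)) = mv k (N g)" using empty_layer_symmetry(2)[of g] True g c Ak by simp
    also have "\<dots> \<le> card (N g)" unfolding mv_def by (rule card_mono) auto
    finally have "card (N g) \<noteq> 1" using four by simp
    then have tg: "Suc t \<le> g" using t g by (metis Suc_leI less_Suc_eq)
    have fat: "2 \<le> card (N l)" if "l \<in> {Suc t..g}" for l using fat0[of l] that g by simp
    interpret F: fat_run \<rho> x c t q by (rule fat_runI) (use c q fat[of "Suc t"] tg in auto)
    show ?thesis
      using finish[of g] F.run_sum_symmetric_end[OF tg fat] tg True four g Ak F.fat_run_axioms by simp
  qed
qed

end

locale string_action = invol_string \<rho> for \<rho> :: "nat \<Rightarrow> 'a \<Rightarrow> 'a" +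
  fixes \<Omega> :: "'a set" and r :: nat
  assumes finite_points: "finite \<Omega>"
    and closed: "y \<in> \<Omega> \<Longrightarrow> \<rho> i y \<in> \<Omega>"
    and trivial_beyond: "r \<le> i \<Longrightarrow> \<rho> i y = y"
    and even_labels: "mv i \<Omega> mod 4 = 0"
    and nontrivial: "i < r \<Longrightarrow> \<exists>y\<in>\<Omega>. \<rho> i y \<noteq> y"
    and transitive: "y \<in> \<Omega> \<Longrightarrow> orb {..<r} y = \<Omega>"
begin

lemma orb_points: "y \<in> \<Omega> \<Longrightarrow> orb I y \<subseteq> \<Omega>"
  by (rule orb_subset) (auto simp: closed)

lemma chain:
  assumes "y \<in> \<Omega>" "\<And>i. c \<le> i \<Longrightarrow> \<rho> i y = y" shows "pure_chain \<rho> y c"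
  by unfold_locales (use assms orb_points[of y UNIV] finite_points finite_subset in auto)

lemma mv_four: "i < r \<Longrightarrow> 4 \<le> mv i \<Omega>"
proof -
  assume "i < r"
  then have "mv i \<Omega> \<noteq> 0" using nontrivial[of i] finite_points by (auto simp: mv_def)
  then show ?thesis by (rule four_le[OF even_labels])
qed

end

locale based_string = string_action + pure_chain \<rho> x c for x c +
  assumes base_point: "x \<in> \<Omega>"
begin

lemma A_r: "A r = \<Omega>" using transitive[OF base_point] by (simp add: A_def)

lemma A_points: "A k \<subseteq> \<Omega>" unfolding A_def using orb_points[OF base_point] .

lemma layer_nonempty: "c \<le> Suc j \<Longrightarrow> Suc j < r \<Longrightarrow> N j \<noteq> {}"
proof
  assume j: "c \<le> Suc j" "Suc j < r" and "N j = {}"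
  then have eq: "A (Suc j) = A j" using A_Suc by auto
  have "\<rho> i y \<in> A j" if "y \<in> A j" for i y
    using A_closed[of i "Suc j" y] A_fixed[of j i y] eq that j by (cases "i \<le> j") auto
  then have "orb UNIV x = A j" by (rule orb_UNIV_eq_A)
  then have "\<Omega> \<subseteq> A j" using A_r A_sub_orb[of r] by simp
  then show False using nontrivial[of "Suc j"] A_fixed[of j "Suc j"] j by blast
qed

lemma last_layer_empty:
  assumes "c \<le> Suc j" "Suc (Suc j) = r" "N (Suc j) = {}"
  shows "A (Suc j) = \<Omega>" "4 \<le> mv (Suc j) (A (Suc j))" "4 \<le> card (N j)"
proof -
  show 1: "A (Suc j) = \<Omega>" using A_r A_Suc[of "Suc j"] assms by simp
  then show 2: "4 \<le> mv (Suc j) (A (Suc j))" using mv_four assms by simp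
  have "mv (Suc j) (A (Suc j)) \<le> card (N j)"
    unfolding empty_layer_symmetry(2)[OF assms(1,3)] unfolding mv_def by (rule card_mono) auto
  then show "4 \<le> card (N j)" using 2 by simp
qed

text \<open>The cut is made at the last one-point layer \<open>N k = {p}\<close>, and the part
  \<open>W\<close> is read backwards from \<open>p\<close>, so that label 0 comes last there. If
  label 0 acts behind the cut too, the run is long enough for \<open>2 * r \<le> n + 1\<close>.
  Otherwise label 0 is even on \<open>W\<close>, \<open>down_sum\<close> applies, and the odd labels
  that it leaves are among those odd on the run, whose surplus covers them.\<close>

theorem thin_case:
  assumes r: "5 \<le> r" and x0: "\<rho> 0 x \<noteq> x" and k: "c \<le> Suc k" "k < r" "card (N k) = 1"
    and last: "\<And>j. k < j \<Longrightarrow> j < r \<Longrightarrow> card (N j) \<noteq> 1"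
  shows "5 * r + 3 \<le> 3 * card \<Omega> \<or> 2 * r \<le> Suc (card \<Omega>)"
proof -
  obtain p where p: "N k = {p}" using k by (auto simp: card_1_singleton_iff)
  define W where "W = A (Suc k)"
  have pW: "p \<in> W" using p A_Suc[of k] by (simp add: W_def)
  have pfix: "\<rho> i p = p" if "i < k" for i using N_closed[of i k p] p that by simp
  have orbp: "orb {..<Suc k} p = W" using pW orb_eq[of p "{..<Suc k}" x] by (simp add: W_def A_def)
  interpret D: pure_chain "reverse (Suc k)" p 1
    by (rule rev_chain) (use pfix orbp in \<open>auto simp: W_def\<close>)
  have DW: "D.orb UNIV p = W" using orb_rev[of "Suc k" p] orbp by simp
  have revd: "reverse (Suc k) i = \<rho> (k - i)" if "i \<le> k" for i using that by (simp add: reverse_def less_Suc_eq_le)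
  have "reverse (Suc k) i y \<in> D.A (Suc k)" if "y \<in> D.A (Suc k)" for i y
    using that D.A_closed[of i "Suc k" y] by (cases "i < Suc k") (auto simp: reverse_def)
  then have DA: "D.A (Suc k) = W" using D.orb_UNIV_eq_A DW by blast
  have xW: "x \<in> W" by (simp add: W_def)
  have kmoves: "\<rho> k p \<noteq> p"
  proof -
    have "entry k = {p}" using entry_nonempty[of k] entry_N[of k] p by auto
    then show ?thesis using p by (auto simp: entry_def)
  qed
  have rev0: "reverse (Suc k) k x \<noteq> x" using x0 by (simp add: revd)
  have ne: "D.N i \<noteq> {}" if "i < k" for i using D.acting_layers(1)[of x k i] that xW DW rev0 by simp
  have ne0: "D.N 0 \<noteq> {}"
  proof -
    have "\<rho> k p \<in> D.A (Suc 0)" using D.A_closed[of 0 "Suc 0" p] by (simp add: revd)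
    then show ?thesis using kmoves by (auto simp: D.N_def D.A_0)
  qed
  have cardW: "k + 2 \<le> card W" using D.acting_layers(3)[of x k] xW DW rev0 by simp
  have Dmv: "D.mv i X = mv (k - i) X" if "i \<le> k" for i X
    using that by (simp add: D.mv_def mv_def revd)
  have Wpoints: "W \<subseteq> \<Omega>" unfolding W_def by (rule A_points)
  have fin: "finite W" "finite (\<Omega> - W)" using finite_points Wpoints finite_subset by auto
  have split: "mv i \<Omega> = mv i W + mv i (\<Omega> - W)" for i
  proof -
    have "mv i (W \<union> (\<Omega> - W)) = mv i W + mv i (\<Omega> - W)" by (rule mv_Un) (use fin in auto)
    moreover have "W \<union> (\<Omega> - W) = \<Omega>" using Wpoints by blast
    ultimately show ?thesis by simp
  qed
  have down: "\<exists>U. U \<subseteq> {..k} \<and> (\<forall>i\<in>U. mv i (\<Omega> - W) mod 4 \<noteq> 0) \<and> 5 * Suc k + 3 \<le> 3 * card W + 2 * card U"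
    if triv: "\<And>z. z \<in> \<Omega> - W \<Longrightarrow> \<rho> 0 z = z"
  proof -
    have "mv 0 (\<Omega> - W) = 0" by (rule mv_eq_0) (rule triv)
    then have m: "mv 0 W = mv 0 \<Omega>" using split[of 0] by simp
    have "D.mv k (D.A (Suc k)) = mv 0 \<Omega>" using Dmv[of k] DA m by simp
    moreover have "0 < r" using r by simp
    ultimately obtain U where U: "U \<subseteq> {..k}" "\<And>i. i \<in> U \<Longrightarrow> D.mv i (D.A (Suc k)) mod 4 \<noteq> 0"
      "5 * Suc k + 3 \<le> 3 * card (D.A (Suc k)) + 2 * card U"
      using D.down_sum[of k] ne ne0 even_labels[of 0] mv_four[of 0] by auto
    have inj: "inj_on (\<lambda>i. k - i) U"
    proof (rule inj_onI)
      fix i j assume "i \<in> U" "j \<in> U" "k - i = k - j"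
      moreover from this have "i \<le> k" "j \<le> k" using U(1) by auto
      ultimately show "i = j" by simp
    qed
    have "mv (k - i) (\<Omega> - W) mod 4 \<noteq> 0" if "i \<in> U" for i
    proof -
      have "mv (k - i) W mod 4 \<noteq> 0" using U(1) U(2)[OF that] Dmv[of i W] that DA by auto
      then show ?thesis using split[of "k - i"] even_labels[of "k - i"] by presburger
    qed
    then show ?thesis using U(1,3) card_image[OF inj] DA
      by (intro exI[of _ "(\<lambda>i. k - i) ` U"]) auto
  qed
  show ?thesis
  proof (cases "Suc k = r")
    case True
    then have "W = \<Omega>" using A_r by (simp add: W_def)
    then obtain U where "U \<subseteq> {..k}" "\<And>i. i \<in> U \<Longrightarrow> mv i {} mod 4 \<noteq> 0"
      "5 * Suc k + 3 \<le> 3 * card W + 2 * card U" using down by auto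
    moreover from this have "U = {}" by (auto simp: mv_def)
    ultimately show ?thesis using True \<open>W = \<Omega>\<close> by simp
  next
    case False
    then have kr: "Suc k < r" using k by simp
    \<comment> \<open>If the last label opens no layer, the run ends one index earlier.\<close>
    define g where "g = (if N (r - 1) = {} then r - 2 else r - 1)"
    have g: "Suc k \<le> g"
    proof (cases "N (r - 1) = {} \<and> Suc (Suc k) = r")
      case True
      then have "4 \<le> card (N k)" using last_layer_empty(3)[of k] k by auto
      then show ?thesis using k by simp
    next
      case False then show ?thesis using kr by (auto simp: g_def)
    qed
    have gr: "g < r" using kr by (auto simp: g_def)
    have fat: "2 \<le> card (N l)" if "l \<in> {Suc k..g}" for l
    proof -
      have "card (N l) \<noteq> 1" using last[of l] that gr by auto
      moreover have "N l \<noteq> {}"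
      proof (cases "Suc l < r")
        case True then show ?thesis using layer_nonempty[of l] that k by simp
      next
        case False
        then have "l = r - 1" "g = r - 1" using that gr by auto
        then show ?thesis using r by (auto simp: g_def split: if_splits)
      qed
      then have "card (N l) \<noteq> 0" by simp
      ultimately show ?thesis by linarith
    qed
    have Ag: "A (Suc g) = \<Omega>"
    proof (cases "N (r - 1) = {}")
      case True
      then show ?thesis using last_layer_empty(1)[of "r - 2"] k kr by (simp add: g_def Suc_diff_Suc numeral_2_eq_2)
    next
      case False then show ?thesis using A_r r by (simp add: g_def)
    qed
    interpret F: fat_run \<rho> x c k p by (rule fat_runI) (use k p fat[of "Suc k"] g in auto)
    have total: "card \<Omega> = card W + (\<Sum>l=Suc k..g. card (N l))"
      using card_A_sum[OF g] Ag by (simp add: W_def)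
    have odd: "F.odd_on_run g = {i. i \<le> k \<and> mv i (\<Omega> - W) mod 4 \<noteq> 0}"
      by (simp add: F.odd_on_run_def Ag W_def)
    have empty: "N (Suc g) = {}" "4 \<le> mv (Suc g) (A (Suc g))" "Suc (Suc g) = r" if "N (r - 1) = {}"
      using last_layer_empty(2)[of "r - 2"] that k kr by (auto simp: g_def Suc_diff_Suc numeral_2_eq_2)
    show ?thesis
    proof (cases "\<exists>z\<in>\<Omega> - W. \<rho> 0 z \<noteq> z")
      case True
      then have act: "F.acts 0 g" using A_diff[OF g] Ag by (auto simp: F.acts_def W_def)
      show ?thesis
      proof (cases "N (r - 1) = {}")
        case False
        then have "g = r - 1" by (simp add: g_def)
        then have gk: "g - k = r - Suc k" by simp
        have "2 * (g - k) + (Suc k - 0) \<le> Suc (\<Sum>l=Suc k..g. card (N l))"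
          by (rule F.fat_run_sum[OF g fat le0 act])
        then have "2 * r \<le> Suc (card \<Omega>)" using total cardW kr unfolding gk by linarith
        then show ?thesis ..
      next
        case True
        have "2 * (g - k) + (Suc k - 0) + 1 \<le> (\<Sum>l=Suc k..g. card (N l)) \<or> g = Suc k \<and> Suc k - 0 = 2"
          using F.symmetric_end[OF g fat empty(1)[OF True] empty(2)[OF True] _ act] by auto
        \<comment> \<open>The exceptional run would have \<open>k = 1\<close> and
          \<open>r = 4\<close>.\<close>
        moreover have "\<not> (g = Suc k \<and> Suc k - 0 = 2)" using empty(3)[OF True] r by auto
        ultimately have "2 * r \<le> Suc (card \<Omega>)" using total cardW kr empty(3)[OF True] by linarith
        then show ?thesis ..
      qed
    next
      case False
      then obtain U where U: "U \<subseteq> {..k}" "\<And>i. i \<in> U \<Longrightarrow> mv i (\<Omega> - W) mod 4 \<noteq> 0"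
        "5 * Suc k + 3 \<le> 3 * card W + 2 * card U" using down by auto
      have "U \<subseteq> F.odd_on_run g" using U odd by auto
      then have "card U \<le> card (F.odd_on_run g)" by (rule card_mono[rotated]) simp
      moreover have "5 * (r - Suc k) + 2 * card (F.odd_on_run g) \<le> 3 * (\<Sum>l=Suc k..g. card (N l))"
      proof (cases "N (r - 1) = {}")
        case False
        then have "g = r - 1" by (simp add: g_def)
        then show ?thesis using F.run_sum_end[OF g fat] even_labels[of g] Ag by simp
      next
        case True
        then show ?thesis using F.run_sum_symmetric_end[OF g fat empty(1,2)] empty(3) by simp
      qed
      moreover obtain d where d: "r = Suc k + d" using kr less_imp_add_positive by blast
      then have "r - Suc k = d" "5 * r = 5 * Suc k + 5 * d" by simp_all
      ultimately have "5 * r + 3 \<le> 3 * card \<Omega>" using U(3) total by simp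
      then show ?thesis ..
    qed
  qed
qed

end

section \<open>Primitive strings without one-point layers\<close>

text \<open>\<open>I\<close> lies below \<open>J\<close> with a gap, so words in \<open>J\<close>
  act as automorphisms on the orbits of \<open>I\<close>, and conversely.\<close>

definition far :: "nat set \<Rightarrow> nat set \<Rightarrow> bool" where "far I J \<longleftrightarrow> (\<forall>i\<in>I. \<forall>j\<in>J. Suc i < j)"

lemma card_le_2_cases:
  assumes "finite S" "card S \<le> 2" "a \<in> S" "b \<in> S" "c \<in> S"
  shows "a = b \<or> b = c \<or> a = c"
proof (rule ccontr)
  assume "\<not> ?thesis"
  then have "card {a, b, c} = 3" by (auto simp: card_insert_if)
  moreover have "card {a, b, c} \<le> card S" by (rule card_mono) (use assms in auto)
  ultimately show False using assms(2) by simp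
qed

section \<open>Words and commuting families of labels\<close>

context invol_string
begin

definition act where "act w y = foldr \<rho> w y"

lemma act_simps [simp]: "act [] y = y" "act (i # w) y = \<rho> i (act w y)"
  by (simp_all add: act_def)

lemma act_append: "act (v @ w) y = act v (act w y)"
  by (simp add: act_def)

lemma act_inj: "act w y = act w z \<longleftrightarrow> y = z"
  by (induction w) (auto simp: rho_inj)

lemma orb_act: "z \<in> orb I y \<longleftrightarrow> (\<exists>w. set w \<subseteq> I \<and> z = act w y)"
proof
  assume "z \<in> orb I y"
  then show "\<exists>w. set w \<subseteq> I \<and> z = act w y"
  proof induction
    case orb_base show ?case by (rule exI[of _ "[]"]) simp
  next
    case (orb_step z i)
    then obtain w where "set w \<subseteq> I" "z = act w y" by blast
    then show ?case using orb_step by (intro exI[of _ "i # w"]) simp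
  qed
next
  assume "\<exists>w. set w \<subseteq> I \<and> z = act w y"
  then obtain w where "set w \<subseteq> I" "z = act w y" by blast
  then show "z \<in> orb I y"
    by (induction w arbitrary: z) (auto intro: orb_step)
qed

lemma act_orb: "set w \<subseteq> I \<Longrightarrow> act w y \<in> orb I y" using orb_act by blast

lemma act_rho: "far I J \<Longrightarrow> set w \<subseteq> J \<Longrightarrow> i \<in> I \<Longrightarrow> act w (\<rho> i y) = \<rho> i (act w y)"
proof (induction w)
  case (Cons j w)
  then have "Suc i < j" by (auto simp: far_def)
  then have "\<rho> j (\<rho> i (act w y)) = \<rho> i (\<rho> j (act w y))" by (rule comm')
  then show ?case using Cons by auto
qed simp

lemma rho_act: "far I J \<Longrightarrow> set w \<subseteq> I \<Longrightarrow> j \<in> J \<Longrightarrow> act w (\<rho> j y) = \<rho> j (act w y)"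
proof (induction w)
  case (Cons i w)
  then have "Suc i < j" by (auto simp: far_def)
  then have "\<rho> i (\<rho> j (act w y)) = \<rho> j (\<rho> i (act w y))" by (rule comm)
  then show ?case using Cons by auto
qed simp

lemma act_image_orb: "far I J \<Longrightarrow> set w \<subseteq> J \<Longrightarrow> act w ` orb I y = orb I (act w y)"
  by (rule orb_commute) (rule act_rho)

lemma act_image_orb': "far I J \<Longrightarrow> set w \<subseteq> I \<Longrightarrow> act w ` orb J y = orb J (act w y)"
  by (rule orb_commute) (rule rho_act)

lemma semiregular: "far I J \<Longrightarrow> set w \<subseteq> J \<Longrightarrow> act w x = x \<Longrightarrow> y \<in> orb I x \<Longrightarrow> act w y = y"
  by (rule orb_fixed[where I = I and x = x]) (auto simp: act_rho)

lemma card_act_image: "card (act w ` S) = card S"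
  by (rule card_image) (simp add: inj_on_def act_inj)

lemma card_orb_eq: "far I J \<Longrightarrow> y \<in> orb I x \<Longrightarrow> card (orb J y) = card (orb J x)"
  using orb_act[of y I x] act_image_orb'[of I J _ x] card_act_image by metis

lemma card_orb_eq': "far I J \<Longrightarrow> y \<in> orb J x \<Longrightarrow> card (orb I y) = card (orb I x)"
  using orb_act[of y J x] act_image_orb[of I J _ x] card_act_image by metis

lemma orb_disjoint: "y \<notin> orb I x \<Longrightarrow> orb I y \<inter> orb I x = {}"
  using orb_eq orb_sym by blast

lemma far_orbit_image:
  assumes "far I J" "y \<in> orb J x" "y \<notin> orb I x" "orb I y \<subseteq> S" "orb I x \<subseteq> S" "finite S"
  shows "2 * card (orb I x) \<le> card S"
proof -
  have "card (orb I y \<union> orb I x) = card (orb I y) + card (orb I x)"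
    using assms orb_disjoint[of y I x] by (intro card_Un_disjoint) (auto intro: finite_subset)
  moreover have "card (orb I y \<union> orb I x) \<le> card S" by (rule card_mono) (use assms in auto)
  ultimately show ?thesis using card_orb_eq'[OF assms(1,2)] by simp
qed

text \<open>If no new \<open>J\<close>-orbit is met, a new point is the image of an old one under a
  word \<open>w\<close> in \<open>J\<close>. Then \<open>act w\<close> carries the old orbit to a
  disjoint copy inside the new one and preserves the \<open>J\<close>-orbit of \<open>x\<close>,
  whose share at least doubles.\<close>

lemma double_or_new:
  assumes far: "far {..<m} J" and fin: "finite (orb UNIV x)" and k: "k < m"
    and strict: "orb {..<Suc k} x \<noteq> orb {..<k} x"
  shows "card (orb J ` orb {..<k} x) < card (orb J ` orb {..<Suc k} x) \<or>
    2 * card (orb J x \<inter> orb {..<k} x) \<le> card (orb J x \<inter> orb {..<Suc k} x)"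
proof -
  let ?A = "\<lambda>k. orb {..<k} x"
  have fA: "finite (?A k)" for k by (rule finite_subset[OF orb_mono fin]) auto
  have sub: "?A k \<subseteq> ?A (Suc k)" by (rule orb_mono) auto
  have fark: "far {..<k} J" using far k by (auto simp: far_def)
  show ?thesis
  proof (cases "orb J ` ?A (Suc k) = orb J ` ?A k")
    case False
    moreover have "orb J ` ?A k \<subseteq> orb J ` ?A (Suc k)" using sub by blast
    ultimately have "orb J ` ?A k \<subset> orb J ` ?A (Suc k)" by blast
    then have "card (orb J ` ?A k) < card (orb J ` ?A (Suc k))" by (rule psubset_card_mono[rotated]) (simp add: fA)
    then show ?thesis ..
  next
    case True
    obtain y where y: "y \<in> ?A (Suc k)" "y \<notin> ?A k" using strict sub by blast
    then obtain z where z: "z \<in> ?A k" "orb J y = orb J z" using True by (metis imageE imageI)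
    then obtain w where w: "set w \<subseteq> J" "y = act w z" using orb_act orb_base by metis
    have im: "act w ` ?A k = orb {..<k} (act w x)" by (rule act_image_orb[OF fark w(1)])
    have ynew: "y \<in> orb {..<k} (act w x)" using im z w by blast
    then have wx: "act w x \<in> orb {..<k} y" by (rule orb_sym)
    have "orb {..<k} y \<subseteq> ?A (Suc k)"
    proof -
      have "orb {..<k} y \<subseteq> orb {..<Suc k} y" by (rule orb_mono) auto
      then show ?thesis using orb_eq[OF y(1)] by simp
    qed
    have disj: "act w ` ?A k \<inter> ?A k = {}"
      using orb_disjoint[of y "{..<k}" x] y(2) orb_eq[OF ynew] im by auto
    have sub2: "act w ` ?A k \<subseteq> ?A (Suc k)"
      using im orb_eq[OF wx] \<open>orb {..<k} y \<subseteq> ?A (Suc k)\<close> by simp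
    let ?D = "orb J x \<inter> ?A k"
    have J: "act w ` ?D \<subseteq> orb J x" using act_orb[OF w(1)] orb_eq[of _ J x] by blast
    have "act w ` ?D \<union> ?D \<subseteq> orb J x \<inter> ?A (Suc k)" using J sub2 sub by auto
    then have "card (act w ` ?D \<union> ?D) \<le> card (orb J x \<inter> ?A (Suc k))" using fA by (intro card_mono) auto
    moreover have "card (act w ` ?D \<union> ?D) = card (act w ` ?D) + card ?D"
      using disj fA by (intro card_Un_disjoint) auto
    ultimately show ?thesis using card_act_image[of w ?D] by simp
  qed
qed

text \<open>Each of the \<open>m\<close> growth steps brings a new \<open>J\<close>-orbit or a
  doubling; \<open>a\<close> counts the doublings.\<close>

lemma doubling_count:
  assumes far: "far {..<m} J" and fin: "finite (orb UNIV x)"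
    and strict: "\<And>k. k < m \<Longrightarrow> orb {..<Suc k} x \<noteq> orb {..<k} x"
  shows "\<exists>a\<le>m. 2 ^ a \<le> card (orb J x \<inter> orb {..<m} x) \<and> Suc m \<le> card (orb J ` orb {..<m} x) + a"
proof -
  let ?A = "\<lambda>k. orb {..<k} x"
  have fA: "finite (?A k)" for k by (rule finite_subset[OF orb_mono fin]) auto
  have "\<exists>a\<le>k. 2 ^ a \<le> card (orb J x \<inter> ?A k) \<and> Suc k \<le> card (orb J ` ?A k) + a" if "k \<le> m" for k
    using that
  proof (induction k)
    case 0
    have "?A 0 = {x}" using orb_subset[of x "{x}" "{..<0}"] by auto
    then show ?case by simp
  next
    case (Suc k)
    then obtain a where a: "a \<le> k" "2 ^ a \<le> card (orb J x \<inter> ?A k)" "Suc k \<le> card (orb J ` ?A k) + a" by auto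
    have sub: "?A k \<subseteq> ?A (Suc k)" by (rule orb_mono) auto
    have e: "card (orb J ` ?A k) \<le> card (orb J ` ?A (Suc k))"
      by (rule card_mono[OF finite_imageI[OF fA] image_mono[OF sub]])
    have d: "card (orb J x \<inter> ?A k) \<le> card (orb J x \<inter> ?A (Suc k))"
      by (rule card_mono) (use fA sub in auto)
    have km: "k < m" using Suc.prems by simp
    from double_or_new[OF far fin km strict[OF km]] show ?case
    proof (elim disjE)
      assume "card (orb J ` ?A k) < card (orb J ` ?A (Suc k))"
      then show ?thesis using a d by (intro exI[of _ a]) linarith
    next
      assume "2 * card (orb J x \<inter> ?A k) \<le> card (orb J x \<inter> ?A (Suc k))"
      then show ?thesis using a e by (intro exI[of _ "Suc a"]) simp
    qed
  qed
  then show ?thesis by blast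
qed

lemma orbit_count:
  assumes far: "far {..<m} J" and fin: "finite (orb UNIV x)"
    and closed: "\<And>y. y \<in> orb {..<m} x \<Longrightarrow> orb J y \<subseteq> orb {..<m} x"
  shows "card (orb {..<m} x) = card (orb J x) * card (orb J ` orb {..<m} x)"
proof -
  let ?B = "orb {..<m} x"
  have fB: "finite ?B" by (rule finite_subset[OF orb_mono fin]) auto
  have "?B = \<Union> (orb J ` ?B)" using closed by auto
  moreover have "card (\<Union> (orb J ` ?B)) = card (orb J x) * card (orb J ` ?B)"
  proof (rule card_partition[of "orb J ` ?B" "card (orb J x)", symmetric])
    show "finite (orb J ` ?B)" using fB by simp
    show "finite (\<Union> (orb J ` ?B))" using fB \<open>?B = \<Union> (orb J ` ?B)\<close> by simp
    show "card c = card (orb J x)" if "c \<in> orb J ` ?B" for c using that card_orb_eq[OF far] by auto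
    show "c1 \<inter> c2 = {}" if "c1 \<in> orb J ` ?B" "c2 \<in> orb J ` ?B" "c1 \<noteq> c2" for c1 c2
      using that orb_disjoint[of _ J] orb_eq by blast
  qed
  ultimately show ?thesis by metis
qed

text \<open>A word \<open>w\<close> in \<open>J\<close> carrying \<open>x\<close> to
  \<open>y\<close> commutes with the chain and fixes no point of it. The chain doubles when it first
  contains \<open>y\<close>; from then on it is invariant under \<open>w\<close>, and every strict
  step brings a pair \<open>z\<close>, \<open>act w z\<close>. Unlike in
  \<open>commuting_double\<close>, \<open>w\<close> need not act as an involution.\<close>

lemma aut_double:
  assumes far: "far {..<m} J" and fin: "finite (orb UNIV x)"
    and g: "y \<in> orb J x" "y \<in> orb {..<m} x" "y \<noteq> x"
    and strict: "\<And>k. k < m \<Longrightarrow> orb {..<Suc k} x \<noteq> orb {..<k} x"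
  shows "2 * m \<le> card (orb {..<m} x)"
proof -
  let ?A = "\<lambda>k. orb {..<k} x"
  have fA: "finite (?A k)" for k by (rule finite_subset[OF orb_mono fin]) auto
  have A0: "?A 0 = {x}" using orb_subset[of x "{x}" "{..<0}"] by auto
  have mono: "k \<le> l \<Longrightarrow> ?A k \<subseteq> ?A l" for k l by (rule orb_mono) auto
  obtain w where w: "set w \<subseteq> J" "y = act w x" using g(1) orb_act by blast
  define k0 where "k0 = (LEAST k. y \<in> ?A k)"
  have k0: "y \<in> ?A k0" "k0 \<le> m" unfolding k0_def using g(2) by (auto intro: LeastI Least_le)
  have "k0 \<noteq> 0" using k0 A0 g(3) by (metis singletonD)
  then obtain l where l: "k0 = Suc l" by (cases k0) auto
  have "y \<notin> ?A l" using not_less_Least[of l "\<lambda>k. y \<in> ?A k"] l by (simp add: k0_def)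
  have fark: "k \<le> m \<Longrightarrow> far {..<k} J" for k using far by (auto simp: far_def)
  have size: "k \<le> m \<Longrightarrow> Suc k \<le> card (?A k)" for k
  proof (induction k)
    case (Suc k)
    have "?A k \<subset> ?A (Suc k)" using mono[of k "Suc k"] strict[of k] Suc.prems by auto
    then have "card (?A k) < card (?A (Suc k))" using fA psubset_card_mono by blast
    then show ?case using Suc by simp
  qed (use A0 in simp)
  have "orb {..<l} y \<subseteq> ?A k0"
  proof -
    have "orb {..<l} y \<subseteq> orb {..<k0} y" using l by (intro orb_mono) auto
    then show ?thesis using orb_eq[OF k0(1)] by simp
  qed
  then have "2 * card (?A l) \<le> card (?A k0)"
    using far_orbit_image[of "{..<l}" J y x "?A k0"] fark[of l] g(1) \<open>y \<notin> ?A l\<close> mono[of l k0] l k0 fA by auto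
  then have base0: "2 * k0 \<le> card (?A k0)" using size[of l] l k0 by simp
  have "2 * k \<le> card (?A k)" if "k0 \<le> k" "k \<le> m" for k using that
  proof (induction k rule: dec_induct)
    case base show ?case using base0 .
  next
    case (step k)
    have sub: "?A k \<subseteq> ?A (Suc k)" by (rule mono) simp
    then obtain z where z: "z \<in> ?A (Suc k)" "z \<notin> ?A k" using strict[of k] step.prems by auto
    have inv: "act w ` ?A j = ?A j" if "k0 \<le> j" "j \<le> m" for j
      using act_image_orb[OF fark[OF that(2)] w(1), of x] orb_eq[of y "{..<j}" x] k0 mono[OF that(1)] w by auto
    have wz: "act w z \<in> ?A (Suc k)" using inv[of "Suc k"] z step by auto
    have wz': "act w z \<notin> ?A k"
    proof
      assume "act w z \<in> ?A k"
      then obtain v where "v \<in> ?A k" "act w z = act w v" using inv[of k] step by auto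
      then show False using z act_inj by metis
    qed
    have "act w z \<noteq> z"
    proof
      assume "act w z = z"
      moreover have "z \<in> orb {..<m} x" using z mono[of "Suc k" m] step.prems by auto
      then have "x \<in> orb {..<m} z" by (rule orb_sym)
      ultimately have "act w x = x" using semiregular[OF far w(1)] by blast
      then show False using w g by simp
    qed
    then have "card {z, act w z} = 2" by simp
    moreover have "card (?A k \<union> {z, act w z}) = card (?A k) + card {z, act w z}"
      using z wz' fA by (intro card_Un_disjoint) auto
    moreover have "card (?A k \<union> {z, act w z}) \<le> card (?A (Suc k))"
      using z wz sub fA by (intro card_mono) auto
    ultimately show ?case using step by simp
  qed
  then show ?thesis using k0 by blast
qed

end

text \<open>Primitivity is stated for invariant equivalence relations, so that equality of orbits or
  of colours can serve directly as \<open>R\<close>.\<close>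

locale primitive_string = string_action +
  assumes primitive: "(\<And>y. y \<in> \<Omega> \<Longrightarrow> R y y) \<Longrightarrow> (\<And>y z. R y z \<Longrightarrow> R z y) \<Longrightarrow>
      (\<And>u y z. R u y \<Longrightarrow> R y z \<Longrightarrow> R u z) \<Longrightarrow>
      (\<And>i y z. i < r \<Longrightarrow> y \<in> \<Omega> \<Longrightarrow> z \<in> \<Omega> \<Longrightarrow> R y z \<Longrightarrow> R (\<rho> i y) (\<rho> i z)) \<Longrightarrow>
      (\<forall>y\<in>\<Omega>. \<forall>z\<in>\<Omega>. R y z \<longrightarrow> y = z) \<or> (\<forall>y\<in>\<Omega>. \<forall>z\<in>\<Omega>. R y z)"
    and noncommuting: "Suc i < r \<Longrightarrow> \<exists>y\<in>\<Omega>. \<rho> i (\<rho> (Suc i) y) \<noteq> \<rho> (Suc i) (\<rho> i y)"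
begin

text \<open>Labels above \<open>m\<close> commute with those below \<open>m\<close>, so they carry
  \<open>x\<close> to points with the same earlier growth. If none of these points grew at
  \<open>m\<close>, their orbits under the labels below \<open>m\<close> would cover everything and
  be permuted by all labels. Primitivity would make them single points, which label 0 forbids, or
  all of \<open>\<Omega>\<close>.\<close>

lemma growing_point:
  assumes "0 < r"
  shows "\<exists>x\<in>\<Omega>. \<rho> 0 x \<noteq> x \<and> (\<forall>k<r. orb {..<k} x \<noteq> \<Omega> \<longrightarrow> orb {..<Suc k} x \<noteq> orb {..<k} x)"
proof -
  have "\<exists>x\<in>\<Omega>. \<rho> 0 x \<noteq> x \<and> (\<forall>k<m. orb {..<k} x \<noteq> \<Omega> \<longrightarrow> orb {..<Suc k} x \<noteq> orb {..<k} x)"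
    if "1 \<le> m" "m \<le> r" for m
    using that
  proof (induction m rule: dec_induct)
    case base
    obtain x where x: "x \<in> \<Omega>" "\<rho> 0 x \<noteq> x" using nontrivial[of 0] assms by blast
    have "\<rho> 0 x \<in> orb {..<Suc 0} x" by (rule orb_step) auto
    moreover have "orb {..<0} x = {x}" using orb_subset[of x "{x}" "{..<0}"] by auto
    ultimately show ?case using x by (intro bexI[of _ x]) auto
  next
    case (step m)
    then obtain x where x: "x \<in> \<Omega>" "\<rho> 0 x \<noteq> x"
      and grow: "\<And>k. k < m \<Longrightarrow> orb {..<k} x \<noteq> \<Omega> \<Longrightarrow> orb {..<Suc k} x \<noteq> orb {..<k} x" by auto
    let ?J = "{Suc m..<r}"
    have far: "far {..<m} ?J" by (auto simp: far_def)
    have img: "\<rho> j ` orb {..<k} y = orb {..<k} (\<rho> j y)" if "k \<le> m" "j \<in> ?J" for j k y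
      using that by (intro orb_commute) (auto intro: comm')
    have \<Omega>img: "j < r \<Longrightarrow> \<rho> j ` \<Omega> = \<Omega>" for j using closed by (auto simp: image_iff) (metis closed invol)
    have good: "y \<in> \<Omega> \<and> \<rho> 0 y \<noteq> y \<and> (\<forall>k<m. orb {..<k} y \<noteq> \<Omega> \<longrightarrow> orb {..<Suc k} y \<noteq> orb {..<k} y)"
      if "y \<in> orb ?J x" for y
      using that
    proof induction
      case orb_base then show ?case using x grow by blast
    next
      case (orb_step y j)
      have "\<rho> 0 (\<rho> j y) \<noteq> \<rho> j y" using orb_step step.hyps fixed_transfer[of 0 j y] by auto
      moreover have "orb {..<Suc k} (\<rho> j y) \<noteq> orb {..<k} (\<rho> j y)" if k: "k < m" "orb {..<k} (\<rho> j y) \<noteq> \<Omega>" for k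
      proof -
        have "orb {..<k} y \<noteq> \<Omega>" using k img[of k j y] orb_step \<Omega>img[of j] by auto
        then have "orb {..<Suc k} y \<noteq> orb {..<k} y" using orb_step k by blast
        then have "\<rho> j ` orb {..<Suc k} y \<noteq> \<rho> j ` orb {..<k} y"
          by (simp add: inj_image_eq_iff inj_def rho_inj)
        then show ?thesis using img[of k j y] img[of "Suc k" j y] k orb_step by auto
      qed
      ultimately show ?case using orb_step closed by blast
    qed
    show ?case
    proof (cases "\<exists>y\<in>orb ?J x. orb {..<m} y = \<Omega> \<or> orb {..<Suc m} y \<noteq> orb {..<m} y")
      case True
      then obtain y where "y \<in> orb ?J x" "orb {..<m} y = \<Omega> \<or> orb {..<Suc m} y \<noteq> orb {..<m} y" by blast
      then show ?thesis using good[of y] by (intro bexI[of _ y]) (auto simp: less_Suc_eq)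
    next
      case False
      define X where "X = (\<Union>y\<in>orb ?J x. orb {..<m} y)"
      have xX: "x \<in> X" by (auto simp: X_def)
      have inv: "orb {..<m} (\<rho> m a) = orb {..<m} a" if a: "a \<in> X" for a
      proof -
        obtain y where y: "y \<in> orb ?J x" "a \<in> orb {..<m} y" using a by (auto simp: X_def)
        have "orb {..<Suc m} y = orb {..<m} y" using y False by blast
        moreover have "\<rho> m a \<in> orb {..<Suc m} y" using y orb_mono[of "{..<m}" "{..<Suc m}" y] by (intro orb_step) auto
        ultimately show ?thesis using y orb_eq by metis
      qed
      have "\<rho> i a \<in> X" if a: "a \<in> X" and i: "i < r" for a i
      proof -
        obtain y where y: "y \<in> orb ?J x" "a \<in> orb {..<m} y" using a by (auto simp: X_def)
        consider "i < m" | "i = m" | "i \<in> ?J" using i by fastforce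
        then show ?thesis
        proof cases
          case 1 then show ?thesis using y by (auto simp: X_def intro: orb_step)
        next
          case 2
          have "\<rho> m a \<in> orb {..<m} y" using inv[OF a] orb_eq[OF y(2)] orb_base by blast
          then show ?thesis using 2 y by (auto simp: X_def)
        next
          case 3
          then have "\<rho> i a \<in> orb {..<m} (\<rho> i y)" using img[of m i y] y by blast
          moreover have "\<rho> i y \<in> orb ?J x" using 3 y by (intro orb_step)
          ultimately show ?thesis by (auto simp: X_def)
        qed
      qed
      then have "orb {..<r} x \<subseteq> X" using xX by (intro orb_subset) auto
      then have "\<Omega> \<subseteq> X" using transitive x by simp
      have "(\<forall>y\<in>\<Omega>. \<forall>z\<in>\<Omega>. orb {..<m} y = orb {..<m} z \<longrightarrow> y = z) \<or> (\<forall>y\<in>\<Omega>. \<forall>z\<in>\<Omega>. orb {..<m} y = orb {..<m} z)"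
      proof (rule primitive)
        fix i y z assume i: "i < r" and yz: "y \<in> \<Omega>" "z \<in> \<Omega>" "orb {..<m} y = orb {..<m} z"
        consider "i < m" | "i = m" | "i \<in> ?J" using i by fastforce
        then show "orb {..<m} (\<rho> i y) = orb {..<m} (\<rho> i z)"
        proof cases
          case 1
          then have "orb {..<m} (\<rho> i v) = orb {..<m} v" for v by (intro orb_eq orb_step) auto
          then show ?thesis using yz by simp
        next
          case 2
          have "orb {..<m} (\<rho> m v) = orb {..<m} v" if "v \<in> \<Omega>" for v using inv that \<open>\<Omega> \<subseteq> X\<close> by blast
          then show ?thesis using 2 yz by metis
        next
          case 3 then show ?thesis using img[of m i y] img[of m i z] yz by simp
        qed
      qed auto
      then show ?thesis
      proof
        assume triv: "\<forall>y\<in>\<Omega>. \<forall>z\<in>\<Omega>. orb {..<m} y = orb {..<m} z \<longrightarrow> y = z"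
        have "\<rho> 0 x \<in> orb {..<m} x" using step.hyps by (intro orb_step) auto
        then have "orb {..<m} (\<rho> 0 x) = orb {..<m} x" by (rule orb_eq)
        then show ?thesis using triv x closed by blast
      next
        assume "\<forall>y\<in>\<Omega>. \<forall>z\<in>\<Omega>. orb {..<m} y = orb {..<m} z"
        then have "\<Omega> \<subseteq> orb {..<m} x" using x orb_base by blast
        then have "orb {..<m} x = \<Omega>" using orb_points[OF x(1)] by blast
        then show ?thesis using False by auto
      qed
    qed
  qed
  then show ?thesis using assms by auto
qed

end

text \<open>\<open>b\<close> is the last label moving \<open>x\<close>, whence the threshold
  \<open>Suc b\<close>. Before index \<open>b\<close> only strict growth of the orbits is
  known.\<close>

locale thick_string = primitive_string \<rho> \<Omega> r + based_string \<rho> \<Omega> r x "Suc b"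
  for \<rho> :: "nat \<Rightarrow> 'a \<Rightarrow> 'a" and \<Omega> r x b +
  assumes b_moves: "\<rho> b x \<noteq> x" and zero_moves: "\<rho> 0 x \<noteq> x" and r6: "6 \<le> r"
    and strict: "k < r \<Longrightarrow> A k \<noteq> \<Omega> \<Longrightarrow> A (Suc k) \<noteq> A k"
    and thick: "b \<le> j \<Longrightarrow> j < r \<Longrightarrow> card (N j) \<noteq> 1"
begin

lemma b_less: "b < r" using b_moves trivial_beyond[of b x] by force

lemma not_full: "A l \<noteq> \<Omega> \<Longrightarrow> k \<le> l \<Longrightarrow> A k \<noteq> \<Omega>"
  using A_mono[of k l] A_points[of l] by blast

lemma size: "A m \<noteq> \<Omega> \<Longrightarrow> m < r \<Longrightarrow> m + 2 \<le> card (A (Suc m))"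
proof (induction m)
  case 0
  have "{x} \<subset> A (Suc 0)" using strict[of 0] 0 A_0 x_A by blast
  then have "card {x} < card (A (Suc 0))" by (rule psubset_card_mono[rotated]) simp
  then show ?case by simp
next
  case (Suc m)
  have "A (Suc m) \<subset> A (Suc (Suc m))" using strict[of "Suc m"] Suc.prems A_mono[of "Suc m" "Suc (Suc m)"] by auto
  then have "card (A (Suc m)) < card (A (Suc (Suc m)))" by (rule psubset_card_mono[rotated]) simp
  then show ?case using Suc not_full[of "Suc m" m] by simp
qed

lemma fat_layer: "b \<le> j \<Longrightarrow> Suc j < r \<Longrightarrow> 2 \<le> card (N j)"
proof -
  assume j: "b \<le> j" "Suc j < r"
  then have "N j \<noteq> {}" by (intro layer_nonempty) simp_all
  then have "card (N j) \<noteq> 0" by simp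
  then show ?thesis using thick[of j] j by linarith
qed

text \<open>From \<open>b\<close> on a layer has at least two points; an empty last layer is made up
  for by the layer before, in which the last label moves four points.\<close>

lemma tail_sum:
  assumes "b \<le> m" "m + 2 \<le> r \<or> m < r \<and> N (r - 1) \<noteq> {}"
  shows "card (A m) + 2 * (r - m) \<le> card \<Omega>"
proof -
  have part: "card (A m) + 2 * (l - m) \<le> card (A l)" if "m \<le> l" "l < r" for l
    using that
  proof (induction l rule: dec_induct)
    case (step l)
    then show ?case using fat_layer[of l] card_A_Suc[of l] assms by simp
  qed simp
  show ?thesis
  proof (cases "N (r - 1) = {}")
    case False
    then have "card (N (r - 1)) \<noteq> 0" by simp
    moreover have "b \<le> r - 1" "r - 1 < r" using assms r6 by linarith+
    then have "card (N (r - 1)) \<noteq> 1" by (rule thick)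
    ultimately have "2 \<le> card (N (r - 1))" by linarith
    moreover have "card (A r) = card (A (r - 1)) + card (N (r - 1))" using card_A_Suc[of "r - 1"] r6 by simp
    ultimately show ?thesis using part[of "r - 1"] assms A_r by simp linarith
  next
    case True
    define j where "j = r - 2"
    have j: "Suc (Suc j) = r" "r - 1 = Suc j" using r6 by (auto simp: j_def)
    have mj: "m \<le> j" using assms True j by auto
    have "A (Suc j) = \<Omega>" "4 \<le> card (N j)" using last_layer_empty[of j] True j mj assms by auto
    then show ?thesis using part[of j] card_A_Suc[of j] mj j by simp
  qed
qed

lemma thick_low: "b \<le> 1 \<Longrightarrow> 2 * r \<le> Suc (card \<Omega>)"
proof -
  assume "b \<le> 1"
  then consider "b = 0" | "b = 1" by linarith
  then show ?thesis
  proof cases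
    case 1 then show ?thesis using tail_sum[of 0] r6 by simp
  next
    case 2
    have "\<rho> 0 x \<in> A 1" using A_closed[of 0 1 x] by simp
    then have "card {x, \<rho> 0 x} \<le> card (A 1)" by (intro card_mono) auto
    moreover have "card {x, \<rho> 0 x} = 2" using zero_moves by simp
    ultimately show ?thesis using tail_sum[of 1] 2 r6 by simp
  qed
qed

lemma fin_all: "finite (orb I y)" if "y \<in> \<Omega>"
  using orb_points[OF that] finite_points finite_subset by blast

text \<open>Below \<open>b\<close> only one point per layer is guaranteed, and
  \<open>x' = \<rho> b x\<close> supplies the missing ones. Outside \<open>A b\<close> it brings a
  copy of \<open>A (b - 1)\<close> into \<open>N b\<close>; inside \<open>A b\<close> but outside
  \<open>A (b - 1)\<close> it doubles \<open>A (b - 1)\<close>; inside \<open>A (b - 1)\<close>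
  label \<open>b\<close> is an automorphism and \<open>aut_double\<close> applies.\<close>

lemma thick_mid:
  assumes "2 \<le> b" "b + 2 \<le> r" shows "2 * r \<le> Suc (card \<Omega>)"
proof -
  obtain l where l: "b = Suc l" "1 \<le> l" using assms by (cases b) auto
  let ?x' = "\<rho> b x"
  have nf: "A b \<noteq> \<Omega>"
  proof
    assume full: "A b = \<Omega>"
    have "Suc b < r" using assms by simp
    then obtain y where "y \<in> \<Omega>" "\<rho> (Suc b) y \<noteq> y" using nontrivial by blast
    then show False using full A_fixed[of b "Suc b" y] by simp
  qed
  have sz: "b \<le> card (A l)" "Suc b \<le> card (A b)"
  proof -
    show "Suc b \<le> card (A b)" using size[of l] not_full[OF nf, of l] l assms by simp
    show "b \<le> card (A l)" using size[of "l - 1"] not_full[OF nf, of "l - 1"] l assms by simp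
  qed
  have strict': "A (Suc k) \<noteq> A k" if "k \<le> b" for k using strict[of k] not_full[OF nf that] that assms by simp
  have x'\<Omega>: "?x' \<in> \<Omega>" using closed base_point by blast
  have farl: "far {..<l} {b}" using l by (auto simp: far_def)
  have x'orb: "?x' \<in> orb {b} x" by (rule orb_step) auto
  show ?thesis
  proof (cases "?x' \<in> A b")
    case False
    define O' where "O' = orb {..<b} ?x'"
    have "?x' \<in> A (Suc b)" using A_closed[of b "Suc b" x] by simp
    then have "orb {..<Suc b} ?x' = A (Suc b)" using orb_eq by (simp add: A_def)
    then have "O' \<subseteq> A (Suc b)" using orb_mono[of "{..<b}" "{..<Suc b}" ?x'] by (auto simp: O'_def)
    moreover have "O' \<inter> A b = {}" using False orb_disjoint unfolding O'_def A_def by blast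
    ultimately have ON: "O' \<subseteq> N b" by (auto simp: N_def)
    have lO: "orb {..<l} ?x' \<subseteq> O'" unfolding O'_def using l by (intro orb_mono) auto
    have card_l: "card (orb {..<l} ?x') = card (A l)"
      using card_orb_eq'[OF farl x'orb] by (simp add: A_def)
    have "b \<le> card O'" using card_mono[OF _ lO] card_l sz fin_all[OF x'\<Omega>] unfolding O'_def by simp
    have finO: "finite O'" unfolding O'_def by (rule fin_all[OF x'\<Omega>])
    have ONc: "card O' \<le> card (N b)" using card_mono[OF _ ON] by simp
    show ?thesis
    proof (cases "b + 3 \<le> r \<or> N (r - 1) \<noteq> {}")
      case True
      then have "card (A (Suc b)) + 2 * (r - Suc b) \<le> card \<Omega>" using assms by (intro tail_sum) auto
      then show ?thesis using card_A_Suc[of b] ONc \<open>b \<le> card O'\<close> sz assms by simp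
    next
      case False
      then have rb: "r = Suc (Suc b)" using assms by simp
      with False have "N (Suc b) = {}" by simp
      note rb = rb this
      note last = last_layer_empty[of b, OF order_refl rb(1)[symmetric] rb(2)]
      note sym = empty_layer_symmetry[of b, OF order_refl rb(2)]
      let ?t = "\<rho> (Suc b)"
      have farb: "far {..<b} {Suc b}" by (auto simp: far_def)
      have torb: "?t ?x' \<in> orb {Suc b} ?x'" by (rule orb_step) auto
      have x'N: "?x' \<in> N b" using ON by (auto simp: O'_def)
      \<comment> \<open>Label \<open>Suc b\<close> opens no layer here, so \<open>N b\<close> has to
        pay for it too. The cases distinguish where this automorphism of \<open>N b\<close> sends
        \<open>x'\<close>.\<close>
      have "b + 2 \<le> card (N b)"
      proof -
        consider "?t ?x' = ?x'" | "?t ?x' \<notin> O'" | "?t ?x' \<noteq> ?x'" "?t ?x' \<in> O'" "?t ?x' \<in> orb {..<l} ?x'"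
          | "?t ?x' \<in> O'" "?t ?x' \<notin> orb {..<l} ?x'" by blast
        then show ?thesis
        proof cases
          case 1
          have "?t y = y" if "y \<in> O'" for y
            using semiregular[OF farb, of "[Suc b]" ?x' y] 1 that by (simp add: O'_def)
          then have "{y \<in> N b. ?t y \<noteq> y} \<subseteq> N b - O'" by blast
          then have "mv (Suc b) (N b) \<le> card (N b - O')" unfolding mv_def by (rule card_mono[rotated]) simp
          moreover have "4 \<le> mv (Suc b) (N b)" using last(2) sym(2) by simp
          moreover have "card (N b - O') = card (N b) - card O'" using ON finO by (simp add: card_Diff_subset)
          ultimately show ?thesis using \<open>b \<le> card O'\<close> by linarith
        next
          case 2
          have "orb {..<b} (?t ?x') \<subseteq> N b" using sym(1)[OF x'N] N_closed by (intro orb_subset) auto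
          then have "2 * card O' \<le> card (N b)"
            using far_orbit_image[OF farb torb, of "N b"] 2 ON by (simp add: O'_def)
          then show ?thesis using \<open>b \<le> card O'\<close> assms by simp
        next
          case 3
          have imk: "\<rho> b ` A k = orb {..<k} ?x'" if "k \<le> l" for k
            unfolding A_def using that l by (intro orb_commute) (auto intro!: comm')
          have st: "orb {..<Suc k} ?x' \<noteq> orb {..<k} ?x'" if k: "k < l" for k
          proof -
            have "\<rho> b ` A (Suc k) \<noteq> \<rho> b ` A k"
              using strict'[of k] k l by (simp add: inj_image_eq_iff inj_def rho_inj)
            then show ?thesis using imk[of k] imk[of "Suc k"] k by simp
          qed
          have "2 * l \<le> card (orb {..<l} ?x')"
            by (rule aut_double[of l "{Suc b}" ?x' "?t ?x'"]) (use 3 l torb st fin_all[OF x'\<Omega>] in \<open>auto simp: far_def\<close>)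
          also have "\<dots> \<le> card O'" using card_mono[OF finO lO] .
          finally show ?thesis using ONc rb l r6 by linarith
        next
          case 4
          have "orb {..<l} (?t ?x') \<subseteq> O'"
          proof -
            have "orb {..<l} (?t ?x') \<subseteq> orb {..<b} (?t ?x')" using l by (intro orb_mono) auto
            then show ?thesis using orb_eq[of "?t ?x'" "{..<b}" ?x'] 4(1) by (simp add: O'_def)
          qed
          then have "2 * card (orb {..<l} ?x') \<le> card O'"
            using far_orbit_image[of "{..<l}" "{Suc b}" "?t ?x'" ?x' O'] torb 4(2) lO finO l by (simp add: far_def)
          then show ?thesis using card_l sz ONc assms by linarith
        qed
      qed
      then show ?thesis using card_A_Suc[of b] last(1) sz rb by simp
    qed
  next
    case True
    have tail: "card (A b) + 2 * (r - b) \<le> card \<Omega>" using assms by (intro tail_sum) auto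
    show ?thesis
    proof (cases "?x' \<in> A l")
      case False
      have "orb {..<l} ?x' \<subseteq> A b"
      proof -
        have "orb {..<l} ?x' \<subseteq> orb {..<b} ?x'" using l by (intro orb_mono) auto
        then show ?thesis using orb_eq[of ?x' "{..<b}" x] True by (simp add: A_def)
      qed
      moreover have "A l \<subseteq> A b" using A_mono l by simp
      ultimately have "2 * card (A l) \<le> card (A b)"
        using far_orbit_image[OF farl x'orb, of "A b"] False finite_A[of b] by (simp add: A_def)
      then show ?thesis using tail sz assms by linarith
    next
      case True
      have "2 * l \<le> card (A l)" unfolding A_def
        by (rule aut_double[OF farl finite_orbit x'orb]) (use True b_moves strict' l in \<open>auto simp: A_def\<close>)
      moreover have "A l \<subset> A b" using strict'[of l] A_mono[of l b] l by auto
      then have "card (A l) < card (A b)" by (rule psubset_card_mono[rotated]) simp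
      ultimately show ?thesis using tail l assms by linarith
    qed
  qed
qed

end

section \<open>Base points moved by the last label\<close>

context invol_string
begin

lemma semiregular_eq:
  assumes "far I J" "set u \<subseteq> J" "set v \<subseteq> J" "act u x = act v x" "y \<in> orb I x"
  shows "act u y = act v y"
  using assms(5) by induction (use assms(1-4) act_rho[OF assms(1)] in auto)

lemma commute_two:
  assumes S: "finite S" "card S \<le> 2" "\<And>y. y \<in> S \<Longrightarrow> \<rho> i y \<in> S" "\<And>y. y \<in> S \<Longrightarrow> \<rho> j y \<in> S" and y: "y \<in> S"
  shows "\<rho> i (\<rho> j y) = \<rho> j (\<rho> i y)"
proof -
  note two = card_le_2_cases[OF S(1,2)]
  consider "\<rho> i y = y" "\<rho> j y = y" | "\<rho> i y = y" "\<rho> j y \<noteq> y" | "\<rho> i y \<noteq> y" "\<rho> j y = y"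
    | "\<rho> i y \<noteq> y" "\<rho> j y \<noteq> y" by blast
  then show ?thesis
  proof cases
    case 2
    then have "\<rho> i (\<rho> j y) \<noteq> y" by (metis invol)
    then show ?thesis using two[of y "\<rho> j y" "\<rho> i (\<rho> j y)"] 2 S y by auto
  next
    case 3
    then have "\<rho> j (\<rho> i y) \<noteq> y" by (metis invol)
    then show ?thesis using two[of y "\<rho> i y" "\<rho> j (\<rho> i y)"] 3 S y by auto
  next
    case 4
    then have "\<rho> i y = \<rho> j y" using two[of y "\<rho> i y" "\<rho> j y"] S y by auto
    then show ?thesis by (metis invol)
  qed simp
qed

text \<open>The labels in \<open>I\<close> are transitive on the orbit and commute with
  \<open>i\<close> and \<open>j\<close>, so two words in \<open>i\<close> and \<open>j\<close> that
  agree at \<open>x\<close> agree on the whole orbit. Any coincidence among the six points listed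
  would make the two labels commute there; this is the fact that a nonabelian dihedral group has at
  least six elements.\<close>

lemma dihedral_six:
  assumes far: "far I {i, j}" and fin: "finite (orb {i, j} x)"
    and cl: "\<And>y. y \<in> orb I x \<Longrightarrow> \<rho> i y \<in> orb I x" "\<And>y. y \<in> orb I x \<Longrightarrow> \<rho> j y \<in> orb I x"
    and y: "y \<in> orb I x" "\<rho> i (\<rho> j y) \<noteq> \<rho> j (\<rho> i y)"
  shows "6 \<le> card (orb {i, j} x)"
proof -
  have eq: "act u z = act v z" if "act u x = act v x" "set u \<subseteq> {i, j}" "set v \<subseteq> {i, j}" "z \<in> orb I x" for u v z
    using semiregular_eq[OF far that(2,3,1,4)] .
  let ?s = "\<rho> i" and ?t = "\<rho> j"
  note in_O = y(1) cl(1)[OF y(1)] cl(2)[OF y(1)]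
  have s1: "?s x \<noteq> x" using eq[of "[i]" "[]"] in_O y(2) by auto
  have t1: "?t x \<noteq> x" using eq[of "[j]" "[]"] in_O y(2) by auto
  have st: "?s x \<noteq> ?t x" using eq[of "[i]" "[j]"] in_O y(2) by (metis act_simps empty_set empty_subsetI insertCI insert_subset invol list.simps(15))
  have c: "?s (?t x) \<noteq> ?t (?s x)" using eq[of "[i, j]" "[j, i]" y] in_O y(2) by auto
  have ne: "?s (?t (?s x)) \<noteq> x" "?s (?t (?s x)) \<noteq> ?s x" "?s (?t (?s x)) \<noteq> ?t x"
    "?s (?t (?s x)) \<noteq> ?s (?t x)" "?s (?t (?s x)) \<noteq> ?t (?s x)"
  proof -
    show "?s (?t (?s x)) \<noteq> x"
    proof
      assume "?s (?t (?s x)) = x"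
      then have "?t (?s x) = ?s x" by (metis invol)
      then have "act [j, i] x = act [i] x" by simp
      from eq[OF this] have "?t (?s z) = ?s z" if "z \<in> orb I x" for z using that by simp
      from this[OF in_O(2)] this[OF in_O(1)] have "?t y = y" "?t (?s y) = ?s y" by simp_all
      then show False using y(2) by simp
    qed
    show "?s (?t (?s x)) \<noteq> ?s x"
      using rho_inj[of i "?t (?s x)" x] st by (metis invol)
    show "?s (?t (?s x)) \<noteq> ?t x" using c by (metis invol)
    show "?s (?t (?s x)) \<noteq> ?s (?t x)" using rho_inj s1 by metis
    show "?s (?t (?s x)) \<noteq> ?t (?s x)"
    proof
      assume "?s (?t (?s x)) = ?t (?s x)"
      then have "act [i, j, i] x = act [j, i] x" by simp
      from eq[OF this] have *: "?s (?t (?s z)) = ?t (?s z)" if "z \<in> orb I x" for z using that by simp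
      have "?s (?t y) = ?t y" using *[OF in_O(2)] by simp
      moreover have "?s y = y" using *[OF cl(1)[OF in_O(3)]] by simp
      ultimately show False using y(2) by simp
    qed
  qed
  have more: "?s (?t x) \<noteq> x" "?s (?t x) \<noteq> ?s x" "?t (?s x) \<noteq> x" "?t (?s x) \<noteq> ?t x"
    using st s1 t1 rho_inj by (metis invol)+
  have ext: "?s (?t x) \<noteq> ?t x" "?t (?s x) \<noteq> ?s x"
  proof -
    show "?s (?t x) \<noteq> ?t x"
    proof
      assume "?s (?t x) = ?t x"
      then have "act [i, j] x = act [j] x" by simp
      from eq[OF this] have *: "?s (?t z) = ?t z" if "z \<in> orb I x" for z using that by simp
      show False using *[OF in_O(1)] *[OF in_O(3)] y(2) by simp
    qed
    show "?t (?s x) \<noteq> ?s x" using ne(1) by (metis invol)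
  qed
  let ?P = "{x, ?s x, ?t x, ?s (?t x), ?t (?s x), ?s (?t (?s x))}"
  have "card ?P = 6" using s1 t1 st c ne more ext by (simp add: card_insert_if eq_commute)
  moreover have "?P \<subseteq> orb {i, j} x" by (auto intro!: orb_step)
  ultimately show ?thesis using card_mono[OF fin] by metis
qed

text \<open>A dihedral group of order four is abelian; the labels in \<open>J\<close> transport this from one orbit
  to all others.\<close>

lemma four_points_commute:
  assumes far: "far {0, 1} J" and sub: "orb {0, 1} x \<subseteq> orb J x" and four: "card (orb {0, 1} x) = 4"
    and y: "y \<in> orb J x"
  shows "\<rho> 0 (\<rho> 1 y) = \<rho> 1 (\<rho> 0 y)"
proof -
  have fin: "finite (orb {0, 1} x)" using four by (metis card.infinite zero_neq_numeral)
  have fix_all: "\<rho> i z = z" if "\<rho> i v = v" "v \<in> orb J x" "z \<in> orb J x" "i \<in> {0, 1}" for i v z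
  proof -
    have "z \<in> orb J v" using that orb_eq[OF that(2)] by simp
    then obtain w where w: "set w \<subseteq> J" "z = act w v" using orb_act by blast
    then show ?thesis using act_rho[OF far w(1) that(4), of v] that(1) by simp
  qed
  have move: "\<rho> i v \<noteq> v" if "v \<in> orb J x" "i \<in> {0, 1}" for i v
  proof
    assume fx: "\<rho> i v = v"
    have fx': "\<rho> i z = z" if "z \<in> orb {0, 1} x" for z using fix_all[OF fx] that \<open>v \<in> orb J x\<close> \<open>i \<in> {0, 1}\<close> sub by blast
    obtain k where k: "{0, 1} = {i, k}" using \<open>i \<in> {0, 1}\<close> by blast
    have "orb {0, 1} x \<subseteq> {x, \<rho> k x}"
    proof (rule orb_subset)
      fix z l assume z: "z \<in> {x, \<rho> k x}" and l: "l \<in> {0, 1 :: nat}"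
      have "k \<in> {0, 1}" using k by blast
      then have "z \<in> orb {0, 1} x" using z orb_step[of x "{0, 1}" x k] by auto
      then have "\<rho> i z = z" by (rule fx')
      moreover have "l = i \<or> l = k" using l k by blast
      ultimately show "\<rho> l z \<in> {x, \<rho> k x}" using z by auto
    qed simp
    then have "card (orb {0, 1} x) \<le> card {x, \<rho> k x}" by (rule card_mono[rotated]) simp
    also have "\<dots> \<le> 2" by (simp add: card_insert_if)
    finally show False using four by simp
  qed
  let ?O = "orb {0, 1} x"
  have O: "x \<in> ?O" "\<rho> 0 x \<in> ?O" "\<rho> 1 x \<in> ?O" by (auto intro: orb_step)
  have OO: "\<rho> 0 (\<rho> 1 x) \<in> ?O" "\<rho> 1 (\<rho> 0 x) \<in> ?O" using O by (auto intro: orb_step)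
  have m: "\<rho> 0 v \<noteq> v" "\<rho> 1 v \<noteq> v" if "v \<in> ?O" for v using move sub that by auto
  have ne: "\<rho> 0 x \<noteq> \<rho> 1 x"
  proof
    assume eq: "\<rho> 0 x = \<rho> 1 x"
    have "?O \<subseteq> {x, \<rho> 0 x}" by (rule orb_subset) (use eq in auto, metis invol)
    then have "card ?O \<le> card {x, \<rho> 0 x}" by (rule card_mono[rotated]) simp
    also have "\<dots> \<le> 2" by (simp add: card_insert_if)
    finally show False using four by simp
  qed
  have x: "\<rho> 0 (\<rho> 1 x) = \<rho> 1 (\<rho> 0 x)"
  proof (rule ccontr)
    assume c: "\<not> ?thesis"
    have d: "\<rho> 0 (\<rho> 1 x) \<noteq> x" "\<rho> 0 (\<rho> 1 x) \<noteq> \<rho> 0 x" "\<rho> 0 (\<rho> 1 x) \<noteq> \<rho> 1 x"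
      "\<rho> 1 (\<rho> 0 x) \<noteq> x" "\<rho> 1 (\<rho> 0 x) \<noteq> \<rho> 0 x" "\<rho> 1 (\<rho> 0 x) \<noteq> \<rho> 1 x"
      using ne m O rho_inj by (metis invol)+
    have "card {x, \<rho> 0 x, \<rho> 1 x, \<rho> 0 (\<rho> 1 x), \<rho> 1 (\<rho> 0 x)} = 5"
      using c d ne m[OF O(1)] by (simp add: card_insert_if eq_commute)
    moreover have "card {x, \<rho> 0 x, \<rho> 1 x, \<rho> 0 (\<rho> 1 x), \<rho> 1 (\<rho> 0 x)} \<le> card ?O"
      using O OO by (intro card_mono[OF fin]) auto
    ultimately show False using four by simp
  qed
  obtain w where w: "set w \<subseteq> J" "y = act w x" using y orb_act by blast
  have "act w (\<rho> 0 (\<rho> 1 x)) = act w (\<rho> 1 (\<rho> 0 x))" using x by simp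
  then show ?thesis using act_rho[OF far w(1)] w(2) by simp
qed

end

text \<open>The assumption \<open>small\<close> negates \<open>2 * r \<le> n + 1\<close>, so
  everything here heads for a contradiction. In terms of \<open>s = r - 3\<close> it reads
  \<open>n \<le> 2 * s + 4\<close>.\<close>

locale thick_top = thick_string +
  assumes top: "Suc b = r" and small: "card \<Omega> + 2 \<le> 2 * r"
begin

definition s where "s = r - 3"

lemma rs: "r = s + 3" "3 \<le> s" "b = s + 2" using r6 top by (auto simp: s_def)

abbreviation "J \<equiv> {Suc s, s + 2}"

lemma farJ: "far {..<s} J" by (auto simp: far_def)

lemma far_less: "k \<le> s \<Longrightarrow> far {..<k} J" by (auto simp: far_def)

lemma A_J_image: "k \<le> s \<Longrightarrow> j \<in> J \<Longrightarrow> \<rho> j ` A k = orb {..<k} (\<rho> j x)"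
  unfolding A_def by (rule orb_commute) (auto intro: comm')

lemma J_noncommuting: "\<exists>y\<in>\<Omega>. \<rho> (Suc s) (\<rho> (s + 2) y) \<noteq> \<rho> (s + 2) (\<rho> (Suc s) y)"
  using noncommuting[of "Suc s"] rs by simp

lemma zero_noncommuting: "\<exists>y\<in>\<Omega>. \<rho> 0 (\<rho> 1 y) \<noteq> \<rho> 1 (\<rho> 0 y)"
  using noncommuting[of 0] rs by simp

lemma tau_moves: "\<rho> (s + 2) x \<noteq> x" using b_moves rs by simp

text \<open>A point \<open>y\<close> of the \<open>J\<close>-orbit outside \<open>A s\<close> brings
  a disjoint copy \<open>B'\<close> of \<open>A s\<close>, and at most two points are left. There is
  no room for a third copy or an automorphism of one copy, so the \<open>J\<close>-orbit is
  \<open>{x, y}\<close>. Then label \<open>Suc s\<close> either moves at most two points or agrees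
  with label \<open>s + 2\<close> on both copies and commutes with it everywhere.\<close>

lemma J_orbit_inside:
  assumes nf: "A s \<noteq> \<Omega>" shows "orb J x \<subseteq> A s"
proof (rule ccontr)
  assume "\<not> ?thesis"
  then obtain y where y: "y \<in> orb J x" "y \<notin> A s" by blast
  define B' where "B' = orb {..<s} y"
  have y\<Omega>: "y \<in> \<Omega>" using y orb_points[OF base_point] by blast
  have B'\<Omega>: "B' \<subseteq> \<Omega>" unfolding B'_def by (rule orb_points[OF y\<Omega>])
  have finB': "finite B'" using B'\<Omega> finite_points finite_subset by blast
  have disj: "B' \<inter> A s = {}" using y(2) orb_disjoint unfolding B'_def A_def by blast
  have cB': "card B' = card (A s)" using card_orb_eq'[OF farJ y(1)] by (simp add: B'_def A_def)
  have szA: "s + 1 \<le> card (A s)" using size[of "s - 1"] not_full[OF nf, of "s - 1"] rs by simp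
  have two: "card (A s \<union> B') = 2 * card (A s)"
    using disj cB' finB' by (subst card_Un_disjoint) auto
  have le: "card (A s \<union> B') \<le> card \<Omega>" using A_points B'\<Omega> by (intro card_mono[OF finite_points]) auto
  \<comment> \<open>A second point would give \<open>4 * s \<le> 2 * s + 4\<close> by
    \<open>aut_double\<close>, against \<open>3 \<le> s\<close>.\<close>
  have only_x: "z = x" if z: "z \<in> orb J x" "z \<in> A s" for z
  proof (rule ccontr)
    assume "z \<noteq> x"
    then have "2 * s \<le> card (A s)" unfolding A_def
      using z strict not_full[OF nf] rs
      by (intro aut_double[OF farJ finite_orbit z(1)]) (auto simp: A_def)
    then show False using two le small rs by linarith
  qed
  have img: "act w ` A s = orb {..<s} (act w x)" if "set w \<subseteq> J" for w
    unfolding A_def by (rule act_image_orb[OF farJ that])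
  have only_y: "z = y" if z: "z \<in> orb J x" "z \<in> B'" for z
  proof -
    obtain w where w: "set w \<subseteq> J" "y = act w x" using y orb_act by blast
    then obtain a where a: "a \<in> A s" "z = act w a" using img[OF w(1)] z(2) by (auto simp: B'_def)
    then have "z \<in> orb J a" using act_orb[OF w(1)] by simp
    then have "a \<in> orb J x" using z(1) orb_eq orb_sym by metis
    then have "a = x" using only_x a(1) by blast
    then show ?thesis using a(2) w(2) by simp
  qed
  have cover: "orb J x \<subseteq> {x, y}"
  proof
    fix z assume z: "z \<in> orb J x"
    show "z \<in> {x, y}"
    proof (rule ccontr)
      assume "z \<notin> {x, y}"
      then have zn: "z \<notin> A s" "z \<notin> B'" using only_x only_y z by blast+
      define B'' where "B'' = orb {..<s} z"
      have z\<Omega>: "z \<in> \<Omega>" using z orb_points[OF base_point] by blast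
      have B''\<Omega>: "B'' \<subseteq> \<Omega>" unfolding B''_def by (rule orb_points[OF z\<Omega>])
      have "B'' \<inter> A s = {}" "B'' \<inter> B' = {}" using zn orb_disjoint unfolding B''_def B'_def A_def by blast+
      moreover have "card B'' = card (A s)" using card_orb_eq'[OF farJ z] by (simp add: B''_def A_def)
      moreover have "finite B''" using B''\<Omega> finite_points finite_subset by blast
      ultimately have "card ((A s \<union> B') \<union> B'') = 3 * card (A s)"
        using two finB' by (subst card_Un_disjoint) auto
      moreover have "card ((A s \<union> B') \<union> B'') \<le> card \<Omega>"
        using A_points B'\<Omega> B''\<Omega> by (intro card_mono[OF finite_points]) auto
      ultimately show False using szA small rs by linarith
    qed
  qed
  have orbstep: "\<rho> j z \<in> {x, y}" if "z \<in> {x, y}" "j \<in> J" for j z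
    using cover orb_step[of z J x j] that y(1) by auto
  have xy: "x \<noteq> y" using y x_A by blast
  have tau1: "\<rho> (s + 2) x = y" using orbstep[of x "s + 2"] tau_moves by simp
  then have "\<rho> (s + 2) y = x" by (metis invol)
  note tau = tau1 this
  have rest: "card (\<Omega> - (A s \<union> B')) \<le> 2"
    using two le small szA rs A_points B'\<Omega> finB' finite_points by (subst card_Diff_subset) auto
  have B'img: "\<rho> j ` B' = orb {..<s} (\<rho> j y)" if "j \<in> J" for j
    unfolding B'_def by (rule orb_commute) (use that in \<open>auto intro: comm'\<close>)
  have closedAB: "\<rho> j z \<in> A s \<union> B'" if "z \<in> A s \<union> B'" "j \<in> J" for j z
  proof -
    have "orb {..<s} (\<rho> j x) \<subseteq> A s \<union> B'" "orb {..<s} (\<rho> j y) \<subseteq> A s \<union> B'"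
      using orbstep[of x j] orbstep[of y j] that by (auto simp: A_def B'_def)
    then show ?thesis using that A_J_image[of s j] B'img[of j] by blast
  qed
  have "\<rho> (Suc s) x \<in> {x, y}" using orbstep by simp
  then consider "\<rho> (Suc s) x = x" | "\<rho> (Suc s) x = y" by blast
  then show False
  proof cases
    case 1
    then have "\<rho> (Suc s) y \<noteq> x" using xy by (metis invol)
    then have "\<rho> (Suc s) y = y" using orbstep[of y "Suc s"] by simp
    then have fx: "\<rho> (Suc s) z = z" if "z \<in> A s \<union> B'" for z
      using that 1 semiregular[OF farJ, of "[Suc s]" x z] semiregular[OF farJ, of "[Suc s]" y z]
      by (auto simp: A_def B'_def)
    have "{z \<in> \<Omega>. \<rho> (Suc s) z \<noteq> z} \<subseteq> \<Omega> - (A s \<union> B')" using fx by blast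
    then have "mv (Suc s) \<Omega> \<le> card (\<Omega> - (A s \<union> B'))" unfolding mv_def by (rule card_mono[rotated]) (simp add: finite_points)
    then show False using rest mv_four[of "Suc s"] rs by simp
  next
    case 2
    then have "\<rho> (Suc s) y = x" by (metis invol)
    then have eq: "\<rho> (Suc s) z = \<rho> (s + 2) z" if "z \<in> A s \<union> B'" for z
      using that 2 tau semiregular_eq[OF farJ, of "[Suc s]" "[s + 2]" x z] semiregular_eq[OF farJ, of "[Suc s]" "[s + 2]" y z]
      by (auto simp: A_def B'_def)
    have "\<rho> (Suc s) (\<rho> (s + 2) z) = \<rho> (s + 2) (\<rho> (Suc s) z)" if z: "z \<in> \<Omega>" for z
    proof (cases "z \<in> A s \<union> B'")
      case True
      then have "\<rho> (s + 2) z \<in> A s \<union> B'" using closedAB by blast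
      then show ?thesis using eq[OF True] eq by simp
    next
      case False
      show ?thesis
      proof (rule commute_two[where S = "\<Omega> - (A s \<union> B')"])
        fix v assume v: "v \<in> \<Omega> - (A s \<union> B')"
        have "\<rho> j v \<notin> A s \<union> B'" if "j \<in> J" for j using closedAB[of "\<rho> j v" j] v that by auto
        then show "\<rho> (Suc s) v \<in> \<Omega> - (A s \<union> B')" "\<rho> (s + 2) v \<in> \<Omega> - (A s \<union> B')"
          using v closed by blast+
      qed (use rest finite_points False z in auto)
    qed
    then show False using J_noncommuting by blast
  qed
qed

lemma J_closed:
  assumes "orb J x \<subseteq> A s" "y \<in> A s" "j \<in> J" shows "\<rho> j y \<in> A s"
proof -
  have "\<rho> j x \<in> A s" using assms orb_step[of x J x j] by auto
  then have "orb {..<s} (\<rho> j x) = A s" unfolding A_def by (rule orb_eq)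
  then show ?thesis using A_J_image[of s j] assms by blast
qed

text \<open>Here \<open>q\<close> is the size of the \<open>J\<close>-orbits in \<open>A s\<close>,
  \<open>e\<close> their number and \<open>a\<close> the number of doublings. The hypotheses give
  \<open>(q - 2) * e \<le> 2 * a + 1\<close>, hence \<open>q \<le> 2 * a + 3\<close>, which
  \<open>2 ^ a \<le> q\<close> permits only for \<open>a \<le> 3\<close>; smaller \<open>a\<close>
  contradict \<open>6 \<le> q\<close> or \<open>3 \<le> s\<close>.\<close>

lemma few_orbits:
  assumes "6 \<le> q" "2 ^ a \<le> q" "Suc s \<le> e + a" "a \<le> s" "q * e \<le> 2 * s + 3" "3 \<le> s"
  shows "s = (3::nat) \<and> e = (1::nat) \<and> a = 3 \<and> 8 \<le> (q::nat) \<and> q \<le> 9"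
proof -
  have e1: "1 \<le> e" using assms by simp
  have "q * e \<le> 2 * e + 2 * a + 1" using assms by simp
  moreover have "q * e = 2 * e + (q - 2) * e" using assms(1) by (simp add: algebra_simps diff_mult_distrib)
  ultimately have qe: "(q - 2) * e \<le> 2 * a + 1" by simp
  have "q - 2 \<le> (q - 2) * e" using e1 by simp
  then have q: "q \<le> 2 * a + 3" using qe by linarith
  have grow: "2 * k + 3 < 2 ^ k" if "4 \<le> k" for k :: nat
    using that by (induction k rule: dec_induct) simp_all
  have "a < 4"
  proof (rule ccontr)
    assume "\<not> a < 4"
    then show False using grow[of a] q assms(2) by simp
  qed
  moreover have "a \<noteq> 0" "a \<noteq> 1" using q assms(1) by auto
  ultimately consider "a = 2" | "a = 3" by linarith
  then show ?thesis
  proof cases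
    case 1
    have "4 \<le> q - 2" using assms(1) by linarith
    then have "4 * e \<le> (q - 2) * e" by (rule mult_right_mono) simp
    then have "e = 1" using qe 1 e1 by linarith
    then show ?thesis using 1 assms by simp
  next
    case 2
    have "4 \<le> q - 2" using assms(1) by linarith
    then have "4 * e \<le> (q - 2) * e" by (rule mult_right_mono) simp
    then have "e = 1" using qe 2 e1 by linarith
    then show ?thesis using 2 assms q by simp
  qed
qed

text \<open>Otherwise the \<open>J\<close>-orbits have at least six points, and the numbers leave
  only \<open>s = 3\<close> with \<open>A s\<close> a single \<open>J\<close>-orbit. The chain
  doubles at every step, so labels 0 and 1 have an orbit of four points and commute on
  \<open>A s\<close>. At most two points lie outside, so they commute everywhere, which is
  excluded.\<close>

lemma J_commute_inside:
  assumes nf: "A s \<noteq> \<Omega>" and y: "y \<in> A s"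
  shows "\<rho> (Suc s) (\<rho> (s + 2) y) = \<rho> (s + 2) (\<rho> (Suc s) y)"
proof (rule ccontr)
  assume nc: "\<not> ?thesis"
  note inside = J_orbit_inside[OF nf]
  note clJ = J_closed[OF inside]
  let ?q = "card (orb J x)" and ?e = "card (orb J ` A s)"
  have finJ: "finite (orb J x)" by (rule fin_all[OF base_point])
  have six: "6 \<le> ?q"
    using y nc clJ by (intro dihedral_six[OF farJ finJ]) (auto simp: A_def)
  have strict_s: "A (Suc k) \<noteq> A k" if "k < s" for k using strict[of k] not_full[OF nf, of k] that rs by simp
  obtain a where a: "a \<le> s" "2 ^ a \<le> card (orb J x \<inter> A s)" "Suc s \<le> ?e + a"
    using doubling_count[OF farJ finite_orbit] strict_s by (auto simp: A_def)
  have sub: "orb J y \<subseteq> A s" if "y \<in> A s" for y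
    by (rule orb_subset) (use that clJ in auto)
  have prod: "card (A s) = ?q * ?e"
    using orbit_count[OF farJ finite_orbit] sub by (simp add: A_def)
  have "A s \<subset> \<Omega>" using nf A_points by blast
  then have lt: "card (A s) < card \<Omega>" by (rule psubset_card_mono[OF finite_points])
  have "orb J x \<inter> A s = orb J x" using inside by blast
  then have few: "s = 3 \<and> ?e = 1 \<and> a = 3 \<and> 8 \<le> ?q \<and> ?q \<le> 9"
  proof (intro few_orbits)
    show "2 ^ a \<le> ?q" using a(2) \<open>orb J x \<inter> A s = orb J x\<close> by simp
    show "?q * ?e \<le> 2 * s + 3" using prod lt small rs by linarith
  qed (use six a rs in blast)+
  then obtain O1 where O1: "orb J ` A s = {O1}" by (auto simp: card_1_singleton_iff)
  then have whole: "A s = orb J x" using inside by (metis imageI orb_base singletonD subsetI subset_antisym x_A)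
  have dbl: "2 * card (A k) \<le> card (A (Suc k))" if k: "k < s" for k
  proof -
    have "A (Suc k) \<subseteq> A s" using A_mono k by simp
    then have "card (orb J ` A (Suc k)) \<le> card (orb J ` A s)" by (intro card_mono image_mono) auto
    moreover have "0 < card (orb J ` A k)" by (metis card_gt_0_iff empty_iff finite_A finite_imageI image_is_empty x_A)
    moreover have "?e = 1" using few by blast
    ultimately have "\<not> card (orb J ` A k) < card (orb J ` A (Suc k))" by linarith
    moreover have "orb J x \<inter> A l = A l" if "l \<le> s" for l using whole A_mono[OF that] by blast
    ultimately show ?thesis using double_or_new[OF farJ finite_orbit k] strict_s[OF k] k by (simp add: A_def)
  qed
  have "card (A 2) = 4"
  proof -
    have "card (A (Suc (Suc 0))) \<ge> 4" using dbl[of 0] dbl[of "Suc 0"] few by (simp add: A_0)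
    moreover have "2 * card (A (Suc (Suc 0))) \<le> card (A (Suc (Suc (Suc 0))))" using few by (intro dbl) simp
    moreover have "Suc (Suc (Suc 0)) = s" using few by simp
    then have "card (A (Suc (Suc (Suc 0)))) \<le> 9" using few prod by (metis mult.right_neutral)
    ultimately have "card (A (Suc (Suc 0))) = 4" by linarith
    then show ?thesis by (simp only: numeral_2_eq_2)
  qed
  moreover have set2: "{..<2} = {0, 1::nat}" by auto
  ultimately have four: "card (orb {0, 1} x) = 4" by (simp add: A_def)
  have "A 2 \<subseteq> A s" using A_mono[of 2 s] rs by simp
  then have sub2: "orb {0, 1} x \<subseteq> orb J x" using whole by (simp add: A_def set2)
  have far2: "far {0, 1} J" using rs by (auto simp: far_def)
  have "\<rho> 0 (\<rho> 1 z) = \<rho> 1 (\<rho> 0 z)" if z: "z \<in> \<Omega>" for z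
  proof (cases "z \<in> A s")
    case True
    then show ?thesis using four_points_commute[OF far2 sub2 four] whole by simp
  next
    case False
    show ?thesis
    proof (rule commute_two[where S = "\<Omega> - A s"])
      have "card (\<Omega> - A s) = card \<Omega> - card (A s)" using A_points by (simp add: card_Diff_subset)
      moreover have "8 \<le> card (A s)" using few prod by (metis mult.right_neutral)
      moreover have "s = 3" using few by blast
      ultimately show "card (\<Omega> - A s) \<le> 2" using small rs(1) by linarith
    qed (use finite_points False z closed A_closed[of 0 s] A_closed[of 1 s] rs in auto)
  qed
  then show False using zero_noncommuting by blast
qed

end

context primitive_string
begin

text \<open>The sets \<open>{y, \<pi> y}\<close> would be blocks.\<close>

lemma no_commuting_involution:
  assumes "\<And>y. y \<in> \<Omega> \<Longrightarrow> \<pi> y \<in> \<Omega>" "\<And>y. y \<in> \<Omega> \<Longrightarrow> \<pi> (\<pi> y) = y"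
    and "\<And>i y. i < r \<Longrightarrow> y \<in> \<Omega> \<Longrightarrow> \<rho> i (\<pi> y) = \<pi> (\<rho> i y)"
    and "x \<in> \<Omega>" "\<pi> x \<noteq> x" "3 \<le> card \<Omega>"
  shows False
proof -
  define R where "R y z \<longleftrightarrow> y \<in> \<Omega> \<and> z \<in> \<Omega> \<and> (z = y \<or> z = \<pi> y)" for y z
  have "(\<forall>y\<in>\<Omega>. \<forall>z\<in>\<Omega>. R y z \<longrightarrow> y = z) \<or> (\<forall>y\<in>\<Omega>. \<forall>z\<in>\<Omega>. R y z)"
    by (rule primitive) (use assms closed in \<open>auto simp: R_def\<close>)
  then show False
  proof
    assume "\<forall>y\<in>\<Omega>. \<forall>z\<in>\<Omega>. R y z \<longrightarrow> y = z"
    then show False using assms by (auto simp: R_def)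
  next
    assume "\<forall>y\<in>\<Omega>. \<forall>z\<in>\<Omega>. R y z"
    then have "\<Omega> \<subseteq> {x, \<pi> x}" using assms(4) by (auto simp: R_def)
    then have "card \<Omega> \<le> card {x, \<pi> x}" by (rule card_mono[rotated]) simp
    also have "\<dots> \<le> 2" by (simp add: card_insert_if)
    finally show False using assms(6) by simp
  qed
qed

lemma closed_full:
  assumes "X \<subseteq> \<Omega>" "y \<in> X" "\<And>i z. i < r \<Longrightarrow> z \<in> X \<Longrightarrow> \<rho> i z \<in> X" shows "X = \<Omega>"
proof -
  have "orb {..<r} y \<subseteq> X" using assms by (intro orb_subset) auto
  then show ?thesis using transitive[of y] assms by auto
qed

end

context thick_top
begin

text \<open>Otherwise the last two labels fail to commute on the complement \<open>F\<close> of
  \<open>B = A s\<close>, so \<open>F\<close> has three or four points and \<open>B\<close> exactly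
  \<open>2 * s\<close>. This forces the structure: once the chain contains the image of
  \<open>x\<close> under the last label \<open>\<tau>\<close>, each layer is a pair exchanged by
  \<open>\<tau>\<close>, and \<open>B\<close> is joined to \<open>F\<close> only by label
  \<open>s\<close> at the last pair \<open>u\<close>, \<open>\<tau> u\<close>. If label 0 fixes
  \<open>u\<close>, it turns out to move only \<open>x\<close> and \<open>\<rho> 0 x\<close>,
  against evenness. If not, it agrees with \<open>\<tau>\<close> at \<open>u\<close>, and
  \<open>\<tau>\<close> on \<open>B\<close> with label 0 on \<open>F\<close> is an involution
  commuting with all labels.\<close>

lemma A_s_full: "A s = \<Omega>"
proof (rule ccontr)
  assume nf: "A s \<noteq> \<Omega>"
  note inside = J_orbit_inside[OF nf]
  note clJ = J_closed[OF inside]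
  note comB = J_commute_inside[OF nf]
  let ?B = "A s" and ?\<tau> = "\<rho> (s + 2)" and ?\<sigma> = "\<rho> (Suc s)"
  define F where "F = \<Omega> - ?B"
  have strict_s: "A (Suc k) \<noteq> A k" if "k < s" for k using strict[of k] not_full[OF nf, of k] that rs by simp
  have szA: "Suc k \<le> card (A k)" if "k \<le> s" for k
    using size[of "k - 1"] not_full[OF nf, of "k - 1"] that rs by (cases k) (auto simp: A_0)
  have tx: "?\<tau> x \<in> orb J x" "?\<tau> x \<in> ?B" using inside by (auto intro: orb_step)
  have comt: "?\<tau> (\<rho> i y) = \<rho> i (?\<tau> y)" if "i \<le> s" for i y using that by (simp add: comm')
  have tfpf: "?\<tau> y \<noteq> y" if "y \<in> ?B" for y
  proof
    assume "?\<tau> y = y"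
    moreover have "x \<in> orb {..<s} y" using that orb_sym by (simp add: A_def)
    ultimately have "?\<tau> x = x" using semiregular[OF farJ, of "[s + 2]" y x] by simp
    then show False using tau_moves by simp
  qed
  have evB: "even (card ?B)"
    by (rule even_card_fpf_involution[of _ ?\<tau>]) (use tfpf clJ in auto)
  have lower: "2 * k \<le> card (A k)" if "k \<le> s" "?\<tau> x \<in> A k" for k
    using that tau_moves strict_s tx(1) unfolding A_def
    by (intro aut_double[of k J x "?\<tau> x"] far_less finite_orbit) (auto simp: A_def)
  have finF: "finite F" using finite_points by (simp add: F_def)
  have cardF: "card F = card \<Omega> - card ?B" unfolding F_def using A_points by (simp add: card_Diff_subset)
  have BO: "card ?B \<le> card \<Omega>" using A_points finite_points by (intro card_mono)
  have Fcl: "\<rho> i y \<in> F" if "y \<in> F" "i < s \<or> i \<in> J" for i y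
  proof -
    have "\<rho> i y \<notin> ?B"
    proof
      assume "\<rho> i y \<in> ?B"
      then have "\<rho> i (\<rho> i y) \<in> ?B" using that(2) clJ[of "\<rho> i y" i] A_closed[of i s "\<rho> i y"] by blast
      then show False using that(1) by (simp add: F_def)
    qed
    then show ?thesis using that(1) closed by (simp add: F_def)
  qed
  obtain y0 where y0: "y0 \<in> F" "?\<sigma> (?\<tau> y0) \<noteq> ?\<tau> (?\<sigma> y0)"
    using J_noncommuting comB by (auto simp: F_def)
  have "3 \<le> card F"
  proof (rule ccontr)
    assume "\<not> ?thesis"
    then have "?\<sigma> (?\<tau> y0) = ?\<tau> (?\<sigma> y0)" using y0(1) finF Fcl by (intro commute_two[of F]) auto
    then show False using y0 by simp
  qed
  then have "card ?B \<le> 2 * s + 1" using cardF BO small rs by linarith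
  \<comment> \<open>The size is even, at least \<open>2 * s\<close> and at most
    \<open>2 * s + 1\<close>.\<close>
  then have cardB: "card ?B = 2 * s" using lower[of s] tx evB by (metis add_diff_cancel_left' even_Suc even_mult_iff even_two_times_div_two le_antisym le_SucE Suc_eq_plus1 dvd_triv_left order_refl)
  then have F4: "card F \<le> 4" using cardF small rs by linarith
  \<comment> \<open>An orbit of three points would be preserved by the last two labels, as
    \<open>F\<close> has no room for a second copy. Their failure to commute at \<open>y0\<close>
    would need six points inside this orbit, and outside too few points are left.\<close>
  have O2: "card (orb {..<s} y) \<le> 2" if y: "y \<in> F" for y
  proof (rule ccontr)
    assume "\<not> ?thesis"
    then have T3: "3 \<le> card (orb {..<s} y)" by simp
    let ?T = "orb {..<s} y"
    have TF: "?T \<subseteq> F" by (rule orb_subset) (use y Fcl in auto)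
    have y\<Omega>: "y \<in> \<Omega>" using y by (simp add: F_def)
    have Tcl: "\<rho> j z \<in> ?T" if "z \<in> ?T" "j \<in> J" for j z
    proof -
      have img: "\<rho> j ` ?T = orb {..<s} (\<rho> j y)" using that by (intro orb_commute) (auto intro: comm')
      have "\<rho> j y \<in> ?T"
      proof (rule ccontr)
        assume no: "\<rho> j y \<notin> ?T"
        have "orb {..<s} (\<rho> j y) \<subseteq> F" by (rule orb_subset) (use y Fcl that in auto)
        moreover have "\<rho> j y \<in> orb J y" using that by (intro orb_step) auto
        ultimately have "2 * card ?T \<le> card F" using far_orbit_image[OF farJ _ no _ TF finF] by blast
        then show False using T3 F4 by simp
      qed
      then show ?thesis using img orb_eq that by blast
    qed
    show False
    proof (cases "y0 \<in> ?T")
      case True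
      have "6 \<le> card (orb J y)"
        using True y0 Tcl fin_all[OF y\<Omega>] by (intro dihedral_six[OF farJ, of y y0]) auto
      moreover have "orb J y \<subseteq> F"
        by (rule order_trans[OF _ TF], rule orb_subset) (use Tcl in auto)
      then have "card (orb J y) \<le> card F" by (rule card_mono[OF finF])
      ultimately show False using F4 by simp
    next
      case False
      have "card (F - ?T) = card F - card ?T" using TF finF finite_subset by (intro card_Diff_subset) auto
      then have "card (F - ?T) \<le> 2" using T3 F4 by simp
      moreover have "\<rho> j z \<in> F - ?T" if "z \<in> F - ?T" "j \<in> J" for j z
        using that Fcl Tcl[of "\<rho> j z" j] by auto
      ultimately have "?\<sigma> (?\<tau> y0) = ?\<tau> (?\<sigma> y0)" using y0(1) finF False by (intro commute_two[of "F - ?T"]) auto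
      then show False using y0 by simp
    qed
  qed
  have three: "a = b \<or> b = c \<or> a = c" if "y \<in> F" "a \<in> orb {..<s} y" "b \<in> orb {..<s} y" "c \<in> orb {..<s} y" for y a b c
    using card_le_2_cases[OF _ O2[OF that(1)] that(2-4)] fin_all[of y] that(1) by (simp add: F_def)
  have Ainv: "?\<tau> y \<in> A k" if "?\<tau> x \<in> A k" "k \<le> s" "y \<in> A k" for k y
    using A_J_image[of k "s + 2"] that orb_eq[of "?\<tau> x" "{..<k}" x] by (auto simp: A_def)
  have Ninv: "?\<tau> y \<in> N k" if "?\<tau> x \<in> A k" "k < s" "y \<in> N k" for k y
  proof -
    have "?\<tau> x \<in> A (Suc k)" using that(1) A_mono[of k "Suc k"] by auto
    then have "?\<tau> y \<in> A (Suc k)" using Ainv[of "Suc k" y] that by (simp add: N_def)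
    moreover have "?\<tau> y \<notin> A k" using Ainv[of k "?\<tau> y"] that by (auto simp: N_def)
    ultimately show ?thesis by (simp add: N_def)
  qed
  have exact: "card (A k) = 2 * k" if k: "?\<tau> x \<in> A k" "k \<le> s" for k
  proof -
    have "card (A k) + 2 * (l - k) \<le> card (A l)" if "k \<le> l" "l \<le> s" for l
      using that
    proof (induction l rule: dec_induct)
      case (step l)
      have in_l: "?\<tau> x \<in> A l" using k(1) A_mono[OF step.hyps(1)] by auto
      obtain y where y: "y \<in> N l" using strict_s[of l] A_Suc[of l] step.prems by (cases "N l = {}") auto
      have "{y, ?\<tau> y} \<subseteq> N l" using y Ninv[OF in_l _ y] step.prems by simp
      then have "card {y, ?\<tau> y} \<le> card (N l)" by (rule card_mono[OF finite_N])
      moreover have "y \<in> ?B" using y A_mono[of "Suc l" s] step.prems by (auto simp: N_def)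
      then have "card {y, ?\<tau> y} = 2" using tfpf[of y] by (simp add: card_insert_if eq_commute)
      ultimately show ?case using step card_A_Suc[of l] by simp
    qed simp
    from this[of s] show ?thesis using lower[of k] k cardB by simp
  qed
  have layer: "N k = {y, ?\<tau> y}" if k: "?\<tau> x \<in> A k" "k < s" and y: "y \<in> N k" for k y
  proof -
    have "?\<tau> x \<in> A (Suc k)" using k A_mono[of k "Suc k"] by auto
    then have "card (N k) = 2" using exact[of k] exact[of "Suc k"] k card_A_Suc[of k] by simp
    moreover have "y \<in> ?B" using y A_mono[of "Suc k" s] k by (auto simp: N_def)
    then have "card {y, ?\<tau> y} = 2" using tfpf[of y] by (simp add: card_insert_if eq_commute)
    moreover have "{y, ?\<tau> y} \<subseteq> N k" using y Ninv[OF k y] by simp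
    ultimately show ?thesis by (metis card_seteq finite_N order_refl)
  qed
  obtain l where l: "s = Suc l" "2 \<le> l" using rs by (cases s) auto
  \<comment> \<open>Label \<open>s\<close> commutes with the labels below \<open>l\<close>, so it
    carries the orbit at one end of a link into a small orbit of \<open>F\<close>.\<close>
  have link_small: "card (orb {..<l} y) \<le> 2" if y: "y \<in> ?B" "\<rho> s y \<in> F" for y
  proof -
    have "\<rho> s ` orb {..<l} y = orb {..<l} (\<rho> s y)" using l by (intro orb_commute) (auto intro: comm')
    also have "\<dots> \<subseteq> orb {..<s} (\<rho> s y)" using l by (intro orb_mono) auto
    finally have "card (\<rho> s ` orb {..<l} y) \<le> card (orb {..<s} (\<rho> s y))"
      using fin_all[of "\<rho> s y"] y by (intro card_mono) (auto simp: F_def)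
    moreover have "card (\<rho> s ` orb {..<l} y) = card (orb {..<l} y)"
      by (rule card_image) (simp add: inj_on_def rho_inj)
    ultimately show ?thesis using O2[OF y(2)] by simp
  qed
  have "\<exists>y\<in>?B. \<rho> s y \<in> F"
  proof (rule ccontr)
    assume no: "\<not> ?thesis"
    have "?B = \<Omega>"
    proof (rule closed_full[OF A_points x_A])
      fix i z assume i: "i < r" and z: "z \<in> ?B"
      consider "i < s" | "i = s" | "i \<in> J" using i rs by fastforce
      then show "\<rho> i z \<in> ?B"
      proof cases
        case 2
        have "\<rho> s z \<in> \<Omega>" using z A_points closed by blast
        then show ?thesis using no z 2 by (auto simp: F_def)
      qed (use z A_closed[of i s z] clJ in auto)
    qed
    then show False using nf by simp
  qed
  then obtain u where u: "u \<in> ?B" "\<rho> s u \<in> F" by blast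
  \<comment> \<open>Otherwise \<open>B\<close> consists of two copies of \<open>A l\<close>, and the
    link at \<open>u\<close> would carry an orbit of at least three points into one of two.\<close>
  have tau_l: "?\<tau> x \<in> A l"
  proof (rule ccontr)
    assume no: "?\<tau> x \<notin> A l"
    let ?C = "orb {..<l} (?\<tau> x)"
    have far: "far {..<l} J" using far_less l by simp
    have cC: "card ?C = card (A l)" using card_orb_eq'[OF far tx(1)] by (simp add: A_def)
    have disj: "?C \<inter> A l = {}" using no orb_disjoint unfolding A_def by blast
    have finC: "finite ?C" using fin_all[of "?\<tau> x"] closed base_point by blast
    have "?C \<subseteq> orb {..<s} (?\<tau> x)" using l by (intro orb_mono) auto
    then have sub: "?C \<union> A l \<subseteq> ?B" using tx(2) orb_eq[of "?\<tau> x" "{..<s}" x] A_mono[of l s] l by (auto simp: A_def)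
    have "card (?C \<union> A l) = 2 * card (A l)" using cC disj finC by (subst card_Un_disjoint) auto
    then have "card ?B \<le> card (?C \<union> A l)" using szA[of l] cardB l by simp
    then have "?B = ?C \<union> A l" using card_seteq[OF finite_A sub] by simp
    then have "u \<in> ?C \<or> u \<in> A l" using u by blast
    then have "card (orb {..<l} u) = card (A l)" using cC orb_eq[of u "{..<l}"] by (auto simp: A_def)
    then show False using link_small[OF u] szA[of l] l by simp
  qed
  have in_layer: "y \<in> N l" if "y \<in> ?B" "\<rho> s y \<in> F" for y
  proof -
    have "y \<notin> A l"
    proof
      assume "y \<in> A l"
      then have "orb {..<l} y = A l" unfolding A_def by (rule orb_eq)
      then show False using link_small[OF that] exact[OF tau_l] l by simp
    qed
    then show ?thesis using that l by (simp add: N_def)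
  qed
  have Nl: "N l = {u, ?\<tau> u}" using layer[OF tau_l _ in_layer[OF u]] l by simp
  have linkY: "y = u \<or> y = ?\<tau> u" if "y \<in> ?B" "\<rho> s y \<in> F" for y using in_layer[OF that] Nl by blast
  \<comment> \<open>At the first index \<open>k0\<close> with \<open>\<tau> x\<close> in the chain,
    \<open>A k0\<close> is two copies of \<open>A m\<close>. Label \<open>k0\<close> carries one
    entry and hence all of \<open>A k0\<close> into the two-point layer \<open>N k0\<close>, so
    \<open>2 * k0 \<le> 2\<close>.\<close>
  have t1: "?\<tau> x = \<rho> 0 x"
  proof -
    define k0 where "k0 = (LEAST k. ?\<tau> x \<in> A k)"
    have k0: "?\<tau> x \<in> A k0" "k0 \<le> l" unfolding k0_def using tau_l by (auto intro: LeastI Least_le)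
    have "k0 \<noteq> 0" using k0 tau_moves A_0 by (metis singletonD)
    then obtain m where m: "k0 = Suc m" by (cases k0) auto
    have no: "?\<tau> x \<notin> A m" using not_less_Least[of m "\<lambda>k. ?\<tau> x \<in> A k"] m by (simp add: k0_def)
    have img: "?\<tau> ` A m = orb {..<m} (?\<tau> x)" using A_J_image[of m "s + 2"] m k0 l by simp
    have disj: "?\<tau> ` A m \<inter> A m = {}" using no orb_disjoint img unfolding A_def by blast
    have sub: "?\<tau> ` A m \<union> A m \<subseteq> A k0" using Ainv[OF k0(1)] A_mono[of m k0] k0 m l by auto
    have "card (?\<tau> ` A m) = card (A m)" by (rule card_image) (simp add: inj_on_def rho_inj)
    then have "card (?\<tau> ` A m \<union> A m) = 2 * card (A m)" using disj by (subst card_Un_disjoint) auto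
    then have "card (A k0) \<le> card (?\<tau> ` A m \<union> A m)" using szA[of m] exact[OF k0(1)] m k0 l by simp
    then have Ak0: "A k0 = ?\<tau> ` A m \<union> A m" using card_seteq[OF finite_A sub] by simp
    have k0s: "k0 < s" using k0 l by simp
    have "N k0 \<noteq> {}" using strict_s[OF k0s] A_Suc[of k0] by auto
    then obtain w where w: "w \<in> entry k0" using entry_nonempty by blast
    then have wN: "w \<in> N k0" "\<rho> k0 w \<in> A k0" using entry_iff by (auto simp: entry_def)
    have N_t: "?\<tau> y \<in> N k0 \<longleftrightarrow> y \<in> N k0" for y using Ninv[OF k0(1) k0s] by (metis invol)
    have "\<exists>v\<in>A m. \<rho> k0 v \<in> N k0"
    proof -
      from wN(2) Ak0 consider "\<rho> k0 w \<in> A m" | v where "v \<in> A m" "\<rho> k0 w = ?\<tau> v" by blast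
      then show ?thesis
      proof cases
        case 1 then show ?thesis using wN by (intro bexI[of _ "\<rho> k0 w"]) auto
      next
        case 2
        have "w = \<rho> k0 (?\<tau> v)" using 2 by (metis invol)
        then have "w = ?\<tau> (\<rho> k0 v)" using comt[of k0 v] k0s by simp
        then show ?thesis using wN(1) N_t 2(1) by auto
      qed
    qed
    then obtain v where v: "v \<in> A m" "\<rho> k0 v \<in> N k0" by blast
    have "orb {..<m} v \<subseteq> {y. \<rho> k0 y \<in> N k0}"
    proof (rule orb_subset)
      fix y i assume y: "y \<in> {y. \<rho> k0 y \<in> N k0}" and i: "i \<in> {..<m}"
      have "\<rho> k0 (\<rho> i y) = \<rho> i (\<rho> k0 y)" using i m by (intro comm') simp
      then show "\<rho> i y \<in> {y. \<rho> k0 y \<in> N k0}" using y i m N_closed[of i k0 "\<rho> k0 y"] by simp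
    qed (use v in simp)
    then have Am: "\<rho> k0 y \<in> N k0" if "y \<in> A m" for y using that v(1) orb_eq[of v "{..<m}" x] by (auto simp: A_def)
    have "\<rho> k0 ` A k0 \<subseteq> N k0"
    proof -
      have "\<rho> k0 (?\<tau> y) \<in> N k0" if "y \<in> A m" for y using Am[OF that] N_t[of "\<rho> k0 y"] comt[of k0 y] k0s by simp
      then show ?thesis using Ak0 Am by auto
    qed
    then have "card (\<rho> k0 ` A k0) \<le> card (N k0)" by (rule card_mono[OF finite_N])
    moreover have "card (\<rho> k0 ` A k0) = card (A k0)" by (rule card_image) (simp add: inj_on_def rho_inj)
    moreover have "?\<tau> x \<in> A (Suc k0)" using k0(1) A_mono[of k0 "Suc k0"] by auto
    then have "card (N k0) = 2" using exact[of k0] exact[of "Suc k0"] k0(1) k0s card_A_Suc[of k0] by simp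
    ultimately have "k0 = 1" using exact[OF k0(1)] k0s m by simp
    have "A 1 \<subseteq> {x, \<rho> 0 x}" unfolding A_def by (rule orb_subset) auto
    then show ?thesis using k0(1) \<open>k0 = 1\<close> tau_moves by auto
  qed
  have A1: "A 1 = {x, \<rho> 0 x}"
  proof
    show "A 1 \<subseteq> {x, \<rho> 0 x}" unfolding A_def by (rule orb_subset) auto
    show "{x, \<rho> 0 x} \<subseteq> A 1" using A_closed[of 0 1 x] by simp
  qed
  have tauk: "?\<tau> x \<in> A k" if "1 \<le> k" for k using A_mono[OF that] A1 t1 by auto
  let ?f = "\<rho> s u"
  have tf: "\<rho> s (?\<tau> u) = ?\<tau> ?f" using comt[of s u] by simp
  have tfF: "?\<tau> ?f \<in> F" using Fcl[OF u(2), of "s + 2"] by simp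
  have c0: "\<rho> 0 (\<rho> i y) = \<rho> i (\<rho> 0 y)" if "2 \<le> i" for i y using that by (intro comm) simp
  have r0u: "\<rho> 0 u = u \<or> \<rho> 0 u = ?\<tau> u" using N_closed[of 0 l u] Nl l by auto
  have cases_i: "i < s \<or> i = s \<or> i \<in> J" if "i < r" for i using that rs by auto
  show False
  proof (cases "\<rho> 0 u = u")
    case True
    \<comment> \<open>Induction downwards from the last pair: label 0 commutes with label
      \<open>Suc k\<close>, so being fixed passes from an entry to its partner in the layer before,
      and \<open>\<tau>\<close> yields the other point of the pair.\<close>
    have fixN: "\<forall>y\<in>N k. \<rho> 0 y = y" if "1 \<le> k" "k \<le> l" for k
      using that(2,1)
    proof (induction k rule: inc_induct)
      case base
      have "\<rho> 0 (?\<tau> u) = ?\<tau> u" using c0[of "s + 2" u] True by simp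
      then show ?case using Nl True by simp
    next
      case (step k)
      have IH: "\<forall>y\<in>N (Suc k). \<rho> 0 y = y" using step by simp
      have sk: "Suc k < s" using step l by simp
      have "N (Suc k) \<noteq> {}" using strict_s[OF sk] A_Suc[of "Suc k"] by auto
      then obtain w where w: "w \<in> entry (Suc k)" using entry_nonempty by blast
      then have wN: "w \<in> N (Suc k)" "\<rho> (Suc k) w \<in> A (Suc k)" using entry_iff by (auto simp: entry_def)
      let ?v = "\<rho> (Suc k) w"
      have v0: "\<rho> 0 ?v = ?v" using c0[of "Suc k" w] IH wN step.prems by simp
      have "?v \<notin> A k"
      proof
        assume vA: "?v \<in> A k"
        show False
        proof (cases "k = 1")
          case True
          then have "?v = x \<or> ?v = \<rho> 0 x" using vA A1 by simp
          then show False using v0 zero_moves by (metis invol)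
        next
          case False
          have "\<rho> (Suc k) ` A k \<subseteq> N (Suc k)"
          proof -
            have "A k = orb {..<k} ?v" using orb_eq[of ?v "{..<k}" x] vA by (simp add: A_def)
            also have "\<rho> (Suc k) ` \<dots> = orb {..<k} (\<rho> (Suc k) ?v)"
              by (intro orb_commute) (auto intro: comm')
            also have "\<dots> \<subseteq> N (Suc k)" by (rule orb_subset) (use wN N_closed in auto)
            finally show ?thesis .
          qed
          then have "card (\<rho> (Suc k) ` A k) \<le> card (N (Suc k))" by (rule card_mono[OF finite_N])
          moreover have "card (\<rho> (Suc k) ` A k) = card (A k)" by (rule card_image) (simp add: inj_on_def rho_inj)
          moreover have "card (N (Suc k)) = 2"
            using exact[of "Suc k"] exact[of "Suc (Suc k)"] tauk sk card_A_Suc[of "Suc k"] by simp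
          ultimately show False using exact[of k] tauk[of k] step.prems step.hyps sk False by simp
        qed
      qed
      then have vN: "?v \<in> N k" using wN by (simp add: N_def)
      have "N k = {?v, ?\<tau> ?v}" using layer[OF tauk _ vN] step.prems sk by simp
      moreover have "\<rho> 0 (?\<tau> ?v) = ?\<tau> ?v" using c0[of "s + 2" ?v] v0 by simp
      ultimately show ?case using v0 by auto
    qed
    have fixB: "\<rho> 0 y = y" if yB: "y \<in> ?B" "y \<notin> {x, \<rho> 0 x}" for y
    proof -
      have "?B - A 1 = (\<Union>j\<in>{1..l}. N j)" using A_diff[of 1 l] l by simp
      moreover have "y \<in> ?B - A 1" using yB A1 by blast
      ultimately obtain j where "1 \<le> j" "j \<le> l" "y \<in> N j" by auto
      then show ?thesis using fixN by blast
    qed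
    \<comment> \<open>Fixed and moved points of \<open>F\<close> are not joined by a label: only
      label 1 fails to commute with label 0 among the labels acting on \<open>F\<close>, and it
      stays in orbits of two points. The link to \<open>B\<close> ends in fixed points.\<close>
    define X where "X = ?B \<union> {y \<in> F. \<rho> 0 y = y}"
    have f0: "\<rho> 0 ?f = ?f" using c0[of s u] True rs by simp
    then have tf0: "\<rho> 0 (?\<tau> ?f) = ?\<tau> ?f" using c0[of "s + 2" ?f] by simp
    have "X = \<Omega>"
    proof (rule closed_full)
      show "X \<subseteq> \<Omega>" "x \<in> X" using A_points by (auto simp: X_def F_def)
      fix i z assume i: "i < r" and z: "z \<in> X"
      show "\<rho> i z \<in> X"
      proof (cases "z \<in> ?B")
        case True
        show ?thesis
        proof (cases "i = s \<and> \<rho> s z \<in> F")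
          case True
          then show ?thesis using linkY[OF \<open>z \<in> ?B\<close>] f0 tf0 tf by (auto simp: X_def)
        next
          case False
          have "\<rho> i z \<in> ?B"
            using False \<open>z \<in> ?B\<close> cases_i[OF i] A_closed[of i s z] clJ[of z i] closed[of z i] A_points by (auto simp: F_def)
          then show ?thesis by (simp add: X_def)
        qed
      next
        case False
        then have zF: "z \<in> F" "\<rho> 0 z = z" using z by (auto simp: X_def)
        show ?thesis
        proof (cases "i = s \<and> \<rho> s z \<in> ?B")
          case True then show ?thesis by (simp add: X_def)
        next
          case F: False
          have iF: "\<rho> i z \<in> F"
            using F zF cases_i[OF i] Fcl[of z i] closed[of z i] by (auto simp: F_def)
          moreover have "\<rho> 0 (\<rho> i z) = \<rho> i z"
          proof -
            consider "2 \<le> i" | "i = 0" | "i = 1" by linarith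
            then show ?thesis
            proof cases
              case 3
              have o: "z \<in> orb {..<s} z" "\<rho> 1 z \<in> orb {..<s} z" "\<rho> 0 (\<rho> 1 z) \<in> orb {..<s} z"
                using rs by (auto intro!: orb_step)
              from three[OF zF(1) o] show ?thesis using 3 zF(2) by (metis invol)
            qed (use c0 zF in auto)
          qed
          ultimately show ?thesis by (simp add: X_def)
        qed
      qed
    qed
    then have "{y \<in> \<Omega>. \<rho> 0 y \<noteq> y} \<subseteq> {x, \<rho> 0 x}" using fixB by (auto simp: X_def)
    then have "mv 0 \<Omega> \<le> card {x, \<rho> 0 x}" unfolding mv_def by (rule card_mono[rotated]) simp
    also have "\<dots> \<le> 2" by (simp add: card_insert_if)
    finally show False using mv_four[of 0] rs by simp
  next
    case False
    then have u0: "\<rho> 0 u = ?\<tau> u" using r0u by blast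
    have f0: "\<rho> 0 ?f = ?\<tau> ?f" using c0[of s u] u0 tf rs by simp
    have fne: "?\<tau> ?f \<noteq> ?f" using tfpf[OF u(1)] tf rho_inj by metis
    define X where "X = ?B \<union> {y \<in> F. \<rho> 0 y \<noteq> y}"
    have tf0: "\<rho> 0 (?\<tau> ?f) \<noteq> ?\<tau> ?f" using f0 fne by (metis invol)
    have "X = \<Omega>"
    proof (rule closed_full)
      show "X \<subseteq> \<Omega>" "x \<in> X" using A_points by (auto simp: X_def F_def)
      fix i z assume i: "i < r" and z: "z \<in> X"
      show "\<rho> i z \<in> X"
      proof (cases "z \<in> ?B")
        case True
        show ?thesis
        proof (cases "i = s \<and> \<rho> s z \<in> F")
          case True
          then show ?thesis using linkY[OF \<open>z \<in> ?B\<close>] f0 tf0 tf fne by (auto simp: X_def)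
        next
          case False
          have "\<rho> i z \<in> ?B"
            using False \<open>z \<in> ?B\<close> cases_i[OF i] A_closed[of i s z] clJ[of z i] closed[of z i] A_points by (auto simp: F_def)
          then show ?thesis by (simp add: X_def)
        qed
      next
        case False
        then have zF: "z \<in> F" "\<rho> 0 z \<noteq> z" using z by (auto simp: X_def)
        show ?thesis
        proof (cases "i = s \<and> \<rho> s z \<in> ?B")
          case True then show ?thesis by (simp add: X_def)
        next
          case F: False
          have iF: "\<rho> i z \<in> F"
            using F zF cases_i[OF i] Fcl[of z i] closed[of z i] by (auto simp: F_def)
          moreover have "\<rho> 0 (\<rho> i z) \<noteq> \<rho> i z"
          proof -
            consider "2 \<le> i" | "i = 0" | "i = 1" by linarith
            then show ?thesis
            proof cases
              case 3
              have o: "z \<in> orb {..<s} z" "\<rho> 0 z \<in> orb {..<s} z" "\<rho> 1 z \<in> orb {..<s} z"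
                using rs by (auto intro!: orb_step)
              from three[OF zF(1) o] show ?thesis using 3 zF(2) by (metis invol)
            next
              case 1 then show ?thesis using c0[OF 1, of z] zF(2) rho_inj by metis
            next
              case 2 then show ?thesis using zF(2) by (metis invol)
            qed
          qed
          ultimately show ?thesis by (simp add: X_def)
        qed
      qed
    qed
    then have F0: "\<rho> 0 y \<noteq> y" if "y \<in> F" for y using that by (auto simp: X_def F_def)
    \<comment> \<open>Label 0 and \<open>\<tau>\<close> agree at the points of \<open>B\<close>
      where label \<open>s\<close> leads to \<open>F\<close>, so the two pieces fit
      together.\<close>
    define \<pi> where "\<pi> y = (if y \<in> ?B then ?\<tau> y else \<rho> 0 y)" for y
    have piB: "\<pi> y = ?\<tau> y" if "y \<in> ?B" for y using that by (simp add: \<pi>_def)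
    have piF: "\<pi> y = \<rho> 0 y" if "y \<in> F" for y using that by (simp add: \<pi>_def F_def)
    have BF: "y \<in> ?B \<or> y \<in> F" if "y \<in> \<Omega>" for y using that by (simp add: F_def)
    have inB: "\<pi> y \<in> ?B" if "y \<in> ?B" for y using piB[OF that] clJ[OF that, of "s + 2"] by simp
    have inF: "\<pi> y \<in> F" if "y \<in> F" for y using piF[OF that] Fcl[OF that, of 0] rs by simp
    have link: "\<rho> 0 y = ?\<tau> y" if "y \<in> ?B" "\<rho> s y \<in> F" for y
      using linkY[OF that] u0 c0[of "s + 2" u] by auto
    show False
    proof (rule no_commuting_involution[of \<pi> x])
      fix y assume y: "y \<in> \<Omega>"
      show "\<pi> y \<in> \<Omega>" using BF[OF y] inB inF A_points by (auto simp: F_def)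
      show "\<pi> (\<pi> y) = y" using BF[OF y] inB[of y] inF[of y] piB piF by auto
    next
      fix i y assume i: "i < r" and y: "y \<in> \<Omega>"
      have iy: "\<rho> i y \<in> \<Omega>" using closed[OF y] .
      from cases_i[OF i] consider "i < s" | "i = s" | "i = Suc s" | "i = s + 2" by blast
      then show "\<rho> i (\<pi> y) = \<pi> (\<rho> i y)"
      proof cases
        case 1
        show ?thesis
        proof (cases "y \<in> ?B")
          case True
          then show ?thesis using 1 A_closed[of i s y] comt[of i y] piB by simp
        next
          case False
          then have yF: "y \<in> F" using BF y by blast
          then have iF: "\<rho> i y \<in> F" using Fcl 1 by blast
          consider "2 \<le> i" | "i = 0" | "i = 1" by linarith
          then have "\<rho> i (\<rho> 0 y) = \<rho> 0 (\<rho> i y)"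
          proof cases
            case 3
            have o: "y \<in> orb {..<s} y" "\<rho> 0 y \<in> orb {..<s} y" "\<rho> 1 y \<in> orb {..<s} y"
              "\<rho> 1 (\<rho> 0 y) \<in> orb {..<s} y"
              using rs by (auto intro!: orb_step)
            have "\<rho> 1 y = y \<or> \<rho> 1 y = \<rho> 0 y" using three[OF yF o(1-3)] F0[OF yF] by metis
            moreover have "\<rho> 1 (\<rho> 0 y) = y \<or> \<rho> 1 (\<rho> 0 y) = \<rho> 0 y" using three[OF yF o(1,2,4)] F0[OF yF] by metis
            ultimately show ?thesis using 3 by (metis invol)
          qed (use c0 in auto)
          then show ?thesis using piF yF iF by simp
        qed
      next
        case 2
        have c: "\<rho> s (\<rho> 0 y) = \<rho> 0 (\<rho> s y)" using c0[of s y] rs by simp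
        have ct: "\<rho> s (?\<tau> y) = ?\<tau> (\<rho> s y)" using comt[of s y] by simp
        show ?thesis
        proof (cases "y \<in> ?B")
          case True
          show ?thesis
          proof (cases "\<rho> s y \<in> ?B")
            case True then show ?thesis using 2 \<open>y \<in> ?B\<close> piB ct by simp
          next
            case False
            then have "\<rho> s y \<in> F" using BF iy 2 by blast
            then show ?thesis using 2 \<open>y \<in> ?B\<close> piB piF link[OF \<open>y \<in> ?B\<close>] c by simp
          qed
        next
          case False
          then have yF: "y \<in> F" using BF y by blast
          show ?thesis
          proof (cases "\<rho> s y \<in> ?B")
            case True
            then have "\<rho> 0 (\<rho> s y) = ?\<tau> (\<rho> s y)" using link[of "\<rho> s y"] yF by simp
            then show ?thesis using 2 True piB piF[OF yF] c by simp
          next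
            case False
            then have "\<rho> s y \<in> F" using BF iy 2 by blast
            then show ?thesis using 2 yF piF c by simp
          qed
        qed
      next
        case 3
        show ?thesis
        proof (cases "y \<in> ?B")
          case True
          then have "\<rho> i y \<in> ?B" using clJ 3 by simp
          then show ?thesis using comB[OF True] piB True 3 by simp
        next
          case False
          then have yF: "y \<in> F" using BF y by blast
          then have "\<rho> i y \<in> F" using Fcl 3 by simp
          then show ?thesis using piF yF c0[of i y] 3 rs by simp
        qed
      next
        case 4
        show ?thesis
        proof (cases "y \<in> ?B")
          case True
          then have "\<rho> i y \<in> ?B" using clJ 4 by simp
          then show ?thesis using piB True 4 by simp
        next
          case False
          then have yF: "y \<in> F" using BF y by blast
          then have "\<rho> i y \<in> F" using Fcl 4 by simp
          then show ?thesis using piF yF c0[of i y] 4 by simp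
        qed
      qed
    next
      show "x \<in> \<Omega>" by (rule base_point)
      show "\<pi> x \<noteq> x" using piB[of x] tau_moves by simp
      show "3 \<le> card \<Omega>" using cardB BO rs by linarith
    qed
  qed
qed

end

text \<open>In its application \<open>q\<close> is the size of an orbit of the labels above
  \<open>m\<close>, \<open>e\<close> the number of such orbits, and \<open>v = s - m\<close>. The
  linear bound \<open>q \<le> 2 * a + 2 * v + 4\<close> is confronted with
  \<open>2 ^ a \<le> q\<close> and \<open>6 * 2 ^ v \<le> q\<close>.\<close>

lemma semiregular_numbers:
  fixes q e a m v :: nat
  assumes q: "6 * 2 ^ v \<le> q" "2 ^ a \<le> q" and e: "Suc m \<le> e + a" "a \<le> m" "q * e \<le> 2 * (m + v) + 4" and s: "3 \<le> m + v"
  shows "e = 1 \<and> m = 3 \<and> (v = 0 \<and> 8 \<le> q \<and> q \<le> 10 \<or> v = 1 \<and> q = 12)"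
proof -
  have e1: "1 \<le> e" using e by simp
  have q6: "6 \<le> q" using q(1) by (metis le_trans mult_le_mono2 one_le_numeral one_le_power mult.right_neutral)
  have "q * e \<le> 2 * (e + a) + 2 * v + 2" using e by simp
  moreover have "q * e = 2 * e + (q - 2) * e" using q6 by (simp add: algebra_simps diff_mult_distrib)
  ultimately have qe: "(q - 2) * e \<le> 2 * a + 2 * v + 2" by simp
  have "q - 2 \<le> (q - 2) * e" using e1 by simp
  then have qa: "q \<le> 2 * a + 2 * v + 4" using qe by linarith
  have pa: "4 * k \<le> 2 ^ k + 4" for k :: nat
  proof (cases "k < 4")
    case True
    then have "k \<in> {0, 1, 2, 3}" by auto
    then show ?thesis by auto
  next
    case False
    then have "4 \<le> k" by simp
    then show ?thesis by (induction k rule: dec_induct) simp_all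
  qed
  have pv: "4 * k + 16 \<le> 6 * 2 ^ k" if "2 \<le> k" for k :: nat
    using that by (induction k rule: dec_induct) simp_all
  have pb: "2 * k + 6 < 2 ^ k" if "4 \<le> k" for k :: nat
    using that by (induction k rule: dec_induct) simp_all
  have "v < 2"
  proof (rule ccontr)
    assume "\<not> v < 2"
    then show False using pv[of v] pa[of a] q qa by linarith
  qed
  have a3: "a \<le> 3"
  proof (rule ccontr)
    assume "\<not> a \<le> 3"
    then have "2 * a + 6 < 2 ^ a" by (intro pb) simp
    then show False using q(2) qa \<open>v < 2\<close> by linarith
  qed
  consider "v = 0" | "v = 1" using \<open>v < 2\<close> by linarith
  then show ?thesis
  proof cases
    case 1
    have "4 \<le> q - 2" using q6 by linarith
    then have 4: "4 * e \<le> (q - 2) * e" by (rule mult_right_mono) simp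
    then have "e \<le> 2" using qe a3 1 by linarith
    have "a = 3"
    proof (rule ccontr)
      assume "a \<noteq> 3"
      then have "a \<le> 2" using a3 by simp
      then have "e = 1" using 4 qe 1 e1 by linarith
      then show False using \<open>a \<le> 2\<close> e s 1 by linarith
    qed
    then have "8 \<le> q" using q(2) by simp
    then have "6 \<le> q - 2" by linarith
    then have "6 * e \<le> (q - 2) * e" by (rule mult_right_mono) simp
    then have "e = 1" using qe 1 e1 \<open>a = 3\<close> by linarith
    then show ?thesis using 1 \<open>a = 3\<close> \<open>8 \<le> q\<close> qa e s by simp
  next
    case 2
    have "a = 3" using a3 q(1) qa 2 by simp
    have "10 \<le> q - 2" using q(1) 2 by simp
    then have "10 * e \<le> (q - 2) * e" by (rule mult_right_mono) simp
    then have "e = 1" using qe 2 e1 \<open>a = 3\<close> by linarith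
    then show ?thesis using 2 \<open>a = 3\<close> q(1) qa e s by simp
  qed
qed

context thick_top
begin

text \<open>Let \<open>A m\<close> be the first full orbit. The labels above \<open>m\<close>
  commute with the transitive labels below \<open>m\<close> and so act semiregularly; the numbers
  force \<open>m = 3\<close> and a regular action on 8 to 10 or on 12 points. The orbit
  \<open>A 2\<close> has even size, at least four and at most half of the points. Size four would
  make labels 0 and 1 commute, so it is six of twelve points, and this half is a block.\<close>

lemma impossible: False
proof -
  define m where "m = (LEAST k. A k = \<Omega>)"
  have Am: "A m = \<Omega>" unfolding m_def using A_s_full by (rule LeastI)
  moreover have "m \<le> s" unfolding m_def using A_s_full by (rule Least_le)
  ultimately have Am: "A m = \<Omega>" "m \<le> s" .
  have nf: "A k \<noteq> \<Omega>" if "k < m" for k using not_less_Least that unfolding m_def by blast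
  have strict_m: "A (Suc k) \<noteq> A k" if "k < m" for k using strict[of k] nf[OF that] that Am rs by simp
  have "\<rho> 0 x \<in> \<Omega>" using closed base_point by blast
  then have "m \<noteq> 0" using Am(1) A_0 zero_moves by (metis singletonD)
  define D where "D = {Suc m..<r}"
  have farD: "far {..<m} D" by (auto simp: far_def D_def)
  have full: "orb {..<m} y = \<Omega>" if "y \<in> \<Omega>" for y using orb_eq[of y "{..<m}" x] that Am(1) by (simp add: A_def)
  have finO: "finite (orb I y)" if "y \<in> \<Omega>" for I y by (rule fin_all[OF that])
  have Csize: "6 * 2 ^ (Suc s - i) \<le> card (orb {i..<r} x)" if "Suc m \<le> i" "i \<le> Suc s" for i
    using that(2,1)
  proof (induction i rule: inc_induct)
    case base
    have eq: "{Suc s..<r} = J" using rs by auto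
    obtain y where "y \<in> \<Omega>" "\<rho> (Suc s) (\<rho> (s + 2) y) \<noteq> \<rho> (s + 2) (\<rho> (Suc s) y)"
      using J_noncommuting by blast
    then have "6 \<le> card (orb J x)"
      using far_less[OF Am(2)] finO[OF base_point] full[OF base_point] closed by (intro dihedral_six[of "{..<m}" _ _ _ y]) auto
    then show ?case by (simp add: eq)
  next
    case (step i)
    let ?E = "{Suc i..<r}"
    have farE: "far {..<m} ?E" using step by (auto simp: far_def)
    have i: "Suc m \<le> i" "i < r" using step rs by auto
    \<comment> \<open>Otherwise label \<open>i\<close> agrees everywhere with a word in later
      labels, which commutes with label \<open>i - 1\<close>; but adjacent labels do not
      commute.\<close>
    have no: "\<rho> i x \<notin> orb ?E x"
    proof
      assume "\<rho> i x \<in> orb ?E x"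
      then obtain w where w: "set w \<subseteq> ?E" "\<rho> i x = act w x" using orb_act by blast
      have farD': "far {..<m} {i..<r}" using i by (auto simp: far_def)
      have eq: "\<rho> i y = act w y" if "y \<in> \<Omega>" for y
        using semiregular_eq[OF farD', of "[i]" w x y] w i full[OF base_point] that by fastforce
      obtain k where k: "i = Suc k" using i by (cases i) auto
      obtain y where y: "y \<in> \<Omega>" "\<rho> k (\<rho> (Suc k) y) \<noteq> \<rho> (Suc k) (\<rho> k y)"
        using noncommuting[of k] i k by blast
      have "act w (\<rho> k y) = \<rho> k (act w y)" by (rule act_rho[of "{k}" ?E]) (use w k in \<open>auto simp: far_def\<close>)
      then show False using y eq k closed by simp
    qed
    have "\<rho> i x \<in> \<Omega>" using closed base_point by blast
    then have same: "card (orb ?E (\<rho> i x)) = card (orb ?E x)"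
      using card_orb_eq[OF farE, of "\<rho> i x" x] full[OF base_point] by simp
    have disj: "orb ?E (\<rho> i x) \<inter> orb ?E x = {}" using no by (rule orb_disjoint)
    have "\<rho> i x \<in> orb {i..<r} x" using i by (intro orb_step) auto
    then have "orb {i..<r} (\<rho> i x) = orb {i..<r} x" by (rule orb_eq)
    moreover have "orb ?E z \<subseteq> orb {i..<r} z" for z by (rule orb_mono) auto
    ultimately have "orb ?E (\<rho> i x) \<union> orb ?E x \<subseteq> orb {i..<r} x" by blast
    then have "card (orb ?E (\<rho> i x) \<union> orb ?E x) \<le> card (orb {i..<r} x)"
      by (rule card_mono[OF finO[OF base_point]])
    moreover have "card (orb ?E (\<rho> i x) \<union> orb ?E x) = 2 * card (orb ?E x)"
      using same disj finO[OF base_point] finO[OF \<open>\<rho> i x \<in> \<Omega>\<close>] by (subst card_Un_disjoint) auto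
    moreover have "6 * 2 ^ (Suc s - Suc i) \<le> card (orb ?E x)" using step by simp
    moreover have "Suc s - i = Suc (Suc s - Suc i)" using step by simp
    ultimately show ?case by simp
  qed
  let ?q = "card (orb D x)" and ?e = "card (orb D ` A m)"
  have q6: "6 * 2 ^ (s - m) \<le> ?q" using Csize[of "Suc m"] Am(2) by (simp add: D_def)
  have DO: "orb D x \<subseteq> \<Omega>" by (rule orb_points[OF base_point])
  obtain a where a: "a \<le> m" "2 ^ a \<le> card (orb D x \<inter> A m)" "Suc m \<le> ?e + a"
    using doubling_count[OF farD finite_orbit] strict_m by (auto simp: A_def)
  have prod: "card \<Omega> = ?q * ?e"
    using orbit_count[OF farD finite_orbit] Am(1) orb_points by (simp add: A_def)
  have "orb D x \<inter> A m = orb D x" using DO Am(1) by blast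
  then have nums: "?e = 1 \<and> m = 3 \<and> (s - m = 0 \<and> 8 \<le> ?q \<and> ?q \<le> 10 \<or> s - m = 1 \<and> ?q = 12)"
    using a Am(2) rs small prod q6
    by (intro semiregular_numbers[of "s - m" ?q a m ?e]) auto
  then have e1: "?e = 1" and m3: "m = 3" by blast+
  then have card_q: "card \<Omega> = ?q" using prod by simp
  then have regular: "orb D x = \<Omega>" using card_seteq[OF finite_points DO] by simp
  have dbl: "2 * card (A k) \<le> card (A (Suc k))" if k: "k < m" for k
  proof -
    have "A (Suc k) \<subseteq> A m" using A_mono k by simp
    then have "card (orb D ` A (Suc k)) \<le> card (orb D ` A m)" by (intro card_mono image_mono) auto
    moreover have "0 < card (orb D ` A k)" by (metis card_gt_0_iff empty_iff finite_A finite_imageI image_is_empty x_A)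
    ultimately have "\<not> card (orb D ` A k) < card (orb D ` A (Suc k))" using e1 by linarith
    moreover have "orb D x \<inter> A l = A l" for l using regular A_points by blast
    ultimately show ?thesis using double_or_new[OF farD finite_orbit k] strict_m[OF k] by (simp add: A_def)
  qed
  have fpf0: "\<rho> 0 y \<noteq> y" if "y \<in> \<Omega>" for y
  proof
    assume fx: "\<rho> 0 y = y"
    have "x \<in> orb D y" using that regular orb_sym by blast
    then obtain w where w: "set w \<subseteq> D" "x = act w y" using orb_act by blast
    have "act w (\<rho> 0 y) = \<rho> 0 (act w y)" using act_rho[OF farD w(1), of 0 y] m3 by simp
    then show False using w fx zero_moves by simp
  qed
  have ev: "even (card (A 2))"
    by (rule even_card_fpf_involution[of _ "\<rho> 0"]) (use A_closed[of 0 2] fpf0 A_points[of 2] in auto)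
  have A2: "4 \<le> card (A 2)" "2 * card (A 2) \<le> ?q"
  proof -
    have "4 \<le> card (A (Suc (Suc 0)))" using dbl[of 0] dbl[of "Suc 0"] m3 by (simp add: A_0)
    then show "4 \<le> card (A 2)" by (simp only: numeral_2_eq_2)
    have "2 * card (A (Suc (Suc 0))) \<le> card (A (Suc (Suc (Suc 0))))" using m3 by (intro dbl) simp
    moreover have "Suc (Suc (Suc 0)) = m" using m3 by simp
    ultimately show "2 * card (A 2) \<le> ?q" using Am(1) card_q by (simp only: numeral_2_eq_2)
  qed
  have set2: "{..<2} = {0, 1::nat}" by auto
  have "card (A 2) \<noteq> 4"
  proof
    assume four: "card (A 2) = 4"
    have "far {0, 1} D" using m3 by (auto simp: far_def D_def)
    moreover have "orb {0, 1} x \<subseteq> orb D x" using regular orb_points[OF base_point] by simp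
    moreover have "card (orb {0, 1} x) = 4" using four by (simp add: A_def set2)
    ultimately have "\<rho> 0 (\<rho> 1 y) = \<rho> 1 (\<rho> 0 y)" if "y \<in> \<Omega>" for y
      using four_points_commute that regular by blast
    then show False using zero_noncommuting by blast
  qed
  moreover have "card (A 2) \<noteq> 5" using ev by auto
  ultimately have six: "6 \<le> card (A 2)" using A2(1) by linarith
  then have q12: "?q = 12" "s = 4" using nums A2(2) by auto
  then have A26: "card (A 2) = 6" using six A2(2) by linarith
  have r7: "r = 7" using q12 rs by simp
  have cc: "card (\<Omega> - A 2) = 6" using A26 card_q q12 A_points[of 2] by (simp add: card_Diff_subset)
  have img: "\<rho> j ` A 2 = orb {..<2} (\<rho> j x)" if "3 \<le> j" for j
    unfolding A_def using that by (intro orb_commute) (auto intro: comm')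
  have imgw: "act w ` A 2 = orb {..<2} (act w x)" if "set w \<subseteq> D" for w
    unfolding A_def by (rule act_image_orb[of _ D]) (use that m3 in \<open>auto simp: far_def D_def\<close>)
  have swap_or_keep: "(\<forall>y\<in>A 2. f y \<in> A 2) \<or> (\<forall>y\<in>A 2. f y \<notin> A 2) \<Longrightarrow> (\<And>y z. f y = f z \<longleftrightarrow> y = z) \<Longrightarrow>
     (\<And>y. y \<in> \<Omega> \<Longrightarrow> f y \<in> \<Omega>) \<Longrightarrow>
     y \<in> \<Omega> \<Longrightarrow> z \<in> \<Omega> \<Longrightarrow> (y \<in> A 2 \<longleftrightarrow> z \<in> A 2) \<Longrightarrow> (f y \<in> A 2 \<longleftrightarrow> f z \<in> A 2)" for f y z
  proof -
    assume f: "(\<forall>y\<in>A 2. f y \<in> A 2) \<or> (\<forall>y\<in>A 2. f y \<notin> A 2)" "\<And>y z. f y = f z \<longleftrightarrow> y = z"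
      "\<And>y. y \<in> \<Omega> \<Longrightarrow> f y \<in> \<Omega>" "y \<in> \<Omega>" "z \<in> \<Omega>" "y \<in> A 2 \<longleftrightarrow> z \<in> A 2"
    have inj: "inj_on f X" for X using f(2) by (simp add: inj_on_def)
    have mem: "f v \<in> f ` A 2 \<longleftrightarrow> v \<in> A 2" for v by (simp add: image_iff f(2))
    from f(1) show ?thesis
    proof
      assume k: "\<forall>y\<in>A 2. f y \<in> A 2"
      then have "f ` A 2 = A 2" using card_image[OF inj, of "A 2"] by (intro card_seteq) auto
      then have "f v \<in> A 2 \<longleftrightarrow> v \<in> A 2" for v using mem[of v] by simp
      then show ?thesis using f(6) by simp
    next
      assume k: "\<forall>y\<in>A 2. f y \<notin> A 2"
      then have "f ` A 2 \<subseteq> \<Omega> - A 2" using f(3) A_points by blast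
      then have "f ` A 2 = \<Omega> - A 2" using card_image[OF inj, of "A 2"] A26 cc finite_points by (intro card_seteq) auto
      then have "f v \<notin> A 2 \<longleftrightarrow> v \<in> A 2" if "v \<in> \<Omega>" for v using mem[of v] f(3)[OF that] by simp
      then show ?thesis using f by blast
    qed
  qed
  have dich: "(\<forall>y\<in>A 2. \<rho> i y \<in> A 2) \<or> (\<forall>y\<in>A 2. \<rho> i y \<notin> A 2)" for i
  proof -
    consider "i < 2" | "i = 2" | "3 \<le> i" by linarith
    then show ?thesis
    proof cases
      case 1 then show ?thesis using A_closed by blast
    next
      case 3
      show ?thesis
      proof (cases "\<rho> i x \<in> A 2")
        case True
        then have "\<rho> i ` A 2 = A 2" using img[OF 3] orb_eq[of "\<rho> i x" "{..<2}" x] by (simp add: A_def)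
        then show ?thesis by blast
      next
        case False
        then have "\<rho> i ` A 2 \<inter> A 2 = {}" using img[OF 3] orb_disjoint unfolding A_def by metis
        then show ?thesis by blast
      qed
    next
      case 2
      \<comment> \<open>Label 2 need not respect the orbits of labels 0 and 1, but it commutes with
        the transitive labels \<open>D\<close>, and the words in \<open>D\<close> that carry
        \<open>x\<close> into \<open>A 2\<close> preserve \<open>A 2\<close>.\<close>
      have equiv: "\<rho> 2 y \<in> A 2 \<longleftrightarrow> \<rho> 2 x \<in> A 2" if y: "y \<in> A 2" for y
      proof -
        have "y \<in> orb D x" using regular A_points[of 2] y by blast
        then obtain w where w: "set w \<subseteq> D" "y = act w x" using orb_act by blast
        have "orb {..<2} (act w x) = A 2" using y w orb_eq[of y "{..<2}" x] by (simp add: A_def)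
        then have im: "act w ` A 2 = A 2" using imgw[OF w(1)] by simp
        have "\<rho> 2 y = act w (\<rho> 2 x)" using act_rho[OF farD w(1), of 2 x] w m3 by simp
        moreover have "act w (\<rho> 2 x) \<in> act w ` A 2 \<longleftrightarrow> \<rho> 2 x \<in> A 2" by (simp add: image_iff act_inj)
        ultimately show ?thesis using im by simp
      qed
      then show ?thesis using 2 by blast
    qed
  qed
  have "(\<forall>y\<in>\<Omega>. \<forall>z\<in>\<Omega>. (y \<in> A 2 \<longleftrightarrow> z \<in> A 2) \<longrightarrow> y = z) \<or> (\<forall>y\<in>\<Omega>. \<forall>z\<in>\<Omega>. y \<in> A 2 \<longleftrightarrow> z \<in> A 2)"
  proof (rule primitive)
    fix i y z assume "y \<in> \<Omega>" "z \<in> \<Omega>" "(y \<in> A 2) = (z \<in> A 2)"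
    then show "(\<rho> i y \<in> A 2) = (\<rho> i z \<in> A 2)"
      using swap_or_keep[OF dich rho_inj closed] by blast
  qed auto
  then show False
  proof
    assume "\<forall>y\<in>\<Omega>. \<forall>z\<in>\<Omega>. (y \<in> A 2 \<longleftrightarrow> z \<in> A 2) \<longrightarrow> y = z"
    moreover have "\<rho> 0 x \<in> A 2" using A_closed[of 0 2 x] by simp
    ultimately show False using zero_moves base_point closed x_A by blast
  next
    assume "\<forall>y\<in>\<Omega>. \<forall>z\<in>\<Omega>. y \<in> A 2 \<longleftrightarrow> z \<in> A 2"
    then have "\<Omega> - A 2 = {}" using base_point x_A by blast
    then show False using cc by (metis card.empty zero_neq_numeral)
  qed
qed

end

context primitive_string
begin

text \<open>Layers are under control from the last label \<open>b\<close> moving the growing base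
  point. A one-point layer there leads to \<open>thin_case\<close>; otherwise the position of
  \<open>b\<close> decides, with \<open>b = r - 1\<close> refuted by
  \<open>impossible\<close>.\<close>

theorem rank_bound:
  assumes r6: "6 \<le> r" shows "5 * r + 3 \<le> 3 * card \<Omega> \<or> 2 * r \<le> Suc (card \<Omega>)"
proof -
  obtain x where x: "x \<in> \<Omega>" "\<rho> 0 x \<noteq> x"
    and grow: "\<And>k. k < r \<Longrightarrow> orb {..<k} x \<noteq> \<Omega> \<Longrightarrow> orb {..<Suc k} x \<noteq> orb {..<k} x"
    using growing_point r6 by auto
  let ?M = "{i. \<rho> i x \<noteq> x}"
  have "?M \<subseteq> {..<r}" using trivial_beyond by (metis (mono_tags, lifting) lessThan_iff linorder_not_le mem_Collect_eq subsetI)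
  then have finM: "finite ?M" using finite_subset by blast
  define b where "b = Max ?M"
  have b: "\<rho> b x \<noteq> x" using Max_in[OF finM] x(2) by (auto simp: b_def)
  have bmax: "\<rho> i x = x" if "Suc b \<le> i" for i using Max_ge[OF finM, of i] that by (auto simp: b_def)
  interpret based_string \<rho> \<Omega> r x "Suc b"
    by (intro based_string.intro string_action_axioms chain based_string_axioms.intro) (use x bmax in auto)
  show ?thesis
  proof (cases "\<exists>k. b \<le> k \<and> k < r \<and> card (N k) = 1")
    case True
    let ?K = "{k. b \<le> k \<and> k < r \<and> card (N k) = 1}"
    have finK: "finite ?K" by (rule finite_subset[of _ "{..<r}"]) auto
    define k where "k = Max ?K"
    have k: "k \<in> ?K" unfolding k_def using True by (intro Max_in[OF finK]) auto
    have "card (N j) \<noteq> 1" if "k < j" "j < r" for j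
    proof
      assume "card (N j) = 1"
      then have "j \<in> ?K" using that k by simp
      then have "j \<le> k" unfolding k_def by (rule Max_ge[OF finK])
      then show False using that by simp
    qed
    then show ?thesis using thin_case[of k] k r6 x(2) by auto
  next
    case False
    interpret thick_string \<rho> \<Omega> r x b
      by unfold_locales (use False b x r6 grow in \<open>auto simp: A_def\<close>)
    consider "b \<le> 1" | "2 \<le> b" "b + 2 \<le> r" | "Suc b = r" using b_less by linarith
    then show ?thesis
    proof cases
      case 3
      show ?thesis
      proof (rule ccontr)
        assume no: "\<not> ?thesis"
        interpret thick_top \<rho> \<Omega> r x b
          by unfold_locales (use no 3 in auto)
        show False by (rule impossible)
      qed
    qed (use thick_low thick_mid in auto)
  qed
qed

end

section \<open>Strings generating an alternating group\<close>

text \<open>Splitting off one transposition changes the parity and removes two moved points.\<close>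

lemma evenperm_involution:
  assumes "finite A" "p permutes A" "\<And>y. p (p y) = y"
  shows "evenperm p \<longleftrightarrow> card {y \<in> A. p y \<noteq> y} mod 4 = 0"
  using assms
proof (induction "card {y \<in> A. p y \<noteq> y}" arbitrary: p rule: less_induct)
  case less
  let ?M = "{y \<in> A. p y \<noteq> y}"
  have finM: "finite ?M" using less.prems by simp
  show ?case
  proof (cases "?M = {}")
    case True
    then have "p = id" using less.prems(2) by (auto simp: permutes_def fun_eq_iff)
    then show ?thesis by (simp add: evenperm_id)
  next
    case False
    then obtain a where a: "a \<in> A" "p a \<noteq> a" by blast
    let ?b = "p a"
    have b: "?b \<in> A" "p ?b = a" using permutes_in_image[OF less.prems(2)] a less.prems(3) by auto
    let ?t = "transpose a ?b"
    let ?q = "?t \<circ> p"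
    have q: "?q y = (if y = a \<or> y = ?b then y else p y)" for y
    proof -
      have "p y = a \<longleftrightarrow> y = ?b" "p y = ?b \<longleftrightarrow> y = a" using less.prems(3) by metis+
      then show ?thesis using b a by (auto simp: transpose_def)
    qed
    have per: "?q permutes A" using permutes_compose[OF less.prems(2)] permutes_swap_id[of a A ?b] a b by blast
    have M: "{y \<in> A. ?q y \<noteq> y} = ?M - {a, ?b}" unfolding q by auto
    have sub: "{a, ?b} \<subseteq> ?M" using a b by auto
    have "card {a, ?b} = 2" using a by simp
    then have c: "card ?M = card (?M - {a, ?b}) + 2"
      using card_Diff_subset[of "{a, ?b}" ?M] card_mono[OF finM sub] sub by simp
    have qq: "?q (?q y) = y" for y
    proof -
      have "p y = a \<longleftrightarrow> y = ?b" "p y = ?b \<longleftrightarrow> y = a" using less.prems(3) by metis+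
      then show ?thesis unfolding q using less.prems(3) by simp
    qed
    have "evenperm ?q \<longleftrightarrow> card {y \<in> A. ?q y \<noteq> y} mod 4 = 0"
      by (rule less.hyps) (use M c less.prems(1) per qq in auto)
    then have eq: "evenperm ?q \<longleftrightarrow> card (?M - {a, ?b}) mod 4 = 0" unfolding M .
    have "permutation p" using less.prems permutation_permutes by blast
    then have "evenperm ?q \<longleftrightarrow> (evenperm ?t \<longleftrightarrow> evenperm p)"
      by (intro evenperm_comp) (simp_all add: permutation_swap_id)
    then have e: "evenperm ?q \<longleftrightarrow> \<not> evenperm p" using a by (simp add: evenperm_swap)
    have "even (card ?M)"
      by (rule even_card_fpf_involution[of _ p]) (use finM less.prems permutes_in_image[OF less.prems(2)] in auto)
    then have th: "(card (?M - {a, ?b}) mod 4 = 0) \<longleftrightarrow> \<not> (card ?M mod 4 = 0)" unfolding c by presburger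
    from e have "evenperm p \<longleftrightarrow> \<not> evenperm ?q" by argo
    also have "\<dots> \<longleftrightarrow> card ?M mod 4 = 0" by (simp only: eq th not_not)
    finally show ?thesis .
  qed
qed

text \<open>Instead of transitivity it is assumed that every even permutation is a word. By
  \<open>outside\<close> words act on the whole type, so they can be equated with permutations as
  functions.\<close>

locale alt_string = invol_string \<rho> for \<rho> :: "nat \<Rightarrow> 'a \<Rightarrow> 'a" +
  fixes \<Omega> :: "'a set" and r :: nat
  assumes finite_points: "finite \<Omega>"
    and closed: "y \<in> \<Omega> \<Longrightarrow> \<rho> i y \<in> \<Omega>"
    and outside: "y \<notin> \<Omega> \<Longrightarrow> \<rho> i y = y"
    and trivial_beyond: "r \<le> i \<Longrightarrow> \<rho> i y = y"
    and even_labels: "mv i \<Omega> mod 4 = 0"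
    and nontrivial: "i < r \<Longrightarrow> \<exists>y\<in>\<Omega>. \<rho> i y \<noteq> y"
    and generates: "p permutes \<Omega> \<Longrightarrow> evenperm p \<Longrightarrow> \<exists>w. set w \<subseteq> {..<r} \<and> act w = p"
begin

lemma three_cycle:
  assumes "a \<in> \<Omega>" "b \<in> \<Omega>" "c \<in> \<Omega>" "a \<noteq> b" "b \<noteq> c" "a \<noteq> c"
  shows "\<exists>w. set w \<subseteq> {..<r} \<and> act w a = b \<and> act w b = c \<and> act w c = a \<and>
    (\<forall>y. y \<notin> {a, b, c} \<longrightarrow> act w y = y)"
proof -
  let ?p = "transpose a b \<circ> transpose b c"
  have "?p permutes \<Omega>" using assms by (intro permutes_compose permutes_swap_id)
  moreover have "evenperm ?p"
    using assms by (subst evenperm_comp) (simp_all add: permutation_swap_id evenperm_swap)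
  ultimately obtain w where w: "set w \<subseteq> {..<r}" "act w = ?p" using generates by blast
  have "act w a = b" "act w b = c" "act w c = a" using assms w(2) by (simp_all add: transpose_def)
  moreover have "act w y = y" if "y \<notin> {a, b, c}" for y using that w(2) by (simp add: transpose_def)
  ultimately show ?thesis using w(1) by blast
qed

lemma other_point:
  assumes "finite X" "card X < card \<Omega>" obtains v where "v \<in> \<Omega>" "v \<notin> X"
proof -
  have "\<not> \<Omega> \<subseteq> X" using card_mono[OF assms(1)] assms(2) by (meson linorder_not_le)
  then show ?thesis using that by blast
qed

lemma orb_points': "y \<in> \<Omega> \<Longrightarrow> orb I y \<subseteq> \<Omega>"
  by (rule orb_subset) (auto simp: closed)

lemma transitive:
  assumes "3 \<le> card \<Omega>" "y \<in> \<Omega>" shows "orb {..<r} y = \<Omega>"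
proof
  show "orb {..<r} y \<subseteq> \<Omega>" by (rule orb_points'[OF assms(2)])
  show "\<Omega> \<subseteq> orb {..<r} y"
  proof
    fix z assume z: "z \<in> \<Omega>"
    show "z \<in> orb {..<r} y"
    proof (cases "z = y")
      case False
      have "card {y, z} < card \<Omega>" using assms(1) by (simp add: card_insert_if)
      then obtain v where v: "v \<in> \<Omega>" "v \<notin> {y, z}" using other_point[of "{y, z}"] by blast
      have "y \<noteq> z" "z \<noteq> v" "y \<noteq> v" using v False by auto
      then obtain w where w: "set w \<subseteq> {..<r}" "act w y = z" using three_cycle[OF assms(2) z v(1)] by blast
      then show ?thesis using act_orb by blast
    qed simp
  qed
qed

lemma invariant_act:
  assumes "\<And>i y z. i < r \<Longrightarrow> y \<in> \<Omega> \<Longrightarrow> z \<in> \<Omega> \<Longrightarrow> R y z \<Longrightarrow> R (\<rho> i y) (\<rho> i z)"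
    and "set w \<subseteq> {..<r}" "y \<in> \<Omega>" "z \<in> \<Omega>" "R y z"
  shows "R (act w y) (act w z) \<and> act w y \<in> \<Omega> \<and> act w z \<in> \<Omega>"
  using assms(2) by (induction w) (use assms closed in auto)

text \<open>If \<open>R\<close> relates \<open>y\<close> to \<open>z\<close>, a three-cycle fixing
  \<open>y\<close> and carrying \<open>z\<close> to \<open>u\<close> relates \<open>y\<close> to
  \<open>u\<close>; the fourth point completes the cycle.\<close>

lemma primitive:
  assumes n: "4 \<le> card \<Omega>"
    and sym: "\<And>y z. R y z \<Longrightarrow> R z y" and trans: "\<And>u y z. R u y \<Longrightarrow> R y z \<Longrightarrow> R u z"
    and refl: "\<And>y. y \<in> \<Omega> \<Longrightarrow> R y y"
    and inv: "\<And>i y z. i < r \<Longrightarrow> y \<in> \<Omega> \<Longrightarrow> z \<in> \<Omega> \<Longrightarrow> R y z \<Longrightarrow> R (\<rho> i y) (\<rho> i z)"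
  shows "(\<forall>y\<in>\<Omega>. \<forall>z\<in>\<Omega>. R y z \<longrightarrow> y = z) \<or> (\<forall>y\<in>\<Omega>. \<forall>z\<in>\<Omega>. R y z)"
proof (cases "\<forall>y\<in>\<Omega>. \<forall>z\<in>\<Omega>. R y z \<longrightarrow> y = z")
  case False
  then obtain y z where yz: "y \<in> \<Omega>" "z \<in> \<Omega>" "R y z" "y \<noteq> z" by blast
  have "R y u" if u: "u \<in> \<Omega>" for u
  proof (cases "u = y \<or> u = z")
    case True then show ?thesis using yz refl by blast
  next
    case False
    have "card {y, z, u} < card \<Omega>" using n by (simp add: card_insert_if)
    then obtain v where v: "v \<in> \<Omega>" "v \<notin> {y, z, u}" using other_point[of "{y, z, u}"] by blast
    have "z \<noteq> u" "u \<noteq> v" "z \<noteq> v" using v False by auto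
    then obtain w where w: "set w \<subseteq> {..<r}" "act w z = u" "\<And>a. a \<notin> {z, u, v} \<Longrightarrow> act w a = a"
      using three_cycle[OF yz(2) u v(1)] by blast
    have "act w y = y" using w(3) yz False v by auto
    then show ?thesis using invariant_act[OF inv w(1) yz(1-3)] w(2) by simp
  qed
  then show ?thesis using sym trans by blast
qed blast

lemma act_rev: "act (rev w) (act w y) = y"
  by (induction w arbitrary: y) (simp_all add: act_append)

text \<open>If labels \<open>i\<close> and \<open>Suc i\<close> commuted, so would the labels up to
  \<open>i\<close> with all later ones. Both families are transitive by primitivity, hence the first
  one is semiregular. Conjugating label 0 by a three-cycle that fixes \<open>x0\<close> and its
  image yields an element of this family that agrees with label 0 at \<open>x0\<close> but not at
  \<open>?w\<close>.\<close>

lemma noncommuting: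
  assumes n: "5 \<le> card \<Omega>" and i: "Suc i < r"
  shows "\<exists>y\<in>\<Omega>. \<rho> i (\<rho> (Suc i) y) \<noteq> \<rho> (Suc i) (\<rho> i y)"
proof (rule ccontr)
  assume "\<not> ?thesis"
  then have com1: "\<rho> i (\<rho> (Suc i) y) = \<rho> (Suc i) (\<rho> i y)" for y
    using outside[of y] by (cases "y \<in> \<Omega>") auto
  let ?I = "{..i}" and ?J = "{Suc i..<r}"
  have com: "\<rho> j (\<rho> k y) = \<rho> k (\<rho> j y)" if "j \<in> ?J" "k \<in> ?I" for j k y
    using that com1 by (cases "j = Suc i \<and> k = i") (auto intro: comm')
  have transI: "orb K z = \<Omega>" if KL: "(K = ?I \<and> L = ?J) \<or> (K = ?J \<and> L = ?I)" and z: "z \<in> \<Omega>" for K L z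
  proof -
    have cKL: "\<rho> l (\<rho> k y) = \<rho> k (\<rho> l y)" if "l \<in> L" "k \<in> K" for l k y
      using KL com[of k l y] com[of l k y] that by auto
    have KLr: "k < r \<Longrightarrow> k \<in> K \<or> k \<in> L" for k using KL by auto
    have "(\<forall>y\<in>\<Omega>. \<forall>z\<in>\<Omega>. orb K y = orb K z \<longrightarrow> y = z) \<or> (\<forall>y\<in>\<Omega>. \<forall>z\<in>\<Omega>. orb K y = orb K z)"
    proof (rule primitive)
      fix k y z assume k: "k < r" and eq: "orb K y = orb K z"
      show "orb K (\<rho> k y) = orb K (\<rho> k z)"
      proof (cases "k \<in> K")
        case True
        then have "orb K (\<rho> k v) = orb K v" for v by (intro orb_eq orb_step) auto
        then show ?thesis using eq by simp
      next
        case False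
        then have "k \<in> L" using KLr k by blast
        then have "orb K (\<rho> k v) = \<rho> k ` orb K v" for v using cKL by (intro orb_commute[symmetric]) auto
        then show ?thesis using eq by simp
      qed
    qed (use n in auto)
    then show ?thesis
    proof
      assume triv: "\<forall>y\<in>\<Omega>. \<forall>z\<in>\<Omega>. orb K y = orb K z \<longrightarrow> y = z"
      obtain k where k: "k \<in> K" "k < r" using KL i by force
      obtain y where y: "y \<in> \<Omega>" "\<rho> k y \<noteq> y" using nontrivial[OF k(2)] by blast
      have "orb K (\<rho> k y) = orb K y" using k by (intro orb_eq orb_step) auto
      then show ?thesis using triv y closed by blast
    next
      assume "\<forall>y\<in>\<Omega>. \<forall>z\<in>\<Omega>. orb K y = orb K z"
      then have "\<Omega> \<subseteq> orb K z" using z orb_base by blast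
      then show ?thesis using orb_points'[OF z] by blast
    qed
  qed
  have actcom: "act u (\<rho> j y) = \<rho> j (act u y)" if "set u \<subseteq> ?I" "j \<in> ?J" for u j y
    using that(1) by (induction u) (use com that(2) in auto)
  have actcom': "act u (\<rho> k y) = \<rho> k (act u y)" if "set u \<subseteq> ?J" "k \<in> ?I" for u k y
    using that(1) by (induction u) (use com that(2) in auto)
  have semireg: "act u y = act v y" if "set u \<subseteq> ?I" "set v \<subseteq> ?I" "x \<in> \<Omega>" "act u x = act v x" "y \<in> \<Omega>" for u v x y
  proof -
    have "y \<in> orb ?J x" using transI[of ?J ?I] that by auto
    then show ?thesis
      by induction (use that actcom in auto)
  qed
  have split: "\<exists>u1 u2. set u1 \<subseteq> ?I \<and> set u2 \<subseteq> ?J \<and> (\<forall>y. act u y = act u1 (act u2 y))" if "set u \<subseteq> {..<r}" for u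
    using that
  proof (induction u)
    case Nil show ?case by (intro exI[of _ "[]"]) simp
  next
    case (Cons k u)
    then obtain u1 u2 where u: "set u1 \<subseteq> ?I" "set u2 \<subseteq> ?J" "\<And>y. act u y = act u1 (act u2 y)" by auto
    show ?case
    proof (cases "k \<in> ?I")
      case True then show ?thesis using u by (intro exI[of _ "k # u1"] exI[of _ u2]) auto
    next
      case False
      then have "k \<in> ?J" using Cons.prems by auto
      then show ?thesis using u actcom[OF u(1)] by (intro exI[of _ u1] exI[of _ "k # u2"]) auto
    qed
  qed
  have "0 < r" using i by simp
  then obtain x0 where x0: "x0 \<in> \<Omega>" "\<rho> 0 x0 \<noteq> x0" using nontrivial by blast
  let ?y0 = "\<rho> 0 x0"
  have fpf: "\<rho> 0 v \<noteq> v" if "v \<in> \<Omega>" for v using semireg[of "[0]" "[]" v x0] that x0 by auto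
  have y0: "?y0 \<in> \<Omega>" using closed x0 by blast
  have "card {x0, ?y0} < card \<Omega>" using n by (simp add: card_insert_if)
  then obtain z where z: "z \<in> \<Omega>" "z \<notin> {x0, ?y0}" using other_point[of "{x0, ?y0}"] by blast
  let ?w = "\<rho> 0 z"
  have w: "?w \<in> \<Omega>" "?w \<noteq> z" "?w \<noteq> x0" "?w \<noteq> ?y0"
    using closed[OF z(1)] fpf[OF z(1)] z(2) rho_flip[of 0 z x0] rho_inj by auto
  have "card {x0, ?y0, z, ?w} < card \<Omega>" using n by (simp add: card_insert_if)
  then obtain v where v: "v \<in> \<Omega>" "v \<notin> {x0, ?y0, z, ?w}" using other_point[of "{x0, ?y0, z, ?w}"] by blast
  obtain u where u: "set u \<subseteq> {..<r}" "act u z = ?w" "act u ?w = v" "\<And>a. a \<notin> {z, ?w, v} \<Longrightarrow> act u a = a"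
    using three_cycle[OF z(1) w(1) v(1)] w(2) v(2) by (metis insertCI)
  obtain u1 u2 where s: "set u1 \<subseteq> ?I" "set u2 \<subseteq> ?J" "\<And>y. act u y = act u1 (act u2 y)" using split[OF u(1)] by blast
  \<comment> \<open>The part \<open>u2\<close> of the three-cycle commutes with label 0, so
    conjugation by \<open>u1\<close> alone gives the same element.\<close>
  let ?k = "u1 @ [0] @ rev u1"
  have k: "act u (\<rho> 0 a) = act ?k (act u a)" for a
    using s(3) actcom'[OF s(2), of 0] by (simp add: act_append act_rev)
  have ux: "act u x0 = x0" "act u ?y0 = ?y0" using u(4) z w v by auto
  then have "act ?k x0 = act [0] x0" using k[of x0] by simp
  moreover have "set ?k \<subseteq> ?I" "set [0] \<subseteq> ?I" using s(1) by auto
  ultimately have "act ?k ?w = act [0] ?w" using semireg[of ?k "[0]" x0 ?w] x0(1) w(1) by blast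
  moreover have "act ?k ?w = v" using k[of z] u by simp
  ultimately show False using v by simp
qed

lemma primitive_string:
  assumes "5 \<le> card \<Omega>" shows "primitive_string \<rho> \<Omega> r"
proof unfold_locales
  fix R :: "'a \<Rightarrow> 'a \<Rightarrow> bool"
  assume a: "\<And>y. y \<in> \<Omega> \<Longrightarrow> R y y" "\<And>y z. R y z \<Longrightarrow> R z y" "\<And>u y z. R u y \<Longrightarrow> R y z \<Longrightarrow> R u z"
    "\<And>i y z. i < r \<Longrightarrow> y \<in> \<Omega> \<Longrightarrow> z \<in> \<Omega> \<Longrightarrow> R y z \<Longrightarrow> R (\<rho> i y) (\<rho> i z)"
  show "(\<forall>y\<in>\<Omega>. \<forall>z\<in>\<Omega>. R y z \<longrightarrow> y = z) \<or> (\<forall>y\<in>\<Omega>. \<forall>z\<in>\<Omega>. R y z)"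
  proof (rule primitive[where R = R, OF _ a(2,3,1,4)])
    show "4 \<le> card \<Omega>" using assms by simp
  qed
next
  show "\<And>i. Suc i < r \<Longrightarrow> \<exists>y\<in>\<Omega>. \<rho> i (\<rho> (Suc i) y) \<noteq> \<rho> (Suc i) (\<rho> i y)"
    by (rule noncommuting[OF assms])
qed (use assms finite_points closed trivial_beyond even_labels nontrivial transitive in auto)

end

section \<open>From lists of generators to labelled actions\<close>

lemma alt_group_square: "f [^]\<^bsub>alt_group n\<^esub> (2::nat) = f \<circ> f"
  by (simp add: numeral_2_eq_2 alt_group_mult alt_group_one
      monoid.nat_pow_Suc[OF group.is_monoid[OF alt_group_is_group]]
      monoid.nat_pow_0[OF group.is_monoid[OF alt_group_is_group]])

definition label_action :: "(nat \<Rightarrow> nat) list \<Rightarrow> nat \<Rightarrow> nat \<Rightarrow> nat" where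
  "label_action S i = (if i < length S then S ! i else id)"

context
  fixes n :: nat and S :: "(nat \<Rightarrow> nat) list"
  assumes sggi: "sggi (alt_group n) S"
begin

lemma sggi_permutes: "i < length S \<Longrightarrow> S ! i permutes {1..n} \<and> evenperm (S ! i)"
  using sggi nth_mem[of i S] by (auto simp: sggi_def involution_def alt_group_carrier)

lemma sggi_square: "i < length S \<Longrightarrow> S ! i \<circ> S ! i = id"
  using sggi nth_mem[of i S]
  by (auto simp: sggi_def involution_def alt_group_square alt_group_one)

lemma sggi_commute:
  assumes "i < length S" "j < length S" "Suc i < j" shows "S ! i \<circ> S ! j = S ! j \<circ> S ! i"
proof -
  have "(S ! i \<otimes>\<^bsub>alt_group n\<^esub> S ! j) [^]\<^bsub>alt_group n\<^esub> (2::nat) = \<one>\<^bsub>alt_group n\<^esub>"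
    using sggi assms by (auto simp: sggi_def)
  then have "(S ! i \<circ> S ! j) \<circ> (S ! i \<circ> S ! j) = id"
    by (simp add: alt_group_square alt_group_mult alt_group_one)
  then have *: "(S ! i) ((S ! j) ((S ! i) ((S ! j) y))) = y" for y by (metis comp_apply id_apply)
  have sq: "(S ! i) ((S ! i) y) = y" "(S ! j) ((S ! j) y) = y" for y
    using sggi_square assms by (metis comp_apply id_apply)+
  show ?thesis
  proof
    fix y
    show "(S ! i \<circ> S ! j) y = (S ! j \<circ> S ! i) y" using *[of y] sq by (metis comp_apply)
  qed
qed

lemma label_invol_string: "invol_string (label_action S)"
proof
  fix i y show "label_action S i (label_action S i y) = y"
    using sggi_square[of i] by (auto simp: label_action_def fun_eq_iff)
next
  fix i j y assume "Suc i < j"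
  then show "label_action S i (label_action S j y) = label_action S j (label_action S i y)"
    using sggi_commute[of i j] by (auto simp: label_action_def fun_eq_iff)
qed

interpretation L: invol_string "label_action S" by (rule label_invol_string)

lemma inv_generator: "x \<in> set S \<Longrightarrow> inv\<^bsub>alt_group n\<^esub> x = x"
proof -
  assume x: "x \<in> set S"
  then obtain i where i: "i < length S" "x = S ! i" by (auto simp: in_set_conv_nth)
  have "x \<in> carrier (alt_group n)" using i sggi_permutes by (simp add: alt_group_carrier)
  moreover have "x \<otimes>\<^bsub>alt_group n\<^esub> x = \<one>\<^bsub>alt_group n\<^esub>"
    using i sggi_square by (simp add: alt_group_mult alt_group_one)
  ultimately show ?thesis using group.inv_equality[OF alt_group_is_group] by blast
qed

lemma generate_act: "p \<in> generate (alt_group n) (set S) \<Longrightarrow> \<exists>w. set w \<subseteq> {..<length S} \<and> L.act w = p"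
proof (induction rule: generate.induct)
  case one
  then show ?case by (intro exI[of _ "[]"]) (auto simp: alt_group_one fun_eq_iff)
next
  case (incl h)
  then obtain i where "i < length S" "h = S ! i" by (auto simp: in_set_conv_nth)
  then show ?case by (intro exI[of _ "[i]"]) (simp add: fun_eq_iff, simp add: label_action_def)
next
  case (inv h)
  then obtain i where "i < length S" "h = S ! i" by (auto simp: in_set_conv_nth)
  then show ?case using inv_generator[OF inv] by (intro exI[of _ "[i]"]) (simp add: fun_eq_iff, simp add: label_action_def)
next
  case (eng h1 h2)
  then obtain w1 w2 where "set w1 \<subseteq> {..<length S}" "L.act w1 = h1" "set w2 \<subseteq> {..<length S}" "L.act w2 = h2" by blast
  then show ?case by (intro exI[of _ "w1 @ w2"]) (auto simp: alt_group_mult fun_eq_iff L.act_append)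
qed

text \<open>The subgroup is confined to the labels occurring in the word, so that a word avoiding
  one label can refute independence.\<close>

lemma act_generate: "set w \<subseteq> {..<length S} \<Longrightarrow> L.act w \<in> generate (alt_group n) ((!) S ` set w)"
proof (induction w)
  case Nil
  have "L.act [] = id" by (auto simp: fun_eq_iff)
  moreover have "id \<in> generate (alt_group n) ((!) S ` set [])"
    using generate.one[of "alt_group n" "{}"] by (simp add: alt_group_one)
  ultimately show ?case by metis
next
  case (Cons i w)
  have "L.act (i # w) = S ! i \<otimes>\<^bsub>alt_group n\<^esub> L.act w"
    using Cons.prems by (auto simp: fun_eq_iff label_action_def alt_group_mult)
  moreover have "L.act w \<in> generate (alt_group n) ((!) S ` set (i # w))"
    using Cons group.mono_generate[OF alt_group_is_group, of "(!) S ` set w" "(!) S ` set (i # w)"] by auto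
  moreover have "S ! i \<in> generate (alt_group n) ((!) S ` set (i # w))" by (rule generate.incl) simp
  ultimately show ?case by (simp add: generate.eng)
qed

lemma label_alt_string: "alt_string (label_action S) {1..n} (length S)"
proof unfold_locales
  show "label_action S i y \<in> {1..n}" if "y \<in> {1..n}" for i y
    using that permutes_in_image[of "S ! i" "{1..n}" y] sggi_permutes[of i] by (auto simp: label_action_def)
  show "label_action S i y = y" if "y \<notin> {1..n}" for i y
    using that permutes_not_in[of "S ! i" "{1..n}" y] sggi_permutes[of i] by (auto simp: label_action_def)
  show "L.mv i {1..n} mod 4 = 0" for i
  proof (cases "i < length S")
    case True
    have "evenperm (S ! i) \<longleftrightarrow> card {y \<in> {1..n}. (S ! i) y \<noteq> y} mod 4 = 0"
      using sggi_permutes[OF True] sggi_square[OF True] by (intro evenperm_involution) (auto simp: fun_eq_iff)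
    then show ?thesis using sggi_permutes[OF True] True by (simp add: L.mv_def label_action_def)
  qed (simp add: L.mv_def label_action_def)
  show "\<exists>y\<in>{1..n}. label_action S i y \<noteq> y" if i: "i < length S" for i
  proof (rule ccontr)
    assume "\<not> ?thesis"
    then have "S ! i = id" using i permutes_not_in[of "S ! i" "{1..n}"] sggi_permutes[OF i]
      by (fastforce simp: label_action_def fun_eq_iff)
    moreover have "S ! i \<noteq> id" using sggi i nth_mem[OF i] by (auto simp: sggi_def involution_def alt_group_one)
    ultimately show False by simp
  qed
  show "\<exists>w. set w \<subseteq> {..<length S} \<and> L.act w = p" if "p permutes {1..n}" "evenperm p" for p
    using generate_act[of p] that sggi by (auto simp: sggi_def alt_group_carrier)
qed (auto simp: label_action_def)

end

section \<open>Five labels on nine points\<close>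

context invol_string
begin

lemma flipD: "\<rho> i y = z \<Longrightarrow> \<rho> i z = y"
  by auto

lemma mv_empty [simp]: "mv i {} = 0" by (simp add: mv_def)

lemma mv_insert: "finite X \<Longrightarrow> a \<notin> X \<Longrightarrow> mv i (insert a X) = (if \<rho> i a = a then mv i X else Suc (mv i X))"
proof -
  assume "finite X" "a \<notin> X"
  moreover have "{y \<in> insert a X. \<rho> i y \<noteq> y} =
      (if \<rho> i a = a then {y \<in> X. \<rho> i y \<noteq> y} else insert a {y \<in> X. \<rho> i y \<noteq> y})" by auto
  ultimately show ?thesis by (simp add: mv_def)
qed

end

context string_action
begin

lemma not_closed:
  assumes "X \<subseteq> \<Omega>" "x \<in> X" "card X < card \<Omega>" "\<And>i y. i < r \<Longrightarrow> y \<in> X \<Longrightarrow> \<rho> i y \<in> X"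
  shows False
proof -
  have "orb {..<r} x \<subseteq> X" by (rule orb_subset) (use assms in auto)
  then have "\<Omega> \<subseteq> X" using transitive[of x] assms by blast
  then show False using assms card_mono[OF finite_subset[OF assms(1) finite_points]] by (meson linorder_not_le)
qed

text \<open>Dropping independence, \<open>Alt(9)\<close> does have strings of five labels. The words below express
  the last label through the others in each of their possible shapes; they come from a
  breadth-first search.\<close>

lemma nine_points_two_fixed:
  assumes \<Omega>: "\<Omega> = {s, s', p, p', q, q', t, t', u}" and d: "distinct [s, s', p, p', q, q', t, t', u]"
    and r0: "\<rho> 0 s = s'" "\<rho> 0 p = p'" "\<rho> 0 q = q" "\<rho> 0 q' = q'" "\<rho> 0 t = t" "\<rho> 0 t' = t'" "\<rho> 0 u = u"
    and r1: "\<rho> 1 s = q" "\<rho> 1 s' = q'" "\<rho> 1 p = t" "\<rho> 1 p' = t'" "\<rho> 1 u = u"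
    and r2: "\<rho> 2 s \<in> {s, s'}" "\<rho> 2 p \<in> {p, p'}" "\<rho> 2 q \<in> {q, q'}" "\<rho> 2 u = t" "\<rho> 2 t' = t'"
    and r3: "\<rho> 3 s = p" "\<rho> 3 s' = p'" "\<rho> 3 q = t" "\<rho> 3 q' = t'" "\<rho> 3 u = u"
    and r4: "\<rho> 4 s = s'" "\<rho> 4 q = q'" "\<rho> 4 p = p" "\<rho> 4 p' = p'" "\<rho> 4 t = t" "\<rho> 4 t' = t'" "\<rho> 4 u = u"
  shows "\<exists>w. set w \<subseteq> {0, 1, 2, 3} \<and> (\<forall>y\<in>\<Omega>. act w y = \<rho> 4 y)"
proof -

  note bk = r0(1,2)[THEN flipD] r1(1-4)[THEN flipD] r2(4)[THEN flipD] r3(1-4)[THEN flipD] r4(1,2)[THEN flipD]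
  have s2: "\<rho> 2 s' = (if \<rho> 2 s = s then s' else s)" using r2(1) bk(1) d
    by (metis comm' insertE invol lessI numeral_2_eq_2 r0(1) singletonD)
  have p2: "\<rho> 2 p' = (if \<rho> 2 p = p then p' else p)" using r2(2) bk(2) d
    by (metis comm' insertE invol lessI numeral_2_eq_2 r0(2) singletonD)
  have q2: "\<rho> 2 q' = (if \<rho> 2 q = q then q' else q)"
  proof -
    have "\<rho> 2 (\<rho> 4 q) = \<rho> 4 (\<rho> 2 q)" by (rule comm) simp
    then show ?thesis using r2(3) r4(2) bk(13) d by auto
  qed
  have mod: "mv 2 \<Omega> mod 4 = 0" by (rule even_labels)
  have ne: "s' \<noteq> s" "p' \<noteq> p" "q' \<noteq> q" "u \<noteq> t" "t' \<noteq> t" using d by auto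
  note facts = r0 r1 r2(4,5) r3 r4 bk \<Omega> ne
  \<comment> \<open>Label 2 exchanges \<open>u\<close> with \<open>t\<close>. By evenness the number
    of the three pairs at \<open>s\<close>, \<open>p\<close> and \<open>q\<close> that it exchanges
    is odd.\<close>
  consider "\<rho> 2 s = s" "\<rho> 2 p = p" "\<rho> 2 q = q'" | "\<rho> 2 s = s" "\<rho> 2 p = p'" "\<rho> 2 q = q"
    | "\<rho> 2 s = s'" "\<rho> 2 p = p" "\<rho> 2 q = q" | "\<rho> 2 s = s'" "\<rho> 2 p = p'" "\<rho> 2 q = q'"
  proof -
    have "mv 2 \<Omega> = 2 + 2 * ((if \<rho> 2 s = s then 0 else 1) + (if \<rho> 2 p = p then 0 else 1) + (if \<rho> 2 q = q then 0 else 1))"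
      unfolding \<Omega> using d r2 bk(7) s2 p2 q2 ne by (simp add: mv_insert)
    then show thesis using mod r2 that by (auto split: if_splits)
  qed
  then show ?thesis
  proof cases
    case 1
    then show ?thesis using s2 p2 q2 d by (intro exI[of _ "[2,1,2,1,2,1,2,1,2,1,2,1]"]) (simp add: facts del: One_nat_def)
  next
    case 2
    then show ?thesis using s2 p2 q2 d by (intro exI[of _ "[3,2,1,0,1,2,1,0,1,2,3]"]) (simp add: facts del: One_nat_def)
  next
    case 3
    then show ?thesis using s2 p2 q2 d by (intro exI[of _ "[1,2,1,0,1,2,1,0,1,2,1,0]"]) (simp add: facts del: One_nat_def)
  next
    case 4
    then show ?thesis using s2 p2 q2 d
      by (intro exI[of _ "[2,1,2,0,1,2,0,1,2,0,1,2,0,1,2,0,1,0]"]) (simp add: facts del: One_nat_def)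
  qed
qed

text \<open>The shape in which labels 0 and 4 exchange the same pairs \<open>y\<close>,
  \<open>y'\<close> and \<open>d\<close>, \<open>d'\<close>.\<close>

lemma nine_points_aligned:
  assumes \<Omega>: "\<Omega> = {a, b, c, e, e', y, y', d, d'}" and dist: "distinct [a, b, c, e, e', y, y', d, d']"
    and r0: "\<rho> 0 a = a" "\<rho> 0 b = b" "\<rho> 0 c = c" "\<rho> 0 e = e" "\<rho> 0 e' = e'" "\<rho> 0 y = y'" "\<rho> 0 d = d'"
    and r1: "\<rho> 1 a = a" "\<rho> 1 b = b" "\<rho> 1 c = c" "\<rho> 1 e = y" "\<rho> 1 e' = y'" "\<rho> 1 d = d" "\<rho> 1 d' = d'"
    and r2: "\<rho> 2 a = e" "\<rho> 2 b = e'" "\<rho> 2 c = c" "\<rho> 2 y = d" "\<rho> 2 y' = d'"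
    and r3: "\<rho> 3 a = a" "\<rho> 3 b = c" "\<rho> 3 d = d'"
    and r3': "(\<rho> 3 e = e \<and> \<rho> 3 e' = e' \<and> \<rho> 3 y = y \<and> \<rho> 3 y' = y') \<or> (\<rho> 3 e = e' \<and> \<rho> 3 y = y')"
    and r4: "\<rho> 4 a = b" "\<rho> 4 c = c" "\<rho> 4 e = e'" "\<rho> 4 y = y'" "\<rho> 4 d = d'"
  shows "\<exists>w. set w \<subseteq> {0, 1, 2, 3} \<and> (\<forall>y\<in>\<Omega>. act w y = \<rho> 4 y)"
proof -

  note bk = r0(6,7)[THEN flipD] r1(4,5)[THEN flipD] r2(1,2,4,5)[THEN flipD] r3(2,3)[THEN flipD] r4(1,3,4,5)[THEN flipD]
  note facts = r0 r1 r2 r3 r4 bk \<Omega>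
  from r3' show ?thesis
  proof
    assume "\<rho> 3 e = e \<and> \<rho> 3 e' = e' \<and> \<rho> 3 y = y \<and> \<rho> 3 y' = y'"
    then show ?thesis using dist by (intro exI[of _ "[1,2,1,0,1,2,1,0]"]) (simp add: facts del: One_nat_def)
  next
    assume x: "\<rho> 3 e = e' \<and> \<rho> 3 y = y'"
    then have "\<rho> 3 e' = e" "\<rho> 3 y' = y" by (metis invol)+
    then show ?thesis using dist x by (intro exI[of _ "[1,2,1,0,1,2,1,0]"]) (simp add: facts del: One_nat_def)
  qed
qed

text \<open>Labels 0 and 4 act regularly on \<open>{y, y', z, z'}\<close> and commute with label 2,
  so the value of label 2 at \<open>y\<close> determines it there. Each of the four values has its
  own word.\<close>

lemma nine_points_crossed:
  assumes \<Omega>: "\<Omega> = {a, b, c, e, e', y, y', z, z'}" and dist: "distinct [a, b, c, e, e', y, y', z, z']"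
    and r0: "\<rho> 0 a = a" "\<rho> 0 b = b" "\<rho> 0 c = c" "\<rho> 0 e = e" "\<rho> 0 e' = e'" "\<rho> 0 y = z" "\<rho> 0 y' = z'"
    and r1: "\<rho> 1 a = a" "\<rho> 1 b = b" "\<rho> 1 c = c" "\<rho> 1 e = y" "\<rho> 1 e' = y'" "\<rho> 1 z = z" "\<rho> 1 z' = z'"
    and r2: "\<rho> 2 a = e" "\<rho> 2 b = e'" "\<rho> 2 c = c" "\<rho> 2 y \<in> {y, y', z, z'}"
    and r3: "\<rho> 3 a = a" "\<rho> 3 b = c" "\<rho> 3 e = e'" "\<rho> 3 y = y'" "\<rho> 3 z = z'"
    and r4: "\<rho> 4 a = b" "\<rho> 4 c = c" "\<rho> 4 e = e'" "\<rho> 4 y = y'" "\<rho> 4 z = z'"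
  shows "\<exists>w. set w \<subseteq> {0, 1, 2, 3} \<and> (\<forall>y\<in>\<Omega>. act w y = \<rho> 4 y)"
proof -

  note bk = r0(6,7)[THEN flipD] r1(4,5)[THEN flipD] r2(1,2)[THEN flipD] r3(2-5)[THEN flipD] r4(1,3-5)[THEN flipD]
  have c0: "\<rho> 2 (\<rho> 0 v) = \<rho> 0 (\<rho> 2 v)" for v by (rule comm') simp
  have c4: "\<rho> 2 (\<rho> 4 v) = \<rho> 4 (\<rho> 2 v)" for v by (rule comm) simp
  have r2': "\<rho> 2 z = \<rho> 0 (\<rho> 2 y)" "\<rho> 2 y' = \<rho> 4 (\<rho> 2 y)" "\<rho> 2 z' = \<rho> 0 (\<rho> 4 (\<rho> 2 y))"
    using c0[of y] c4[of y] c0[of y'] r0 r4 by simp_all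
  note facts = r0 r1 r2(1-3) r3 r4 bk r2' \<Omega>
  from r2(4) consider "\<rho> 2 y = y" | "\<rho> 2 y = z" | "\<rho> 2 y = y'" | "\<rho> 2 y = z'" by blast
  then show ?thesis
  proof cases
    case 1
    then show ?thesis using dist
      by (intro exI[of _ "[3,2,3,2,3,2,3,1,2,3,1,2,3,2,3,1,2,3,1,2,3,2,3,2,3,1]"]) (simp add: facts del: One_nat_def)
  next
    case 2
    then show ?thesis using dist
      by (intro exI[of _ "[3,2,3,2,3,2,3,2,3,1,2,3,1,2,3,2,3,2,3,2,3,2,1,2,1]"]) (simp add: facts del: One_nat_def)
  next
    case 3
    then show ?thesis using dist by (intro exI[of _ "[2,1,2,1,2,1]"]) (simp add: facts del: One_nat_def)
  next
    case 4
    then show ?thesis using dist by (intro exI[of _ "[2,1,2,0,1,2,0,1,0]"]) (simp add: facts del: One_nat_def)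
  qed
qed

end

context string_action
begin

lemma card_eqI: "card X = n \<Longrightarrow> distinct l \<Longrightarrow> length l = n \<Longrightarrow> set l \<subseteq> X \<Longrightarrow> finite X \<Longrightarrow> X = set l"
  by (metis card_subset_eq distinct_card)

lemma fixed_iff: "Suc i < j \<or> Suc j < i \<Longrightarrow> \<rho> i (\<rho> j y) = \<rho> j y \<longleftrightarrow> \<rho> i y = y"
  by (rule fixed_transfer)

lemma other_fixed: "\<rho> i g = g \<Longrightarrow> \<rho> i h \<in> {g, h} \<Longrightarrow> g \<noteq> h \<Longrightarrow> \<rho> i h = h"
  by (metis insertE invol singletonD)

text \<open>Transitivity requires some label to join the points moved by \<open>k\<close> to those
  fixed by \<open>k\<close>, and the last hypothesis leaves only label \<open>j\<close>.\<close>

lemma crossing_point: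
  assumes "y \<in> \<Omega>" "\<rho> k y = y" "z \<in> \<Omega>" "\<rho> k z \<noteq> z"
    and "\<And>i v. i < r \<Longrightarrow> i \<noteq> j \<Longrightarrow> v \<in> \<Omega> \<Longrightarrow> \<rho> k v \<noteq> v \<Longrightarrow> \<rho> k (\<rho> i v) \<noteq> \<rho> i v"
  shows "\<exists>v\<in>\<Omega>. \<rho> k v \<noteq> v \<and> \<rho> k (\<rho> j v) = \<rho> j v"
proof (rule ccontr)
  assume no: "\<not> ?thesis"
  let ?X = "{v \<in> \<Omega>. \<rho> k v \<noteq> v}"
  have "?X \<subset> \<Omega>" using assms by blast
  then have "card ?X < card \<Omega>" by (rule psubset_card_mono[OF finite_points])
  then show False
  proof (rule not_closed[rotated 2])
    show "?X \<subseteq> \<Omega>" "z \<in> ?X" using assms by auto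
    fix i v assume i: "i < r" and v: "v \<in> ?X"
    show "\<rho> i v \<in> ?X"
    proof (cases "i = j")
      case True then show ?thesis using no v closed by auto
    next
      case False then show ?thesis using assms(5)[OF i] v closed by auto
    qed
  qed
qed

text \<open>Labels 0, 1 and 2 commute with label 4 and fix its only fixed point \<open>c\<close>.
  Walking away from \<open>c\<close> by labels 3, 4, 2 and 1 gives \<open>b\<close>,
  \<open>a\<close>, \<open>e\<close> and \<open>y\<close>, and label 4 supplies \<open>e'\<close>
  and \<open>y'\<close>; the five fixed points of label 0 are \<open>a\<close>, \<open>b\<close>,
  \<open>c\<close>, \<open>e\<close>, \<open>e'\<close>. Whether label 0 sends \<open>y\<close> to
  \<open>y'\<close> separates the two possible shapes.\<close>

lemma nine_points_dependent_asym:
  assumes n: "card \<Omega> = 9" and r5: "r = 5" and m0: "mv 0 \<Omega> = 4" and m4: "mv 4 \<Omega> = 8"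
  shows "\<exists>w. set w \<subseteq> {0, 1, 2, 3} \<and> (\<forall>y\<in>\<Omega>. act w y = \<rho> 4 y)"
proof -
  have c02: "\<rho> 0 (\<rho> 2 v) = \<rho> 2 (\<rho> 0 v)" and c03: "\<rho> 0 (\<rho> 3 v) = \<rho> 3 (\<rho> 0 v)"
    and c04: "\<rho> 0 (\<rho> 4 v) = \<rho> 4 (\<rho> 0 v)" and c13: "\<rho> 1 (\<rho> 3 v) = \<rho> 3 (\<rho> 1 v)"
    and c14: "\<rho> 1 (\<rho> 4 v) = \<rho> 4 (\<rho> 1 v)" and c24: "\<rho> 2 (\<rho> 4 v) = \<rho> 4 (\<rho> 2 v)" for v
    by (rule comm; simp)+
  have split: "card {y \<in> \<Omega>. \<rho> i y = y} = 9 - mv i \<Omega>" for i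
  proof -
    have "\<Omega> = {y \<in> \<Omega>. \<rho> i y = y} \<union> {y \<in> \<Omega>. \<rho> i y \<noteq> y}" by blast
    then have "card \<Omega> = card {y \<in> \<Omega>. \<rho> i y = y} + mv i \<Omega>"
      unfolding mv_def using finite_points by (subst card_Un_disjoint[symmetric]) auto
    then show ?thesis using n by simp
  qed
  have "card {y \<in> \<Omega>. \<rho> 4 y = y} = 1" using split[of 4] m4 by simp
  then obtain c where c: "{y \<in> \<Omega>. \<rho> 4 y = y} = {c}" by (auto simp: card_1_singleton_iff)
  then have c\<Omega>: "c \<in> \<Omega>" "\<rho> 4 c = c" and c_only: "\<And>y. y \<in> \<Omega> \<Longrightarrow> \<rho> 4 y = y \<Longrightarrow> y = c" by blast+
  have ic: "\<rho> 0 c = c" "\<rho> 1 c = c" "\<rho> 2 c = c"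
    using c_only[of "\<rho> 0 c"] c_only[of "\<rho> 1 c"] c_only[of "\<rho> 2 c"] c04[of c] c14[of c] c24[of c] c\<Omega> closed by simp_all
  have labels: "i = 0 \<or> i = 1 \<or> i = 2 \<or> i = 3 \<or> i = 4" if "i < r" for i using that r5 by auto
  define b where "b = \<rho> 3 c"
  have bc: "b \<noteq> c"
  proof
    assume "b = c"
    show False
    proof (rule not_closed[of "{c}" c])
      fix i y assume "i < r" "y \<in> {c}"
      then show "\<rho> i y \<in> {c}" using labels[of i] ic c\<Omega> \<open>b = c\<close> by (auto simp: b_def)
    qed (use c\<Omega> n in auto)
  qed
  have b\<Omega>: "b \<in> \<Omega>" using closed c\<Omega> by (simp add: b_def)
  have ib: "\<rho> 0 b = b" "\<rho> 1 b = b" "\<rho> 3 b = c" using c03[of c] c13[of c] ic by (simp_all add: b_def)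
  define a where "a = \<rho> 4 b"
  have a\<Omega>: "a \<in> \<Omega>" using closed b\<Omega> by (simp add: a_def)
  have a4: "\<rho> 4 a = b" by (simp add: a_def)
  have ab: "a \<noteq> b" using c_only[OF b\<Omega>] bc by (auto simp: a_def)
  have ac: "a \<noteq> c" using a4 c\<Omega> bc by auto
  have ia: "\<rho> 0 a = a" "\<rho> 1 a = a" using c04[of b] c14[of b] ib by (simp_all add: a_def)
  obtain z0 where z0: "z0 \<in> \<Omega>" "\<rho> 0 z0 \<noteq> z0" using nontrivial[of 0] r5 by auto
  obtain y1 where y1: "y1 \<in> \<Omega>" "\<rho> 0 y1 \<noteq> y1" "\<rho> 0 (\<rho> 1 y1) = \<rho> 1 y1"
  proof -
    have "\<exists>v\<in>\<Omega>. \<rho> 0 v \<noteq> v \<and> \<rho> 0 (\<rho> 1 v) = \<rho> 1 v"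
    proof (rule crossing_point[OF c\<Omega>(1) ic(1) z0])
      fix i v assume "i < r" "i \<noteq> 1" and v: "\<rho> 0 v \<noteq> v"
      then consider "i = 0" | "1 < i" using labels by fastforce
      then show "\<rho> 0 (\<rho> i v) \<noteq> \<rho> i v"
      proof cases
        case 1 then show ?thesis using v by (metis invol)
      next
        case 2 then show ?thesis using v fixed_iff[of 0 i v] by simp
      qed
    qed
    then show ?thesis using that by blast
  qed
  define e0 where "e0 = \<rho> 1 y1"
  have e0: "e0 \<in> \<Omega>" "\<rho> 0 e0 = e0" "\<rho> 1 e0 = y1" using y1 closed by (simp_all add: e0_def)
  have e0n: "\<rho> 1 e0 \<noteq> e0" "e0 \<noteq> a" "e0 \<noteq> b" "e0 \<noteq> c" using e0 y1 ia ib ic by auto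
  let ?e1 = "\<rho> 4 e0"
  have e1: "?e1 \<in> \<Omega>" "\<rho> 0 ?e1 = ?e1" "\<rho> 1 ?e1 = \<rho> 4 y1" "\<rho> 1 ?e1 \<noteq> ?e1"
    using e0 closed c04[of e0] c14[of e0] fixed_iff[of 1 4 e0] e0n by simp_all
  have e1n: "?e1 \<noteq> e0" "?e1 \<noteq> a" "?e1 \<noteq> b" "?e1 \<noteq> c"
    using c_only[OF e0(1)] e0n e1(4) ia ib ic by auto
  have F0: "{y \<in> \<Omega>. \<rho> 0 y = y} = {a, b, c, e0, ?e1}"
  proof -
    have "{y \<in> \<Omega>. \<rho> 0 y = y} = set [a, b, c, e0, ?e1]"
      by (rule card_eqI[of _ 5]) (use split[of 0] m0 ab ac bc e0n e1n a\<Omega> b\<Omega> c\<Omega> e0 e1 ia ib ic finite_points in auto)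
    then show ?thesis by simp
  qed
  have inF: "v \<in> {a, b, c, e0, ?e1}" if "v \<in> \<Omega>" "\<rho> 0 v = v" for v using that F0 by blast
  have a3: "\<rho> 3 a = a"
  proof -
    have "\<rho> 0 (\<rho> 3 a) = \<rho> 3 a" "\<rho> 1 (\<rho> 3 a) = \<rho> 3 a" using c03[of a] c13[of a] ia by simp_all
    then have "\<rho> 3 a \<in> {a, b, c}" using inF[of "\<rho> 3 a"] closed[OF a\<Omega>] e0n(1) e1(4) by auto
    moreover have "\<rho> 3 a \<noteq> b" using ac b_def rho_inj by blast
    moreover have "\<rho> 3 a \<noteq> c" using ab ib(3) rho_inj by metis
    ultimately show ?thesis by blast
  qed
  define e where "e = \<rho> 2 a"
  define e' where "e' = \<rho> 4 e"
  have e\<Omega>: "e \<in> \<Omega>" "e' \<in> \<Omega>" using closed a\<Omega> by (simp_all add: e_def e'_def)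
  have b2: "\<rho> 2 b = e'" using c24[of a] a4 by (simp add: e_def e'_def)
  have efix: "\<rho> 0 e = e" "\<rho> 0 e' = e'" using c02[of a] c04[of e] ia by (simp_all add: e_def e'_def)
  have enc: "e \<noteq> c" using ac ic(3) rho_inj[of 2 a c] by (auto simp: e_def)
  have "e \<notin> {a, b}"
  proof
    assume "e \<in> {a, b}"
    then have e'ab: "e' \<in> {a, b}" using a4 by (auto simp: e'_def a_def)
    have c4ab: "\<rho> 4 b = a" by (simp add: a_def)
    show False
    proof (rule not_closed[of "{a, b, c}" a])
      fix i y assume "i < r" "y \<in> {a, b, c}"
      then show "\<rho> i y \<in> {a, b, c}"
        using labels[of i] ia ib ic a3 a4 c4ab c\<Omega> b2 \<open>e \<in> {a, b}\<close> e'ab e_def b_def by auto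
    next
      have "card {a, b, c} \<le> 3" by (simp add: card_insert_if)
      then show "card {a, b, c} < card \<Omega>" using n by simp
    qed (use a\<Omega> b\<Omega> c\<Omega> in auto)
  qed
  then have ee: "e = e0 \<or> e = ?e1" using inF[OF e\<Omega>(1) efix(1)] enc by blast
  then have ee': "{e, e'} = {e0, ?e1}" by (auto simp: e'_def)
  have enn: "e \<noteq> a" "e \<noteq> b" "e \<noteq> c" "e' \<noteq> a" "e' \<noteq> b" "e' \<noteq> c" "e' \<noteq> e"
    using ee e0n e1n unfolding e'_def by auto
  define y where "y = \<rho> 1 e"
  define y' where "y' = \<rho> 4 y"
  have y0: "\<rho> 0 y \<noteq> y" using ee y1 e0 e1 fixed_iff[of 0 4 y1] by (auto simp: y_def)
  have y\<Omega>: "y \<in> \<Omega>" "y' \<in> \<Omega>" using closed e\<Omega> by (simp_all add: y_def y'_def)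
  have y'1: "\<rho> 1 e' = y'" using c14[of e] by (simp add: y_def y'_def e'_def)
  have y'0: "\<rho> 0 y' \<noteq> y'" using y0 fixed_iff[of 0 4 y] by (simp add: y'_def)
  have yy': "y' \<noteq> y" using c_only[OF y\<Omega>(1)] y0 ic by (auto simp: y'_def)
  have F0': "{v \<in> \<Omega>. \<rho> 0 v = v} = {a, b, c, e, e'}" using F0 ee' by blast
  have e3: "\<rho> 3 e = e \<and> \<rho> 3 e' = e' \<or> \<rho> 3 e = e' \<and> \<rho> 3 e' = e"
  proof -
    have in3: "\<rho> 3 v \<in> {e, e'}" if "v \<in> {e, e'}" for v
    proof -
      have v: "v \<in> \<Omega>" "\<rho> 0 v = v" using that e\<Omega> efix by auto
      then have "\<rho> 3 v \<in> {a, b, c, e, e'}" using F0' closed[of v 3] c03[of v] by auto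
      moreover have "\<rho> 3 v \<noteq> a" "\<rho> 3 v \<noteq> b" "\<rho> 3 v \<noteq> c"
        using that enn a3 ib(3) b_def rho_inj by (metis empty_iff insert_iff)+
      ultimately show ?thesis by blast
    qed
    show ?thesis using in3[of e] in3[of e'] enn(7) by (metis insertCI insertE invol singletonD)
  qed
  have y3: "\<rho> 3 y = \<rho> 1 (\<rho> 3 e)" "\<rho> 3 y' = \<rho> 1 (\<rho> 3 e')" using c13[of e] c13[of e'] y'1 by (simp_all add: y_def)
  have y1': "\<rho> 1 y = e" "\<rho> 1 y' = e'" using y'1 by (auto simp: y_def)
  have M0: "card {v \<in> \<Omega>. \<rho> 0 v \<noteq> v} = 4" using m0 by (simp add: mv_def)
  have FM: "\<Omega> = {a, b, c, e, e'} \<union> {v \<in> \<Omega>. \<rho> 0 v \<noteq> v}" using F0' by blast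
  have M0_1: "\<rho> 1 v \<in> {v \<in> \<Omega>. \<rho> 0 v \<noteq> v} - {y, y'}" if "v \<in> {v \<in> \<Omega>. \<rho> 0 v \<noteq> v} - {y, y'}" for v
  proof -
    have "\<rho> 1 v \<notin> {a, b, c, e, e', y, y'}"
    proof
      assume v: "\<rho> 1 v \<in> {a, b, c, e, e', y, y'}"
      have "\<rho> 1 e = y" by (simp add: y_def)
      then have "\<forall>w\<in>{a, b, c, e, e', y, y'}. \<rho> 1 w \<in> {a, b, c, e, e', y, y'}"
        using ia(2) ib(2) ic(2) y'1 y1' by (simp del: One_nat_def)
      then have "\<rho> 1 (\<rho> 1 v) \<in> {a, b, c, e, e', y, y'}" using v by (rule bspec)
      then have "v \<in> {a, b, c, e, e', y, y'}" by simp
      then show False using that F0' by auto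
    qed
    then show ?thesis using FM closed[of v 1] that by blast
  qed
  have M0_3: "\<rho> 3 v \<in> {v \<in> \<Omega>. \<rho> 0 v \<noteq> v} - {y, y'}" if "v \<in> {v \<in> \<Omega>. \<rho> 0 v \<noteq> v} - {y, y'}" for v
  proof -
    have "\<rho> 3 v \<notin> {y, y'}"
    proof
      assume "\<rho> 3 v \<in> {y, y'}"
      then have "v \<in> {y, y'}" using e3 y3 y'1 y_def by (metis insert_iff invol empty_iff)
      then show False using that by auto
    qed
    then show ?thesis using closed[of v 3] that fixed_iff[of 0 3 v] by auto
  qed
  have mv1: "mv 1 \<Omega> mod 4 = 0" and mv3: "mv 3 \<Omega> mod 4 = 0" by (rule even_labels)+
  have tab0: "\<rho> 0 a = a" "\<rho> 0 b = b" "\<rho> 0 c = c" "\<rho> 0 e = e" "\<rho> 0 e' = e'" using ia ib ic efix by auto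
  have tab1: "\<rho> 1 a = a" "\<rho> 1 b = b" "\<rho> 1 c = c" "\<rho> 1 e = y" "\<rho> 1 e' = y'" "\<rho> 1 y = e" "\<rho> 1 y' = e'"
    using ia ib ic y'1 y1' by (auto simp: y_def)
  have tab2: "\<rho> 2 a = e" "\<rho> 2 b = e'" "\<rho> 2 c = c" using b2 ic by (auto simp: e_def)
  have tab3: "\<rho> 3 a = a" "\<rho> 3 b = c" "\<rho> 3 c = b" using a3 ib by (auto simp: b_def)
  have tab4: "\<rho> 4 a = b" "\<rho> 4 c = c" "\<rho> 4 e = e'" "\<rho> 4 y = y'" using a4 c\<Omega> by (auto simp: e'_def y'_def)
  have ny: "v \<notin> {a, b, c, e, e'}" if "\<rho> 0 v \<noteq> v" for v using that tab0 by auto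
  show ?thesis
  proof (cases "\<rho> 0 y = y'")
    case True
    have y'y: "\<rho> 0 y' = y" using True by (metis invol)
    let ?M = "{v \<in> \<Omega>. \<rho> 0 v \<noteq> v}"
    have "card (?M - {y, y'}) = 2"
      using M0 y0 y'0 y\<Omega> yy' finite_points by (subst card_Diff_subset) auto
    then obtain g h where gh: "?M - {y, y'} = {g, h}" "g \<noteq> h" by (auto simp: card_2_iff)
    have Mgh: "?M = {y, y', g, h}" using gh y0 y'0 y\<Omega> by blast
    have in2: "\<rho> i v \<in> {g, h}" if v_in: "v \<in> {g, h}" and i: "i = 0 \<or> i = 1 \<or> i = 3 \<or> i = 4" for i v
    proof -
      have v: "v \<in> \<Omega>" "\<rho> 0 v \<noteq> v" "v \<noteq> y" "v \<noteq> y'" using v_in gh by auto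
      consider "i = 0" | "i = 1" | "i = 3" | "i = 4" using i by blast
      then show ?thesis
      proof cases
        case 1
        have "\<rho> 0 v \<in> ?M - {y, y'}" using v closed[of v 0] True y'y by (auto simp: rho_inj)
        then show ?thesis using 1 gh by simp
      next
        case 2 then show ?thesis using M0_1[of v] gh v_in by blast
      next
        case 3 then show ?thesis using M0_3[of v] gh v_in by blast
      next
        case 4
        have "\<rho> 4 v \<noteq> y" "\<rho> 4 v \<noteq> y'" using v(3,4) y'_def by (metis invol)+
        then have "\<rho> 4 v \<in> ?M - {y, y'}" using v closed[of v 4] fixed_iff[of 0 4 v] by auto
        then show ?thesis using 4 gh by simp
      qed
    qed
    have gh\<Omega>: "g \<in> \<Omega>" "h \<in> \<Omega>" "\<rho> 0 g \<noteq> g" "\<rho> 0 h \<noteq> h" using gh by auto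
    have g0: "\<rho> 0 g = h" using in2[of g 0] gh\<Omega> by auto
    have g4: "\<rho> 4 g = h" using in2[of g 4] c_only[of g] gh\<Omega> ic by auto
    have dist: "distinct [a, b, c, e, e', y, y', g, h]"
      using ab ac bc enn yy' ny[OF y0] ny[OF y'0] ny[OF gh\<Omega>(3)] ny[OF gh\<Omega>(4)] gh by auto
    have \<Omega>eq: "\<Omega> = {a, b, c, e, e', y, y', g, h}" using FM Mgh by auto
    \<comment> \<open>Label 1 already moves \<open>e\<close>, \<open>e'\<close>, \<open>y\<close>
      and \<open>y'\<close>; one more exchanged pair would make six moved points.\<close>
    have g1: "\<rho> 1 g = g" "\<rho> 1 h = h"
    proof -
      have "\<rho> 1 g = g"
      proof (rule ccontr)
        assume "\<rho> 1 g \<noteq> g"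
        then have "\<rho> 1 g = h" using in2[of g 1] by auto
        moreover from this have "\<rho> 1 h = g" by (metis invol)
        ultimately have "mv 1 \<Omega> = 6" unfolding \<Omega>eq using dist dist[THEN distinct_rev[THEN iffD2]] by (simp add: mv_insert tab1 del: One_nat_def)
        then show False using mv1 by simp
      qed
      then show "\<rho> 1 g = g" "\<rho> 1 h = h" using in2[of h 1] gh(2) other_fixed[of 1 g h] by simp_all
    qed
    have g3: "\<rho> 3 g = h"
    proof (rule ccontr)
      assume "\<rho> 3 g \<noteq> h"
      moreover have in3: "\<rho> 3 g \<in> {g, h}" "\<rho> 3 h \<in> {g, h}" by (rule in2; simp)+
      ultimately have g3: "\<rho> 3 g = g" by blast
      then have h3: "\<rho> 3 h = h" using in3(2) gh(2) by (rule other_fixed)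
      note d3 = dist dist[THEN distinct_rev[THEN iffD2]]
      from e3 have "mv 3 \<Omega> = 2 \<or> mv 3 \<Omega> = 6"
      proof
        assume x: "\<rho> 3 e = e \<and> \<rho> 3 e' = e'"
        then have "\<rho> 3 y = y" "\<rho> 3 y' = y'" using y3 tab1 by simp_all
        then show ?thesis unfolding \<Omega>eq using d3 x g3 h3 by (simp add: mv_insert tab3)
      next
        assume x: "\<rho> 3 e = e' \<and> \<rho> 3 e' = e"
        then have "\<rho> 3 y = y'" "\<rho> 3 y' = y" using y3 tab1 by simp_all
        then show ?thesis unfolding \<Omega>eq using d3 x g3 h3 by (simp add: mv_insert tab3)
      qed
      then show False using mv3 by auto
    qed
    have "\<rho> 2 y \<notin> {y, y'}"
    proof
      assume y2: "\<rho> 2 y \<in> {y, y'}"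
      have y'2: "\<rho> 2 y' \<in> {y, y'}" using y2 c24[of y] by (auto simp: y'_def)
      have in22: "\<rho> 2 v \<in> {g, h}" if "v \<in> {g, h}" for v
      proof -
        have v: "v \<in> \<Omega>" "\<rho> 0 v \<noteq> v" "v \<noteq> y" "v \<noteq> y'" using that gh by auto
        have "\<rho> 2 v \<notin> {y, y'}"
        proof
          assume "\<rho> 2 v \<in> {y, y'}"
          then have "\<rho> 2 (\<rho> 2 v) \<in> {y, y'}" using y2 y'2 by auto
          then show False using v by simp
        qed
        then have "\<rho> 2 v \<in> ?M - {y, y'}" using v closed[of v 2] fixed_iff[of 0 2 v] by auto
        then show ?thesis using gh by simp
      qed
      show False
      proof (rule not_closed[of "{g, h}" g])
        fix i v assume "i < r" "v \<in> {g, h}"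
        then show "\<rho> i v \<in> {g, h}" using labels[of i] in2[of v i] in22[of v] by blast
      qed (use gh\<Omega> n gh in auto)
    qed
    moreover have "\<rho> 2 y \<in> ?M" using closed[of y 2] y\<Omega> y0 fixed_iff[of 0 2 y] by auto
    ultimately have "\<rho> 2 y \<in> {g, h}" using Mgh by blast
    then obtain d d' where dd: "{d, d'} = {g, h}" "d = \<rho> 2 y" "d \<noteq> d'" using gh(2) by blast
    have d04: "\<rho> 0 d = d'" "\<rho> 4 d = d'" "\<rho> 3 d = d'" "\<rho> 1 d = d" "\<rho> 1 d' = d'"
    proof -
      have "\<rho> 0 h = g" "\<rho> 4 h = g" "\<rho> 3 h = g" using g0 g4 g3 by (metis invol)+
      then show "\<rho> 0 d = d'" "\<rho> 4 d = d'" "\<rho> 3 d = d'" "\<rho> 1 d = d" "\<rho> 1 d' = d'"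
        using dd g0 g4 g3 g1 gh(2) by (auto simp: doubleton_eq_iff)
    qed
    have y'2: "\<rho> 2 y' = d'" using c24[of y] d04(2) dd(2) by (simp add: y'_def)
    have dist': "distinct [a, b, c, e, e', y, y', d, d']" using dist dd(1,3) by (auto simp: doubleton_eq_iff)
    have \<Omega>eq': "\<Omega> = {a, b, c, e, e', y, y', d, d'}" using \<Omega>eq dd(1) by blast
    show ?thesis
      by (rule nine_points_aligned[OF \<Omega>eq' dist'])
        (use tab0 tab1 tab2 tab3 tab4 True d04 dd(2) y'2 e3 y3 in \<open>auto simp del: One_nat_def\<close>)
  next
    case False
    define z where "z = \<rho> 0 y"
    define z' where "z' = \<rho> 4 z"
    have z\<Omega>: "z \<in> \<Omega>" "z' \<in> \<Omega>" using closed y\<Omega> by (simp_all add: z_def z'_def)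
    have y'z': "\<rho> 0 y' = z'" using c04[of y] by (simp add: z_def z'_def y'_def)
    have zy: "z \<noteq> y" "z \<noteq> y'" using y0 False by (auto simp: z_def)
    have z'y: "z' \<noteq> y'" "z' \<noteq> y" "z' \<noteq> z"
    proof -
      show "z' \<noteq> y'" using zy(1) rho_inj by (simp add: z'_def y'_def)
      show "z' \<noteq> y" using zy(2) by (metis invol y'_def z'_def)
      show "z' \<noteq> z" using yy' rho_inj y'z' by (metis z_def)
    qed
    have z0: "\<rho> 0 z \<noteq> z" "\<rho> 0 z' \<noteq> z'" using zy(1) z'y(1) y'z' by (metis invol z_def, metis invol)
    have Meq: "{v \<in> \<Omega>. \<rho> 0 v \<noteq> v} = {y, y', z, z'}"
    proof -
      have "{v \<in> \<Omega>. \<rho> 0 v \<noteq> v} = set [y, y', z, z']"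
        by (rule card_eqI[OF M0]) (use y0 y'0 z0 y\<Omega> z\<Omega> zy z'y yy' finite_points in auto)
      then show ?thesis by simp
    qed
    have \<Omega>eq: "\<Omega> = {a, b, c, e, e', y, y', z, z'}" using FM Meq by auto
    have dist: "distinct [a, b, c, e, e', y, y', z, z']"
      using ab ac bc enn yy' zy z'y ny[OF y0] ny[OF y'0] ny[OF z0(1)] ny[OF z0(2)] by auto
    have inz: "\<rho> 1 v \<in> {z, z'}" if "v \<in> {z, z'}" for v using M0_1[of v] that Meq zy z'y by auto
    have z1: "\<rho> 1 z = z" "\<rho> 1 z' = z'"
    proof -
      have "\<rho> 1 z = z"
      proof (rule ccontr)
        assume "\<rho> 1 z \<noteq> z"
        then have "\<rho> 1 z = z'" using inz[of z] by auto
        moreover from this have "\<rho> 1 z' = z" by (metis invol)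
        ultimately have "mv 1 \<Omega> = 6" unfolding \<Omega>eq using dist dist[THEN distinct_rev[THEN iffD2]] by (simp add: mv_insert tab1 del: One_nat_def)
        then show False using mv1 by simp
      qed
      then show "\<rho> 1 z = z" "\<rho> 1 z' = z'" using inz[of z'] z'y(3) other_fixed[of 1 z z'] by simp_all
    qed
    have e3': "\<rho> 3 e = e' \<and> \<rho> 3 e' = e"
    proof (rule ccontr)
      assume "\<not> ?thesis"
      then have f: "\<rho> 3 e = e" "\<rho> 3 e' = e'" using e3 by auto
      then have g: "\<rho> 3 y = y" "\<rho> 3 y' = y'" using y3 y'1 by (auto simp: y_def)
      have "\<rho> 3 z = z" "\<rho> 3 z' = z'" using c03[of y] c03[of y'] g y'z' by (auto simp: z_def)
      then have "mv 3 \<Omega> = 2" unfolding \<Omega>eq using dist dist[THEN distinct_rev[THEN iffD2]] f g by (simp add: mv_insert tab3)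
      then show False using mv3 by simp
    qed
    have y3': "\<rho> 3 y = y'" using y3 y'1 e3' by simp
    have z3: "\<rho> 3 z = z'" using c03[of y] y3' y'z' by (simp add: z_def)
    have "\<rho> 2 y \<in> {v \<in> \<Omega>. \<rho> 0 v \<noteq> v}" using closed[of y 2] y\<Omega> y0 fixed_iff[of 0 2 y] by auto
    then have y2: "\<rho> 2 y \<in> {y, y', z, z'}" using Meq by blast
    show ?thesis
      by (rule nine_points_crossed[OF \<Omega>eq dist])
        (use tab0 tab1 tab2 tab3 tab4 z1 e3' y3' z3 y2 y'z' z_def z'_def in \<open>auto simp del: One_nat_def\<close>)
  qed
qed

end

context string_action
begin

lemma self_fixed: "\<rho> i (\<rho> i v) = \<rho> i v \<longleftrightarrow> \<rho> i v = v"
  by (metis invol)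

text \<open>The points are sorted by which of labels 0 and 4 move them. Only label 1 can change
  whether label 0 moves a point, and only label 3 can do so for label 4. The classes turn out to
  have sizes 2, 2, 2 and 3; labels 1 and 3 join eight points to two squares, and label 2 has to
  attach the remaining point \<open>u\<close>.\<close>

lemma nine_points_dependent_sym:
  assumes n: "card \<Omega> = 9" and r5: "r = 5" and m0: "mv 0 \<Omega> = 4" and m4: "mv 4 \<Omega> = 4"
  shows "\<exists>w. set w \<subseteq> {0, 1, 2, 3} \<and> (\<forall>y\<in>\<Omega>. act w y = \<rho> 4 y)"
proof -
  have c02: "\<rho> 0 (\<rho> 2 v) = \<rho> 2 (\<rho> 0 v)" and c03: "\<rho> 0 (\<rho> 3 v) = \<rho> 3 (\<rho> 0 v)"
    and c04: "\<rho> 0 (\<rho> 4 v) = \<rho> 4 (\<rho> 0 v)" and c13: "\<rho> 1 (\<rho> 3 v) = \<rho> 3 (\<rho> 1 v)"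
    and c14: "\<rho> 1 (\<rho> 4 v) = \<rho> 4 (\<rho> 1 v)" and c24: "\<rho> 2 (\<rho> 4 v) = \<rho> 4 (\<rho> 2 v)" for v
    by (rule comm; simp)+
  define T11 where "T11 = {v \<in> \<Omega>. \<rho> 0 v \<noteq> v \<and> \<rho> 4 v \<noteq> v}"
  define T10 where "T10 = {v \<in> \<Omega>. \<rho> 0 v \<noteq> v \<and> \<rho> 4 v = v}"
  define T01 where "T01 = {v \<in> \<Omega>. \<rho> 0 v = v \<and> \<rho> 4 v \<noteq> v}"
  define T00 where "T00 = {v \<in> \<Omega>. \<rho> 0 v = v \<and> \<rho> 4 v = v}"
  note T = T11_def T10_def T01_def T00_def
  have fin: "finite T11" "finite T10" "finite T01" "finite T00" using finite_points by (auto simp: T)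
  have M0: "{v \<in> \<Omega>. \<rho> 0 v \<noteq> v} = T11 \<union> T10" and M4: "{v \<in> \<Omega>. \<rho> 4 v \<noteq> v} = T11 \<union> T01"
    and all: "\<Omega> = (T11 \<union> T10) \<union> (T01 \<union> T00)" by (auto simp: T)
  have disj: "T11 \<inter> T10 = {}" "T11 \<inter> T01 = {}" "(T11 \<union> T10) \<inter> (T01 \<union> T00) = {}" "T01 \<inter> T00 = {}" by (auto simp: T)
  have k0: "card T11 + card T10 = 4"
    using m0 unfolding mv_def M0 using card_Un_disjoint[OF fin(1,2) disj(1)] by simp
  have k4: "card T11 + card T01 = 4"
    using m4 unfolding mv_def M4 using card_Un_disjoint[OF fin(1,3) disj(2)] by simp
  have kall: "card (T11 \<union> T10) + card (T01 \<union> T00) = 9"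
    using n card_Un_disjoint[OF _ _ disj(3)] fin unfolding all[symmetric] by simp
  have k9: "card T11 + card T10 + (card T01 + card T00) = 9"
    using kall card_Un_disjoint[OF fin(1,2) disj(1)] card_Un_disjoint[OF fin(3,4) disj(4)] by simp
  have st0: "\<rho> 0 (\<rho> i v) = \<rho> i v \<longleftrightarrow> \<rho> 0 v = v" if "i \<noteq> 1" for i v
    using fixed_iff[of 0 i v] self_fixed[of 0 v] that by (cases "i = 0") simp_all
  have st4: "\<rho> 4 (\<rho> i v) = \<rho> i v \<longleftrightarrow> \<rho> 4 v = v" if "i < r" "i \<noteq> 3" for i v
    using fixed_iff[of 4 i v] self_fixed[of 4 v] that r5 by (cases "i = 4") simp_all
  have ev: "even (card T11)"
    by (rule even_card_fpf_involution[of _ "\<rho> 0"]) (use fin closed st0[of 0] st4[of 0] r5 in \<open>auto simp: T11_def\<close>)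
  have labels: "i = 0 \<or> i = 1 \<or> i = 2 \<or> i = 3 \<or> i = 4" if "i < r" for i using that r5 by auto
  have "T00 \<noteq> {}" using k9 k0 k4 ev by fastforce
  then obtain o0 where o0: "o0 \<in> \<Omega>" "\<rho> 0 o0 = o0" "\<rho> 4 o0 = o0" by (auto simp: T00_def)
  obtain z0 where z0: "z0 \<in> \<Omega>" "\<rho> 0 z0 \<noteq> z0" using nontrivial[of 0] r5 by auto
  obtain z4 where z4: "z4 \<in> \<Omega>" "\<rho> 4 z4 \<noteq> z4" using nontrivial[of 4] r5 by auto
  obtain y1 where y1: "y1 \<in> \<Omega>" "\<rho> 0 y1 \<noteq> y1" "\<rho> 0 (\<rho> 1 y1) = \<rho> 1 y1"
    using crossing_point[OF o0(1,2) z0, of 1] st0 by blast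
  obtain y3 where y3: "y3 \<in> \<Omega>" "\<rho> 4 y3 \<noteq> y3" "\<rho> 4 (\<rho> 3 y3) = \<rho> 3 y3"
    using crossing_point[OF o0(1,3) z4, of 3] st4 by blast
  \<comment> \<open>The size is even and at most four. Size four leaves no class for
    \<open>\<rho> 1 y1\<close>. Size zero leaves one point in \<open>T00\<close>, at which
    \<open>y1\<close> and \<open>y3\<close> meet; the square of the commuting labels 1 and 3 through
    it has its fourth corner in \<open>T11\<close>.\<close>
  have "card T11 = 2"
  proof -
    have "card T11 \<le> 4" using k0 by simp
    moreover obtain m where m: "card T11 = 2 * m" using ev by (rule evenE)
    ultimately consider "m = 0" | "m = 1" | "m = 2" by linarith
    then consider "card T11 = 0" | "card T11 = 2" | "card T11 = 4" using m by cases simp_all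
    then show ?thesis
    proof cases
      case 3
      then have "T10 = {}" "T01 = {}" using k0 k4 fin by auto
      then have "y1 \<in> T11" using y1 by (auto simp: T)
      then have "\<rho> 1 y1 \<in> T01" using y1 closed[of y1 1] st4[of 1 y1] r5 by (auto simp: T)
      then show ?thesis using \<open>T01 = {}\<close> by simp
    next
      case 1
      then have e: "T11 = {}" "card T00 = 1" using k0 k4 k9 fin by auto
      then obtain c where c: "T00 = {c}" by (auto simp: card_1_singleton_iff)
      have "y1 \<in> T10" "y3 \<in> T01" using y1 y3 e by (auto simp: T)
      then have "\<rho> 1 y1 \<in> T00" "\<rho> 3 y3 \<in> T00"
        using y1 y3 closed st4[of 1 y1] st0[of 3 y3] r5 by (auto simp: T)
      then have "\<rho> 1 y1 = \<rho> 3 y3" using c by auto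
      then have "\<rho> 3 y1 = \<rho> 1 y3" by (metis c13 invol)
      moreover have "\<rho> 0 (\<rho> 3 y1) \<noteq> \<rho> 3 y1" using st0[of 3 y1] y1 by simp
      moreover have "\<rho> 4 (\<rho> 1 y3) \<noteq> \<rho> 1 y3" using st4[of 1 y3] y3 r5 by simp
      ultimately have "\<rho> 3 y1 \<in> T11" using closed[of y1 3] y1(1) unfolding T11_def by (metis (mono_tags, lifting) mem_Collect_eq)
      then show ?thesis using e by simp
    qed
  qed
  then have k: "card T11 = 2" "card T10 = 2" "card T01 = 2" "card T00 = 3" using k0 k4 k9 by auto
  have pair: "\<exists>v'. X = {v, v'} \<and> v' \<noteq> v" if X: "card X = 2" "v \<in> X" for X and v :: 'a
  proof -
    obtain a b where "X = {a, b}" "a \<noteq> b" using X(1) by (auto simp: card_2_iff)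
    then show ?thesis using X(2) by auto
  qed
  obtain s where s: "s \<in> T11" using k(1) by fastforce
  define s' where "s' = \<rho> 0 s"
  have s'T: "s' \<in> T11" "s' \<noteq> s" using s closed st0[of 0 s] st4[of 0 s] r5 by (auto simp: T11_def s'_def)
  then have T11: "T11 = {s, s'}" using pair[OF k(1) s] by auto
  have "\<rho> 4 s \<in> T11" "\<rho> 4 s \<noteq> s" using s closed st0[of 4 s] st4[of 4 s] r5 by (auto simp: T11_def)
  then have s4: "\<rho> 4 s = s'" using T11 by auto
  have s0: "\<rho> 0 s = s'" by (simp add: s'_def)
  have s'0: "\<rho> 0 s' = s" "\<rho> 4 s' = s" using s0 s4 by (metis invol)+
  have sub: "T11 \<subseteq> \<Omega>" "T10 \<subseteq> \<Omega>" "T01 \<subseteq> \<Omega>" "T00 \<subseteq> \<Omega>" by (auto simp: T)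
  have not11: False if c: "\<And>i v. i < r \<Longrightarrow> v \<in> T11 \<Longrightarrow> \<rho> i v \<in> T11"
    using not_closed[OF sub(1) s] c k n by simp
  have keep02: "\<rho> i v \<in> T11" if "v \<in> T11" "i = 0 \<or> i = 2 \<or> i = 4" for i v
    using that closed st0[of i v] st4[of i v] r5 by (auto simp: T11_def)
  \<comment> \<open>Suppose label 1 preserves \<open>T11\<close>. Label 3 does not, so it exchanges
    \<open>T11\<close> with \<open>T10\<close>; commuting with it, label 1 preserves
    \<open>T10\<close> as well, and no crossing point \<open>y1\<close> is left.\<close>
  have s1: "\<rho> 1 s \<in> T01"
  proof (rule ccontr)
    assume no: "\<rho> 1 s \<notin> T01"
    have "\<rho> 4 (\<rho> 1 s) \<noteq> \<rho> 1 s" using st4[of 1 s] s r5 by (simp add: T11_def)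
    then have s11: "\<rho> 1 s \<in> T11" using no closed[of s 1] s by (auto simp: T)
    have "\<rho> 1 s' = \<rho> 4 (\<rho> 1 s)" using c14[of s] s4 by simp
    then have k1: "\<rho> 1 v \<in> T11" if "v \<in> T11" for v using that T11 s11 keep02[of "\<rho> 1 s" 4] by auto
    have "y1 \<notin> T11" using k1[of y1] y1 by (auto simp: T11_def)
    then have "y1 \<in> T10" using y1 by (auto simp: T)
    have t0: "\<rho> 0 (\<rho> 3 (\<rho> 1 y1)) = \<rho> 3 (\<rho> 1 y1)" using st0[of 3 "\<rho> 1 y1"] y1 by simp
    have "y3 \<notin> T01 \<or> \<rho> 3 s \<in> T11"
    proof (rule ccontr)
      assume "\<not> ?thesis"
      then have y3T: "y3 \<in> T01" "\<rho> 3 s \<notin> T11" by auto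
      have "\<rho> 0 (\<rho> 3 s) \<noteq> \<rho> 3 s" using st0[of 3 s] s by (simp add: T11_def)
      then have p: "\<rho> 3 s \<in> T10" using y3T closed[of s 3] s by (auto simp: T)
      have p': "\<rho> 3 s' \<in> T10"
      proof -
        have "\<rho> 3 s' = \<rho> 0 (\<rho> 3 s)" using c03[of s] s0 by simp
        then show ?thesis using p closed st0[of 0 "\<rho> 3 s"] st4[of 0 "\<rho> 3 s"] r5 by (auto simp: T10_def)
      qed
      have "\<rho> 3 s \<noteq> \<rho> 3 s'" using s'T rho_inj by simp
      then have "T10 = {\<rho> 3 s, \<rho> 3 s'}" using p p' pair[OF k(2) p] by auto
      then have "\<rho> 3 y1 \<in> T11" using \<open>y1 \<in> T10\<close> T11 by auto
      then have "\<rho> 1 (\<rho> 3 y1) \<in> T11" by (rule k1)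
      then show False using c13[of y1] t0 by (simp add: T11_def)
    qed
    moreover have "\<not> \<rho> 3 s \<in> T11"
    proof
      assume s3: "\<rho> 3 s \<in> T11"
      have "\<rho> 3 s' = \<rho> 0 (\<rho> 3 s)" using c03[of s] s0 by simp
      then have k3: "\<rho> 3 v \<in> T11" if "v \<in> T11" for v using that T11 s3 keep02[of "\<rho> 3 s" 0] by auto
      show False by (rule not11) (use labels k1 k3 keep02 in blast)
    qed
    moreover have "y3 \<in> T01 \<or> y3 \<in> T11" using y3 by (auto simp: T)
    ultimately have y3T: "y3 \<in> T11" "\<rho> 3 s \<notin> T11" by auto
    have "\<rho> 0 (\<rho> 3 s) \<noteq> \<rho> 3 s" using st0[of 3 s] s by (simp add: T11_def)
    then have p: "\<rho> 3 s \<in> T10" using y3T closed[of s 3] s by (auto simp: T)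
    have p': "\<rho> 3 s' \<in> T10"
    proof -
      have "\<rho> 3 s' = \<rho> 0 (\<rho> 3 s)" using c03[of s] s0 by simp
      then show ?thesis using p closed st0[of 0 "\<rho> 3 s"] st4[of 0 "\<rho> 3 s"] r5 by (auto simp: T10_def)
    qed
    have "\<rho> 3 s \<noteq> \<rho> 3 s'" using s'T rho_inj by simp
    then have "T10 = {\<rho> 3 s, \<rho> 3 s'}" using p p' pair[OF k(2) p] by auto
    then have "\<rho> 3 y1 \<in> T11" using \<open>y1 \<in> T10\<close> T11 by auto
    then have "\<rho> 1 (\<rho> 3 y1) \<in> T11" by (rule k1)
    then show False using c13[of y1] t0 by (simp add: T11_def)
  qed
  have keep4: "\<rho> 4 v \<in> T01" if "v \<in> T01" for v
    using that closed st0[of 4 v] st4[of 4 v] r5 by (auto simp: T01_def)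
  have s'1: "\<rho> 1 s' = \<rho> 4 (\<rho> 1 s)" using c14[of s] s4 by simp
  have T01: "T01 = {\<rho> 1 s, \<rho> 1 s'}"
  proof -
    have "\<rho> 1 s' \<in> T01" using s'1 keep4[OF s1] by simp
    moreover have "\<rho> 1 s' \<noteq> \<rho> 1 s" using s'T rho_inj by simp
    ultimately show ?thesis using pair[OF k(3) s1] by auto
  qed
  have s3: "\<rho> 3 s \<in> T10"
  proof (rule ccontr)
    assume no: "\<rho> 3 s \<notin> T10"
    have "\<rho> 0 (\<rho> 3 s) \<noteq> \<rho> 3 s" using st0[of 3 s] s by (simp add: T11_def)
    then have s11: "\<rho> 3 s \<in> T11" using no closed[of s 3] s by (auto simp: T)
    have "\<rho> 3 s' = \<rho> 0 (\<rho> 3 s)" using c03[of s] s0 by simp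
    then have k3: "\<rho> 3 v \<in> T11" if "v \<in> T11" for v using that T11 s11 keep02[of "\<rho> 3 s" 0] by auto
    have "y3 \<notin> T11" using k3[of y3] y3 by (auto simp: T11_def)
    then have "y3 \<in> T01" using y3 by (auto simp: T)
    then obtain v where v: "v \<in> T11" "y3 = \<rho> 1 v" using T01 T11 by auto
    have "\<rho> 3 y3 = \<rho> 1 (\<rho> 3 v)" using v(2) c13[of v] by simp
    moreover have "\<rho> 1 (\<rho> 3 v) \<in> T01" using k3[OF v(1)] T11 T01 by auto
    ultimately show False using y3 by (simp add: T01_def)
  qed
  have conf: ?thesis if sx: "sx \<in> T11" "\<rho> 2 u = \<rho> 1 (\<rho> 3 sx)" and u: "u \<in> T00" "u \<notin> \<rho> 1 ` \<rho> 3 ` T11" for sx u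
  proof -
    obtain sx' where sx': "T11 = {sx, sx'}" "sx' \<noteq> sx" using pair[OF k(1) sx(1)] by auto
    have a0: "\<rho> 0 sx = sx'" "\<rho> 4 sx = sx'"
      using sx' T11 s0 s4 s'0 s'T(2) by (auto simp: doubleton_eq_iff)
    have a1: "\<rho> 1 sx \<in> T01" "\<rho> 1 sx' \<in> T01" using T01 T11 sx' by auto
    have a3: "\<rho> 3 sx \<in> T10" "\<rho> 3 sx' \<in> T10"
    proof -
      have "\<rho> 3 s' = \<rho> 0 (\<rho> 3 s)" using c03[of s] s0 by simp
      then have "\<rho> 3 s' \<in> T10" using s3 closed st0[of 0 "\<rho> 3 s"] st4[of 0 "\<rho> 3 s"] r5 by (auto simp: T10_def)
      then show "\<rho> 3 sx \<in> T10" "\<rho> 3 sx' \<in> T10" using s3 T11 sx' by (auto simp: doubleton_eq_iff)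
    qed
    define q where "q = \<rho> 1 sx" define q' where "q' = \<rho> 1 sx'"
    define p where "p = \<rho> 3 sx" define p' where "p' = \<rho> 3 sx'"
    define t where "t = \<rho> 1 p" define t' where "t' = \<rho> 1 p'"
    note defs = q_def q'_def p_def p'_def t_def t'_def
    have T10: "T10 = {p, p'}" "p \<noteq> p'"
      using pair[OF k(2) a3(1)] a3 sx'(2) rho_inj[of 3 sx sx'] by (auto simp: defs)
    have T01': "T01 = {q, q'}" "q \<noteq> q'"
      using pair[OF k(3) a1(1)] a1 sx'(2) rho_inj[of 1 sx sx'] by (auto simp: defs)
    have tq: "t = \<rho> 3 q" "t' = \<rho> 3 q'" using c13[of sx] c13[of sx'] by (simp_all add: defs)
    have tT: "t \<in> T00" "t' \<in> T00"
    proof -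
      have "\<rho> 4 t = t" "\<rho> 4 t' = t'" using st4[of 1 p] st4[of 1 p'] a3 r5 by (simp_all add: T10_def defs)
      moreover have "\<rho> 0 t = t" "\<rho> 0 t' = t'"
        using st0[of 3 q] st0[of 3 q'] a1 tq by (simp_all add: T01_def defs)
      ultimately show "t \<in> T00" "t' \<in> T00" using closed sub a3 by (auto simp: T00_def defs)
    qed
    have tne: "t \<noteq> t'" using T10(2) rho_inj by (simp add: t_def t'_def)
    have une: "u \<noteq> t" "u \<noteq> t'" using u(2) sx' by (auto simp: defs)
    have T00: "T00 = {t, t', u}"
    proof -
      have "T00 = set [t, t', u]" by (rule card_eqI[OF k(4)]) (use tT u tne une fin in auto)
      then show ?thesis by simp
    qed
    have \<Omega>eq: "\<Omega> = {sx, sx', p, p', q, q', t, t', u}" using all sx' T10 T01' T00 by auto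
    have dist: "distinct [sx, sx', p, p', q, q', t, t', u]"
      using disj sx' T10 T01' T00 tne une by auto
    have "\<rho> 1 t = p" "\<rho> 1 t' = p'" "\<rho> 1 q = sx" "\<rho> 1 q' = sx'" "\<rho> 3 p = sx" "\<rho> 3 p' = sx'"
      by (simp_all add: defs)
    moreover have "\<rho> 3 t = q" "\<rho> 3 t' = q'" using tq by simp_all
    ultimately have b: "\<rho> 1 t = p" "\<rho> 1 t' = p'" "\<rho> 1 q = sx" "\<rho> 1 q' = sx'" "\<rho> 3 p = sx" "\<rho> 3 p' = sx'"
      "\<rho> 3 t = q" "\<rho> 3 t' = q'" by blast+
    let ?Y = "{sx, sx', p, p', q, q', t, t'}"
    have uY: "u \<notin> ?Y" using dist by auto
    have fwd: "\<rho> 1 p = t" "\<rho> 1 p' = t'" "\<rho> 1 sx = q" "\<rho> 1 sx' = q'"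
      "\<rho> 3 sx = p" "\<rho> 3 sx' = p'" "\<rho> 3 q = t" "\<rho> 3 q' = t'"
      using tq by (simp_all add: defs)
    have Y: "\<forall>w\<in>?Y. \<rho> 1 w \<in> ?Y" "\<forall>w\<in>?Y. \<rho> 3 w \<in> ?Y"
      using b fwd by (simp_all del: One_nat_def)
    have u1: "\<rho> 1 u = u"
    proof -
      have "\<rho> 1 u \<notin> ?Y"
      proof
        assume "\<rho> 1 u \<in> ?Y"
        then have "\<rho> 1 (\<rho> 1 u) \<in> ?Y" by (rule bspec[OF Y(1)])
        then show False using uY by simp
      qed
      then show ?thesis using \<Omega>eq closed[of u 1] u sub by auto
    qed
    have u3: "\<rho> 3 u = u"
    proof -
      have "\<rho> 3 u \<notin> ?Y"
      proof
        assume "\<rho> 3 u \<in> ?Y"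
        then have "\<rho> 3 (\<rho> 3 u) \<in> ?Y" by (rule bspec[OF Y(2)])
        then show False using uY by simp
      qed
      then show ?thesis using \<Omega>eq closed[of u 3] u sub by auto
    qed
    have r2in: "\<rho> 2 v \<in> X" if "X = T11 \<or> X = T10 \<or> X = T01 \<or> X = T00" "v \<in> X" for X v
      using that closed[of v 2] st0[of 2 v] st4[of 2 v] r5 by (auto simp: T)
    have u2: "\<rho> 2 u = t" using sx(2) by (simp add: defs)
    then have t2: "\<rho> 2 t = u" by (metis invol)
    have t'2: "\<rho> 2 t' = t'"
    proof -
      have "\<rho> 2 t' \<in> T00" using r2in tT by blast
      moreover have "\<rho> 2 t' \<noteq> t" "\<rho> 2 t' \<noteq> u" using t2 u2 dist rho_inj by (metis distinct_length_2_or_more invol)+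
      ultimately show ?thesis using T00 by auto
    qed
    have p0: "\<rho> 0 p = p'" using c03[of sx] a0 by (simp add: defs)
    have q4: "\<rho> 4 q = q'" using c14[of sx] a0 by (simp add: defs)
    have "p \<in> T10" "p' \<in> T10" "q \<in> T01" "q' \<in> T01" "u \<in> T00" using T10 T01' T00 by auto
    then have st: "\<rho> 4 p = p" "\<rho> 4 p' = p'" "\<rho> 0 q = q" "\<rho> 0 q' = q'" "\<rho> 0 t = t" "\<rho> 0 t' = t'"
      "\<rho> 4 t = t" "\<rho> 4 t' = t'" "\<rho> 0 u = u" "\<rho> 4 u = u" using tT by (auto simp: T)
    have r2: "\<rho> 2 sx \<in> {sx, sx'}" "\<rho> 2 p \<in> {p, p'}" "\<rho> 2 q \<in> {q, q'}"
      using r2in[of T11 sx] r2in[of T10 p] r2in[of T01 q] sx' T10 T01' by auto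
    show ?thesis
      by (rule nine_points_two_fixed[OF \<Omega>eq dist])
        (use a0 p0 q4 st r2 u1 u3 u2 t'2 tq in \<open>simp_all add: defs del: One_nat_def\<close>)
  qed
  have im: "\<rho> 1 ` \<rho> 3 ` T11 = {\<rho> 1 (\<rho> 3 s), \<rho> 1 (\<rho> 3 s')}" using T11 by auto
  have "card (\<rho> 1 ` \<rho> 3 ` T11) \<le> 2" unfolding im by (simp add: card_insert_if)
  then have "\<not> T00 \<subseteq> \<rho> 1 ` \<rho> 3 ` T11" using card_mono[of "\<rho> 1 ` \<rho> 3 ` T11" T00] k(4) fin by auto
  then obtain u where u: "u \<in> T00" "u \<notin> \<rho> 1 ` \<rho> 3 ` T11" by blast
  have imT: "\<rho> 1 ` \<rho> 3 ` T11 \<subseteq> T00"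
  proof -
    have "\<rho> 1 (\<rho> 3 v) \<in> T00" if v: "v \<in> T11" for v
    proof -
      have v3: "\<rho> 3 v \<in> T10"
      proof -
        have "\<rho> 3 s' = \<rho> 0 (\<rho> 3 s)" using c03[of s] s0 by simp
        then have "\<rho> 3 s' \<in> T10" using s3 closed st0[of 0 "\<rho> 3 s"] st4[of 0 "\<rho> 3 s"] r5 by (auto simp: T10_def)
        then show ?thesis using s3 T11 v by auto
      qed
      have v1: "\<rho> 1 v \<in> T01" using T01 T11 v by auto
      have "\<rho> 4 (\<rho> 1 (\<rho> 3 v)) = \<rho> 1 (\<rho> 3 v)" using st4[of 1 "\<rho> 3 v"] v3 r5 by (simp add: T10_def)
      moreover have "\<rho> 0 (\<rho> 1 (\<rho> 3 v)) = \<rho> 1 (\<rho> 3 v)" using st0[of 3 "\<rho> 1 v"] v1 c13[of v] by (simp add: T01_def)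
      ultimately show ?thesis using closed sub v by (auto simp: T00_def)
    qed
    then show ?thesis by blast
  qed
  have T00u: "T00 = insert u (\<rho> 1 ` \<rho> 3 ` T11)"
  proof -
    have inj: "\<rho> 1 (\<rho> 3 s) \<noteq> \<rho> 1 (\<rho> 3 s')" using s'T rho_inj by metis
    have "T00 = set [u, \<rho> 1 (\<rho> 3 s), \<rho> 1 (\<rho> 3 s')]"
      by (rule card_eqI[OF k(4)]) (use u im imT inj fin in auto)
    then show ?thesis using im by simp
  qed
  \<comment> \<open>Otherwise all labels fix \<open>u\<close>: its possible partners under labels 1
    and 3 are already matched within the two squares.\<close>
  have "\<rho> 2 u \<noteq> u"
  proof
    assume u2: "\<rho> 2 u = u"
    have nT: "v \<notin> T00" if "v \<in> T10 \<or> v \<in> T01" for v using that by (auto simp: T)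
    have bad: "\<rho> i u = u" if i: "i = 1 \<or> i = 3" for i
    proof (rule ccontr)
      assume ne: "\<rho> i u \<noteq> u"
      consider "\<rho> i u \<in> T00" | "\<rho> i u \<in> T10" | "\<rho> i u \<in> T01" | "\<rho> i u \<in> T11"
        using closed[of u i] u by (auto simp: T)
      then show False
      proof cases
        case 1
        then obtain v where v: "v \<in> T11" "\<rho> i u = \<rho> 1 (\<rho> 3 v)" using T00u ne by auto
        from i show False
        proof
          assume "i = 1"
          then have "u = \<rho> 3 v" using v(2) rho_inj by blast
          then show False using v(1) u s3 st0[of 3 v] by (auto simp: T)
        next
          assume "i = 3"
          then have "u = \<rho> 1 v" using v(2) c13[of v] rho_inj by metis
          then show False using v(1) u st4[of 1 v] r5 by (auto simp: T)
        qed
      next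
        case 2
        have "i = 1" using i 2 u st0[of 3 u] by (auto simp: T)
        have "card (\<rho> 3 ` T11) = 2" using k(1) by (subst card_image) (auto simp: inj_on_def rho_inj)
        moreover have "\<rho> 3 ` T11 \<subseteq> T10"
        proof -
          have "\<rho> 3 s' = \<rho> 0 (\<rho> 3 s)" using c03[of s] s0 by simp
          then have "\<rho> 3 s' \<in> T10" using s3 closed st0[of 0 "\<rho> 3 s"] st4[of 0 "\<rho> 3 s"] r5 by (auto simp: T10_def)
          then show ?thesis using s3 T11 by auto
        qed
        ultimately have "\<rho> 3 ` T11 = T10" using k(2) fin by (intro card_subset_eq) auto
        then obtain v where "v \<in> T11" "\<rho> 1 u = \<rho> 3 v" using 2 \<open>i = 1\<close> by auto
        then have "u = \<rho> 1 (\<rho> 3 v)" by (metis invol)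
        then show False using u \<open>v \<in> T11\<close> by blast
      next
        case 3
        have "i = 3" using i 3 u st4[of 1 u] r5 by (auto simp: T)
        obtain v where "v \<in> T11" "\<rho> 3 u = \<rho> 1 v" using 3 \<open>i = 3\<close> T01 T11 by auto
        then have "u = \<rho> 1 (\<rho> 3 v)" by (metis invol c13)
        then show False using u \<open>v \<in> T11\<close> by blast
      next
        case 4
        then show False using i u st4[of 1 u] st0[of 3 u] r5 by (auto simp: T)
      qed
    qed
    show False
    proof (rule not_closed[of "{u}" u])
      fix i y assume "i < r" "y \<in> {u}"
      then show "\<rho> i y \<in> {u}" using labels[of i] bad u2 u by (auto simp: T00_def)
    qed (use u sub n in auto)
  qed
  moreover have "\<rho> 2 u \<in> T00" using u(1) closed[of u 2] st0[of 2 u] st4[of 2 u] r5 by (auto simp: T00_def)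
  ultimately obtain sx where "sx \<in> T11" "\<rho> 2 u = \<rho> 1 (\<rho> 3 sx)" using T00u by auto
  then show ?thesis using conf u by blast
qed

end

section \<open>Strings from labelled paths\<close>

definition three_cycle_map :: "'a \<Rightarrow> 'a \<Rightarrow> 'a \<Rightarrow> 'a \<Rightarrow> 'a" where
  "three_cycle_map a b c x = (if x = a then b else if x = b then c else if x = c then a else x)"

lemma three_cycle_map_rotate: "distinct [a, b, c] \<Longrightarrow> three_cycle_map a b c = three_cycle_map b c a"
  by (auto simp: three_cycle_map_def fun_eq_iff)

lemma three_cycle_map_square:
  "distinct [a, b, c] \<Longrightarrow> three_cycle_map a b c \<circ> three_cycle_map a b c = three_cycle_map b a c"
  by (auto simp: three_cycle_map_def fun_eq_iff)

lemma three_cycle_map_inverse: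
  "distinct [a, b, c] \<Longrightarrow> three_cycle_map a b c (three_cycle_map b a c x) = x"
  by (auto simp: three_cycle_map_def)

lemma three_cycle_map_conjugate:
  assumes "\<And>x. g (h x) = x" "\<And>x. h (g x) = x"
  shows "g \<circ> three_cycle_map a b c \<circ> h = three_cycle_map (g a) (g b) (g c)"
proof
  fix x
  have "h x = y \<longleftrightarrow> x = g y" for y using assms by metis
  then show "(g \<circ> three_cycle_map a b c \<circ> h) x = three_cycle_map (g a) (g b) (g c) x"
    using assms(1)[of x] by (simp add: three_cycle_map_def)
qed

definition all_three_cycles :: "('a \<Rightarrow> 'a) set \<Rightarrow> 'a set \<Rightarrow> bool" where
  "all_three_cycles H X \<longleftrightarrow> (\<forall>a\<in>X. \<forall>b\<in>X. \<forall>c\<in>X. distinct [a, b, c] \<longrightarrow> three_cycle_map a b c \<in> H)"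

context
  fixes H :: "('a \<Rightarrow> 'a) set"
  assumes comp: "f \<in> H \<Longrightarrow> g \<in> H \<Longrightarrow> f \<circ> g \<in> H"
begin

lemma three_cycle_map_swap:
  "three_cycle_map a b c \<in> H \<Longrightarrow> distinct [a, b, c] \<Longrightarrow> three_cycle_map b a c \<in> H"
  using three_cycle_map_square comp by metis

lemma three_cycle_map_conj_mem:
  assumes "three_cycle_map u v w \<in> H" "distinct [u, v, w]" "three_cycle_map a b c \<in> H"
  shows "three_cycle_map (three_cycle_map u v w a) (three_cycle_map u v w b) (three_cycle_map u v w c) \<in> H"
proof -
  have d: "distinct [v, u, w]" using assms(2) by auto
  have "three_cycle_map u v w \<circ> three_cycle_map a b c \<circ> three_cycle_map v u w \<in> H"
    using comp[OF comp[OF assms(1,3)] three_cycle_map_swap[OF assms(1,2)]] .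
  then show ?thesis
    using three_cycle_map_conjugate[OF three_cycle_map_inverse[OF assms(2)] three_cycle_map_inverse[OF d]]
    by metis
qed

lemma all_three_cycles_triple:
  assumes "distinct [a, b, c]" "three_cycle_map a b c \<in> H" shows "all_three_cycles H {a, b, c}"
proof -
  have ac: "distinct [b, c, a]" "distinct [c, a, b]" using assms(1) by auto
  have r: "three_cycle_map b c a \<in> H" "three_cycle_map c a b \<in> H"
    using assms(2) three_cycle_map_rotate[OF assms(1)] three_cycle_map_rotate[OF ac(1)] by simp_all
  have s: "three_cycle_map b a c \<in> H" "three_cycle_map c b a \<in> H" "three_cycle_map a c b \<in> H"
    using three_cycle_map_swap[OF assms(2,1)] three_cycle_map_swap[OF r(1) ac(1)] three_cycle_map_swap[OF r(2) ac(2)]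
    by simp_all
  show ?thesis using assms r s by (auto simp: all_three_cycles_def)
qed

text \<open>Call a pair good if its three-cycle with \<open>z\<close> is in \<open>H\<close>.
  Conjugation with the three-cycles of \<open>X\<close> replaces one member of a good pair at a
  time, so all pairs become good.\<close>

lemma all_three_cycles_insert:
  assumes X: "all_three_cycles H X" and z: "z \<notin> X"
    and ab: "a \<in> X" "b \<in> X" "a \<noteq> b" "three_cycle_map a b z \<in> H"
  shows "all_three_cycles H (insert z X)"
proof -
  define R where "R x y \<longleftrightarrow> x \<in> X \<and> y \<in> X \<and> x \<noteq> y \<and> three_cycle_map x y z \<in> H" for x y
  have step: "R v x" if R: "R u v" and x: "x \<in> X" "x \<noteq> v" for u v x
  proof (cases "x = u")
    case True
    then show ?thesis using R z three_cycle_map_swap[of u v z] by (auto simp: R_def)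
  next
    case False
    have d: "distinct [u, v, x]" using R x False by (auto simp: R_def)
    have "three_cycle_map u v x \<in> H" using X R x d by (auto simp: R_def all_three_cycles_def)
    from three_cycle_map_conj_mem[OF this d, of u v z] show ?thesis
      using R x d z by (auto simp: R_def three_cycle_map_def split: if_splits)
  qed
  have R: "R a b" using ab by (simp add: R_def)
  have all: "R x y" if "x \<in> X" "y \<in> X" "x \<noteq> y" for x y
  proof (cases "x = b")
    case True then show ?thesis using step[OF R, of y] that by simp
  next
    case False then show ?thesis using step[OF step[OF R that(1)], of y] that by simp
  qed
  show ?thesis unfolding all_three_cycles_def
  proof (intro ballI impI)
    fix u v w assume m: "u \<in> insert z X" "v \<in> insert z X" "w \<in> insert z X" and d: "distinct [u, v, w]"
    have d': "distinct [v, w, u]" using d by auto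
    consider "u \<in> X" "v \<in> X" "w \<in> X" | "w = z" "u \<in> X" "v \<in> X" | "u = z" "v \<in> X" "w \<in> X" | "v = z" "w \<in> X" "u \<in> X"
      using m d by auto
    then show "three_cycle_map u v w \<in> H"
    proof cases
      case 1 then show ?thesis using X d by (auto simp: all_three_cycles_def)
    next
      case 2 then show ?thesis using all[of u v] d by (auto simp: R_def)
    next
      case 3 then show ?thesis using all[of v w] d three_cycle_map_rotate[OF d] by (auto simp: R_def)
    next
      case 4
      then show ?thesis using all[of w u] d three_cycle_map_rotate[OF d] three_cycle_map_rotate[OF d']
        by (auto simp: R_def)
    qed
  qed
qed

end

lemma carrier_from_three_cycles:
  assumes S: "S \<subseteq> carrier (alt_group n)" and all: "all_three_cycles (generate (alt_group n) S) {1..n}"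
  shows "generate (alt_group n) S = carrier (alt_group n)"
proof
  show "generate (alt_group n) S \<subseteq> carrier (alt_group n)"
    by (rule group.generate_incl[OF alt_group_is_group S])
  have "three_cycles n \<subseteq> generate (alt_group n) S"
  proof
    fix p assume "p \<in> three_cycles n"
    then obtain cs where cs: "p = cycle_of_list cs" "distinct cs" "length cs = 3" "set cs \<subseteq> {1..n}" by auto
    then obtain u v w where c: "cs = [u, v, w]"
      by (auto simp: numeral_3_eq_3 length_Suc_conv)
    have "p = three_cycle_map u v w" using cs c by (auto simp: three_cycle_map_def fun_eq_iff transpose_def)
    then show "p \<in> generate (alt_group n) S" using all cs c by (auto simp: all_three_cycles_def)
  qed
  moreover have "subgroup (generate (alt_group n) S) (alt_group n)"
    by (rule group.generate_is_subgroup[OF alt_group_is_group S])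
  ultimately show "carrier (alt_group n) \<subseteq> generate (alt_group n) S"
    unfolding alt_group_carrier_as_three_cycles
    by (rule group.generate_subgroup_incl[OF alt_group_is_group])
qed

text \<open>\<open>E k\<close> belongs to the edge between \<open>k\<close> and
  \<open>Suc k\<close>. By \<open>adjacent\<close>, labels on neighbouring edges differ by one, so
  labels that have to commute meet only along a common edge. Evenness of the permutations is
  \<open>even_label\<close>; \<open>single\<close> serves independence, as it gives each label an
  edge bridged by no other.\<close>

locale labelled_path =
  fixes E :: "nat \<Rightarrow> nat set" and n r :: nat
  assumes edges: "E k \<noteq> {} \<longleftrightarrow> 1 \<le> k \<and> k < n"
    and label_less: "i \<in> E k \<Longrightarrow> i < r"
    and adjacent: "i \<in> E k \<Longrightarrow> j \<in> E (Suc k) \<Longrightarrow> i = Suc j \<or> j = Suc i"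
    and even_label: "even (card {k. i \<in> E k})"
    and single: "i < r \<Longrightarrow> \<exists>k. E k = {i}"
begin

definition shift :: "nat \<Rightarrow> nat \<Rightarrow> nat" where
  "shift i x = (if i \<in> E x then Suc x else if i \<in> E (x - 1) then x - 1 else x)"

lemma edge_range: "i \<in> E k \<Longrightarrow> 1 \<le> k \<and> k < n"
  using edges by blast

lemma no_edge [simp]: "i \<notin> E 0" using edge_range[of i 0] by auto

lemma shift_involution [simp]: "shift i (shift i x) = x"
proof (cases x)
  case (Suc y)
  show ?thesis using adjacent[of i x i] adjacent[of i "y - 1" i] adjacent[of i y i] Suc
    by (cases y) (auto simp: shift_def)
qed (auto simp: shift_def dest: adjacent)

lemma shift_commute:
  assumes "Suc i < j \<or> Suc j < i" shows "shift i (shift j x) = shift j (shift i x)"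
proof -
  have a: "j \<notin> E (Suc k)" if "i \<in> E k" for k using adjacent[OF that, of j] assms by auto
  have b: "i \<notin> E (Suc k)" if "j \<in> E k" for k using adjacent[OF that, of i] assms by auto
  have c: "i \<notin> E (Suc k)" if "i \<in> E k" for k using adjacent[OF that, of i] by auto
  have d: "j \<notin> E (Suc k)" if "j \<in> E k" for k using adjacent[OF that, of j] by auto
  note a' = a[of "x - 2"] b[of "x - 2"] c[of "x - 2"] d[of "x - 2"]
    a[of "x - 1"] b[of "x - 1"] c[of "x - 1"] d[of "x - 1"] a[of x] b[of x] c[of x] d[of x]
  consider "x = 0" | "x = 1" | y where "x = Suc (Suc y)" by (metis One_nat_def not0_implies_Suc)
  then show ?thesis
    by cases (use a' in \<open>auto simp: shift_def numeral_2_eq_2\<close>)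
qed

lemma moved_points: "{y \<in> {1..n}. shift i y \<noteq> y} = {k. i \<in> E k} \<union> Suc ` {k. i \<in> E k}"
proof (rule Set.set_eqI)
  fix y
  show "y \<in> {y \<in> {1..n}. shift i y \<noteq> y} \<longleftrightarrow> y \<in> {k. i \<in> E k} \<union> Suc ` {k. i \<in> E k}"
    using edge_range[of i y] edge_range[of i "y - 1"] adjacent[of i "y - 1" i]
    by (cases y) (auto simp: shift_def)
qed

lemma shift_permutes: "shift i permutes {1..n}"
proof (rule bij_imp_permutes)
  show "bij_betw (shift i) {1..n} {1..n}"
  proof (rule bij_betw_byWitness[where f' = "shift i"])
    show "shift i ` {1..n} \<subseteq> {1..n}"
    proof
      fix z assume "z \<in> shift i ` {1..n}"
      then obtain y where y: "y \<in> {1..n}" "z = shift i y" by blast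
      show "z \<in> {1..n}"
        using y edge_range[of i y] edge_range[of i "y - 1"] by (auto simp: shift_def)
    qed
    then show "shift i ` {1..n} \<subseteq> {1..n}" .
  qed auto
  show "\<And>x. x \<notin> {1..n} \<Longrightarrow> shift i x = x"
    using edge_range[of i] unfolding shift_def by fastforce
qed

lemma shift_carrier: "shift i \<in> carrier (alt_group n)"
proof -
  have fin: "finite {k. i \<in> E k}" by (rule finite_subset[of _ "{..n}"]) (auto dest: edge_range)
  have "card ({k. i \<in> E k} \<union> Suc ` {k. i \<in> E k}) = card {k. i \<in> E k} + card (Suc ` {k. i \<in> E k})"
    by (rule card_Un_disjoint) (use fin adjacent[of i _ i] in auto)
  then have "card {y \<in> {1..n}. shift i y \<noteq> y} = 2 * card {k. i \<in> E k}"
    unfolding moved_points by (simp add: card_image)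
  then have "card {y \<in> {1..n}. shift i y \<noteq> y} mod 4 = 0" using even_label[of i] by (auto elim!: evenE)
  then show ?thesis
    using evenperm_involution[of "{1..n}" "shift i"] shift_permutes by (simp add: alt_group_carrier)
qed

definition strings where "strings = map shift [0..<r]"

lemma set_strings: "set strings = shift ` {..<r}" by (auto simp: strings_def)

lemma shift_neq: assumes "E k = {i}" "i \<noteq> j" shows "shift j k < Suc k"
  using assms by (auto simp: shift_def)

lemma distinct_strings: "distinct strings"
proof -
  have "inj_on shift {..<r}"
  proof (rule inj_onI)
    fix i j assume ij: "i \<in> {..<r}" "j \<in> {..<r}" "shift i = shift j"
    obtain k where k: "E k = {i}" using single ij by blast
    then have "shift i k = Suc k" by (simp add: shift_def)
    then show "i = j" using shift_neq[OF k, of j] ij by auto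
  qed
  then show ?thesis by (simp add: strings_def distinct_map lessThan_atLeast0)
qed

definition H where "H = generate (alt_group n) (set strings)"

lemma shift_H: "i < r \<Longrightarrow> shift i \<in> H"
  unfolding H_def by (rule generate.incl) (simp add: set_strings)

lemma comp_H: "f \<in> H \<Longrightarrow> g \<in> H \<Longrightarrow> f \<circ> g \<in> H"
  unfolding H_def using generate.eng[of f "alt_group n" _ g] by (simp add: alt_group_mult)

lemma three_cycle_map_shift:
  assumes "i < r" "three_cycle_map a b c \<in> H"
  shows "three_cycle_map (shift i a) (shift i b) (shift i c) \<in> H"
proof -
  have "shift i \<circ> three_cycle_map a b c \<circ> shift i \<in> H" using assms shift_H comp_H by blast
  then show ?thesis using three_cycle_map_conjugate[of "shift i" "shift i" a b c] by simp
qed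

text \<open>Conjugation with label \<open>i\<close> carries a three-cycle of \<open>X\<close> to one
  with a single new point.\<close>

lemma all_three_cycles_extend:
  assumes X: "all_three_cycles H X" and i: "i < r" and z: "z \<in> X" "shift i z \<notin> X"
    and uv: "u \<in> X" "v \<in> X" "u \<noteq> v" "shift i u \<in> X" "shift i v \<in> X"
  shows "all_three_cycles H (insert (shift i z) X)"
proof (rule all_three_cycles_insert[OF comp_H X z(2) uv(4,5)])
  have ne: "u \<noteq> z" "v \<noteq> z" using z uv by auto
  show "shift i u \<noteq> shift i v" using uv(3) by (metis shift_involution)
  have "three_cycle_map u v z \<in> H" using X uv z ne by (auto simp: all_three_cycles_def)
  from three_cycle_map_shift[OF i this]
  show "three_cycle_map (shift i u) (shift i v) (shift i z) \<in> H" .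
qed

text \<open>The first extension is the critical one: with only three points at hand, the label
  \<open>g\<close> that leads to \<open>a + 3\<close> must keep the other two inside, so it must not
  occur on the edge before \<open>a\<close>.\<close>

context
  fixes a g
  assumes a: "1 \<le> a" and g: "g \<in> E (a + 2)" "g \<notin> E (a - 1)"
    and base: "three_cycle_map a (a + 1) (a + 2) \<in> H"
begin

lemma three_cycles_four: "all_three_cycles H {a..a + 3}"
proof -
  have X: "all_three_cycles H {a, a + 1, a + 2}"
    by (rule all_three_cycles_triple[OF comp_H _ base]) simp_all
  have ng: "g \<notin> E (a + 1)" using adjacent[of g "a + 1" g] g by auto
  have s: "shift g (a + 2) = a + 3" "shift g a \<in> {a, a + 1}" "shift g (a + 1) \<in> {a, a + 1}"
    using g ng by (auto simp: shift_def)
  have "all_three_cycles H (insert (shift g (a + 2)) {a, a + 1, a + 2})"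
    by (rule all_three_cycles_extend[OF X label_less[OF g(1)], where u = a and v = "a + 1"]) (use s in auto)
  moreover have "insert (a + 3) {a, a + 1, a + 2} = {a..a + 3}" by auto
  ultimately show ?thesis using s by simp
qed

lemma three_cycles_right:
  assumes "a + 3 + k \<le> n" shows "all_three_cycles H {a..a + 3 + k}"
  using assms
proof (induction k)
  case 0 then show ?case using three_cycles_four by simp
next
  case (Suc k)
  let ?b = "a + 3 + k"
  obtain i where i: "i \<in> E ?b" using edges[of ?b] a Suc.prems by auto
  have "Suc (?b - 1) = ?b" by simp
  then have ni: "i \<notin> E (?b - 1)" using adjacent[of i "?b - 1" i] i n_not_Suc_n by metis
  have s: "shift i ?b = Suc ?b" using i by (simp add: shift_def)
  have t: "shift i u \<in> {a..?b}" if "a < u" "u < ?b" for u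
    using that ni by (auto simp: shift_def)
  have "all_three_cycles H (insert (shift i ?b) {a..?b})"
    by (rule all_three_cycles_extend[OF _ label_less[OF i], where u = "a + 1" and v = "a + 2"])
      (use s t[of "a + 1"] t[of "a + 2"] Suc in auto)
  moreover have "insert (Suc ?b) {a..?b} = {a..a + 3 + Suc k}" by auto
  ultimately show ?case using s by simp
qed

lemma three_cycles_left:
  assumes "k < a" "a + 3 \<le> n" shows "all_three_cycles H {a - k..n}"
  using assms
proof (induction k)
  case 0
  then show ?case using three_cycles_right[of "n - (a + 3)"] by simp
next
  case (Suc k)
  let ?b = "a - k"
  have b: "?b - 1 = a - Suc k" "1 \<le> ?b - 1" "?b + 3 \<le> n" using Suc.prems by auto
  obtain i where i: "i \<in> E (?b - 1)" using edges[of "?b - 1"] b by fastforce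
  have "Suc (?b - 1) = ?b" using b by linarith
  then have ni: "i \<notin> E ?b" using adjacent[of i "?b - 1" i] i n_not_Suc_n by metis
  have s: "shift i ?b = ?b - 1" using i ni by (simp add: shift_def)
  have t: "shift i u \<in> {?b..n}" if "?b < u" "u < n" for u
    using that by (auto simp: shift_def)
  have "all_three_cycles H (insert (shift i ?b) {?b..n})"
    by (rule all_three_cycles_extend[OF _ label_less[OF i], where u = "?b + 1" and v = "?b + 2"])
      (use s t[of "?b + 1"] t[of "?b + 2"] b Suc in auto)
  moreover have "insert (?b - 1) {?b..n} = {a - Suc k..n}" using b by auto
  ultimately show ?case using s by simp
qed

lemma carrier_strings: "carrier (alt_group n) = H"
  unfolding H_def
proof (rule carrier_from_three_cycles[symmetric])
  show "set strings \<subseteq> carrier (alt_group n)" using shift_carrier by (auto simp: set_strings)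
  have "a + 3 \<le> n" using edge_range[OF g(1)] by auto
  then have "all_three_cycles H {1..n}" using three_cycles_left[of "a - 1"] a by simp
  then show "all_three_cycles (generate (alt_group n) (set strings)) {1..n}" by (simp only: H_def)
qed

lemma path_sggi: "sggi (alt_group n) strings"
proof -
  have inv: "involution (alt_group n) (shift i)" if i: "i < r" for i
  proof -
    obtain k where "E k = {i}" using single[OF i] by blast
    then have "shift i k \<noteq> id k" by (simp add: shift_def)
    then have "shift i \<noteq> id" by metis
    then show ?thesis using shift_carrier
      by (auto simp: involution_def alt_group_square alt_group_one fun_eq_iff)
  qed
  have com: "(shift i \<circ> shift j) \<circ> (shift i \<circ> shift j) = id" if "\<bar>int i - int j\<bar> \<noteq> 1" for i j
  proof (cases "i = j")
    case False
    then have "Suc i < j \<or> Suc j < i" using that by linarith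
    then show ?thesis using shift_commute[of i j] by (auto simp: fun_eq_iff)
  qed (auto simp: fun_eq_iff)
  show ?thesis
    unfolding sggi_def alt_group_square
    using alt_group_is_group distinct_strings inv com carrier_strings
    by (auto simp: set_strings H_def strings_def alt_group_mult alt_group_one)
qed

lemma path_independent: "independent_generating_set (alt_group n) (set strings)"
proof -
  have "shift i \<notin> generate (alt_group n) (set strings - {shift i})" if i: "i < r" for i
  proof -
    obtain k where k: "E k = {i}" using single[OF i] by blast
    have le: "shift j x \<le> k" if "j \<noteq> i" "x \<le> k" for j x
    proof (cases "x = k")
      case True
      then have "j \<notin> E x" using that(1) k by simp
      then show ?thesis using that(2) by (auto simp: shift_def)
    next
      case False
      then show ?thesis using that(2) by (auto simp: shift_def)
    qed
    have le': "shift j x \<le> k" if "shift j \<noteq> shift i" "x \<le> k" for j x using le[of j x] that by blast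
    have "\<forall>x\<le>k. p x \<le> k" if "p \<in> generate (alt_group n) (set strings - {shift i})" for p
      using that
    proof (induction rule: generate.induct)
      case (incl h) then show ?case using le' by (auto simp: set_strings)
    next
      case (inv h)
      then have "inv\<^bsub>alt_group n\<^esub> h = h" using inv_generator[OF path_sggi] by blast
      then show ?case using inv le' by (auto simp: set_strings)
    qed (auto simp: alt_group_one alt_group_mult)
    moreover have "shift i k = Suc k" using k by (simp add: shift_def)
    ultimately show ?thesis by force
  qed
  then show ?thesis
    using carrier_strings shift_carrier by (auto simp: independent_generating_set_def set_strings H_def)
qed

lemma path_rank: "r \<in> sggi_ranks (alt_group n)"
proof -
  have "card (set strings) = r" using distinct_card[OF distinct_strings] by (simp add: strings_def)
  then show ?thesis using path_sggi path_independent by (auto simp: sggi_ranks_def sggi_of_rank_def)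
qed

end

lemma boundary_three_cycle:
  assumes p: "h \<in> E (p - 1)" "g \<in> E p" and sep: "\<And>k. h \<in> E k \<Longrightarrow> k < p" "\<And>k. g \<in> E k \<Longrightarrow> p \<le> k"
  shows "three_cycle_map (p - 1) p (p + 1) \<in> H"
proof -
  have hr: "h < r" "g < r" using label_less p by auto
  have p2: "2 \<le> p" using edge_range[OF p(1)] by auto
  have nh: "h \<notin> E k" if "p \<le> k" for k using sep(1)[of k] that by auto
  have ng: "g \<notin> E k" if "k < p" for k using sep(2)[of k] that by auto
  have nh2: "h \<notin> E (p - 2)" using adjacent[of h "p - 2" h] p(1) p2 by (auto simp: numeral_2_eq_2 Suc_diff_Suc)
  have ng2: "g \<notin> E (Suc p)" using adjacent[of g p g] p(2) by auto
  let ?f = "shift g \<circ> shift h"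
  have "?f \<circ> ?f = three_cycle_map (p - 1) p (p + 1)"
  proof
    fix x
    have ph: "shift h (p - 1) = p" "shift h p = p - 1" "shift h (p + 1) = p + 1"
      using p p2 nh[of p] nh[of "p + 1"] nh2 by (auto simp: shift_def)
    have pg: "shift g (p - 1) = p - 1" "shift g p = p + 1" "shift g (p + 1) = p"
      using p p2 ng[of "p - 1"] ng[of "p - 2"] ng2 by (auto simp: shift_def numeral_2_eq_2)
    consider "x < p - 1" | "x = p - 1" | "x = p" | "x = p + 1" | "p + 1 < x" by linarith
    then show "(?f \<circ> ?f) x = three_cycle_map (p - 1) p (p + 1) x"
    proof cases
      case 1
      then have "shift h x < p - 1"
        using nh2 by (cases "x = p - 2") (auto simp: shift_def)
      then have "shift g (shift h x) = shift h x" "shift g x = x"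
        using ng 1 by (auto simp: shift_def)
      moreover have "x \<noteq> p - 1" "x \<noteq> p" "x \<noteq> p + 1" using 1 by auto
      ultimately show ?thesis by (simp add: three_cycle_map_def)
    next
      case 5
      then have "p + 1 < shift g x"
        using ng2 by (cases "x = p + 2") (auto simp: shift_def)
      then have "shift h (shift g x) = shift g x" "shift h x = x"
        using nh 5 by (auto simp: shift_def)
      moreover have "x \<noteq> p - 1" "x \<noteq> p" "x \<noteq> p + 1" using 5 by auto
      ultimately show ?thesis by (simp add: three_cycle_map_def)
    qed (use ph pg p2 in \<open>auto simp: three_cycle_map_def\<close>)
  qed
  moreover have "?f \<circ> ?f \<in> H" using hr shift_H comp_H by blast
  ultimately show ?thesis by simp
qed

end

section \<open>Paths composed of blocks, and their ranks\<close>

definition edge_labels :: "nat set list \<Rightarrow> nat \<Rightarrow> nat set" where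
  "edge_labels L k = (if 1 \<le> k \<and> k \<le> length L then L ! (k - 1) else {})"

lemma edge_labels_Suc [simp]: "edge_labels L (Suc k) = (if k < length L then L ! k else {})"
  by (auto simp: edge_labels_def)

lemma edge_labels_zero [simp]: "edge_labels L 0 = {}"
  by (simp add: edge_labels_def)

lemma edge_labels_iff: "i \<in> edge_labels L k \<longleftrightarrow> (\<exists>l<length L. k = Suc l \<and> i \<in> L ! l)"
  by (cases k) simp_all

lemma labelled_path_list:
  assumes sub: "\<forall>X\<in>set L. X \<noteq> {} \<and> X \<subseteq> {..<r}"
    and adj: "successively (\<lambda>X Y. \<forall>i\<in>X. \<forall>j\<in>Y. i = Suc j \<or> j = Suc i) L"
    and cnt: "\<forall>i<r. even (length (filter (\<lambda>X. i \<in> X) L))"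
    and single: "\<forall>i<r. {i} \<in> set L"
  shows "labelled_path (edge_labels L) (Suc (length L)) r"
proof unfold_locales
  have mem: "L ! l \<noteq> {} \<and> L ! l \<subseteq> {..<r}" if "l < length L" for l using sub nth_mem[OF that] by blast
  show "edge_labels L k \<noteq> {} \<longleftrightarrow> 1 \<le> k \<and> k < Suc (length L)" for k
  proof (cases k)
    case (Suc l)
    show ?thesis unfolding Suc using mem[of l] by simp
  qed simp
  show less: "i < r" if "i \<in> edge_labels L k" for i k
    using that mem unfolding edge_labels_iff by blast
  show "i = Suc j \<or> j = Suc i" if ij: "i \<in> edge_labels L k" "j \<in> edge_labels L (Suc k)" for i j k
  proof -
    obtain l where l: "i \<in> L ! l" "j \<in> L ! Suc l" "Suc l < length L" using ij unfolding edge_labels_iff by blast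
    then show ?thesis using adj unfolding successively_conv_nth by blast
  qed
  show "even (card {k. i \<in> edge_labels L k})" for i
  proof (cases "i < r")
    case True
    have "{k. i \<in> edge_labels L k} = Suc ` {k. k < length L \<and> i \<in> L ! k}"
      unfolding edge_labels_iff image_def by blast
    then have "card {k. i \<in> edge_labels L k} = length (filter (\<lambda>X. i \<in> X) L)"
      by (simp add: card_image length_filter_conv_card)
    then show ?thesis using cnt True by metis
  next
    case False
    then have "{k. i \<in> edge_labels L k} = {}" using less by blast
    then show ?thesis by simp
  qed
  show "\<exists>k. edge_labels L k = {i}" if "i < r" for i
  proof -
    have "{i} \<in> set L" using single that by blast
    then obtain k where k: "k < length L" "L ! k = {i}" unfolding in_set_conv_nth by blast
    show ?thesis by (rule exI[of _ "Suc k"]) (simp add: k)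
  qed
qed

text \<open>At a point where the labels used so far are replaced by new ones, the two adjacent
  generators overlap in that point only, so the square of their product is a three-cycle.\<close>

lemma rank_from_boundary:
  assumes path: "labelled_path (edge_labels (A @ B)) (Suc (length (A @ B))) r"
    and A: "A \<noteq> []" "\<forall>X\<in>set A. X \<subseteq> {..<s}" and B: "2 \<le> length B" "\<forall>X\<in>set B. X \<subseteq> {s..}"
  shows "r \<in> sggi_ranks (alt_group (Suc (length (A @ B))))"
proof -
  interpret labelled_path "edge_labels (A @ B)" "Suc (length (A @ B))" r by (rule path)
  let ?E = "edge_labels (A @ B)" and ?p = "Suc (length A)"
  have ne: "?E k \<noteq> {}" if "1 \<le> k" "k < Suc (length (A @ B))" for k using edges that by blast
  have low: "i < s" if ik: "i \<in> ?E k" "k < ?p" for i k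
  proof -
    obtain l where l: "l < length A" "i \<in> A ! l" using ik unfolding edge_labels_iff by (auto simp: nth_append)
    then show ?thesis using A(2) nth_mem[OF l(1)] by blast
  qed
  have high: "s \<le> i" if ik: "i \<in> ?E k" "?p \<le> k" for i k
  proof -
    obtain l where l: "l < length A + length B" "k = Suc l" "i \<in> (A @ B) ! l" using ik unfolding edge_labels_iff by auto
    then have "l - length A < length B" "i \<in> B ! (l - length A)" using ik(2) by (auto simp: nth_append)
    then show ?thesis using B(2) nth_mem[of "l - length A" B] by blast
  qed
  obtain h where h: "h \<in> ?E (length A)" using ne[of "length A"] A(1) by (auto simp: Suc_le_eq)
  obtain g where g: "g \<in> ?E ?p" using ne[of ?p] B(1) by fastforce
  obtain g' where g': "g' \<in> ?E (Suc ?p)" using ne[of "Suc ?p"] B(1) by auto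
  have "three_cycle_map (?p - 1) ?p (?p + 1) \<in> H"
  proof (rule boundary_three_cycle)
    show "k < ?p" if "h \<in> ?E k" for k using high[OF that] low[OF h] by fastforce
    show "?p \<le> k" if "g \<in> ?E k" for k using low[OF that] high[OF g] by fastforce
  qed (use h g in auto)
  then have base: "three_cycle_map (length A) (length A + 1) (length A + 2) \<in> H" by simp
  show ?thesis
  proof (rule path_rank[OF _ _ _ base])
    show "1 \<le> length A" using A(1) by (simp add: Suc_le_eq)
    show "g' \<in> ?E (length A + 2)" using g' by simp
    show "g' \<notin> ?E (length A - 1)"
      using low[of g' "length A - 1"] high[OF g'] by (metis diff_le_self le_imp_less_Suc le_SucI linorder_not_less order_refl)
  qed
qed

text \<open>The label sets along the edges of a path. A block of five edges uses up three labels and a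
  block of four edges two labels, every label occurring twice. Eleven edges cannot be
  composed of such blocks, so twelve points need a path of their own.\<close>

fun chunk_path :: "nat \<Rightarrow> nat \<Rightarrow> nat \<Rightarrow> nat set list" where
  "chunk_path s (Suc a) b = [{s}, {Suc s}, {s, Suc (Suc s)}, {Suc s}, {Suc (Suc s)}] @ chunk_path (s + 3) a b"
| "chunk_path s 0 (Suc b) = [{s}, {Suc s}, {s}, {Suc s}] @ chunk_path (s + 2) 0 b"
| "chunk_path s 0 0 = []"

lemma length_chunk_path: "length (chunk_path s a b) = 5 * a + 4 * b"
  by (induction s a b rule: chunk_path.induct) auto

lemma chunk_path_range: "X \<in> set (chunk_path s a b) \<Longrightarrow> X \<noteq> {} \<and> X \<subseteq> {s..<s + 3 * a + 2 * b}"
proof (induction s a b rule: chunk_path.induct)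
  case (1 s a b)
  then consider "X = {s}" | "X = {Suc s}" | "X = {s, Suc (Suc s)}" | "X = {Suc (Suc s)}"
    | "X \<in> set (chunk_path (s + 3) a b)" by (auto simp only: chunk_path.simps set_append list.set Un_iff insert_iff empty_iff)
  then show ?case
  proof cases
    case 5 then show ?thesis using 1(1) by fastforce
  qed auto
next
  case (2 s b)
  then consider "X = {s}" | "X = {Suc s}" | "X \<in> set (chunk_path (s + 2) 0 b)"
    by (auto simp only: chunk_path.simps set_append list.set Un_iff insert_iff empty_iff)
  then show ?case
  proof cases
    case 3 then show ?thesis using 2(1) by fastforce
  qed auto
qed simp

lemma chunk_path_hd: "chunk_path s a b \<noteq> [] \<Longrightarrow> hd (chunk_path s a b) = {s}"
  by (cases "(s, a, b)" rule: chunk_path.cases) auto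

lemma chunk_path_adjacent:
  "successively (\<lambda>X Y. \<forall>i\<in>X. \<forall>j\<in>Y. i = Suc j \<or> j = Suc i) (chunk_path s a b)"
proof (induction s a b rule: chunk_path.induct)
  case (1 s a b)
  then show ?case using chunk_path_hd[of "s + 3" a b] by (auto simp: successively_Cons)
next
  case (2 s b)
  then show ?case using chunk_path_hd[of "s + 2" 0 b] by (auto simp: successively_Cons)
qed simp

lemma chunk_path_count:
  "s \<le> i \<Longrightarrow> i < s + 3 * a + 2 * b \<Longrightarrow> length (filter (\<lambda>X. i \<in> X) (chunk_path s a b)) = 2"
proof (induction s a b rule: chunk_path.induct)
  case (1 s a b)
  have z: "filter (\<lambda>X. i \<in> X) (chunk_path (s + 3) a b) = []" if "i < s + 3"
    using chunk_path_range[of _ "s + 3" a b] that by (fastforce simp: filter_empty_conv)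
  consider "i = s" | "i = Suc s" | "i = Suc (Suc s)" | "s + 3 \<le> i" using 1 by linarith
  then show ?case using 1 z by cases auto
next
  case (2 s b)
  have z: "filter (\<lambda>X. i \<in> X) (chunk_path (s + 2) 0 b) = []" if "i < s + 2"
    using chunk_path_range[of _ "s + 2" 0 b] that by (fastforce simp: filter_empty_conv)
  consider "i = s" | "i = Suc s" | "s + 2 \<le> i" using 2 by linarith
  then show ?case using 2 z by cases auto
qed simp

lemma chunk_path_single: "s \<le> i \<Longrightarrow> i < s + 3 * a + 2 * b \<Longrightarrow> {i} \<in> set (chunk_path s a b)"
proof (induction s a b rule: chunk_path.induct)
  case (1 s a b)
  consider "i = s" | "i = Suc s" | "i = Suc (Suc s)" | "s + 3 \<le> i" using 1 by linarith
  then show ?case using 1 by cases auto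
next
  case (2 s b)
  consider "i = s" | "i = Suc s" | "s + 2 \<le> i" using 2 by linarith
  then show ?case using 2 by cases auto
qed simp

text \<open>With at least two blocks there is a boundary at which all labels are replaced, which
  yields the three-cycle.\<close>

lemma chunk_rank:
  assumes "2 \<le> a + b" shows "3 * a + 2 * b \<in> sggi_ranks (alt_group (Suc (5 * a + 4 * b)))"
proof -
  let ?L = "chunk_path 0 a b" and ?r = "3 * a + 2 * b"
  have path: "labelled_path (edge_labels ?L) (Suc (length ?L)) ?r"
  proof (rule labelled_path_list)
    show "\<forall>X\<in>set ?L. X \<noteq> {} \<and> X \<subseteq> {..<?r}" using chunk_path_range[of _ 0 a b] by (auto simp: lessThan_atLeast0)
  qed (use chunk_path_adjacent chunk_path_count[of 0 _ a b] chunk_path_single[of 0 _ a b] in auto)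
  obtain A s a' b' where L: "?L = A @ chunk_path s a' b'" "A \<noteq> []" "\<forall>X\<in>set A. X \<subseteq> {..<s}" "1 \<le> a' + b'"
  proof (cases a)
    case (Suc a')
    then show ?thesis
      by (intro that[of "[{0}, {1}, {0, 2}, {1}, {2}]" 3 a' b]) (use assms in \<open>auto simp: numeral_2_eq_2\<close>)
  next
    case 0
    then obtain b' where "b = Suc b'" using assms by (cases b) auto
    then show ?thesis
      by (intro that[of "[{0}, {1}, {0}, {1}]" 2 0 b']) (use assms 0 in \<open>auto simp: numeral_2_eq_2\<close>)
  qed
  have "?r \<in> sggi_ranks (alt_group (Suc (length (A @ chunk_path s a' b'))))"
  proof (rule rank_from_boundary[where s = s])
    show "labelled_path (edge_labels (A @ chunk_path s a' b')) (Suc (length (A @ chunk_path s a' b'))) ?r"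
      using path L(1) by simp
    show "\<forall>X\<in>set (chunk_path s a' b'). X \<subseteq> {s..}" using chunk_path_range[of _ s a' b'] by fastforce
    show "2 \<le> length (chunk_path s a' b')" using L(4) by (simp add: length_chunk_path)
  qed (use L in auto)
  then show ?thesis using L(1) length_chunk_path[of 0 a b] by simp
qed

text \<open>Labels 0 and 3 occur twice and labels 1 and 2 four times; each of them also occurs alone
  on some edge.\<close>

lemma twelve_points_path:
  "labelled_path (edge_labels [{0}, {1}, {2}, {1}, {0}, {1}, {2}, {3}, {2}, {1, 3}, {2}]) 12 4"
proof -
  let ?L = "[{0}, {1}, {2}, {1}, {0}, {1}, {2}, {3}, {2}, {1, 3}, {2}] :: nat set list"
  have less4: "i < 4 \<longleftrightarrow> i = 0 \<or> i = 1 \<or> i = 2 \<or> i = 3" for i :: nat by auto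
  have "labelled_path (edge_labels ?L) (Suc (length ?L)) 4"
    by (rule labelled_path_list) (auto simp: less4)
  moreover have "Suc (length ?L) = 12" by simp
  ultimately show ?thesis by metis
qed

text \<open>This path has no boundary at which all labels change. The three-cycle comes instead from
  the product of the first two labels, whose cycles have lengths three, four and two: its fourth
  power is the cycle on 1, 2, 3.\<close>

lemma twelve_points_rank: "sggi_ranks (alt_group 12) \<noteq> {}"
proof -
  let ?L = "[{0}, {1}, {2}, {1}, {0}, {1}, {2}, {3}, {2}, {1, 3}, {2}] :: nat set list"
  interpret labelled_path "edge_labels ?L" 12 4 by (rule twelve_points_path)
  define F where "F = shift 0 \<circ> shift 1"
  let ?g = "(F \<circ> F) \<circ> (F \<circ> F)"
  have "?g = three_cycle_map 1 2 3"
  proof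
    fix x
    have e0: "0 \<in> edge_labels ?L x \<longleftrightarrow> x = 1 \<or> x = 5" for x
      by (auto simp: edge_labels_def nth_Cons' split: if_splits)
    have e1: "1 \<in> edge_labels ?L x \<longleftrightarrow> x = 2 \<or> x = 4 \<or> x = 6 \<or> x = 10" for x
      by (auto simp: edge_labels_def nth_Cons' split: if_splits)
    have s0: "shift 0 x = (if x = 1 then 2 else if x = 2 then 1 else if x = 5 then 6 else if x = 6 then 5 else x)" for x
      unfolding shift_def e0 by auto
    have s1: "shift 1 x = (if x = 2 then 3 else if x = 3 then 2 else if x = 4 then 5 else if x = 5 then 4
        else if x = 6 then 7 else if x = 7 then 6 else if x = 10 then 11 else if x = 11 then 10 else x)" for x
      unfolding shift_def e1 by auto
    have f: "F x = (if x = 1 then 2 else if x = 2 then 3 else if x = 3 then 1 else if x = 4 then 6 else if x = 6 then 7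
        else if x = 7 then 5 else if x = 5 then 4 else if x = 10 then 11 else if x = 11 then 10 else x)" for x
      unfolding F_def comp_def s0 s1 by simp
    have g: "?g x = F (F (F (F x)))" by simp
    consider "x = 1" | "x = 2" | "x = 3" | "x = 4" | "x = 5" | "x = 6" | "x = 7" | "x = 10" | "x = 11"
      | "x \<notin> {1, 2, 3, 4, 5, 6, 7, 10, 11}" by blast
    then show "?g x = three_cycle_map 1 2 3 x"
      unfolding g by cases (simp_all add: f three_cycle_map_def)
  qed
  moreover have "?g \<in> H" unfolding F_def using shift_H[of 0] shift_H[of 1] comp_H by simp
  ultimately have base: "three_cycle_map 1 (1 + 1) (1 + 2) \<in> H" by (simp add: numeral_3_eq_3 numeral_2_eq_2)
  have "4 \<in> sggi_ranks (alt_group 12)"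
    by (rule path_rank[OF _ _ _ base, where g = 2]) (simp_all add: edge_labels_def numeral_eq_Suc)
  then show ?thesis by blast
qed

text \<open>A remainder \<open>j > 0\<close> of \<open>n - 1\<close> modulo five is produced by
  \<open>5 - j\<close> blocks of four edges. For \<open>j = 1\<close> this takes sixteen edges, more
  than the eleven of twelve points.\<close>

lemma sggi_ranks_nonempty:
  assumes "9 \<le> n" shows "sggi_ranks (alt_group n) \<noteq> {}"
proof (cases "n = 12")
  case False
  obtain m j where m: "n = Suc (5 * m + j)" "j < 5"
    using assms mod_mult_div_eq[of "n - 1" 5] mod_less_divisor[of 5 "n - 1"]
    by (metis Suc_pred' add.commute less_le_trans zero_less_numeral)
  consider "j = 0" | "j = 1" | "j = 2" | "j = 3" | "j = 4" using m(2) by linarith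
  then have "\<exists>a b. 2 \<le> a + b \<and> n = Suc (5 * a + 4 * b)"
  proof cases
    case 1 then show ?thesis using assms m by - (rule exI[of _ m], rule exI[of _ 0], linarith)
  next
    case 2
    then have "3 \<le> m" using assms m False by (cases "m = 2") auto
    then show ?thesis using m 2 by - (rule exI[of _ "m - 3"], rule exI[of _ 4], linarith)
  next
    case 3 then show ?thesis using assms m by - (rule exI[of _ "m - 2"], rule exI[of _ 3], linarith)
  next
    case 4 then show ?thesis using assms m by - (rule exI[of _ "m - 1"], rule exI[of _ 2], linarith)
  next
    case 5 then show ?thesis using assms m by - (rule exI[of _ m], rule exI[of _ 1], linarith)
  qed
  then show ?thesis using chunk_rank by blast
qed (use twelve_points_rank in simp)

text \<open>A block of four edges falls short of \<open>12 / 5\<close> labels by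
  \<open>2 / 5\<close>, and rounding down hides at most two such losses. With zero, one or two of
  these blocks, \<open>n\<close> has residue 1, 0 or 4.\<close>

lemma sggi_rank_attained:
  assumes "9 \<le> n" "n mod 5 \<in> {0, 1, 4}" shows "3 * (n - 1) div 5 \<in> sggi_ranks (alt_group n)"
proof -
  obtain m where n: "n = 5 * m + n mod 5" by (metis mult_div_mod_eq)
  consider "n mod 5 = 0" | "n mod 5 = 1" | "n mod 5 = 4" using assms by auto
  then have "\<exists>a b. b \<le> 2 \<and> 2 \<le> a + b \<and> n = Suc (5 * a + 4 * b)"
  proof cases
    case 1 then show ?thesis using assms n by - (rule exI[of _ "m - 1"], rule exI[of _ 1], linarith)
  next
    case 2 then show ?thesis using assms n by - (rule exI[of _ m], rule exI[of _ 0], linarith)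
  next
    case 3 then show ?thesis using assms n by - (rule exI[of _ "m - 1"], rule exI[of _ 2], linarith)
  qed
  then obtain a b :: nat where ab: "b \<le> 2" "2 \<le> a + b" "n = Suc (5 * a + 4 * b)" by blast
  have "3 * (n - 1) = 12 * b + 5 * (3 * a)" using ab(3) by simp
  then have "3 * (n - 1) div 5 = 3 * a + 12 * b div 5" by (simp only: div_mult_self2)
  also have "12 * b div 5 = 2 * b" using ab(1) by (auto simp: le_Suc_eq numeral_2_eq_2)
  finally show ?thesis using chunk_rank[OF ab(2)] ab(3) by simp
qed

section \<open>The upper bound\<close>

context string_action
begin

lemma multiple_of_four: "m \<le> n \<Longrightarrow> 4 \<le> m \<Longrightarrow> m mod 4 = 0 \<Longrightarrow> n < 12 \<Longrightarrow> m = 4 \<or> m = 8" for m n :: nat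
  by presburger

lemma mv_values: "i < r \<Longrightarrow> card \<Omega> < 12 \<Longrightarrow> mv i \<Omega> = 4 \<or> mv i \<Omega> = 8"
proof -
  assume i: "i < r" and n: "card \<Omega> < 12"
  have "mv i \<Omega> \<le> card \<Omega>" unfolding mv_def using finite_points by (intro card_mono) auto
  then show ?thesis using multiple_of_four[OF _ mv_four[OF i] even_labels n] by blast
qed

lemma card_fixed: "card {y \<in> \<Omega>. \<rho> i y = y} + mv i \<Omega> = card \<Omega>"
proof -
  have "card ({y \<in> \<Omega>. \<rho> i y = y} \<union> {y \<in> \<Omega>. \<rho> i y \<noteq> y}) = card {y \<in> \<Omega>. \<rho> i y = y} + mv i \<Omega>"
    unfolding mv_def by (rule card_Un_disjoint) (use finite_points in auto)
  moreover have "{y \<in> \<Omega>. \<rho> i y = y} \<union> {y \<in> \<Omega>. \<rho> i y \<noteq> y} = \<Omega>" by blast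
  ultimately show ?thesis by simp
qed

text \<open>Labels commuting with label \<open>i\<close> permute its fixed points, and there is just
  one.\<close>

lemma single_fixed_point:
  assumes "Suc (mv i \<Omega>) = card \<Omega>"
  shows "\<exists>c\<in>\<Omega>. (\<forall>j. Suc i < j \<or> Suc j < i \<or> j = i \<longrightarrow> \<rho> j c = c) \<and> (\<forall>y\<in>\<Omega>. \<rho> i y = y \<longrightarrow> y = c)"
proof -
  have "card {y \<in> \<Omega>. \<rho> i y = y} = 1" using card_fixed[of i] assms by simp
  then obtain c where c: "{y \<in> \<Omega>. \<rho> i y = y} = {c}" by (rule card_1_singletonE)
  have "\<rho> j c = c" if "Suc i < j \<or> Suc j < i \<or> j = i" for j
  proof -
    have ci: "c \<in> \<Omega>" "\<rho> i c = c" using c by auto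
    have "\<rho> i (\<rho> j c) = \<rho> j c" using fixed_iff[of i j c] that ci by auto
    then have "\<rho> j c \<in> {y \<in> \<Omega>. \<rho> i y = y}" using closed[OF ci(1)] by simp
    then show ?thesis using c by simp
  qed
  then show ?thesis using c by blast
qed

text \<open>If both moved eight points, each would have one fixed point. That of label 4 is fixed by
  label 0, so the two coincide; since every label other than 0 and 4 commutes with one of these, all
  labels fix this point.\<close>

lemma nine_points_ends:
  assumes n: "card \<Omega> = 9" and r5: "r = 5" shows "mv 0 \<Omega> = 4 \<or> mv 4 \<Omega> = 4"
proof (rule ccontr)
  assume "\<not> ?thesis"
  then have m: "mv 0 \<Omega> = 8" "mv 4 \<Omega> = 8" using mv_values[of 0] mv_values[of 4] n r5 by auto
  have m': "Suc (mv 0 \<Omega>) = card \<Omega>" "Suc (mv 4 \<Omega>) = card \<Omega>" using m n by simp_all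
  obtain c where c: "c \<in> \<Omega>" "\<And>j. Suc 4 < j \<or> Suc j < 4 \<or> j = 4 \<Longrightarrow> \<rho> j c = c"
    "\<And>y. y \<in> \<Omega> \<Longrightarrow> \<rho> 4 y = y \<Longrightarrow> y = c"
    using single_fixed_point[OF m'(2)] by blast
  obtain d where d: "d \<in> \<Omega>" "\<And>j. Suc 0 < j \<or> Suc j < 0 \<or> j = 0 \<Longrightarrow> \<rho> j d = d" "\<And>y. y \<in> \<Omega> \<Longrightarrow> \<rho> 0 y = y \<Longrightarrow> y = d"
    using single_fixed_point[OF m'(1)] by blast
  have "d = c" using d(3)[OF c(1)] c(2)[of 0] by auto
  have "\<rho> i c = c" if "i < r" for i
    using c(2)[of i] d(2)[of i] \<open>d = c\<close> by (cases "i = 1"; cases "i = 0") auto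
  then show False using not_closed[of "{c}" c] c(1) n by simp
qed

lemma nine_points_dependent:
  assumes "card \<Omega> = 9" "r = 5" "mv 0 \<Omega> = 4"
  shows "\<exists>w. set w \<subseteq> {0, 1, 2, 3} \<and> (\<forall>y\<in>\<Omega>. act w y = \<rho> 4 y)"
  using assms nine_points_dependent_asym nine_points_dependent_sym mv_values[of 4] by fastforce

end

lemma sggi_rev: "sggi G S \<Longrightarrow> sggi G (rev S)"
  unfolding sggi_def
proof (elim conjE, intro conjI allI impI)
  fix i j
  assume S: "\<forall>i<length S. \<forall>j<length S. \<bar>int i - int j\<bar> \<noteq> 1 \<longrightarrow> (S ! i \<otimes>\<^bsub>G\<^esub> S ! j) [^]\<^bsub>G\<^esub> (2::nat) = \<one>\<^bsub>G\<^esub>"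
    and ij: "i < length (rev S)" "j < length (rev S)" "\<bar>int i - int j\<bar> \<noteq> 1"
  have "\<bar>int (length S - Suc i) - int (length S - Suc j)\<bar> \<noteq> 1" using ij by auto
  then show "(rev S ! i \<otimes>\<^bsub>G\<^esub> rev S ! j) [^]\<^bsub>G\<^esub> (2::nat) = \<one>\<^bsub>G\<^esub>"
    using S ij by (simp add: rev_nth)
qed auto

lemma nine_points_last_dependent:
  assumes S: "sggi (alt_group 9) S" and l: "length S = 5"
    and m: "card {y \<in> {1..9}. (S ! 0) y \<noteq> y} = 4"
  shows "S ! 4 \<in> generate (alt_group 9) (set S - {S ! 4})"
proof -
  interpret alt_string "label_action S" "{1..9}" 5 using label_alt_string[OF S] l by simp
  interpret P: primitive_string "label_action S" "{1..9}" 5 by (rule primitive_string) simp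
  have "mv 0 {1..9} = 4" using m l by (simp add: mv_def label_action_def)
  then obtain w where w: "set w \<subseteq> {0, 1, 2, 3}" "\<forall>y\<in>{1..9}. act w y = label_action S 4 y"
    using P.nine_points_dependent by auto
  have "act w y = (S ! 4) y" for y
  proof (cases "y \<in> {1..9}")
    case True then show ?thesis using w l by (simp add: label_action_def)
  next
    case False
    then have "label_action S i y = y" for i by (rule outside)
    moreover have "act u y = y" for u by (induction u) (simp_all add: calculation)
    ultimately show ?thesis using l by (metis label_action_def lessI eval_nat_numeral(3))
  qed
  then have "act w = S ! 4" by blast
  moreover have "act w \<in> generate (alt_group 9) ((!) S ` set w)" by (rule act_generate[OF S]) (use w l in auto)
  moreover have "(!) S ` set w \<subseteq> set S - {S ! 4}"
  proof
    fix x assume "x \<in> (!) S ` set w"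
    then obtain i where "i \<in> set w" "x = S ! i" by blast
    then have i: "i < 4" "x = S ! i" using w(1) by auto
    moreover have "distinct S" using S by (simp add: sggi_def)
    ultimately show "x \<in> set S - {S ! 4}" using l by (auto simp: nth_eq_iff_index_eq)
  qed
  ultimately show ?thesis using group.mono_generate[OF alt_group_is_group] by (metis subsetD)
qed

text \<open>If label 4 rather than label 0 moves four points, the reversed string is used, and it is
  the first generator that depends on the others.\<close>

lemma nine_points_rank:
  assumes S: "sggi (alt_group 9) S" "independent_generating_set (alt_group 9) (set S)" shows "length S \<noteq> 5"
proof
  assume l: "length S = 5"
  interpret alt_string "label_action S" "{1..9}" 5 using label_alt_string[OF S(1)] l by simp
  interpret P: primitive_string "label_action S" "{1..9}" 5 by (rule primitive_string) simp
  have "mv 0 {1..9} = 4 \<or> mv 4 {1..9} = 4" by (rule P.nine_points_ends) simp_all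
  then show False
  proof
    assume "mv 0 {1..9} = 4"
    then have "S ! 4 \<in> generate (alt_group 9) (set S - {S ! 4})"
      by (intro nine_points_last_dependent[OF S(1) l]) (simp add: mv_def label_action_def l)
    then show False using S(2) l by (auto simp: independent_generating_set_def)
  next
    assume "mv 4 {1..9} = 4"
    then have "card {y \<in> {1..9}. (rev S ! 0) y \<noteq> y} = 4"
      by (simp add: mv_def label_action_def l rev_nth)
    then have "rev S ! 4 \<in> generate (alt_group 9) (set (rev S) - {rev S ! 4})"
      by (intro nine_points_last_dependent[OF sggi_rev[OF S(1)]]) (simp_all add: l)
    then show False using S(2) l by (auto simp: independent_generating_set_def rev_nth)
  qed
qed

lemma sggi_rank_upper_bound:
  assumes n: "9 \<le> n" and S: "sggi_of_rank (alt_group n) S r" shows "r \<le> 3 * (n - 1) div 5"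
proof -
  have s: "sggi (alt_group n) S" "independent_generating_set (alt_group n) (set S)" and r: "length S = r"
    using S distinct_card[of S] by (auto simp: sggi_of_rank_def sggi_def)
  interpret alt_string "label_action S" "{1..n}" r using label_alt_string[OF s(1)] r by simp
  interpret P: primitive_string "label_action S" "{1..n}" r by (rule primitive_string) (use n in simp)
  have b: "5 * r + 3 \<le> 3 * n \<or> 2 * r \<le> Suc n" if "6 \<le> r" using P.rank_bound[OF that] by simp
  have "5 * r \<le> 3 * (n - 1)"
  proof (cases "6 \<le> r")
    case True
    then show ?thesis using b n by linarith
  next
    case False
    \<comment> \<open>On nine points the bound reads \<open>5 * r \<le> 24\<close>, so among the
      ranks below six only five is in conflict with it.\<close>
    have "r \<noteq> 5" if "n = 9" using nine_points_rank[of S] s r that by auto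
    then show ?thesis using False n by (cases "n = 9") auto
  qed
  then show ?thesis by simp
qed

lemma max_sggi_rank_le:
  assumes "9 \<le> n" shows "max_sggi_rank (alt_group n) \<le> 3 * (n - 1) div 5"
  unfolding max_sggi_rank_def
  using sggi_ranks_nonempty[OF assms] finite_sggi_ranks[OF finite_carrier_alt_group] sggi_rank_upper_bound[OF assms]
  by (subst Max_le_iff) (auto simp: sggi_ranks_def)

lemma max_sggi_rank_eq:
  assumes "9 \<le> n" "n mod 5 \<in> {0, 1, 4}" shows "max_sggi_rank (alt_group n) = 3 * (n - 1) div 5"
proof (rule antisym[OF max_sggi_rank_le[OF assms(1)]])
  show "3 * (n - 1) div 5 \<le> max_sggi_rank (alt_group n)"
    unfolding max_sggi_rank_def
    using sggi_rank_attained[OF assms] finite_sggi_ranks[OF finite_carrier_alt_group] by (rule Max_ge[rotated])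
qed

section \<open>At most five points\<close>

context invol_string
begin

text \<open>Two involutions generate a dihedral group, and words of even length are its
  rotations.\<close>

lemma even_words_commute:
  assumes "even (length u)" "set u \<subseteq> {0, 1}" "even (length v)" "set v \<subseteq> {0, 1}"
  shows "act u (act v y) = act v (act u y)"
proof -
  have c: "act u (\<rho> 0 (\<rho> 1 z)) = \<rho> 0 (\<rho> 1 (act u z)) \<and> act u (\<rho> 1 (\<rho> 0 z)) = \<rho> 1 (\<rho> 0 (act u z))" for z
    using assms(1,2)
  proof (induction u rule: induct_list012)
    case (3 i j u)
    have "(i = 0 \<or> i = 1) \<and> (j = 0 \<or> j = 1)" using 3 by auto
    then show ?case using 3 by (elim conjE disjE) (simp_all del: One_nat_def)
  qed simp_all
  show ?thesis using assms(3,4)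
  proof (induction v arbitrary: y rule: induct_list012)
    case (3 i j v)
    have "(i = 0 \<or> i = 1) \<and> (j = 0 \<or> j = 1)" using 3 by auto
    then show ?case using 3 c by (elim conjE disjE) (simp_all del: One_nat_def)
  qed simp_all
qed

text \<open>The fixed-point-free involutions of four points all lie in the Klein four-group.\<close>

lemma four_points_free_commute:
  assumes X: "finite X" "card X = 4" and cl: "\<And>v. v \<in> X \<Longrightarrow> \<rho> i v \<in> X \<and> \<rho> i v \<noteq> v \<and> \<rho> j v \<in> X \<and> \<rho> j v \<noteq> v"
    and y: "y \<in> X"
  shows "\<rho> i (\<rho> j y) = \<rho> j (\<rho> i y)"
proof (cases "\<rho> i y = \<rho> j y")
  case True then show ?thesis by (metis invol)
next
  case False
  let ?l = "[y, \<rho> i y, \<rho> j y, \<rho> i (\<rho> j y)]"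
  have cy: "\<rho> i y \<in> X" "\<rho> i y \<noteq> y" "\<rho> j y \<in> X" "\<rho> j y \<noteq> y" using cl[OF y] by auto
  have "\<rho> i (\<rho> j y) \<noteq> y" using False by (metis invol)
  then have d: "distinct ?l" using cy cl[OF cy(3)] False by (auto simp: rho_inj)
  have X': "X = set ?l" by (rule card_subset_eq[OF X(1), symmetric]) (use distinct_card[OF d] X y cy cl[OF cy(3)] in auto)
  have "\<rho> j (\<rho> i y) \<in> X" "\<rho> j (\<rho> i y) \<noteq> \<rho> i y" using cl[OF cy(1)] by auto
  moreover have "\<rho> j (\<rho> i y) \<noteq> y" using False by (metis invol)
  moreover have "\<rho> j (\<rho> i y) \<noteq> \<rho> j y" using cy rho_inj by blast
  ultimately show ?thesis unfolding X' by auto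
qed

end

context alt_string
begin

lemma four_distinct_points:
  assumes "4 \<le> card \<Omega>" shows "\<exists>a\<in>\<Omega>. \<exists>b\<in>\<Omega>. \<exists>c\<in>\<Omega>. \<exists>d\<in>\<Omega>. distinct [a, b, c, d]"
proof -
  obtain X where X: "X \<subseteq> \<Omega>" "card X = 4" using assms by (meson obtain_subset_with_card_n)
  have "card X = Suc (Suc (Suc (Suc 0)))" using X by simp
  then obtain a b c d where "X = {a, b, c, d}" "distinct [a, b, c, d]"
    by (auto simp: card_Suc_eq)
  then show ?thesis using X(1) by - (rule bexI[of _ a], rule bexI[of _ b], rule bexI[of _ c], rule bexI[of _ d], auto)
qed

text \<open>Squares are words of even length. With two labels the squares of all three-cycles would
  commute, which fails for two three-cycles sharing two points.\<close>

lemma three_labels: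
  assumes "4 \<le> card \<Omega>" shows "3 \<le> r"
proof (rule ccontr)
  assume "\<not> ?thesis"
  then have sub: "{..<r} \<subseteq> {0, 1}" by auto
  obtain a b c d where p: "a \<in> \<Omega>" "b \<in> \<Omega>" "c \<in> \<Omega>" "d \<in> \<Omega>" and dist: "distinct [a, b, c, d]"
    using four_distinct_points[OF assms] by blast
  obtain w where w: "set w \<subseteq> {..<r}" "act w a = b" "act w b = c" "act w c = a" "\<And>y. y \<notin> {a, b, c} \<Longrightarrow> act w y = y"
    using three_cycle[of a b c] p dist by auto
  obtain v where v: "set v \<subseteq> {..<r}" "act v b = c" "act v c = d" "act v d = b" "\<And>y. y \<notin> {b, c, d} \<Longrightarrow> act v y = y"
    using three_cycle[of b c d] p dist by auto
  have "act (w @ w) (act (v @ v) b) = act (v @ v) (act (w @ w) b)"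
    by (rule even_words_commute) (use w(1) v(1) sub in auto)
  moreover have "act w d = d" "act v a = a" using w(5)[of d] v(5)[of a] dist by auto
  ultimately show False using w(2-4) v(2-4) dist by (simp add: act_append)
qed

text \<open>Evenness makes every label fixed-point-free, so the labels generate at most the Klein
  four-group, which has no three-cycle.\<close>

lemma four_points_false: "card \<Omega> \<noteq> 4"
proof
  assume n: "card \<Omega> = 4"
  have free: "\<rho> i y \<noteq> y" if "i < r" "y \<in> \<Omega>" for i y
  proof -
    have "mv i \<Omega> \<noteq> 0" using nontrivial[OF that(1)] finite_points by (auto simp: mv_def)
    then have "4 \<le> mv i \<Omega>" using even_labels[of i] by (intro four_le) auto
    then have "{y \<in> \<Omega>. \<rho> i y \<noteq> y} = \<Omega>" unfolding mv_def using n finite_points by (intro card_seteq) auto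
    then show ?thesis using that(2) by blast
  qed
  have com: "\<rho> i (\<rho> j y) = \<rho> j (\<rho> i y)" if "i < r" "j < r" for i j y
  proof (cases "y \<in> \<Omega>")
    case True
    show ?thesis by (rule four_points_free_commute[OF finite_points n _ True]) (use that free closed in auto)
  qed (simp add: outside)
  have comw: "act w (\<rho> i y) = \<rho> i (act w y)" if "set w \<subseteq> {..<r}" "i < r" for w i y
    using that(1) by (induction w) (use com that(2) in auto)
  have sq: "act w (act w y) = y" if "set w \<subseteq> {..<r}" for w y
    using that by (induction w arbitrary: y) (auto simp: comw)
  obtain a b c d where "a \<in> \<Omega>" "b \<in> \<Omega>" "c \<in> \<Omega>" "distinct [a, b, c, d]"
    using four_distinct_points n by auto
  then obtain w where w: "set w \<subseteq> {..<r}" "act w a = b" "act w b = c" "a \<noteq> c"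
    using three_cycle[of a b c] by auto
  show False using sq[OF w(1), of a] w(2-4) by simp
qed

lemma three_points_false: "card \<Omega> \<noteq> 3"
proof
  assume n: "card \<Omega> = 3"
  have "r = 0"
  proof (rule ccontr)
    assume "r \<noteq> 0"
    then have "mv 0 \<Omega> \<noteq> 0" using nontrivial[of 0] finite_points by (auto simp: mv_def)
    then have "4 \<le> mv 0 \<Omega>" using even_labels[of 0] by (intro four_le) auto
    moreover have "mv 0 \<Omega> \<le> card \<Omega>" unfolding mv_def using finite_points by (intro card_mono) auto
    ultimately show False using n by simp
  qed
  obtain a b c where "\<Omega> = {a, b, c}" "distinct [a, b, c]"
    using n by (auto simp: numeral_3_eq_3 card_Suc_eq)
  then obtain w where "set w \<subseteq> {..<r}" "act w a = b" "a \<noteq> b" using three_cycle[of a b c] by auto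
  then show False using \<open>r = 0\<close> by simp
qed

text \<open>Each label moves all points but one. The point fixed by label 0 is also fixed by labels
  2 and 3, which then act freely on the other four points and commute, although they are
  adjacent.\<close>

lemma five_points_three_labels:
  assumes n: "card \<Omega> = 5" shows "r = 3"
proof (rule ccontr)
  assume "r \<noteq> 3"
  then have r: "4 \<le> r" using three_labels n by fastforce
  interpret P: primitive_string \<rho> \<Omega> r by (rule primitive_string) (use n in simp)
  have m: "mv i \<Omega> = 4" if "i < r" for i
  proof -
    have "mv i \<Omega> \<le> card \<Omega>" unfolding mv_def using finite_points by (intro card_mono) auto
    then show ?thesis using P.mv_values[OF that] n by auto
  qed
  have sf: "\<exists>c\<in>\<Omega>. (\<forall>j. Suc i < j \<or> Suc j < i \<or> j = i \<longrightarrow> \<rho> j c = c) \<and> (\<forall>y\<in>\<Omega>. \<rho> i y = y \<longrightarrow> y = c)" if "i < r" for i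
    by (rule P.single_fixed_point) (use m[OF that] n in simp)
  obtain c where c: "c \<in> \<Omega>" "\<forall>j. Suc 0 < j \<longrightarrow> \<rho> j c = c" using sf[of 0] r by auto
  obtain c2 where c2: "\<forall>y\<in>\<Omega>. \<rho> 2 y = y \<longrightarrow> y = c2" using sf[of 2] r by auto
  obtain c3 where c3: "\<forall>y\<in>\<Omega>. \<rho> 3 y = y \<longrightarrow> y = c3" using sf[of 3] r by auto
  have cc: "\<rho> 2 c = c" "\<rho> 3 c = c" "c2 = c" "c3 = c" using c c2 c3 by auto
  have free: "\<rho> 2 y \<noteq> y" "\<rho> 3 y \<noteq> y" if "y \<in> \<Omega>" "y \<noteq> c" for y using c2 c3 cc that by auto
  have "\<rho> 2 (\<rho> 3 y) = \<rho> 3 (\<rho> 2 y)" if y: "y \<in> \<Omega>" for y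
  proof (cases "y = c")
    case False
    show ?thesis
    proof (rule four_points_free_commute)
      show "finite (\<Omega> - {c})" "card (\<Omega> - {c}) = 4" "y \<in> \<Omega> - {c}" using finite_points n c y False by auto
      show "\<rho> 2 v \<in> \<Omega> - {c} \<and> \<rho> 2 v \<noteq> v \<and> \<rho> 3 v \<in> \<Omega> - {c} \<and> \<rho> 3 v \<noteq> v" if "v \<in> \<Omega> - {c}" for v
        using that free[of v] closed[of v] cc rho_inj[of _ v c] by (metis Diff_iff singleton_iff)
    qed
  qed (simp add: cc)
  moreover have "\<exists>y\<in>\<Omega>. \<rho> 2 (\<rho> (Suc 2) y) \<noteq> \<rho> (Suc 2) (\<rho> 2 y)" by (rule P.noncommuting) (use r in simp)
  ultimately show False by (simp add: numeral_3_eq_3 numeral_2_eq_2)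
qed

end

lemma sggi_length_ge_3: "sggi (alt_group n) S \<Longrightarrow> 4 \<le> n \<Longrightarrow> 3 \<le> length S"
  using alt_string.three_labels[OF label_alt_string, of n S] by simp

text \<open>Two of the three generators form a string in either order, because no commutation is
  required of two adjacent positions. Since strings of two labels do not generate, this yields
  independence on five points.\<close>

lemma sggi_drop_generator:
  assumes S: "sggi G S" and l: "length S = 3" and s: "s \<in> set S" "s \<in> generate G (set S - {s})"
  shows "\<exists>T. sggi G T \<and> length T = 2"
proof -
  define T where "T = remove1 s S"
  have g: "group G" and d: "distinct S" and inv: "\<forall>x\<in>set S. involution G x" and gen: "generate G (set S) = carrier G"
    and sq: "\<And>i j. i < length S \<Longrightarrow> j < length S \<Longrightarrow> \<bar>int i - int j\<bar> \<noteq> 1 \<Longrightarrow>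
      (S ! i \<otimes>\<^bsub>G\<^esub> S ! j) [^]\<^bsub>G\<^esub> (2::nat) = \<one>\<^bsub>G\<^esub>"
    using S by (auto simp: sggi_def)
  have T: "distinct T" "set T = set S - {s}" "length T = 2"
    by (simp_all add: T_def length_remove1 d l s(1))
  have sub: "set T \<subseteq> carrier G" using inv T(2) by (auto simp: involution_def)
  have "set S \<subseteq> generate G (set T)"
  proof
    fix x assume "x \<in> set S"
    then show "x \<in> generate G (set T)" using s(2) T(2) generate.incl[of x "set T" G] by (cases "x = s") auto
  qed
  then have "generate G (set S) \<subseteq> generate G (set T)"
    by (rule group.generate_subgroup_incl[OF g _ group.generate_is_subgroup[OF g sub]])
  then have "generate G (set T) = carrier G" using gen group.generate_incl[OF g sub] by blast
  moreover have "(T ! i \<otimes>\<^bsub>G\<^esub> T ! j) [^]\<^bsub>G\<^esub> (2::nat) = \<one>\<^bsub>G\<^esub>"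
    if ij: "i < length T" "j < length T" "\<bar>int i - int j\<bar> \<noteq> 1" for i j
  proof -
    have "i = j" using ij T(3) by auto
    obtain k where "k < length S" "S ! k = T ! i" using nth_mem[OF ij(1)] T(2) by (auto simp: in_set_conv_nth)
    then show ?thesis using sq[of k k] \<open>i = j\<close> by simp
  qed
  ultimately have "sggi G T" using g T inv by (auto simp: sggi_def)
  then show ?thesis using T(3) by blast
qed

lemma five_points_rank:
  assumes S: "sggi (alt_group 5) S" shows "sggi_of_rank (alt_group 5) S 3"
proof -
  have l: "length S = 3" using alt_string.five_points_three_labels[OF label_alt_string[OF S]] by simp
  have "s \<notin> generate (alt_group 5) (set S - {s})" if "s \<in> set S" for s
    using sggi_drop_generator[OF S l that] sggi_length_ge_3[of 5] by fastforce
  moreover have "set S \<subseteq> carrier (alt_group 5)" "generate (alt_group 5) (set S) = carrier (alt_group 5)"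
    "card (set S) = 3"
    using S l distinct_card[of S] by (auto simp: sggi_def involution_def)
  ultimately show ?thesis using S by (auto simp: sggi_of_rank_def independent_generating_set_def)
qed

lemma three_points_no_sggi: "\<not> sggi (alt_group 3) S" and four_points_no_sggi: "\<not> sggi (alt_group 4) S"
  using alt_string.three_points_false[OF label_alt_string, of 3 S] alt_string.four_points_false[OF label_alt_string, of 4 S]
  by auto

section \<open>An explicit string for Alt(5)\<close>

definition double_swap :: "'a \<Rightarrow> 'a \<Rightarrow> 'a \<Rightarrow> 'a \<Rightarrow> 'a \<Rightarrow> 'a" where
  "double_swap a b c d x = (if x = a then b else if x = b then a else if x = c then d else if x = d then c else x)"

lemma double_swap_involution: "distinct [a, b, c, d] \<Longrightarrow> double_swap a b c d (double_swap a b c d x) = x"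
  by (auto simp: double_swap_def)

lemma double_swap_carrier:
  assumes "distinct [a, b, c, d]" "{a, b, c, d} \<subseteq> {1..n}"
  shows "double_swap a b c d \<in> carrier (alt_group n)"
proof -
  let ?p = "double_swap a b c d"
  have "?p permutes {1..n}"
  proof (rule bij_imp_permutes)
    show "bij_betw ?p {1..n} {1..n}"
    proof (rule bij_betw_byWitness[where f' = ?p])
      show "?p ` {1..n} \<subseteq> {1..n}" using assms(2) by (intro image_subsetI) (simp add: double_swap_def)
      then show "?p ` {1..n} \<subseteq> {1..n}" .
    qed (simp_all add: double_swap_involution[OF assms(1)])
  qed (use assms in \<open>auto simp: double_swap_def\<close>)
  moreover have "{y \<in> {1..n}. ?p y \<noteq> y} = {a, b, c, d}"
    using assms by (auto simp: double_swap_def)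
  then have "card {y \<in> {1..n}. ?p y \<noteq> y} = 4" using distinct_card[OF assms(1)] by simp
  ultimately show ?thesis
    using evenperm_involution[of "{1..n}" ?p] double_swap_involution[OF assms(1)]
    by (simp add: alt_group_carrier)
qed

text \<open>The outer involutions \<open>f0\<close> and \<open>f2\<close> lie in the Klein
  four-group on \<open>1..4\<close> and commute; \<open>f1\<close> brings in the point 5. The
  product of all three is a three-cycle, and its conjugates under \<open>f1\<close> and
  \<open>f0\<close> reach the remaining points.\<close>

lemma five_points_sggi: "\<exists>S. sggi (alt_group 5) S"
proof -
  define f0 f1 f2 :: "nat \<Rightarrow> nat" where "f0 = double_swap 1 2 3 4" and "f1 = double_swap 1 3 2 5"
    and "f2 = double_swap 1 4 2 3"
  note fs = f0_def f1_def f2_def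
  define H where "H = generate (alt_group 5) {f0, f1, f2}"
  have fc: "{f0, f1, f2} \<subseteq> carrier (alt_group 5)" unfolding fs by (auto intro!: double_swap_carrier)
  have mem: "f0 \<in> H" "f1 \<in> H" "f2 \<in> H" unfolding H_def by (auto intro: generate.incl)
  have comp: "f \<circ> g \<in> H" if "f \<in> H" "g \<in> H" for f g
    using generate.eng[of f "alt_group 5" _ g] that by (simp add: H_def alt_group_mult)
  have inv: "f0 (f0 x) = x" "f1 (f1 x) = x" "f2 (f2 x) = x" for x
    unfolding fs by (rule double_swap_involution; simp)+
  have "f2 \<circ> f1 \<circ> f0 = three_cycle_map 1 5 3"
  proof
    fix x :: nat
    consider "x = 1" | "x = 2" | "x = 3" | "x = 4" | "x = 5" | "x \<notin> {1, 2, 3, 4, 5}" by blast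
    then show "(f2 \<circ> f1 \<circ> f0) x = three_cycle_map 1 5 3 x"
      unfolding fs comp_def by cases (simp_all add: double_swap_def three_cycle_map_def)
  qed
  then have c: "three_cycle_map 1 5 3 \<in> H" using comp[OF comp[OF mem(3,2)] mem(1)] by simp
  have "f1 \<circ> three_cycle_map 1 5 3 \<circ> f1 = three_cycle_map 3 2 1"
    using three_cycle_map_conjugate[of f1 f1 1 5 3] inv by (simp add: f1_def double_swap_def)
  then have c1: "three_cycle_map 1 3 2 \<in> H"
    using comp[OF comp[OF mem(2) c] mem(2)] three_cycle_map_rotate[of 1 3 "2::nat"] three_cycle_map_rotate[of 3 2 "1::nat"] by simp
  have "f0 \<circ> three_cycle_map 1 5 3 \<circ> f0 = three_cycle_map 2 5 4"
    using three_cycle_map_conjugate[of f0 f0 1 5 3] inv by (simp add: f0_def double_swap_def)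
  then have c2: "three_cycle_map 2 5 4 \<in> H" using comp[OF comp[OF mem(1) c] mem(1)] by simp
  have X: "all_three_cycles H {1, 5, 3}" by (rule all_three_cycles_triple[OF comp _ c]) simp_all
  have X2: "all_three_cycles H (insert 2 {1, 5, 3})"
    by (rule all_three_cycles_insert[OF comp X _ _ _ _ c1]) simp_all
  have "all_three_cycles H (insert 4 (insert 2 {1, 5, 3}))"
  proof (rule all_three_cycles_insert[OF comp X2])
    show "three_cycle_map 5 2 4 \<in> H" using three_cycle_map_swap[OF comp c2] by simp
  qed simp_all
  moreover have "insert 4 (insert 2 {1, 5, 3}) = {1..5::nat}" by auto
  ultimately have "all_three_cycles H {1..5}" by simp
  then have gen: "generate (alt_group 5) {f0, f1, f2} = carrier (alt_group 5)"
    using carrier_from_three_cycles[OF fc] by (simp add: H_def)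
  have val: "f0 1 = 2" "f1 1 = 3" "f2 1 = 4" by (simp_all add: fs double_swap_def)
  then have dist: "distinct [f0, f1, f2]" "f0 \<noteq> id" "f1 \<noteq> id" "f2 \<noteq> id" by (auto dest: fun_cong[of _ _ 1])
  have com: "f0 (f2 x) = f2 (f0 x)" for x by (simp add: fs double_swap_def)
  have less: "i < 3 \<longleftrightarrow> i = 0 \<or> i = 1 \<or> i = 2" for i :: nat by auto
  have "(([f0, f1, f2] ! i) \<circ> ([f0, f1, f2] ! j)) \<circ> (([f0, f1, f2] ! i) \<circ> ([f0, f1, f2] ! j)) = id"
    if "i < 3" "j < 3" "\<bar>int i - int j\<bar> \<noteq> 1" for i j
    using that unfolding less by (elim disjE) (auto simp: fun_eq_iff inv com)
  then have "sggi (alt_group 5) [f0, f1, f2]"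
    unfolding sggi_def alt_group_square alt_group_mult alt_group_one involution_def
    using alt_group_is_group dist fc gen inv by (auto simp: fun_eq_iff)
  then show ?thesis by blast
qed

section \<open>Seven and eight points\<close>

definition even_meet :: "'a set \<Rightarrow> 'a set \<Rightarrow> bool" where
  "even_meet C Z \<longleftrightarrow> even (card (C \<inter> Z))"

lemma even_card_symmetric_difference:
  assumes "finite A" "finite B"
  shows "even (card ((A - B) \<union> (B - A))) \<longleftrightarrow> even (card A) = even (card B)"
proof -
  have "card A = card (A - B) + card (A \<inter> B)" "card B = card (B - A) + card (A \<inter> B)"
    using card_Int_Diff[OF assms(1), of B] card_Int_Diff[OF assms(2), of A] by (simp_all add: Int_commute)
  moreover have "card ((A - B) \<union> (B - A)) = card (A - B) + card (B - A)"
    by (rule card_Un_disjoint) (use assms in auto)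
  ultimately show ?thesis by auto
qed

text \<open>Each condition is linear over the field with two elements and at most halves the number
  of solutions: symmetric difference with one set \<open>D\<close> of odd meet maps the sets of odd
  meet injectively to those of even meet.\<close>

lemma even_meet_count:
  assumes "finite X" "finite F"
  shows "2 ^ card X \<le> 2 ^ card F * card {C. C \<subseteq> X \<and> (\<forall>Z\<in>F. even_meet C Z)}"
  using assms(2)
proof (induction F)
  case empty
  then show ?case using card_Pow[OF assms(1)] by (simp add: Pow_def)
next
  case (insert Z F)
  let ?S = "{C. C \<subseteq> X \<and> (\<forall>Z\<in>F. even_meet C Z)}"
  let ?T = "{C \<in> ?S. even_meet C Z}" and ?U = "{C \<in> ?S. \<not> even_meet C Z}"
  have fin: "finite ?S" by (rule finite_subset[of _ "Pow X"]) (use assms(1) in auto)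
  have "card ?U \<le> card ?T"
  proof (cases "?U = {}")
    case False
    then obtain D where D: "D \<in> ?U" by blast
    let ?f = "\<lambda>C. (C - D) \<union> (D - C)"
    have par: "even_meet (?f C) W \<longleftrightarrow> even_meet C W = even_meet D W" if "C \<subseteq> X" for C W
    proof -
      have "?f C \<inter> W = (C \<inter> W - D \<inter> W) \<union> (D \<inter> W - C \<inter> W)" by blast
      moreover have "finite (C \<inter> W)" "finite (D \<inter> W)" using that D assms(1) by (auto intro: finite_subset)
      ultimately show ?thesis unfolding even_meet_def using even_card_symmetric_difference by metis
    qed
    show ?thesis
    proof (rule card_inj_on_le)
      show "inj_on ?f ?U" by (rule inj_onI) blast
      show "?f ` ?U \<subseteq> ?T"
      proof
        fix B assume "B \<in> ?f ` ?U"
        then obtain C where C: "C \<in> ?U" "B = ?f C" by blast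
        then show "B \<in> ?T" using D par[of C] by auto
      qed
      show "finite ?T" by (rule finite_subset[OF _ fin]) blast
    qed
  next
    case True
    then show ?thesis by (metis card.empty le0)
  qed
  moreover have "card ?S = card ?T + card ?U"
  proof -
    have "?S = ?T \<union> ?U" by blast
    moreover have "card (?T \<union> ?U) = card ?T + card ?U"
      by (rule card_Un_disjoint) (blast intro: finite_subset[OF _ fin])+
    ultimately show ?thesis by (simp only:)
  qed
  moreover have "{C. C \<subseteq> X \<and> (\<forall>Z\<in>insert Z F. even_meet C Z)} = ?T" by blast
  ultimately have "card ?S \<le> 2 * card {C. C \<subseteq> X \<and> (\<forall>Z\<in>insert Z F. even_meet C Z)}" by simp
  then have "2 ^ card F * card ?S \<le> 2 ^ card (insert Z F) * card {C. C \<subseteq> X \<and> (\<forall>Z\<in>insert Z F. even_meet C Z)}"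
    using insert by simp
  then show ?case using insert.IH by linarith
qed

text \<open>Subsets of an eight-point set, up to complement and of even size, form a projective space
  over the field with two elements; a pairing \<open>C \<mapsto> card (C \<inter> Z)\<close> modulo two identifies it
  with its dual. The colourings preserved by an involution up to swapping the colours are
  the ones annihilated by a line. The lines of commuting involutions meet, so the lines of a
  string of five labels form a closed pentagon.\<close>

lemma few_points_span:
  fixes L :: "nat \<Rightarrow> 'p set"
  assumes r: "3 \<le> r" "r \<le> 5"
    and two: "\<And>i Z. i < r \<Longrightarrow> \<exists>W\<in>L i. W \<noteq> Z"
    and meet: "\<And>i j. Suc i < j \<Longrightarrow> j < r \<Longrightarrow> \<exists>Z. Z \<in> L i \<and> Z \<in> L j"
  shows "(\<exists>P. \<forall>i<r. P \<in> L i) \<or>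
    (\<exists>xs. length xs \<le> 5 \<and> (\<forall>E. (\<forall>i<r. \<forall>Z\<in>L i. \<forall>W\<in>L i. Z \<noteq> W \<longrightarrow> E Z \<longrightarrow> E W \<longrightarrow> (\<forall>V\<in>L i. E V)) \<longrightarrow>
      (\<forall>Z\<in>set xs. E Z) \<longrightarrow> (\<forall>i<r. \<forall>V\<in>L i. E V)))"
    (is "?common \<or> (\<exists>xs. length xs \<le> 5 \<and> (\<forall>E. ?ok E \<longrightarrow> ?on E xs \<longrightarrow> ?all E))")
proof -
  have fin: "?common \<or> (\<exists>xs. length xs \<le> 5 \<and> (\<forall>E. ?ok E \<longrightarrow> ?on E xs \<longrightarrow> ?all E))"
    if "length xs \<le> 5" "\<And>E. ?ok E \<Longrightarrow> ?on E xs \<Longrightarrow> ?all E" for xs using that by blast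
  have "\<forall>i Z. i < r \<longrightarrow> (\<exists>W. W \<in> L i \<and> W \<noteq> Z)" using two by blast
  then obtain y where y: "\<And>i Z. i < r \<Longrightarrow> y i Z \<in> L i \<and> y i Z \<noteq> Z" by metis
  have grow: "\<forall>V\<in>L i. E V" if "?ok E" "i < r" "Z \<in> L i" "E Z" "E (y i Z)" for E i Z
    using that y[OF that(2), of Z] by metis
  consider "r = 3" | "r = 4" | "r = 5" using r by linarith
  then show ?thesis
  proof cases
    case 1
    then have less: "i < r \<longleftrightarrow> i = 0 \<or> i = 1 \<or> i = 2" for i by auto
    obtain f where f: "f \<in> L 0" "f \<in> L 2" using meet[of 0 2] 1 by auto
    define q where "q = y 1 f"
    have q: "q \<in> L 1" using y[of 1 f] 1 by (simp add: q_def)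
    show ?thesis
    proof (rule fin[of "[f, y 0 f, y 2 f, q, y 1 q]"])
      fix E assume ok: "?ok E" and on: "?on E [f, y 0 f, y 2 f, q, y 1 q]"
      have "\<forall>V\<in>L 0. E V" "\<forall>V\<in>L 2. E V" "\<forall>V\<in>L 1. E V"
        by (rule grow[OF ok _ f(1)] grow[OF ok _ f(2)] grow[OF ok _ q]; use on 1 in simp)+
      then show "?all E" unfolding less by blast
    qed simp
  next
    case 2
    then have less: "i < r \<longleftrightarrow> i = 0 \<or> i = 1 \<or> i = 2 \<or> i = 3" for i by auto
    obtain f a d where p: "f \<in> L 0" "f \<in> L 2" "a \<in> L 0" "a \<in> L 3" "d \<in> L 1" "d \<in> L 3"
      using meet[of 0 2] meet[of 0 3] meet[of 1 3] 2 by auto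
    show ?thesis
    proof (rule fin[of "[a, y 0 a, y 3 a, y 1 d, y 2 f]"])
      fix E assume ok: "?ok E" and on: "?on E [a, y 0 a, y 3 a, y 1 d, y 2 f]"
      have l: "\<forall>V\<in>L 0. E V" "\<forall>V\<in>L 3. E V"
        by (rule grow[OF ok _ p(3)] grow[OF ok _ p(4)]; use on 2 in simp)+
      then have fd: "E f" "E d" using p by blast+
      have "\<forall>V\<in>L 1. E V" "\<forall>V\<in>L 2. E V"
        by (rule grow[OF ok _ p(5)] grow[OF ok _ p(2)]; use on fd 2 in simp)+
      then show "?all E" unfolding less using l by blast
    qed simp
  next
    case 3
    \<comment> \<open>Five lines in a cycle, each meeting the next. Two points span line
      \<open>i\<close>, and one further point each suffices for \<open>j\<close>, \<open>k\<close>
      and \<open>l\<close>; line \<open>m\<close> is then spanned by its intersections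
      \<open>t\<close> and \<open>u\<close> with its neighbours, if these differ.\<close>
    have cycle: ?thesis if all: "{..<r} = {i, j, k, l, m}"
      and p: "p \<in> L i \<inter> L j" "q \<in> L j \<inter> L k" "s \<in> L k \<inter> L l" "t \<in> L l \<inter> L m" "u \<in> L m \<inter> L i" "t \<noteq> u"
      for i j k l m p q s t u
    proof (rule fin[of "[p, y i p, y j p, y k q, y l s]"])
      fix E assume ok: "?ok E" and on: "?on E [p, y i p, y j p, y k q, y l s]"
      have less: "i < r" "j < r" "k < r" "l < r" "m < r" using all by blast+
      have li: "\<forall>V\<in>L i. E V" and lj: "\<forall>V\<in>L j. E V" using grow[OF ok less(1), of p] grow[OF ok less(2), of p] p(1) on by simp_all
      have lk: "\<forall>V\<in>L k. E V" using grow[OF ok less(3), of q] lj p(2) on by simp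
      have ll: "\<forall>V\<in>L l. E V" using grow[OF ok less(4), of s] lk p(3) on by simp
      have "E t" "E u" using ll li p(4,5) by auto
      then have lm: "\<forall>V\<in>L m. E V" using ok less(5) p(4-6) by blast
      show "?all E"
      proof (intro allI impI)
        fix v assume "v < r"
        then have "v \<in> {i, j, k, l, m}" using all by blast
        then show "\<forall>V\<in>L v. E V" using li lj lk ll lm by blast
      qed
    qed simp
    obtain a d e h f where p: "a \<in> L 0 \<inter> L 3" "d \<in> L 3 \<inter> L 1" "e \<in> L 1 \<inter> L 4" "h \<in> L 4 \<inter> L 2" "f \<in> L 2 \<inter> L 0"
      using meet[of 0 3] meet[of 1 3] meet[of 1 4] meet[of 2 4] meet[of 0 2] 3 by auto
    \<comment> \<open>In the cyclic order 0, 3, 1, 4, 2 neighbouring lines belong to commuting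
      labels. The rotations choose which line comes last; if the intersections coincide for all
      choices, the five lines share a point.\<close>
    have all: "{..<r} = {0, 3, 1, 4, 2}" "{..<r} = {3, 1, 4, 2, 0}" "{..<r} = {1, 4, 2, 0, 3}"
      "{..<r} = {4, 2, 0, 3, 1}" "{..<r} = {2, 0, 3, 1, 4}" using 3 by auto
    show ?thesis
    proof (cases "h = f \<and> f = a \<and> a = d \<and> d = e")
      case True
      then have "\<forall>i<r. a \<in> L i" using p 3 by (auto simp: less_Suc_eq numeral_eq_Suc)
      then show ?thesis by blast
    next
      case False
      then show ?thesis
        using cycle[OF all(1) p] cycle[OF all(2) p(2-5,1)] cycle[OF all(3) p(3-5,1,2)]
          cycle[OF all(4) p(4,5,1-3)] by blast
    qed
  qed
qed

section \<open>Lines of involutions on eight points\<close>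

definition two_coloured :: "'a set \<Rightarrow> ('a \<Rightarrow> 'a) \<Rightarrow> 'a set \<Rightarrow> bool" where
  "two_coloured X g C \<longleftrightarrow> (\<forall>y\<in>X. g y \<in> C \<longleftrightarrow> y \<in> C) \<or> (\<forall>y\<in>X. g y \<in> C \<longleftrightarrow> y \<notin> C)"

text \<open>The line of an involution on eight points. Complementary sets are the same point, so
  only the representative containing the base point \<open>x\<close> is kept.\<close>

definition line :: "'a set \<Rightarrow> 'a \<Rightarrow> ('a \<Rightarrow> 'a) \<Rightarrow> 'a set set" where
  "line X x g = {Z. Z \<subseteq> X \<and> x \<in> Z \<and> Z \<noteq> X \<and> (\<forall>y\<in>X. g y \<in> Z \<longleftrightarrow> y \<in> Z) \<and>
     (Z \<subseteq> {y \<in> X. g y \<noteq> y} \<or> X - Z \<subseteq> {y \<in> X. g y \<noteq> y}) \<and>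
     ((\<forall>y\<in>X. g y \<noteq> y) \<longrightarrow> card Z = 4)}"

lemma third_point:
  assumes "L = {A, B, D}" "Z \<in> L" "W \<in> L" "Z \<noteq> W" "E Z" "E W" "E D \<longleftrightarrow> E A = E B"
  shows "E A \<and> E B \<and> (\<forall>V\<in>L. E V)"
  using assms by blast

lemma even_meet_pair:
  assumes "a \<noteq> b" shows "even_meet C {a, b} \<longleftrightarrow> (a \<in> C) = (b \<in> C)"
proof -
  have "C \<inter> {a, b} = (if a \<in> C then {a} else {}) \<union> (if b \<in> C then {b} else {})" by auto
  then show ?thesis using assms by (simp add: even_meet_def card_insert_if split: if_splits)
qed

lemma even_meet_Un:
  assumes "finite A" "finite B" "A \<inter> B = {}" shows "even_meet C (A \<union> B) \<longleftrightarrow> even_meet C A = even_meet C B"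
proof -
  have "card (C \<inter> (A \<union> B)) = card (C \<inter> A) + card (C \<inter> B)"
    unfolding Int_Un_distrib by (rule card_Un_disjoint) (use assms in auto)
  then show ?thesis by (simp add: even_meet_def)
qed

lemma even_meet_two_pairs:
  assumes "distinct [a, b, c, d]"
  shows "even_meet C {a, b, c, d} \<longleftrightarrow> even_meet C {a, b} = even_meet C {c, d}"
proof -
  have "{a, b} \<inter> {c, d} = {}" "{a, b} \<union> {c, d} = {a, b, c, d}" using assms by auto
  then show ?thesis using even_meet_Un[of "{a, b}" "{c, d}" C] by simp
qed

context
  fixes X :: "'a set" and x :: 'a
  assumes X: "finite X" "card X = 8" and x: "x \<in> X"
begin

text \<open>The sets \<open>C\<close> tested have even size, so the parity of the intersection does
  not distinguish a set from its complement, and the two may count as one point.\<close>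

lemma even_meet_complement:
  assumes "C \<subseteq> X" "even (card C)" "Z \<subseteq> X" shows "even_meet C (X - Z) \<longleftrightarrow> even_meet C Z"
proof -
  have "even_meet C (Z \<union> (X - Z)) \<longleftrightarrow> even_meet C Z = even_meet C (X - Z)"
    by (rule even_meet_Un) (use X assms(3) finite_subset in auto)
  moreover have "Z \<union> (X - Z) = X" using assms(3) by blast
  moreover have "even_meet C X" using assms(1,2) by (simp add: even_meet_def Int_absorb2)
  ultimately show ?thesis by simp
qed

lemma point_outside:
  assumes "length l < 8" shows "\<exists>y\<in>X. y \<notin> set l"
proof (rule ccontr)
  assume "\<not> ?thesis"
  then have "card X \<le> card (set l)" by (intro card_mono) auto
  then show False using card_length[of l] assms X by linarith
qed

lemma free_of_card: "card {y \<in> X. f y \<noteq> y} = 8 \<Longrightarrow> y \<in> X \<Longrightarrow> f y \<noteq> y"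
proof -
  assume "card {y \<in> X. f y \<noteq> y} = 8" "y \<in> X"
  moreover from this have "{y \<in> X. f y \<noteq> y} = X" using X by (intro card_subset_eq) auto
  ultimately show ?thesis by blast
qed

context
  fixes g :: "'a \<Rightarrow> 'a"
  assumes g: "\<And>y. g (g y) = y" "\<And>y. y \<in> X \<Longrightarrow> g y \<in> X"
    and m: "card {y \<in> X. g y \<noteq> y} = 4 \<or> card {y \<in> X. g y \<noteq> y} = 8"
begin

lemma flip: "g y = z \<longleftrightarrow> y = g z"
  using g(1) by metis

lemma four_support:
  assumes "card {y \<in> X. g y \<noteq> y} = 4"
  shows "\<exists>a b. distinct [a, g a, b, g b] \<and> {y \<in> X. g y \<noteq> y} = {a, g a, b, g b}"
proof -
  let ?M = "{y \<in> X. g y \<noteq> y}"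
  have "?M \<noteq> {}" using assms by (metis card.empty zero_neq_numeral)
  then obtain a where a: "a \<in> ?M" by blast
  have a': "g a \<in> ?M" "g a \<noteq> a" using a g flip[of "g a" a] by auto
  have "\<not> ?M \<subseteq> {a, g a}" using card_mono[of "{a, g a}" ?M] a' assms by auto
  then obtain b where b: "b \<in> ?M" "b \<notin> {a, g a}" by blast
  have b': "g b \<in> ?M" "g b \<noteq> b" using b g flip[of "g b" b] by auto
  have d: "distinct [a, g a, b, g b]" using a' b b' flip[of b a] flip[of b "g a"] g(1) by auto
  have "?M = set [a, g a, b, g b]"
    by (rule card_subset_eq[symmetric]) (use X a a' b b' distinct_card[OF d] assms in auto)
  then show ?thesis using d by auto
qed

lemma free_pairs:
  assumes "\<And>y. y \<in> X \<Longrightarrow> g y \<noteq> y"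
  shows "\<exists>a b c. distinct [x, g x, a, g a, b, g b, c, g c] \<and> X = {x, g x, a, g a, b, g b, c, g c}"
proof -
  obtain a where a: "a \<in> X" "a \<notin> set [x, g x]" using point_outside[of "[x, g x]"] by auto
  obtain b where b: "b \<in> X" "b \<notin> set [x, g x, a, g a]" using point_outside[of "[x, g x, a, g a]"] by auto
  obtain c where c: "c \<in> X" "c \<notin> set [x, g x, a, g a, b, g b]"
    using point_outside[of "[x, g x, a, g a, b, g b]"] by auto
  have n: "g x \<noteq> x" "g a \<noteq> a" "g b \<noteq> b" "g c \<noteq> c" using assms x a b c by auto
  have d: "distinct [x, g x, a, g a, b, g b, c, g c]"
    using a b c n g(1) flip[of a x] flip[of b x] flip[of c x] flip[of b a] flip[of c a] flip[of c b]
      flip[of a "g x"] flip[of b "g x"] flip[of c "g x"] flip[of b "g a"] flip[of c "g a"] flip[of c "g b"]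
    by auto
  have "X = set [x, g x, a, g a, b, g b, c, g c]"
    by (rule card_subset_eq[symmetric]) (use X x a b c g(2) distinct_card[OF d] in auto)
  then show ?thesis using d by auto
qed

text \<open>The invariant nonempty subsets of the support are the two exchanged pairs and their
  union, which add up to zero modulo two.\<close>

lemma line_four:
  assumes d: "distinct [a, g a, b, g b]" and M: "{y \<in> X. g y \<noteq> y} = {a, g a, b, g b}"
  defines "norm \<equiv> \<lambda>Z. if x \<in> Z then Z else X - Z"
  shows "line X x g = {norm {a, g a}, norm {b, g b}, norm {a, g a, b, g b}}"
proof
  have sub: "{a, g a, b, g b} \<subseteq> X" using M by blast
  have nf: "\<not> (\<forall>y\<in>X. g y \<noteq> y)"
  proof
    assume "\<forall>y\<in>X. g y \<noteq> y"
    then have "X = set [a, g a, b, g b]" using M by auto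
    then show False using distinct_card[OF d] X by simp
  qed
  show "line X x g \<subseteq> {norm {a, g a}, norm {b, g b}, norm {a, g a, b, g b}}"
  proof
    fix Z assume Z: "Z \<in> line X x g"
    have inv: "a \<in> Z \<longleftrightarrow> g a \<in> Z" "b \<in> Z \<longleftrightarrow> g b \<in> Z" using Z sub by (auto simp: line_def)
    have xZ: "x \<in> Z" "Z \<subseteq> X" "Z \<noteq> X" using Z by (auto simp: line_def)
    have small: "Y \<in> {{a, g a}, {b, g b}, {a, g a, b, g b}}"
      if Y: "Y \<subseteq> {a, g a, b, g b}" "Y \<noteq> {}" "a \<in> Y \<longleftrightarrow> g a \<in> Y" "b \<in> Y \<longleftrightarrow> g b \<in> Y" for Y
    proof -
      have "Y = (if a \<in> Y then {a, g a} else {}) \<union> (if b \<in> Y then {b, g b} else {})" using Y by auto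
      then show ?thesis using Y(2) by (auto split: if_splits)
    qed
    consider "Z \<subseteq> {a, g a, b, g b}" | "X - Z \<subseteq> {a, g a, b, g b}" using Z M by (auto simp: line_def)
    then show "Z \<in> {norm {a, g a}, norm {b, g b}, norm {a, g a, b, g b}}"
    proof cases
      case 1
      have "norm Z = Z" using xZ by (simp add: norm_def)
      moreover have "norm Z \<in> norm ` {{a, g a}, {b, g b}, {a, g a, b, g b}}"
        by (rule imageI, rule small[OF 1 _ inv]) (use xZ in blast)
      ultimately show ?thesis by (simp only: image_insert image_empty)
    next
      case 2
      have "norm (X - Z) = Z" using xZ by (auto simp: norm_def)
      moreover have "norm (X - Z) \<in> norm ` {{a, g a}, {b, g b}, {a, g a, b, g b}}"
        by (rule imageI, rule small[OF 2]) (use xZ inv sub in auto)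
      ultimately show ?thesis by (simp only: image_insert image_empty)
    qed
  qed
  have *: "norm Y \<in> line X x g" if Y: "Y \<subseteq> {a, g a, b, g b}" "Y \<noteq> {}" "\<And>y. y \<in> Y \<Longrightarrow> g y \<in> Y" for Y
  proof -
    have i: "g y \<in> Y \<longleftrightarrow> y \<in> Y" for y using Y(3) g(1) by metis
    have "card Y \<le> card (set [a, g a, b, g b])" by (rule card_mono) (use Y(1) in auto)
    then have "Y \<noteq> X" using distinct_card[OF d] X by auto
    have YX: "Y \<subseteq> X" using Y(1) sub by blast
    have YM: "Y \<subseteq> {y \<in> X. g y \<noteq> y}" using Y(1) M by simp
    show ?thesis
    proof (cases "x \<in> Y")
      case True
      then have "Y \<in> line X x g" unfolding line_def mem_Collect_eq using YX \<open>Y \<noteq> X\<close> YM nf i by blast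
      then show ?thesis using True by (simp add: norm_def)
    next
      case False
      have XY: "X - (X - Y) = Y" "X - Y \<noteq> X" using YX Y(2) by auto
      have "\<forall>y\<in>X. g y \<in> X - Y \<longleftrightarrow> y \<in> X - Y" using i g(2) by simp
      then have "X - Y \<in> line X x g" unfolding line_def mem_Collect_eq XY(1) using False x XY(2) YM nf by blast
      then show ?thesis using False by (simp add: norm_def)
    qed
  qed
  then show "{norm {a, g a}, norm {b, g b}, norm {a, g a, b, g b}} \<subseteq> line X x g"
    using *[of "{a, g a}"] *[of "{b, g b}"] *[of "{a, g a, b, g b}"] g(1) by auto
qed

text \<open>An invariant set of four points is a union of two exchanged pairs; that of
  \<open>x\<close> is one of them, which leaves three choices.\<close>

lemma line_free:
  assumes d: "distinct [x, g x, a, g a, b, g b, c, g c]" and M: "X = {x, g x, a, g a, b, g b, c, g c}"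
    and free: "\<And>y. y \<in> X \<Longrightarrow> g y \<noteq> y"
  shows "line X x g = {{x, g x, a, g a}, {x, g x, b, g b}, {x, g x, c, g c}}"
proof
  show "line X x g \<subseteq> {{x, g x, a, g a}, {x, g x, b, g b}, {x, g x, c, g c}}"
  proof
    fix Z assume Z: "Z \<in> line X x g"
    have inv: "a \<in> Z \<longleftrightarrow> g a \<in> Z" "b \<in> Z \<longleftrightarrow> g b \<in> Z" "c \<in> Z \<longleftrightarrow> g c \<in> Z" "x \<in> Z" "g x \<in> Z"
      using Z M by (auto simp: line_def)
    define p q t where "p = (a \<in> Z)" and "q = (b \<in> Z)" and "t = (c \<in> Z)"
    define l where "l = [x, g x] @ (if p then [a, g a] else []) @ (if q then [b, g b] else []) @ (if t then [c, g c] else [])"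
    have e: "Z = set l"
    proof
      show "Z \<subseteq> set l"
      proof
        fix v assume v: "v \<in> Z"
        then have "v \<in> {x, g x, a, g a, b, g b, c, g c}" using Z M unfolding line_def by blast
        then show "v \<in> set l" using v inv unfolding l_def p_def q_def t_def by (elim insertE) simp_all
      qed
      show "set l \<subseteq> Z"
        using inv unfolding l_def p_def q_def t_def by (cases "a \<in> Z"; cases "b \<in> Z"; cases "c \<in> Z") simp_all
    qed
    have "distinct l" using d unfolding l_def by (cases p; cases q; cases t) simp_all
    then have "card Z = length l" unfolding e by (rule distinct_card)
    moreover have "card Z = 4" using Z free by (simp add: line_def)
    ultimately have "length l = 4" by simp
    then show "Z \<in> {{x, g x, a, g a}, {x, g x, b, g b}, {x, g x, c, g c}}"
      unfolding e l_def by (cases p; cases q; cases t) simp_all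
  qed
  have "{x, g x, y, g y} \<in> line X x g" if y: "y \<in> {a, b, c}" for y
  proof -
    have dy: "distinct [x, g x, y, g y]" using d y by auto
    have "card {x, g x, y, g y} = 4" using distinct_card[OF dy] by simp
    moreover have "{x, g x, y, g y} \<subseteq> X" using y M by auto
    moreover have "g v \<in> {x, g x, y, g y} \<longleftrightarrow> v \<in> {x, g x, y, g y}" for v
      using g(1) flip[of v] by (metis insert_iff empty_iff)
    moreover have "{x, g x, y, g y} \<noteq> X" using calculation(1) X by auto
    ultimately show ?thesis unfolding line_def mem_Collect_eq using free by blast
  qed
  then show "{{x, g x, a, g a}, {x, g x, b, g b}, {x, g x, c, g c}} \<subseteq> line X x g" by simp
qed

lemma norm_eq:
  assumes "A \<subseteq> X" "B \<subseteq> X" "(if x \<in> A then A else X - A) = (if x \<in> B then B else X - B)"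
  shows "A = B \<or> A = X - B"
  using assms by (auto split: if_splits)

lemma two_points_on_line: "\<exists>Z W. Z \<in> line X x g \<and> W \<in> line X x g \<and> Z \<noteq> W"
  using m
proof
  assume "card {y \<in> X. g y \<noteq> y} = 4"
  then obtain a b where d: "distinct [a, g a, b, g b]" and M: "{y \<in> X. g y \<noteq> y} = {a, g a, b, g b}"
    using four_support by blast
  have sub: "{a, g a} \<subseteq> X" "{b, g b} \<subseteq> X" using M by blast+
  have "{a, g a} \<noteq> {b, g b}" using d by auto
  moreover have "{a, g a} \<noteq> X - {b, g b}"
  proof
    assume "{a, g a} = X - {b, g b}"
    then have "X = set [a, g a, b, g b]" using sub by auto
    then show False using distinct_card[OF d] X by simp
  qed
  ultimately have ne: "(if x \<in> {a, g a} then {a, g a} else X - {a, g a}) \<noteq> (if x \<in> {b, g b} then {b, g b} else X - {b, g b})"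
    using norm_eq[OF sub] by blast
  then show ?thesis unfolding line_four[OF d M] by blast
next
  assume "card {y \<in> X. g y \<noteq> y} = 8"
  then have free: "\<And>y. y \<in> X \<Longrightarrow> g y \<noteq> y" using free_of_card by blast
  obtain a b c where d: "distinct [x, g x, a, g a, b, g b, c, g c]" and M: "X = {x, g x, a, g a, b, g b, c, g c}"
    using free_pairs[OF free] by blast
  have "{x, g x, a, g a} \<noteq> {x, g x, b, g b}" using d by auto
  moreover have "line X x g = {{x, g x, a, g a}, {x, g x, b, g b}, {x, g x, c, g c}}" by (rule line_free[OF d M free])
  ultimately show ?thesis by blast
qed

text \<open>The three points of a line add up to zero, so two conditions imply the third. With four
  moved points this means that each exchanged pair has one colour, so \<open>g\<close> preserves
  colours. With eight, all four pairs have the same parity, so \<open>g\<close> preserves every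
  colour or swaps every colour.\<close>

lemma line_determined:
  assumes C: "C \<subseteq> X" "even (card C)" and ZW: "Z \<in> line X x g" "W \<in> line X x g" "Z \<noteq> W"
    and e: "even_meet C Z" "even_meet C W"
  shows "(\<forall>V\<in>line X x g. even_meet C V) \<and> two_coloured X g C"
  using m
proof
  assume "card {y \<in> X. g y \<noteq> y} = 4"
  then obtain a b where d: "distinct [a, g a, b, g b]" and M: "{y \<in> X. g y \<noteq> y} = {a, g a, b, g b}"
    using four_support by blast
  let ?n = "\<lambda>Z. if x \<in> Z then Z else X - Z"
  have sub: "{a, g a} \<subseteq> X" "{b, g b} \<subseteq> X" "{a, g a, b, g b} \<subseteq> X" using M by blast+
  have n: "even_meet C (?n Z) \<longleftrightarrow> even_meet C Z" if "Z \<subseteq> X" for Z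
    using even_meet_complement[OF C that] by simp
  note ns = n[OF sub(1)] n[OF sub(2)] n[OF sub(3)] even_meet_two_pairs[OF d]
  have L: "line X x g = {?n {a, g a}, ?n {b, g b}, ?n {a, g a, b, g b}}" by (rule line_four[OF d M])
  have "even_meet C (?n {a, g a, b, g b}) \<longleftrightarrow> even_meet C (?n {a, g a}) = even_meet C (?n {b, g b})"
    unfolding ns ..
  from third_point[of _ _ _ _ Z W "even_meet C", OF L ZW e this]
  have all: "even_meet C {a, g a}" "even_meet C {b, g b}" and "\<forall>V\<in>line X x g. even_meet C V"
    unfolding ns by blast+
  note this(3)
  moreover have "g y \<in> C \<longleftrightarrow> y \<in> C" if "y \<in> X" for y
  proof (cases "g y = y")
    case False
    then have "y \<in> {a, g a, b, g b}" using M that by blast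
    moreover have "a \<in> C \<longleftrightarrow> g a \<in> C" "b \<in> C \<longleftrightarrow> g b \<in> C" using all even_meet_pair d by (metis distinct_length_2_or_more)+
    ultimately show ?thesis using g(1) by auto
  qed simp
  ultimately show ?thesis by (simp add: two_coloured_def)
next
  assume "card {y \<in> X. g y \<noteq> y} = 8"
  then have free: "\<And>y. y \<in> X \<Longrightarrow> g y \<noteq> y" using free_of_card by blast
  obtain a b c where d: "distinct [x, g x, a, g a, b, g b, c, g c]" and M: "X = {x, g x, a, g a, b, g b, c, g c}"
    using free_pairs[OF free] by blast
  have L: "line X x g = {{x, g x, a, g a}, {x, g x, b, g b}, {x, g x, c, g c}}" by (rule line_free[OF d M free])
  let ?p = "\<lambda>v. even_meet C {v, g v}"
  have dd: "distinct [x, g x, a, g a]" "distinct [x, g x, b, g b]" "distinct [x, g x, c, g c]" "distinct [b, g b, c, g c]"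
    using d by auto
  note ps = dd[THEN even_meet_two_pairs, of C]
  have "even_meet C ({x, g x, a, g a} \<union> {b, g b, c, g c}) \<longleftrightarrow> even_meet C {x, g x, a, g a} = even_meet C {b, g b, c, g c}"
    by (rule even_meet_Un) (use d in auto)
  moreover have "{x, g x, a, g a} \<union> {b, g b, c, g c} = X" unfolding M by auto
  moreover have "even_meet C X" using C by (simp add: even_meet_def Int_absorb2)
  ultimately have total: "even_meet C {x, g x, a, g a} = even_meet C {b, g b, c, g c}" by simp
  have "even_meet C {x, g x, c, g c} \<longleftrightarrow> even_meet C {x, g x, a, g a} = even_meet C {x, g x, b, g b}"
    using total unfolding ps by argo
  from third_point[of _ _ _ _ Z W "even_meet C", OF L ZW e this]
  have ev: "\<forall>V\<in>line X x g. even_meet C V" by blast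
  then have "even_meet C {x, g x, a, g a}" "even_meet C {x, g x, b, g b}" "even_meet C {x, g x, c, g c}"
    unfolding L by blast+
  then have all: "?p a = ?p x" "?p b = ?p x" "?p c = ?p x" unfolding ps by blast+
  note ev
  moreover have op: "?p v \<longleftrightarrow> (v \<in> C) = (g v \<in> C)" if "v \<in> X" for v using even_meet_pair[of v "g v" C] free[OF that] by metis
  have "?p v = ?p x" if "v \<in> X" for v
  proof -
    have "?p (g v) = ?p v" for v using g(1) by (simp add: insert_commute)
    then show ?thesis using that all unfolding M by auto
  qed
  then have "two_coloured X g C" using op unfolding two_coloured_def by blast
  ultimately show ?thesis by blast
qed

lemma line_even: assumes "Z \<in> line X x g" shows "even (card Z)"
  using m
proof
  assume "card {y \<in> X. g y \<noteq> y} = 4"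
  then obtain a b where d: "distinct [a, g a, b, g b]" and M: "{y \<in> X. g y \<noteq> y} = {a, g a, b, g b}"
    using four_support by blast
  have sub: "{a, g a} \<subseteq> X" "{b, g b} \<subseteq> X" "{a, g a, b, g b} \<subseteq> X" using M by blast+
  have c: "card {a, g a} = 2" "card {b, g b} = 2" "card {a, g a, b, g b} = 4" using d by auto
  have n: "even (card (X - Y))" if "Y \<subseteq> X" "even (card Y)" for Y
    using card_Diff_subset[OF finite_subset[OF that(1) X(1)] that(1)] X that(2) by simp
  show ?thesis using assms n[OF sub(1)] n[OF sub(2)] n[OF sub(3)] c
    unfolding line_four[OF d M] by (elim insertE emptyE) (simp_all split: if_splits)
next
  assume "card {y \<in> X. g y \<noteq> y} = 8"
  then have "\<forall>y\<in>X. g y \<noteq> y" using free_of_card by blast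
  then show ?thesis using assms by (simp add: line_def)
qed

end

lemma normal_point:
  assumes "Z \<subseteq> X" "Z \<noteq> {}" "Z \<noteq> X" "\<And>y. y \<in> X \<Longrightarrow> g y \<in> X" "\<And>y. y \<in> X \<Longrightarrow> g y \<in> Z \<longleftrightarrow> y \<in> Z"
    and "Z \<subseteq> {y \<in> X. g y \<noteq> y} \<or> X - Z \<subseteq> {y \<in> X. g y \<noteq> y}" "(\<forall>y\<in>X. g y \<noteq> y) \<Longrightarrow> card Z = 4"
  shows "(if x \<in> Z then Z else X - Z) \<in> line X x g"
proof (cases "x \<in> Z")
  case True
  then have "Z \<in> line X x g" unfolding line_def mem_Collect_eq using assms by blast
  then show ?thesis using True by simp
next
  case False
  have XZ: "X - (X - Z) = Z" "X - Z \<noteq> X" using assms(1,2) by auto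
  have "card (X - Z) = card X - card Z" using X assms(1) finite_subset by (intro card_Diff_subset) auto
  then have "(\<forall>y\<in>X. g y \<noteq> y) \<longrightarrow> card (X - Z) = 4" using X assms(7) by auto
  moreover have "\<forall>y\<in>X. g y \<in> X - Z \<longleftrightarrow> y \<in> X - Z" using assms(4,5) by simp
  ultimately have "X - Z \<in> line X x g" unfolding line_def mem_Collect_eq XZ(1) using False x XZ(2) assms(6) by blast
  then show ?thesis using False by simp
qed

text \<open>A proper set invariant under both involutions is needed. For two supports of four points
  it is their intersection or, if they are disjoint and hence complementary, either of them. A
  support of four points also serves if the other involution is free. If both are free, an orbit of
  the two involutions is used, or two exchanged pairs if the involutions agree on all
  points.\<close>

lemma lines_meet:
  assumes g: "\<And>y. g (g y) = y" "\<And>y. y \<in> X \<Longrightarrow> g y \<in> X"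
    and mg: "card {y \<in> X. g y \<noteq> y} = 4 \<or> card {y \<in> X. g y \<noteq> y} = 8"
    and h: "\<And>y. h (h y) = y" "\<And>y. y \<in> X \<Longrightarrow> h y \<in> X"
    and mh: "card {y \<in> X. h y \<noteq> y} = 4 \<or> card {y \<in> X. h y \<noteq> y} = 8"
    and com: "\<And>y. g (h y) = h (g y)"
  shows "\<exists>Z. Z \<in> line X x g \<and> Z \<in> line X x h"
proof -
  let ?G = "{y \<in> X. g y \<noteq> y}" and ?H = "{y \<in> X. h y \<noteq> y}"
  have both: ?thesis
    if Z: "Z \<subseteq> X" "Z \<noteq> {}" "Z \<noteq> X" "\<And>y. y \<in> X \<Longrightarrow> g y \<in> Z \<longleftrightarrow> y \<in> Z" "\<And>y. y \<in> X \<Longrightarrow> h y \<in> Z \<longleftrightarrow> y \<in> Z"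
      "Z \<subseteq> ?G \<or> X - Z \<subseteq> ?G" "Z \<subseteq> ?H \<or> X - Z \<subseteq> ?H"
      "(\<forall>y\<in>X. g y \<noteq> y) \<Longrightarrow> card Z = 4" "(\<forall>y\<in>X. h y \<noteq> y) \<Longrightarrow> card Z = 4" for Z
    using normal_point[OF Z(1-3) g(2) Z(4,6,8)] normal_point[OF Z(1-3) h(2) Z(5,7,9)] by blast
  have gG: "g y \<in> ?G \<longleftrightarrow> y \<in> ?G" "h y \<in> ?H \<longleftrightarrow> y \<in> ?H" if "y \<in> X" for y using that g h by force+
  have hG: "h y \<in> ?G \<longleftrightarrow> y \<in> ?G" if "y \<in> X" for y using that h(2) h(1) com by (metis (mono_tags, lifting) mem_Collect_eq)
  have gH: "g y \<in> ?H \<longleftrightarrow> y \<in> ?H" if "y \<in> X" for y using that g(2) g(1) com by (metis (mono_tags, lifting) mem_Collect_eq)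
  have nonfree: "\<not> (\<forall>y\<in>X. f y \<noteq> y)" if "card {y \<in> X. f y \<noteq> y} = 4" for f
  proof
    assume "\<forall>y\<in>X. f y \<noteq> y"
    then have "{y \<in> X. f y \<noteq> y} = X" by blast
    then show False using that X by simp
  qed
  have small: "Y \<noteq> {} \<and> Y \<noteq> X" if "card Y = 4" for Y using that X by auto
  consider (AA) "card ?G = 4" "card ?H = 4" | (AB) "card ?G = 4" "card ?H = 8" | (BA) "card ?G = 8" "card ?H = 4"
    | (BB) "card ?G = 8" "card ?H = 8" using mg mh by blast
  then show ?thesis
  proof cases
    case AA
    show ?thesis
    proof (cases "?G \<inter> ?H = {}")
      case True
      have "card (?G \<union> ?H) = 8" using card_Un_disjoint[OF _ _ True] AA X by simp
      then have "?G \<union> ?H = X" using X by (intro card_subset_eq) auto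
      then have "X - ?G \<subseteq> ?H" by blast
      show ?thesis
      proof (rule both[of "?G"])
        show "?G \<noteq> {}" "?G \<noteq> X" using small[OF AA(1)] by blast+
        show "\<And>y. y \<in> X \<Longrightarrow> g y \<in> ?G \<longleftrightarrow> y \<in> ?G" by (rule gG(1))
        show "\<And>y. y \<in> X \<Longrightarrow> h y \<in> ?G \<longleftrightarrow> y \<in> ?G" by (rule hG)
        show "?G \<subseteq> ?H \<or> X - ?G \<subseteq> ?H" using \<open>X - ?G \<subseteq> ?H\<close> by (rule disjI2)
        show "card ?G = 4" by (rule AA(1))
        show "card ?G = 4" by (rule AA(1))
      qed blast+
    next
      case False
      have "?G \<inter> ?H \<noteq> X" using AA small[of ?G] by blast
      show ?thesis
      proof (rule both[of "?G \<inter> ?H"])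
        show "?G \<inter> ?H \<noteq> {}" by (rule False)
        show "?G \<inter> ?H \<noteq> X" by (rule \<open>?G \<inter> ?H \<noteq> X\<close>)
        show "g y \<in> ?G \<inter> ?H \<longleftrightarrow> y \<in> ?G \<inter> ?H" if "y \<in> X" for y unfolding Int_iff gG(1)[OF that] gH[OF that] ..
        show "h y \<in> ?G \<inter> ?H \<longleftrightarrow> y \<in> ?G \<inter> ?H" if "y \<in> X" for y unfolding Int_iff gG(2)[OF that] hG[OF that] ..
        show "card (?G \<inter> ?H) = 4" if "\<forall>y\<in>X. g y \<noteq> y" using nonfree[OF AA(1)] that by (rule notE)
        show "card (?G \<inter> ?H) = 4" if "\<forall>y\<in>X. h y \<noteq> y" using nonfree[OF AA(2)] that by (rule notE)
      qed blast+
    qed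
  next
    case AB
    have "?H = X" using free_of_card[OF AB(2)] by blast
    then have "?G \<subseteq> ?H" by blast
    show ?thesis
    proof (rule both[of "?G"])
      show "?G \<noteq> {}" "?G \<noteq> X" using small[OF AB(1)] by blast+
      show "\<And>y. y \<in> X \<Longrightarrow> g y \<in> ?G \<longleftrightarrow> y \<in> ?G" by (rule gG(1))
      show "\<And>y. y \<in> X \<Longrightarrow> h y \<in> ?G \<longleftrightarrow> y \<in> ?G" by (rule hG)
      show "?G \<subseteq> ?H \<or> X - ?G \<subseteq> ?H" using \<open>?G \<subseteq> ?H\<close> by (rule disjI1)
      show "card ?G = 4" by (rule AB(1))
      show "card ?G = 4" by (rule AB(1))
    qed blast+
  next
    case BA
    have "?G = X" using free_of_card[OF BA(1)] by blast
    then have "?H \<subseteq> ?G" by blast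
    show ?thesis
    proof (rule both[of "?H"])
      show "?H \<noteq> {}" "?H \<noteq> X" using small[OF BA(2)] by blast+
      show "\<And>y. y \<in> X \<Longrightarrow> g y \<in> ?H \<longleftrightarrow> y \<in> ?H" by (rule gH)
      show "\<And>y. y \<in> X \<Longrightarrow> h y \<in> ?H \<longleftrightarrow> y \<in> ?H" by (rule gG(2))
      show "?H \<subseteq> ?G \<or> X - ?H \<subseteq> ?G" using \<open>?H \<subseteq> ?G\<close> by (rule disjI1)
      show "card ?H = 4" by (rule BA(2))
      show "card ?H = 4" by (rule BA(2))
    qed blast+
  next
    case BB
    have fr: "?G = X" "?H = X" using free_of_card[OF BB(1)] free_of_card[OF BB(2)] by blast+
    have four: ?thesis if Z: "card Z = 4" "Z \<subseteq> X" "\<And>y. g y \<in> Z \<longleftrightarrow> y \<in> Z" "\<And>y. h y \<in> Z \<longleftrightarrow> y \<in> Z" for Z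
      by (rule both[of Z]) (use Z small[OF Z(1)] fr in blast)+
    have gn: "g y \<noteq> y" "h y \<noteq> y" if "y \<in> X" for y using fr that by blast+
    show ?thesis
    proof (cases "\<exists>y\<in>X. g y \<noteq> h y")
      case True
      then obtain y where y: "y \<in> X" "g y \<noteq> h y" by blast
      have d: "distinct [y, g y, h y, g (h y)]"
        using y gn[OF y(1)] gn[OF h(2)[OF y(1)]] g(1) h(1) com by (simp, metis)
      show ?thesis
      proof (rule four[of "{y, g y, h y, g (h y)}"])
        show "card {y, g y, h y, g (h y)} = 4" using distinct_card[OF d] by simp
        show "{y, g y, h y, g (h y)} \<subseteq> X" using y g(2) h(2) by simp
        show "g v \<in> {y, g y, h y, g (h y)} \<longleftrightarrow> v \<in> {y, g y, h y, g (h y)}" for v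
          using g(1) by (metis insert_iff empty_iff)
        show "h v \<in> {y, g y, h y, g (h y)} \<longleftrightarrow> v \<in> {y, g y, h y, g (h y)}" for v
          using h(1) com by (metis insert_iff empty_iff)
      qed
    next
      case False
      obtain z where z: "z \<in> X" "z \<notin> set [x, g x]" using point_outside[of "[x, g x]"] by auto
      have d: "distinct [x, g x, z, g z]" using z gn[OF x] gn[OF z(1)] g(1) by (simp, metis)
      show ?thesis
      proof (rule four[of "{x, g x, z, g z}"])
        show "card {x, g x, z, g z} = 4" using distinct_card[OF d] by simp
        show sub: "{x, g x, z, g z} \<subseteq> X" using x z g(2) by simp
        show gi: "g v \<in> {x, g x, z, g z} \<longleftrightarrow> v \<in> {x, g x, z, g z}" for v
          using g(1) by (metis insert_iff empty_iff)
        show "h v \<in> {x, g x, z, g z} \<longleftrightarrow> v \<in> {x, g x, z, g z}" for v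
          using gi[of v] gi[of "h v"] False sub h by (metis subsetD)
      qed
    qed
  qed
qed

end

text \<open>Five spanning points and the requirement of even size are at most six linear conditions
  on subsets of eight points, so at least four subsets remain, and one is neither empty nor
  everything. If all lines share a point, that set is itself the colouring.\<close>

lemma (in invol_string) eight_points_colouring:
  assumes X: "finite X" "card X = 8" and cl: "\<And>i y. i < r \<Longrightarrow> y \<in> X \<Longrightarrow> \<rho> i y \<in> X" and r: "3 \<le> r" "r \<le> 5"
    and m: "\<And>i. i < r \<Longrightarrow> mv i X = 4 \<or> mv i X = 8"
  shows "\<exists>C\<subseteq>X. even (card C) \<and> C \<noteq> {} \<and> C \<noteq> X \<and> (\<forall>i<r. two_coloured X (\<rho> i) C)"
proof -
  have "X \<noteq> {}" using X by auto
  then obtain x where x: "x \<in> X" by blast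
  define L where "L i = line X x (\<rho> i)" for i
  have two: "\<exists>Z W. Z \<in> L i \<and> W \<in> L i \<and> Z \<noteq> W" if "i < r" for i
    unfolding L_def by (rule two_points_on_line[OF X x invol cl[OF that] m[OF that, unfolded mv_def]])
  have det: "(\<forall>V\<in>L i. even_meet C V) \<and> two_coloured X (\<rho> i) C"
    if "i < r" "C \<subseteq> X" "even (card C)" "Z \<in> L i" "W \<in> L i" "Z \<noteq> W" "even_meet C Z" "even_meet C W" for i C Z W
    using line_determined[OF X x invol cl[OF that(1)] m[OF that(1), unfolded mv_def]] that unfolding L_def by blast
  have meet: "\<exists>Z. Z \<in> L i \<and> Z \<in> L j" if "Suc i < j" "j < r" for i j
  proof -
    have ij: "i < r" "j < r" using that by auto
    show ?thesis unfolding L_def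
      by (rule lines_meet[OF X x invol cl[OF ij(1)] m[OF ij(1), unfolded mv_def] invol cl[OF ij(2)] m[OF ij(2), unfolded mv_def]])
        (assumption | rule comm[OF that(1)])+
  qed
  have two': "\<exists>W\<in>L i. W \<noteq> Z" if "i < r" for i Z using two[OF that] by metis
  consider (common) P where "\<forall>i<r. P \<in> L i"
    | (span) xs where "length xs \<le> 5" "\<forall>E. (\<forall>i<r. \<forall>Z\<in>L i. \<forall>W\<in>L i. Z \<noteq> W \<longrightarrow> E Z \<longrightarrow> E W \<longrightarrow> (\<forall>V\<in>L i. E V)) \<longrightarrow>
        (\<forall>Z\<in>set xs. E Z) \<longrightarrow> (\<forall>i<r. \<forall>V\<in>L i. E V)"
    by (rule disjE[OF few_points_span[OF r, of L]])
      (erule two' | (erule meet, assumption) | (erule exE, erule that(1)) | (elim exE conjE, erule that(2), assumption))+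
  then show ?thesis
  proof cases
    case common
    have "0 < r" using r by simp
    have P: "P \<in> line X x (\<rho> i)" if "i < r" for i using common that by (simp add: L_def)
    have "even (card P)" by (rule line_even[OF X x invol cl[OF \<open>0 < r\<close>] m[OF \<open>0 < r\<close>, unfolded mv_def] P[OF \<open>0 < r\<close>]])
    moreover have "P \<subseteq> X" "P \<noteq> {}" "P \<noteq> X" using P[OF \<open>0 < r\<close>] by (auto simp: line_def)
    moreover have "two_coloured X (\<rho> i) P" if "i < r" for i using P[OF that] by (simp add: line_def two_coloured_def)
    ultimately show ?thesis by blast
  next
    case span
    let ?F = "insert X (set xs)"
    let ?S = "{C. C \<subseteq> X \<and> (\<forall>Z\<in>?F. even_meet C Z)}"
    have "card ?F \<le> Suc (card (set xs))" by (rule card_insert_le_m1) (simp_all add: card_insert_if)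
    then have "card ?F \<le> 6" using card_length[of xs] span(1) by linarith
    then have "(2::nat) ^ card ?F \<le> 2 ^ 6" by (intro power_increasing) auto
    moreover have "(2::nat) ^ 8 \<le> 2 ^ card ?F * card ?S" using even_meet_count[of X ?F] X by simp
    ultimately have "2 ^ 8 \<le> 2 ^ 6 * card ?S" by (meson le_trans mult_le_mono1)
    then have "\<not> card ?S \<le> 2" by simp
    moreover have "card {{}, X} \<le> 2" by (simp add: card_insert_if)
    ultimately have "\<not> ?S \<subseteq> {{}, X}" using card_mono[of "{{}, X}" ?S] by fastforce
    then obtain C where C: "C \<in> ?S" "C \<noteq> {}" "C \<noteq> X" by blast
    have CX: "C \<subseteq> X" "even (card C)" "\<forall>Z\<in>set xs. even_meet C Z"
      using C(1) by (auto simp: even_meet_def Int_absorb2)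
    have all: "\<forall>i<r. \<forall>V\<in>L i. even_meet C V"
      by (rule span(2)[THEN spec, of "even_meet C", THEN mp, THEN mp]) (use det CX in blast)+
    have "two_coloured X (\<rho> i) C" if "i < r" for i
      using two[OF that] det[OF that CX(1,2)] all that by blast
    then show ?thesis using C CX by blast
  qed
qed

context alt_string
begin

lemma eight_points_false: "card \<Omega> \<noteq> 8"
proof
  assume n: "card \<Omega> = 8"
  interpret P: primitive_string \<rho> \<Omega> r by (rule primitive_string) (use n in simp)
  \<comment> \<open>For \<open>r \<ge> 6\<close> both alternatives of \<open>rank_bound\<close> fail
    on eight points.\<close>
  have r: "3 \<le> r" "r \<le> 5" using three_labels P.rank_bound n by fastforce+
  obtain C where C: "C \<subseteq> \<Omega>" "C \<noteq> {}" "C \<noteq> \<Omega>" "\<forall>i<r. two_coloured \<Omega> (\<rho> i) C"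
    using eight_points_colouring[OF finite_points n closed r P.mv_values] n by auto
  have "(\<forall>y\<in>\<Omega>. \<forall>z\<in>\<Omega>. (y \<in> C) = (z \<in> C) \<longrightarrow> y = z) \<or> (\<forall>y\<in>\<Omega>. \<forall>z\<in>\<Omega>. (y \<in> C) = (z \<in> C))"
  proof (rule primitive)
    fix i y z assume "i < r" "y \<in> \<Omega>" "z \<in> \<Omega>" "(y \<in> C) = (z \<in> C)"
    moreover from this have "two_coloured \<Omega> (\<rho> i) C" using C by blast
    ultimately show "(\<rho> i y \<in> C) = (\<rho> i z \<in> C)" by (auto simp: two_coloured_def)
  qed (use n in auto)
  then have inj: "\<forall>y\<in>\<Omega>. \<forall>z\<in>\<Omega>. (y \<in> C) = (z \<in> C) \<longrightarrow> y = z" using C by blast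
  have "inj_on (\<lambda>y. y \<in> C) \<Omega>" using inj by (intro inj_onI) blast
  then have "card \<Omega> \<le> card (UNIV :: bool set)" by (rule card_inj_on_le) auto
  then show False using n by simp
qed

text \<open>A fixed point \<open>z\<close> is added to reach eight points. It prevents labels from
  swapping the colours, so \<open>C\<close> is invariant and contains all seven points; but then
  \<open>C\<close> is \<open>\<Omega>\<close>, of odd size.\<close>

lemma seven_points_false:
  assumes z: "z \<notin> \<Omega>" shows "card \<Omega> \<noteq> 7"
proof
  assume n: "card \<Omega> = 7"
  interpret P: primitive_string \<rho> \<Omega> r by (rule primitive_string) (use n in simp)
  have r: "3 \<le> r" "r \<le> 5" using three_labels P.rank_bound n by fastforce+
  let ?X = "insert z \<Omega>"
  have X: "finite ?X" "card ?X = 8" using finite_points n z by auto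
  have m: "mv i ?X = 4 \<or> mv i ?X = 8" if "i < r" for i
    using P.mv_values[OF that] n z finite_points outside[OF z] by (simp add: mv_insert)
  have clX: "\<rho> i y \<in> ?X" if "y \<in> ?X" for i y using that closed outside[OF z] by auto
  obtain C where C: "C \<subseteq> ?X" "even (card C)" "C \<noteq> {}" "C \<noteq> ?X" "\<forall>i<r. two_coloured ?X (\<rho> i) C"
    using eight_points_colouring[OF X clX r m] by blast
  have inv: "\<rho> i y \<in> C" if "i < r" "y \<in> C" for i y
  proof -
    have "(\<forall>y\<in>?X. \<rho> i y \<in> C \<longleftrightarrow> y \<in> C) \<or> (\<forall>y\<in>?X. \<rho> i y \<in> C \<longleftrightarrow> y \<notin> C)"
      using C(5) that(1) by (simp only: two_coloured_def)
    moreover have "\<not> (\<forall>y\<in>?X. \<rho> i y \<in> C \<longleftrightarrow> y \<notin> C)" using outside[OF z, of i] by simp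
    ultimately show ?thesis using that(2) C(1) by blast
  qed
  have "C \<inter> \<Omega> \<noteq> {}"
  proof
    assume "C \<inter> \<Omega> = {}"
    then have "C = {z}" using C by blast
    then show False using C by simp
  qed
  then obtain y where y: "y \<in> C \<inter> \<Omega>" by blast
  have "C \<inter> \<Omega> = \<Omega>" by (rule P.closed_full[OF _ y]) (use inv closed in auto)
  then have "C = \<Omega>" using C by blast
  then show False using C n by simp
qed

end

lemma seven_points_no_sggi: "\<not> sggi (alt_group 7) S" and eight_points_no_sggi: "\<not> sggi (alt_group 8) S"
  using alt_string.seven_points_false[OF label_alt_string, of 7 S 0] alt_string.eight_points_false[OF label_alt_string, of 8 S]
  by auto

section \<open>Six points\<close>

text \<open>The Klein four-group respects all three partitions of four points into pairs.\<close>

lemma (in invol_string) four_points_partition: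
  assumes d: "distinct [p, q, x, y]" and h: "\<And>z. z \<in> {p, q, x, y} \<Longrightarrow> \<rho> i z \<in> {p, q, x, y} \<and> \<rho> i z \<noteq> z"
  shows "{\<rho> i p, \<rho> i q} \<in> {{p, q}, {x, y}}" "{\<rho> i x, \<rho> i y} \<in> {{p, q}, {x, y}}"
proof -
  have fl: "\<rho> i w = z" if "\<rho> i z = w" for z w using that by auto
  have hq: "\<rho> i q \<in> {p, x, y}" and hx: "\<rho> i x \<in> {p, q, y}" and hy: "\<rho> i y \<in> {p, q, x}" using h by auto
  consider "\<rho> i p = q" | "\<rho> i p = x" | "\<rho> i p = y" using h[of p] by auto
  then have "(\<rho> i p = q \<and> \<rho> i q = p \<and> \<rho> i x = y \<and> \<rho> i y = x) \<or> (\<rho> i p = x \<and> \<rho> i x = p \<and> \<rho> i q = y \<and> \<rho> i y = q) \<or>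
    (\<rho> i p = y \<and> \<rho> i y = p \<and> \<rho> i q = x \<and> \<rho> i x = q)"
  proof cases
    case 1
    moreover have "\<rho> i x = y" using hx fl[OF 1] fl[of x p] fl[of x q] 1 d by auto
    ultimately show ?thesis using fl by blast
  next
    case 2
    moreover have "\<rho> i q = y" using hq fl[OF 2] fl[of q p] fl[of q x] 2 d by auto
    ultimately show ?thesis using fl by blast
  next
    case 3
    moreover have "\<rho> i q = x" using hq fl[OF 3] fl[of q p] fl[of q y] 3 d by auto
    ultimately show ?thesis using fl by blast
  qed
  then show "{\<rho> i p, \<rho> i q} \<in> {{p, q}, {x, y}}" "{\<rho> i x, \<rho> i y} \<in> {{p, q}, {x, y}}" by auto
qed

context string_action
begin

text \<open>Both labels fix two points and, since they commute, permute each other's fixed points.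
  So label \<open>j\<close> exchanges the two points fixed by label 0, label 0 exchanges the two
  fixed by label \<open>j\<close>, and both exchange the remaining two.\<close>

lemma six_points_crossed:
  assumes n: "card \<Omega> = 6" and j: "Suc 0 < j" and m: "mv 0 \<Omega> = 4" "mv j \<Omega> = 4"
    and f: "f \<in> \<Omega>" "\<rho> 0 f = f" "\<rho> j f \<noteq> f"
  shows "\<exists>u v. distinct [f, \<rho> j f, u, \<rho> 0 u, v, \<rho> 0 v] \<and> \<Omega> = {f, \<rho> j f, u, \<rho> 0 u, v, \<rho> 0 v} \<and>
    \<rho> 0 (\<rho> j f) = \<rho> j f \<and> \<rho> j u = u \<and> \<rho> j v = \<rho> 0 v"
proof -
  let ?f = "\<rho> j f"
  have f': "?f \<in> \<Omega>" "\<rho> 0 ?f = ?f" using closed[OF f(1)] fixed_iff[of 0 j f] j f(2) by auto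
  have c0: "card {y \<in> \<Omega>. \<rho> 0 y = y} = 2" and cj: "card {y \<in> \<Omega>. \<rho> j y = y} = 2"
    using card_fixed[of 0] card_fixed[of j] m n by simp_all
  have F0: "{y \<in> \<Omega>. \<rho> 0 y = y} = set [f, ?f]"
    by (rule card_eqI[OF c0]) (use f f' finite_points in auto)
  have "{y \<in> \<Omega>. \<rho> j y = y} \<noteq> {}" using cj by (metis card.empty zero_neq_numeral)
  then obtain u where u: "u \<in> \<Omega>" "\<rho> j u = u" by blast
  have uf: "u \<noteq> f" "u \<noteq> ?f" using u(2) f(3) by auto
  have u0: "\<rho> 0 u \<noteq> u" using F0 u uf by auto
  have u': "\<rho> 0 u \<in> \<Omega>" "\<rho> j (\<rho> 0 u) = \<rho> 0 u" using closed[OF u(1)] fixed_iff[of j 0 u] j u(2) by auto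
  have Fj: "{y \<in> \<Omega>. \<rho> j y = y} = set [u, \<rho> 0 u]"
    by (rule card_eqI[OF cj]) (use u u' u0 finite_points in auto)
  have uf': "\<rho> 0 u \<noteq> f" "\<rho> 0 u \<noteq> ?f" using u'(2) f(3) by auto
  have "card (set [f, ?f, u, \<rho> 0 u]) < card \<Omega>" using card_length[of "[f, ?f, u, \<rho> 0 u]"] n by simp
  then have "\<not> \<Omega> \<subseteq> set [f, ?f, u, \<rho> 0 u]" using card_mono[of "set [f, ?f, u, \<rho> 0 u]" \<Omega>] by fastforce
  then obtain v where v: "v \<in> \<Omega>" "v \<noteq> f" "v \<noteq> ?f" "v \<noteq> u" "v \<noteq> \<rho> 0 u" by auto
  have v0: "\<rho> 0 v \<noteq> v" "\<rho> j v \<noteq> v" using F0 Fj v by auto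
  have v1: "\<rho> 0 v \<noteq> f" "\<rho> 0 v \<noteq> ?f" "\<rho> 0 v \<noteq> u" "\<rho> 0 v \<noteq> \<rho> 0 u"
    using v f(2) f'(2) rho_inj by (metis invol)+
  have d: "distinct [f, ?f, u, \<rho> 0 u, v, \<rho> 0 v]" using f(3) uf uf' u0 v v0 v1 by auto
  have "\<Omega> = set [f, ?f, u, \<rho> 0 u, v, \<rho> 0 v]"
    by (rule card_eqI[OF n d]) (use f f' u u' v closed[OF v(1)] finite_points in auto)
  then have \<Omega>: "\<Omega> = {f, ?f, u, \<rho> 0 u, v, \<rho> 0 v}" by simp
  have "\<rho> j v \<noteq> f" "\<rho> j v \<noteq> ?f" "\<rho> j v \<noteq> u" "\<rho> j v \<noteq> \<rho> 0 u"
    using v u(2) u'(2) by (metis invol)+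
  then have "\<rho> j v = \<rho> 0 v" using closed[OF v(1), of j] v0(2) \<Omega> by blast
  then show ?thesis using d \<Omega> f'(2) u(2) by blast
qed

end

text \<open>A block \<open>{i, j, k}\<close> of the 2-(6,3,2) design preserved by \<open>PSL(2,5)\<close> is coded by its
  binary characteristic number.\<close>

definition design :: "nat \<Rightarrow> nat \<Rightarrow> nat \<Rightarrow> bool" where
  "design i j k \<longleftrightarrow> 2 ^ i + 2 ^ j + 2 ^ k \<in> {7, 11, 22, 25, 28, 37, 42, 44, 49, 50::nat}"

text \<open>The permutations of positions that labels can induce: three double exchanges inside the
  pairs of positions 0 and 1, 2 and 3, 4 and 5, and the one across the pairs that belongs to label
  1.\<close>

definition design_swaps :: "nat list list" where
  "design_swaps = [[1, 0, 3, 2, 4, 5], [1, 0, 2, 3, 5, 4], [0, 1, 3, 2, 5, 4], [2, 1, 0, 4, 3, 5]]"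

lemma design_invariant:
  assumes "s \<in> set design_swaps" "i < 6" "j < 6" "k < 6" "design i j k"
  shows "design (s ! i) (s ! j) (s ! k) \<and> s ! i < 6 \<and> s ! j < 6 \<and> s ! k < 6"
proof -
  have "list_all (\<lambda>s. list_all (\<lambda>i. list_all (\<lambda>j. list_all (\<lambda>k. design i j k \<longrightarrow>
      design (s ! i) (s ! j) (s ! k) \<and> s ! i < 6 \<and> s ! j < 6 \<and> s ! k < 6) [0..<6]) [0..<6]) [0..<6]) design_swaps"
    by code_simp
  then show ?thesis using assms by (simp add: list_all_iff)
qed

context alt_string
begin

lemma six_points_blocks:
  assumes n: "card \<Omega> = 6" and d: "distinct [a, a', b, b', c, c']" and \<Omega>: "\<Omega> = {a, a', b, b', c, c'}"
    and inv: "\<And>i y z. i < r \<Longrightarrow> (y, z) \<in> {(a, a'), (b, b'), (c, c')} \<Longrightarrow>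
      {\<rho> i y, \<rho> i z} \<in> {{a, a'}, {b, b'}, {c, c'}}"
  shows False
proof -
  define blk :: "'a \<Rightarrow> nat" where "blk y = (if y \<in> {a, a'} then 0 else if y \<in> {b, b'} then 1 else 2)" for y
  have same: "blk y = blk z" if "{y, z} \<in> {{a, a'}, {b, b'}, {c, c'}}" for y z
    using that d by (auto simp: blk_def doubleton_eq_iff)
  have "(\<forall>y\<in>\<Omega>. \<forall>z\<in>\<Omega>. blk y = blk z \<longrightarrow> y = z) \<or> (\<forall>y\<in>\<Omega>. \<forall>z\<in>\<Omega>. blk y = blk z)"
  proof (rule primitive)
    fix i y z assume i: "i < r" and y: "y \<in> \<Omega>" "z \<in> \<Omega>" "blk y = blk z"
    have "y = z \<or> (y, z) \<in> {(a, a'), (b, b'), (c, c')} \<or> (z, y) \<in> {(a, a'), (b, b'), (c, c')}"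
      using y d unfolding \<Omega> by (auto simp: blk_def split: if_splits)
    then show "blk (\<rho> i y) = blk (\<rho> i z)"
      using same[OF inv[OF i, of y z]] same[OF inv[OF i, of z y]] by metis
  qed (use n in auto)
  then show False using d unfolding \<Omega> by (auto simp: blk_def)
qed

context
  assumes n: "card \<Omega> = 6"
begin

interpretation P: primitive_string \<rho> \<Omega> r by (rule primitive_string) (use n in simp)

lemma six_moved: "i < r \<Longrightarrow> mv i \<Omega> = 4"
proof -
  assume i: "i < r"
  have "mv i \<Omega> \<le> card \<Omega>" unfolding mv_def using finite_points by (intro card_mono) auto
  then show ?thesis using P.mv_values[OF i] n by auto
qed

lemma six_fixed: assumes "i < r" shows "\<exists>f f'. f \<noteq> f' \<and> {y \<in> \<Omega>. \<rho> i y = y} = {f, f'}"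
proof -
  have "card {y \<in> \<Omega>. \<rho> i y = y} = 2" using P.card_fixed[of i] six_moved[OF assms] n by simp
  then show ?thesis by (metis card_2_iff)
qed

lemma six_pair_not_closed:
  assumes "y \<in> \<Omega>" "z \<in> \<Omega>" "\<And>i. i < r \<Longrightarrow> \<rho> i y \<in> {y, z} \<and> \<rho> i z \<in> {y, z}" shows False
  by (rule P.not_closed[of "{y, z}" y]) (use assms n in \<open>auto simp: card_insert_if\<close>)

text \<open>Every label commutes with label 0 or with label 3. If these two have the same fixed
  points, all labels preserve this pair. Otherwise the fixed pair of label 0, that of label 3 and
  the remaining pair are blocks.\<close>

lemma six_points_many_labels: "r < 4"
proof (rule ccontr)
  assume "\<not> r < 4"
  then have r: "4 \<le> r" by simp
  obtain f f' where ff: "f \<noteq> f'" "{y \<in> \<Omega>. \<rho> 0 y = y} = {f, f'}" using six_fixed[of 0] r by auto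
  then have f: "f \<in> \<Omega>" "f' \<in> \<Omega>" "\<rho> 0 f = f" "\<rho> 0 f' = f'" by blast+
  have stab: "\<rho> i y \<in> {f, f'}" if "i \<noteq> 1" "y \<in> {f, f'}" for i y
  proof (cases "i = 0")
    case False
    then have "\<rho> 0 (\<rho> i y) = \<rho> i y" using fixed_transfer[of 0 i y] that f by auto
    then show ?thesis using closed[of y i] that(2) f ff(2) by blast
  qed (use that f in auto)
  show False
  proof (cases "\<rho> 3 f = f")
    case True
    then have f3: "\<rho> 3 f' = f'" using stab[of 3 f'] rho_inj ff(1) by (metis insertE singletonD insertI1 insertI2 numeral_eq_one_iff semiring_norm(84))
    obtain g g' where g: "{y \<in> \<Omega>. \<rho> 3 y = y} = {g, g'}" using six_fixed[of 3] r by auto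
    then have "f \<in> {g, g'}" "f' \<in> {g, g'}" using True f3 f by blast+
    then have F3: "{y \<in> \<Omega>. \<rho> 3 y = y} = {f, f'}" using g ff(1) by auto
    have "\<rho> i y \<in> {f, f'}" if "y \<in> {f, f'}" for i y
    proof (cases "i = 1")
      case True
      have "\<rho> 3 (\<rho> 1 y) = \<rho> 1 y" using fixed_transfer[of 3 1 y] that F3 by auto
      then show ?thesis using closed[of y 1] that f F3 True by blast
    qed (use stab that in blast)
    then show False using six_pair_not_closed[OF f(1,2)] by blast
  next
    case False
    then have f': "\<rho> 3 f = f'" using stab[of 3 f] by auto
    obtain u v where d: "distinct [f, f', u, \<rho> 0 u, v, \<rho> 0 v]" and \<Omega>: "\<Omega> = {f, f', u, \<rho> 0 u, v, \<rho> 0 v}"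
      and u3: "\<rho> 3 u = u" "\<rho> 3 v = \<rho> 0 v"
      using P.six_points_crossed[OF n, of 3 f] six_moved[of 0] six_moved[of 3] r f False f' by auto
    have c30: "\<rho> 3 (\<rho> 0 y) = \<rho> 0 (\<rho> 3 y)" for y by (rule comm') simp
    have v3: "\<rho> 3 f' = f" "\<rho> 3 (\<rho> 0 u) = \<rho> 0 u" "\<rho> 3 (\<rho> 0 v) = v"
      using f' u3 c30 by (metis invol)+
    show False
    proof (rule six_points_blocks[OF n d \<Omega>])
      fix i y z assume i: "i < r" and yz: "(y, z) \<in> {(f, f'), (u, \<rho> 0 u), (v, \<rho> 0 v)}"
      show "{\<rho> i y, \<rho> i z} \<in> {{f, f'}, {u, \<rho> 0 u}, {v, \<rho> 0 v}}"
      proof (cases "i = 1")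
        case False
        have c: "\<rho> i (\<rho> 0 w) = \<rho> 0 (\<rho> i w)" for w using False comm'[of 0 i w] by (cases "i = 0") auto
        have p: "{w, \<rho> 0 w} \<in> {{u, \<rho> 0 u}, {v, \<rho> 0 v}}" if "w \<in> \<Omega>" "w \<notin> {f, f'}" for w
          using that unfolding \<Omega> by (auto simp: insert_commute)
        show ?thesis
        proof (cases "y = f")
          case True
          then have "z = f'" using yz d by auto
          moreover have "\<rho> i f \<noteq> \<rho> i f'" using ff(1) rho_inj by blast
          ultimately show ?thesis using stab[OF False, of f] stab[OF False, of f'] True by (auto simp: insert_commute)
        next
          case False
          then have z: "z = \<rho> 0 y" "y \<in> \<Omega>" "\<rho> 0 y \<noteq> y" using yz d \<Omega> by auto
          then have "\<rho> i y \<notin> {f, f'}" using c[of y] f rho_inj by (metis insertE singletonD)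
          then show ?thesis using p[of "\<rho> i y"] closed[OF z(2)] c z by auto
        qed
      next
        case True
        have c: "\<rho> 1 (\<rho> 3 w) = \<rho> 3 (\<rho> 1 w)" for w by (rule comm) simp
        have F: "w \<in> {u, \<rho> 0 u}" if "w \<in> \<Omega>" "\<rho> 3 w = w" for w
          using that u3 v3 f' d unfolding \<Omega> by auto
        have p: "{w, \<rho> 3 w} \<in> {{f, f'}, {v, \<rho> 0 v}}" if "w \<in> \<Omega>" "\<rho> 3 w \<noteq> w" for w
          using that u3 v3 f' unfolding \<Omega> by (auto simp: insert_commute)
        show ?thesis
        proof (cases "y = u")
          case True
          then have z: "z = \<rho> 0 u" using yz d by auto
          have "\<rho> 1 u \<in> {u, \<rho> 0 u}" "\<rho> 1 (\<rho> 0 u) \<in> {u, \<rho> 0 u}"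
            using F[OF closed[of u 1]] F[OF closed[of "\<rho> 0 u" 1]] c[of u] c[of "\<rho> 0 u"] u3 v3 \<Omega> by auto
          moreover have "\<rho> 1 u \<noteq> \<rho> 1 (\<rho> 0 u)" using d rho_inj by auto
          ultimately show ?thesis using z True \<open>i = 1\<close> by (auto simp: insert_commute)
        next
          case False
          then have z: "z = \<rho> 3 y" "y \<in> \<Omega>" "\<rho> 3 y \<noteq> y" using yz d \<Omega> u3 f' by auto
          then have "\<rho> 3 (\<rho> 1 y) \<noteq> \<rho> 1 y" using c[of y] rho_inj by metis
          then show ?thesis using p[of "\<rho> 1 y"] closed[OF z(2)] c[of y] z True by auto
        qed
      qed
    qed
  qed
qed

text \<open>Evenness restricts labels 0 and 2 to exchanging two of the three pairs, and label 1 to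
  the edges given, so all labels preserve the design. A three-cycle fixing \<open>a\<close> and
  \<open>a'\<close> and carrying \<open>b\<close> to \<open>c\<close> would map the block
  \<open>0 1 2\<close> to \<open>0 1 4\<close>, which is no block, its code being 19.\<close>

lemma six_points_design:
  assumes r: "r = 3" and d: "distinct [a, a', b, b', c, c']" and \<Omega>: "\<Omega> = {a, a', b, b', c, c'}"
    and r1: "\<rho> 1 a = b" "\<rho> 1 b' = c"
    and pair: "\<And>i. i \<in> {0, 2} \<Longrightarrow> \<rho> i a \<in> {a, a'} \<and> \<rho> i a' \<in> {a, a'} \<and> \<rho> i b \<in> {b, b'} \<and> \<rho> i b' \<in> {b, b'} \<and>
      \<rho> i c \<in> {c, c'} \<and> \<rho> i c' \<in> {c, c'}"
  shows False
proof -
  let ?p = "[a, a', b, b', c, c']"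
  have less6: "i < 6 \<longleftrightarrow> i = 0 \<or> i = 1 \<or> i = 2 \<or> i = 3 \<or> i = 4 \<or> i = 5" for i :: nat by auto
  have moves: "mv i \<Omega> = (if \<rho> i a = a then 0 else 1) + (if \<rho> i a' = a' then 0 else 1) + (if \<rho> i b = b then 0 else 1)
      + (if \<rho> i b' = b' then 0 else 1) + (if \<rho> i c = c then 0 else 1) + (if \<rho> i c' = c' then 0 else 1)" for i
    unfolding \<Omega> using d by (simp add: mv_insert)
  have "\<exists>s\<in>set design_swaps. \<forall>k<6. \<rho> i (?p ! k) = ?p ! (s ! k)" if i: "i < r" for i
  proof (cases "i = 1")
    case True
    have m: "mv 1 \<Omega> = 4" using six_moved[of 1] r by simp
    have b: "\<rho> 1 b = a" "\<rho> 1 c = b'" using r1 by auto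
    then have f: "\<rho> 1 a' = a'" "\<rho> 1 c' = c'"
      using m moves[of 1] r1 d by (auto split: if_splits)
    then show ?thesis unfolding True
      by (intro bexI[of _ "[2, 1, 0, 4, 3, 5]"]) (use r1 b in \<open>auto simp: less6 design_swaps_def\<close>)
  next
    case False
    then have i02: "i \<in> {0, 2}" using i r by auto
    have m: "mv i \<Omega> = 4" using six_moved[OF i] .
    have sw: "\<rho> i y = y \<and> \<rho> i y' = y' \<or> \<rho> i y = y' \<and> \<rho> i y' = y"
      if "\<rho> i y \<in> {y, y'}" "\<rho> i y' \<in> {y, y'}" "y \<noteq> y'" for y y'
      using that rho_inj[of i y y'] by auto
    have sa: "\<rho> i a = a \<and> \<rho> i a' = a' \<or> \<rho> i a = a' \<and> \<rho> i a' = a" and sb: "\<rho> i b = b \<and> \<rho> i b' = b' \<or> \<rho> i b = b' \<and> \<rho> i b' = b"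
      and sc: "\<rho> i c = c \<and> \<rho> i c' = c' \<or> \<rho> i c = c' \<and> \<rho> i c' = c" using sw pair[OF i02] d by simp_all
    have "(\<rho> i a = a' \<and> \<rho> i a' = a \<and> \<rho> i b = b' \<and> \<rho> i b' = b \<and> \<rho> i c = c \<and> \<rho> i c' = c') \<or>
      (\<rho> i a = a' \<and> \<rho> i a' = a \<and> \<rho> i b = b \<and> \<rho> i b' = b' \<and> \<rho> i c = c' \<and> \<rho> i c' = c) \<or>
      (\<rho> i a = a \<and> \<rho> i a' = a' \<and> \<rho> i b = b' \<and> \<rho> i b' = b \<and> \<rho> i c = c' \<and> \<rho> i c' = c)"
      using sa sb sc m moves[of i] d by (elim disjE conjE) auto
    then show ?thesis
    proof (elim disjE conjE)
      assume "\<rho> i a = a'" "\<rho> i a' = a" "\<rho> i b = b'" "\<rho> i b' = b" "\<rho> i c = c" "\<rho> i c' = c'"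
      then show ?thesis by (intro bexI[of _ "[1, 0, 3, 2, 4, 5]"]) (auto simp: less6 design_swaps_def)
    next
      assume "\<rho> i a = a'" "\<rho> i a' = a" "\<rho> i b = b" "\<rho> i b' = b'" "\<rho> i c = c'" "\<rho> i c' = c"
      then show ?thesis by (intro bexI[of _ "[1, 0, 2, 3, 5, 4]"]) (auto simp: less6 design_swaps_def)
    next
      assume "\<rho> i a = a" "\<rho> i a' = a'" "\<rho> i b = b'" "\<rho> i b' = b" "\<rho> i c = c'" "\<rho> i c' = c"
      then show ?thesis by (intro bexI[of _ "[0, 1, 3, 2, 5, 4]"]) (auto simp: less6 design_swaps_def)
    qed
  qed
  note step = this
  define Q where "Q x y z \<longleftrightarrow> (\<exists>i<6. \<exists>j<6. \<exists>k<6. x = ?p ! i \<and> y = ?p ! j \<and> z = ?p ! k \<and> design i j k)" for x y z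
  have Qinv: "Q (\<rho> l x) (\<rho> l y) (\<rho> l z)" if l: "l < r" and Q: "Q x y z" for l x y z
  proof -
    obtain i j k where ijk: "i < 6" "j < 6" "k < 6" "x = ?p ! i" "y = ?p ! j" "z = ?p ! k" "design i j k"
      using Q unfolding Q_def by blast
    obtain s where s: "s \<in> set design_swaps" "\<And>k. k < 6 \<Longrightarrow> \<rho> l (?p ! k) = ?p ! (s ! k)" using step[OF l] by blast
    show ?thesis unfolding Q_def ijk(4-6) s(2)[OF ijk(1)] s(2)[OF ijk(2)] s(2)[OF ijk(3)]
      using design_invariant[OF s(1) ijk(1-3,7)] by blast
  qed
  have Qact: "Q (act w x) (act w y) (act w z)" if "set w \<subseteq> {..<r}" "Q x y z" for w x y z
    using that by (induction w) (simp_all add: Qinv)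
  obtain w where w: "set w \<subseteq> {..<r}" "act w b = c" "\<And>y. y \<notin> {b, c, c'} \<Longrightarrow> act w y = y"
    using three_cycle[of b c c'] d \<Omega> by auto
  have "Q a a' b" unfolding Q_def
    by (rule exI[of _ 0], simp, rule exI[of _ 1], simp, rule exI[of _ 2], simp add: design_def)
  from Qact[OF w(1) this] have "Q a a' c" using w(2) w(3)[of a] w(3)[of a'] d by auto
  then obtain i j k where ijk: "i < 6" "j < 6" "k < 6" "a = ?p ! i" "a' = ?p ! j" "c = ?p ! k" "design i j k"
    unfolding Q_def by blast
  have idx: "k = l" if "k < 6" "l < 6" "?p ! k = ?p ! l" for k l
    using that nth_eq_iff_index_eq[OF d] by simp
  have "i = 0" "j = 1" "k = 4" using idx[of i 0] idx[of j 1] idx[of k 4] ijk(1-6) by simp_all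
  then show False using ijk(7) by (simp add: design_def)
qed

text \<open>If labels 0 and 2 have the same fixed points, label 1 has to move both of them away, and
  this pair, its image and the rest are blocks. Otherwise \<open>\<pi>\<close> gives three pairs,
  each preserved by labels 0 and 2, and label 1 joins them in the way that
  \<open>six_points_design\<close> describes.\<close>

lemma six_points_three_labels: "r \<noteq> 3"
proof
  assume r: "r = 3"
  have less: "i < r \<Longrightarrow> i = 0 \<or> i = 1 \<or> i = 2" for i using r by auto
  obtain f f' where ff: "f \<noteq> f'" "{y \<in> \<Omega>. \<rho> 0 y = y} = {f, f'}" using six_fixed[of 0] r by auto
  then have f: "f \<in> \<Omega>" "f' \<in> \<Omega>" "\<rho> 0 f = f" "\<rho> 0 f' = f'" by blast+
  have "\<rho> 0 (\<rho> 2 y) = \<rho> 2 y" if "y \<in> {f, f'}" for y using fixed_transfer[of 0 2 y] that f by auto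
  then have stab: "\<rho> 2 f \<in> {f, f'}" "\<rho> 2 f' \<in> {f, f'}" using closed[of f 2] closed[of f' 2] f ff(2) by blast+
  show False
  proof (cases "\<rho> 2 f = f")
    case True
    then have t: "\<rho> 2 f' = f'" using stab(2) rho_inj ff(1) by (metis insertE singletonD)
    obtain g g' where g: "{y \<in> \<Omega>. \<rho> 2 y = y} = {g, g'}" using six_fixed[of 2] r by auto
    then have "f \<in> {g, g'}" "f' \<in> {g, g'}" using True t f by blast+
    then have F2: "{y \<in> \<Omega>. \<rho> 2 y = y} = {f, f'}" using g ff(1) by auto
    let ?p = "\<rho> 1 f" and ?q = "\<rho> 1 f'"
    have nc: "\<not> (\<rho> 1 y \<in> {y, z} \<and> \<rho> 1 z \<in> {y, z})" if "y \<in> {f, f'}" "z \<in> {f, f'}" for y z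
    proof
      assume "\<rho> 1 y \<in> {y, z} \<and> \<rho> 1 z \<in> {y, z}"
      moreover have "y \<in> \<Omega>" "z \<in> \<Omega>" "\<rho> 0 y = y" "\<rho> 0 z = z" "\<rho> 2 y = y" "\<rho> 2 z = z" using that f True t by auto
      ultimately show False using six_pair_not_closed[of y z] less by (metis insertI1 insertI2)
    qed
    have pq: "?p \<notin> {f, f'}" "?q \<notin> {f, f'}" "?p \<noteq> ?q"
      using nc[of f f] nc[of f' f'] nc[of f f'] ff(1) rho_inj by (auto simp: rho_flip[of 1 f f'])
    have pq\<Omega>: "?p \<in> \<Omega>" "?q \<in> \<Omega>" using f closed by auto
    have free: "\<rho> i y \<noteq> y" "\<rho> i y \<notin> {f, f'}" if "i \<in> {0, 2}" "y \<in> \<Omega>" "y \<notin> {f, f'}" for i y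
    proof -
      have "\<rho> 0 y \<noteq> y" "\<rho> 2 y \<noteq> y" using that(2,3) ff(2) F2 by blast+
      then show "\<rho> i y \<noteq> y" using that(1) by auto
      have "\<rho> i f = f" "\<rho> i f' = f'" using that(1) f True t by auto
      then show "\<rho> i y \<notin> {f, f'}" using that(3) by (metis insert_iff invol empty_iff)
    qed
    have "card (set [f, f', ?p, ?q]) < card \<Omega>" using card_length[of "[f, f', ?p, ?q]"] n by simp
    then have "\<not> \<Omega> \<subseteq> set [f, f', ?p, ?q]" using card_mono[of "set [f, f', ?p, ?q]" \<Omega>] by fastforce
    then obtain x where x: "x \<in> \<Omega>" "x \<notin> set [f, f', ?p, ?q]" by blast
    have "card (set [f, f', ?p, ?q, x]) < card \<Omega>" using card_length[of "[f, f', ?p, ?q, x]"] n by simp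
    then have "\<not> \<Omega> \<subseteq> set [f, f', ?p, ?q, x]" using card_mono[of "set [f, f', ?p, ?q, x]" \<Omega>] by fastforce
    then obtain y where y: "y \<in> \<Omega>" "y \<notin> set [f, f', ?p, ?q, x]" by blast
    have d: "distinct [f, f', ?p, ?q, x, y]" using ff(1) pq x y by auto
    have "\<Omega> = set [f, f', ?p, ?q, x, y]"
      by (rule P.card_eqI[OF n d]) (use f pq\<Omega> x y finite_points in auto)
    then have \<Omega>: "\<Omega> = {f, f', ?p, ?q, x, y}" by simp
    have m: "mv 1 \<Omega> = 4" using six_moved[of 1] r by simp
    have "mv 1 \<Omega> = 4 + (if \<rho> 1 x = x then 0 else 1) + (if \<rho> 1 y = y then 0 else 1)"
      using d unfolding \<Omega> by (auto simp: mv_insert)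
    then have xy: "\<rho> 1 x = x" "\<rho> 1 y = y" using m by (auto split: if_splits)
    show False
    proof (rule six_points_blocks[OF n d \<Omega>])
      fix i u v assume i: "i < r" and uv: "(u, v) \<in> {(f, f'), (?p, ?q), (x, y)}"
      show "{\<rho> i u, \<rho> i v} \<in> {{f, f'}, {?p, ?q}, {x, y}}"
      proof (cases "i = 1")
        case True
        then show ?thesis using uv xy by auto
      next
        case False
        then have i02: "i \<in> {0, 2}" using less[OF i] by auto
        then have ifx: "\<rho> i f = f" "\<rho> i f' = f'" using f True t by auto
        have ifr: "\<rho> i z \<in> {?p, ?q, x, y} \<and> \<rho> i z \<noteq> z" if "z \<in> {?p, ?q, x, y}" for z
          using free[OF i02, of z] closed[of z i] that \<Omega> d by auto
        have "distinct [?p, ?q, x, y]" using d by simp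
        note part = four_points_partition[OF this ifr]
        consider "u = f" "v = f'" | "u = ?p" "v = ?q" | "u = x" "v = y" using uv by blast
        then show ?thesis using part ifx by cases (metis insertI1 insertI2)+
      qed
    qed
  next
    case False
    then have f2: "\<rho> 2 f = f'" using stab by auto
    obtain u v where d: "distinct [f, f', u, \<rho> 0 u, v, \<rho> 0 v]" and \<Omega>: "\<Omega> = {f, f', u, \<rho> 0 u, v, \<rho> 0 v}"
      and u2: "\<rho> 2 u = u" "\<rho> 2 v = \<rho> 0 v"
      using P.six_points_crossed[OF n, of 2 f] six_moved[of 0] six_moved[of 2] r f False f2 by auto
    have c20: "\<rho> 2 (\<rho> 0 y) = \<rho> 0 (\<rho> 2 y)" for y by (rule comm') simp
    have v2: "\<rho> 2 f' = f" "\<rho> 2 (\<rho> 0 u) = \<rho> 0 u" "\<rho> 2 (\<rho> 0 v) = v" using f2 u2 c20 by (metis invol)+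
    define \<pi> where "\<pi> y = (if \<rho> 0 y = y then \<rho> 2 y else \<rho> 0 y)" for y
    have \<pi>: "\<pi> f = f'" "\<pi> f' = f" "\<pi> u = \<rho> 0 u" "\<pi> (\<rho> 0 u) = u" "\<pi> v = \<rho> 0 v" "\<pi> (\<rho> 0 v) = v"
      using f f2 v2 d by (auto simp: \<pi>_def)
    have inv: "\<pi> y \<in> \<Omega>" "\<pi> (\<pi> y) = y" "\<pi> y \<noteq> y" if "y \<in> \<Omega>" for y
      using that d \<pi> unfolding \<Omega> by auto
    have lab: "\<rho> i y \<in> {y, \<pi> y}" if "i \<in> {0, 2}" "y \<in> \<Omega>" for i y
      using that f f2 u2 v2 \<pi> unfolding \<Omega> by auto
    have lab': "\<rho> i y \<in> {y, \<pi> y} \<and> \<rho> i (\<pi> y) \<in> {y, \<pi> y}" if "i \<in> {0, 2}" "y \<in> \<Omega>" for i y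
      using lab[OF that] lab[OF that(1) inv(1)[OF that(2)]] inv(2)[OF that(2)] by auto
    have out: "\<exists>z\<in>{y, \<pi> y}. \<rho> 1 z \<notin> {y, \<pi> y}" if "y \<in> \<Omega>" for y
      using six_pair_not_closed[OF that inv(1)[OF that]] lab'[OF _ that] less by blast
    have out': "\<exists>z\<in>{y, \<pi> y}. \<rho> 1 z \<notin> {z, \<pi> z}" if "y \<in> \<Omega>" for y
      using out[OF that] inv(2)[OF that] by auto
    obtain a where a: "a \<in> \<Omega>" "\<rho> 1 a \<notin> {a, \<pi> a}" using out'[OF f(1)] inv(1)[OF f(1)] f(1) by blast
    let ?b = "\<rho> 1 a"
    have b: "?b \<in> \<Omega>" using a closed by blast
    have "card (set [a, \<pi> a, ?b, \<pi> ?b]) < card \<Omega>" using card_length[of "[a, \<pi> a, ?b, \<pi> ?b]"] n by simp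
    then have "\<not> \<Omega> \<subseteq> set [a, \<pi> a, ?b, \<pi> ?b]" using card_mono[of "set [a, \<pi> a, ?b, \<pi> ?b]" \<Omega>] by fastforce
    then obtain y where y: "y \<in> \<Omega>" "y \<notin> set [a, \<pi> a, ?b, \<pi> ?b]" by blast
    obtain c where c: "c \<in> {y, \<pi> y}" "\<rho> 1 c \<notin> {c, \<pi> c}" using out'[OF y(1)] by blast
    have c\<Omega>: "c \<in> \<Omega>" using c(1) y(1) inv(1) by blast
    have cn: "c \<noteq> a" "c \<noteq> \<pi> a" "c \<noteq> ?b" "c \<noteq> \<pi> ?b"
      using c(1) y inv(2)[OF y(1)] inv(2)[OF a(1)] inv(2)[OF b] by auto
    have d6: "distinct [a, \<pi> a, ?b, \<pi> ?b, c, \<pi> c]"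
    proof -
      have iv: "\<pi> (\<pi> a) = a" "\<pi> (\<pi> ?b) = ?b" "\<pi> (\<pi> c) = c" using inv(2) a(1) b c\<Omega> by blast+
      have b2: "?b \<noteq> a" "?b \<noteq> \<pi> a" using a(2) by auto
      then have "\<pi> ?b \<noteq> a" "\<pi> ?b \<noteq> \<pi> a" using iv by metis+
      moreover have "\<pi> c \<noteq> a" "\<pi> c \<noteq> \<pi> a" "\<pi> c \<noteq> ?b" "\<pi> c \<noteq> \<pi> ?b" using iv cn by metis+
      ultimately show ?thesis
        using b2 cn inv(3)[OF a(1)] inv(3)[OF b] inv(3)[OF c\<Omega>] by (simp add: eq_commute)
    qed
    have "\<Omega> = set [a, \<pi> a, ?b, \<pi> ?b, c, \<pi> c]"
      by (rule P.card_eqI[OF n d6]) (use a b c\<Omega> inv(1) finite_points in auto)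
    then have \<Omega>6: "\<Omega> = {a, \<pi> a, ?b, \<pi> ?b, c, \<pi> c}" by simp
    have "\<rho> 1 c \<noteq> a" "\<rho> 1 c \<noteq> ?b" using cn(1,3) rho_inj by (auto simp: rho_flip)
    \<comment> \<open>Label 1 joins the third pair to the partner of \<open>?b\<close> or of
      \<open>a\<close>; exchanging the roles of \<open>a\<close> and \<open>?b\<close> reduces the
      second case to the first.\<close>
    then consider "\<rho> 1 c = \<pi> ?b" | "\<rho> 1 c = \<pi> a" using closed[OF c\<Omega>, of 1] c(2) \<Omega>6 by blast
    then show False
    proof cases
      case 1
      then have "\<rho> 1 (\<pi> ?b) = c" by (metis invol)
      then show False
        using six_points_design[OF r d6 \<Omega>6 refl] lab'[OF _ a(1)] lab'[OF _ b] lab'[OF _ c\<Omega>] by blast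
    next
      case 2
      then have "\<rho> 1 (\<pi> a) = c" by (metis invol)
      moreover have "distinct [?b, \<pi> ?b, a, \<pi> a, c, \<pi> c]" using d6 by auto
      moreover have "\<Omega> = {?b, \<pi> ?b, a, \<pi> a, c, \<pi> c}" using \<Omega>6 by auto
      ultimately show False
        using six_points_design[OF r _ _ invol] lab'[OF _ a(1)] lab'[OF _ b] lab'[OF _ c\<Omega>] by blast
    qed
  qed
qed

end

lemma six_points_false: "card \<Omega> \<noteq> 6"
  using six_points_many_labels six_points_three_labels three_labels by fastforce

end

lemma six_points_no_sggi: "\<not> sggi (alt_group 6) S"
  using alt_string.six_points_false[OF label_alt_string, of 6 S] by auto

text \<open>Nonemptiness of the set of ranks belongs to the third claim, since
  \<open>max_sggi_rank\<close> is a \<open>Max\<close> and is meaningful only for a nonempty finite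
  set.\<close>

theorem theorem1p1:
  shows "((\<exists>S. sggi (alt_group 5) S) \<and>
          (\<forall>S. sggi (alt_group 5) S \<longrightarrow> sggi_of_rank (alt_group 5) S 3)) \<and>
         (\<forall>n\<in>{3, 4, 6, 7, 8}. \<not> (\<exists>S. sggi (alt_group n) S)) \<and>
         (\<forall>n\<ge>9. sggi_ranks (alt_group n) \<noteq> {} \<and>
            max_sggi_rank (alt_group n) \<le> 3 * (n - 1) div 5 \<and>
            (n mod 5 \<in> {0, 1, 4} \<longrightarrow> max_sggi_rank (alt_group n) = 3 * (n - 1) div 5))"
  using five_points_sggi five_points_rank three_points_no_sggi four_points_no_sggi six_points_no_sggi
    seven_points_no_sggi eight_points_no_sggi sggi_ranks_nonempty max_sggi_rank_le max_sggi_rank_eq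
  by auto

end
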